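(* Let $(M,g)$ be a connected quaternionic-Kähler manifold of dimension $4n\geq 8$ with non-zero scalar curvature. If $(M,g)$ has a non-parallel compatible conformal-Killing $2$-form, then the holonomy group of $(M,g)$ is $\mathrm{Sp}(1)\mathrm{Sp}(n)$.
   Context: A quaternionic-Kähler manifold is a Riemannian manifold $(M,g)$ of dimension $4n\geq 8$ with holonomy group included in $\mathrm{Sp}(1)\mathrm{Sp}(n)$; equivalently, there is a rank three sub-bundle $Q\subset \mathrm{End}(TM)$, preserved by the Levi-Civita connection $\nabla$ of $g$, locally generated by three anti-commuting $g$-orthogonal almost complex structures $J_1,J_2,J_3$ with $J_3=J_1J_2$, with Kähler forms $\omega_i:=g(J_i\cdot,\cdot)$. The metric $g$ is Einstein. As real bundles, $S^2H\subset\Lambda^2(M)$ is the bundle spanned locally by $\omega_1,\omega_2,\omega_3$, and $S^2E\subset\Lambda^2(M)$ is the bundle of $2$-forms $\psi$ with $\psi(J_i\cdot,J_i\cdot)=\psi$ for $i=1,2,3$. A $2$-form is compatible if it is a section of $S^2H\oplus S^2E$. Tangent vectors are identified with $1$-forms using $g$. A $2$-form $\psi$ on $(M,g)$ is conformal-Killing if $\nabla_Y\psi=\frac13 i_Yd\psi-\frac{1}{4n-1}Y\wedge\delta\psi$ for all $Y\in TM$, where $\delta\psi=-\sum_k i_{e_k}\nabla_{e_k}\psi$ is the codifferential ($\{e_k\}$ a local orthonormal frame). It is parallel if $\nabla\psi=0$. *)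

theory Defs
  imports "HOL-Analysis.Analysis"
begin

section \<open>Smooth maps between open sets of normed spaces\<close>

text \<open>For open \<open>S\<close> in a finite-dimensional space, \<open>Ck_on k f S\<close> is the usual \<open>C\<^sup>k\<close> notion:
  all iterated directional derivatives up to order \<open>k\<close> exist and are continuous.\<close>

fun Ck_on :: "nat \<Rightarrow> ('e::real_normed_vector \<Rightarrow> 'f::real_normed_vector) \<Rightarrow> 'e set \<Rightarrow> bool" where
  "Ck_on 0 f S \<longleftrightarrow> continuous_on S f"
| "Ck_on (Suc k) f S \<longleftrightarrow>
     (\<forall>x\<in>S. f differentiable (at x)) \<and> (\<forall>v. Ck_on k (\<lambda>x. frechet_derivative f (at x) v) S)"

definition smooth_on :: "('e::real_normed_vector \<Rightarrow> 'f::real_normed_vector) \<Rightarrow> 'e set \<Rightarrow> bool" where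
  "smooth_on f S \<longleftrightarrow> (\<forall>k. Ck_on k f S)"


section \<open>Manifolds and tensor fields\<close>

text \<open>A chart is a pair of its domain and its coordinate map.\<close>

type_synonym ('a, 'e) chart = "'a set \<times> ('a \<Rightarrow> 'e)"

definition chart_image :: "('a, 'e) chart \<Rightarrow> 'e set" where
  "chart_image c = snd c ` fst c"

definition overlap :: "('a, 'e) chart \<Rightarrow> ('a, 'e) chart \<Rightarrow> 'e set" where
  "overlap c c' = snd c ` (fst c \<inter> fst c')"

definition transition :: "('a, 'e) chart \<Rightarrow> ('a, 'e) chart \<Rightarrow> 'e \<Rightarrow> 'e" where
  "transition c c' x = snd c' (inv_into (fst c) (snd c) x)"

definition jac :: "('a, 'e::euclidean_space) chart \<Rightarrow> ('a, 'e) chart \<Rightarrow> 'e \<Rightarrow> 'e \<Rightarrow> 'e" where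
  "jac c c' x = frechet_derivative (transition c c') (at x)"

definition smooth_atlas :: "'a topology \<Rightarrow> ('a, 'e::euclidean_space) chart set \<Rightarrow> bool" where
  "smooth_atlas X A \<longleftrightarrow>
     (\<forall>c\<in>A. openin X (fst c) \<and> open (chart_image c) \<and>
        homeomorphic_map (subtopology X (fst c)) (top_of_set (chart_image c)) (snd c)) \<and>
     (\<Union>c\<in>A. fst c) = topspace X \<and>
     (\<forall>c\<in>A. \<forall>c'\<in>A. smooth_on (transition c c') (overlap c c'))"

text \<open>A tensor field is given by its coordinate representations: a value \<open>T c x\<close> for every chart
  \<open>c\<close> of the atlas and every point \<open>x\<close> of the image of \<open>c\<close>, subject to the usual transformation law
  on overlaps. Bilinear forms are represented by the type \<open>'e bilin\<close>, endomorphisms by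
  \<open>'e endo\<close>, so that they live in normed spaces and can be differentiated. Values for pairs outside
  the atlas or outside the chart images are irrelevant.\<close>

type_synonym 'e bilin = "'e \<Rightarrow>\<^sub>L 'e \<Rightarrow>\<^sub>L real"
type_synonym 'e endo = "'e \<Rightarrow>\<^sub>L 'e"

definition bilinear_tensor_field ::
    "('a, 'e::euclidean_space) chart set \<Rightarrow> (('a, 'e) chart \<Rightarrow> 'e \<Rightarrow> 'e bilin) \<Rightarrow> bool" where
  "bilinear_tensor_field A T \<longleftrightarrow>
     (\<forall>c\<in>A. smooth_on (T c) (chart_image c)) \<and>
     (\<forall>c\<in>A. \<forall>c'\<in>A. \<forall>x\<in>overlap c c'. \<forall>v w.
        T c' (transition c c' x) (jac c c' x v) (jac c c' x w) = T c x v w)"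

record (overloaded) ('a, 'e::euclidean_space) riem =
  mtop :: "'a topology"
  atlas :: "('a, 'e) chart set"
  metric :: "('a, 'e) chart \<Rightarrow> 'e \<Rightarrow> 'e bilin"

definition riemannian_manifold :: "('a, 'e::euclidean_space) riem \<Rightarrow> bool" where
  "riemannian_manifold M \<longleftrightarrow>
     Hausdorff_space (mtop M) \<and> second_countable (mtop M) \<and> smooth_atlas (mtop M) (atlas M) \<and>
     bilinear_tensor_field (atlas M) (metric M) \<and>
     (\<forall>c\<in>atlas M. \<forall>x\<in>chart_image c.
        (\<forall>v w. metric M c x v w = metric M c x w v) \<and> (\<forall>v. v \<noteq> 0 \<longrightarrow> metric M c x v v > 0))"

definition orthonormal_frame :: "'e::euclidean_space bilin \<Rightarrow> 'e set \<Rightarrow> bool" where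
  "orthonormal_frame b B \<longleftrightarrow>
     card B = DIM('e) \<and> (\<forall>u\<in>B. \<forall>v\<in>B. b u v = (if u = v then 1 else 0))"


section \<open>Levi-Civita connection and scalar curvature\<close>

text \<open>The Christoffel tensor \<open>\<Gamma>\<close> of the unique torsion-free metric connection: in the chart \<open>c\<close>
  one has \<open>\<nabla>\<^sub>u W = D\<^sub>u W + \<Gamma> u W\<close> for vector fields \<open>W\<close>.\<close>

definition christoffel ::
    "('a, 'e::euclidean_space) riem \<Rightarrow> ('a, 'e) chart \<Rightarrow> 'e \<Rightarrow> 'e \<Rightarrow>\<^sub>L 'e \<Rightarrow>\<^sub>L 'e" where
  "christoffel M c x = (THE \<Gamma> :: 'e \<Rightarrow>\<^sub>L 'e \<Rightarrow>\<^sub>L 'e. (\<forall>u v. \<Gamma> u v = \<Gamma> v u) \<and>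
     (\<forall>u v w. frechet_derivative (metric M c) (at x) u v w =
        metric M c x (\<Gamma> u v) w + metric M c x v (\<Gamma> u w)))"

lemma levi_civita_algebra:
  fixes b :: "'e::euclidean_space bilin" and D :: "'e \<Rightarrow> 'e bilin"
  assumes sym: "\<And>v w. b v w = b w v" and pos: "\<And>v. v \<noteq> 0 \<Longrightarrow> b v v > 0"
    and lin: "linear D" and Dsym: "\<And>u v w. D u v w = D u w v"
  shows "\<exists>!\<Gamma> :: 'e \<Rightarrow>\<^sub>L 'e \<Rightarrow>\<^sub>L 'e. (\<forall>u v. \<Gamma> u v = \<Gamma> v u) \<and>
     (\<forall>u v w. D u v w = b (\<Gamma> u v) w + b v (\<Gamma> u w))"
proof -
  have nd: "v = v'" if "\<And>w. b v w = b v' w" for v v'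
  proof -
    have "b (v - v') (v - v') = 0" using that by (simp add: blinfun.diff_left blinfun.diff_right)
    then show ?thesis using pos[of "v - v'"] by force
  qed
  define G where "G v = (\<Sum>i\<in>Basis. b v i *\<^sub>R i)" for v
  have G_in: "G v \<bullet> w = b v w" for v w
  proof -
    have "b v w = b v (\<Sum>i\<in>Basis. (w \<bullet> i) *\<^sub>R i)" by (simp add: euclidean_representation)
    also have "\<dots> = G v \<bullet> w"
      by (simp add: G_def blinfun.sum_right blinfun.scaleR_right inner_sum_left inner_commute[of w] mult.commute)
    finally show ?thesis by simp
  qed
  have linG: "linear G"
    by (rule linearI; rule vector_eq_ldot[THEN iffD1, rule_format])
      (simp_all add: G_in inner_commute[of _ "G _"] inner_add_right inner_add_left blinfun.add_left blinfun.scaleR_left blinfun.add_right blinfun.scaleR_right)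
  have "inj G" by (rule injI, rule nd) (metis G_in)
  then have "surj G" using linG linear_injective_imp_surjective by blast
  have ex: "\<exists>z. \<forall>w. b z w = f w" if "linear f" for f :: "'e \<Rightarrow> real"
  proof -
    obtain z where z: "G z = (\<Sum>i\<in>Basis. f i *\<^sub>R i)" using \<open>surj G\<close> by (metis surjD)
    have "b z w = f w" for w
    proof -
      have "f w = f (\<Sum>i\<in>Basis. (w \<bullet> i) *\<^sub>R i)" by (simp add: euclidean_representation)
      also have "\<dots> = G z \<bullet> w"
        unfolding z by (simp add: linear_sum[OF that] linear_cmul[OF that] inner_sum_left inner_commute[of w] mult.commute)
      finally show ?thesis by (simp add: G_in)
    qed
    then show ?thesis by blast
  qed
  define K where "K u v w = (D u v w + D v u w - D w u v) / 2" for u v w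
  have Dadd: "D (x + y) = D x + D y" and Dscale: "D (r *\<^sub>R x) = r *\<^sub>R D x" for x y r
    using lin by (simp_all add: linear_add linear_cmul)
  note bl = Dadd Dscale blinfun.add_left blinfun.add_right blinfun.scaleR_left blinfun.scaleR_right
  have "\<exists>z. \<forall>w. b z w = K u v w" for u v
    by (rule ex, rule linearI) (simp_all add: K_def bl algebra_simps add_divide_distrib diff_divide_distrib)
  then obtain \<gamma> where \<gamma>: "\<And>u v w. b (\<gamma> u v) w = K u v w" by metis
  have g1: "\<gamma> (u + u') v = \<gamma> u v + \<gamma> u' v" and g2: "\<gamma> (r *\<^sub>R u) v = r *\<^sub>R \<gamma> u v"
    and g3: "\<gamma> u (v + v') = \<gamma> u v + \<gamma> u v'" and g4: "\<gamma> u (r *\<^sub>R v) = r *\<^sub>R \<gamma> u v" for u u' v v' r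
    by (rule nd, simp add: \<gamma> blinfun.add_left blinfun.scaleR_left blinfun.add_right blinfun.scaleR_right,
        simp add: K_def bl algebra_simps add_divide_distrib diff_divide_distrib)+
  have l2: "bounded_linear (\<gamma> u)" for u
    unfolding linear_conv_bounded_linear[symmetric] by (rule linearI) (simp_all add: g3 g4)
  have l1: "bounded_linear (\<lambda>u. Blinfun (\<gamma> u))"
    unfolding linear_conv_bounded_linear[symmetric]
    by (rule linearI; rule blinfun_eqI)
      (simp_all add: bounded_linear_Blinfun_apply[OF l2] g1 g2 blinfun.add_left blinfun.scaleR_left)
  define \<Gamma> where "\<Gamma> = Blinfun (\<lambda>u. Blinfun (\<gamma> u))"
  have \<Gamma>: "\<Gamma> u v = \<gamma> u v" for u v
    by (simp add: \<Gamma>_def bounded_linear_Blinfun_apply[OF l1] bounded_linear_Blinfun_apply[OF l2])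
  show ?thesis
  proof (rule ex1I[of _ \<Gamma>])
    have "\<gamma> u v = \<gamma> v u" for u v
      by (rule nd) (use Dsym in \<open>simp add: \<gamma> K_def algebra_simps\<close>)
    moreover have "D u v w = b (\<gamma> u v) w + b v (\<gamma> u w)" for u v w
      unfolding sym[of v] \<gamma> K_def using Dsym[of u v w] Dsym[of v u w] Dsym[of w u v] by (simp add: field_simps)
    ultimately show "(\<forall>u v. \<Gamma> u v = \<Gamma> v u) \<and> (\<forall>u v w. D u v w = b (\<Gamma> u v) w + b v (\<Gamma> u w))"
      by (simp add: \<Gamma>)
  next
    fix \<Delta> :: "'e \<Rightarrow>\<^sub>L 'e \<Rightarrow>\<^sub>L 'e"
    assume *: "(\<forall>u v. \<Delta> u v = \<Delta> v u) \<and> (\<forall>u v w. D u v w = b (\<Delta> u v) w + b v (\<Delta> u w))"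
    have "\<Delta> u v = \<gamma> u v" for u v
    proof (rule nd)
      fix w
      have D: "D u v w = b (\<Delta> u v) w + b v (\<Delta> u w)" for u v w using * by blast
      have s: "\<Delta> u v = \<Delta> v u" for u v using * by blast
      show "b (\<Delta> u v) w = b (\<gamma> u v) w"
        unfolding \<gamma> K_def D using s[of v u] s[of w u] s[of w v] sym[of v "\<Delta> u w"] sym[of u "\<Delta> v w"]
          by (simp add: sym)
    qed
    then show "\<Delta> = \<Gamma>" by (intro blinfun_eqI) (simp add: \<Gamma>)
  qed
qed

lemma christoffel_ex1:
  fixes M :: "('a, 'e::euclidean_space) riem"
  assumes M: "riemannian_manifold M" and c: "c \<in> atlas M" and x: "x \<in> chart_image c"
  shows "\<exists>!\<Gamma> :: 'e \<Rightarrow>\<^sub>L 'e \<Rightarrow>\<^sub>L 'e. (\<forall>u v. \<Gamma> u v = \<Gamma> v u) \<and>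
     (\<forall>u v w. frechet_derivative (metric M c) (at x) u v w =
        metric M c x (\<Gamma> u v) w + metric M c x v (\<Gamma> u w))"
proof -
  let ?g = "metric M c" let ?D = "frechet_derivative ?g (at x)"
  have op: "open (chart_image c)"
    using M c by (auto simp: riemannian_manifold_def smooth_atlas_def)
  have "smooth_on ?g (chart_image c)"
    using M c by (auto simp: riemannian_manifold_def bilinear_tensor_field_def)
  then have "Ck_on (Suc 0) ?g (chart_image c)" unfolding smooth_on_def by blast
  then have "?g differentiable (at x)" using x by simp
  then have D: "(?g has_derivative ?D) (at x)" using frechet_derivative_works by blast
  have D': "((\<lambda>y. ?g y v w) has_derivative (\<lambda>u. ?D u v w)) (at x)" for v w
    by (auto intro!: derivative_eq_intros D)
  have "?D u v w = ?D u w v" for u v w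
  proof -
    have "((\<lambda>y. ?g y w v) has_derivative (\<lambda>u. ?D u v w)) (at x)"
      by (rule has_derivative_transform_within_open[OF D' op x])
        (use M c in \<open>auto simp: riemannian_manifold_def\<close>)
    from has_derivative_unique[OF this D'] show ?thesis by meson
  qed
  moreover have "linear ?D" using D has_derivative_linear by blast
  ultimately show ?thesis
    using M c x by (intro levi_civita_algebra) (auto simp: riemannian_manifold_def)
qed

definition curvature ::
    "('a, 'e::euclidean_space) riem \<Rightarrow> ('a, 'e) chart \<Rightarrow> 'e \<Rightarrow> 'e \<Rightarrow> 'e \<Rightarrow> 'e \<Rightarrow> 'e" where
  "curvature M c x u v w =
     (let \<Gamma> = christoffel M c x; D\<Gamma> = frechet_derivative (christoffel M c) (at x)
      in D\<Gamma> u v w - D\<Gamma> v u w + \<Gamma> u (\<Gamma> v w) - \<Gamma> v (\<Gamma> u w))"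

definition scalar_curvature ::
    "('a, 'e::euclidean_space) riem \<Rightarrow> ('a, 'e) chart \<Rightarrow> 'e \<Rightarrow> real" where
  "scalar_curvature M c x =
     (let B = (SOME B. orthonormal_frame (metric M c x) B)
      in \<Sum>e\<in>B. \<Sum>f\<in>B. metric M c x (curvature M c x e f f) e)"

definition nonzero_scalar_curvature :: "('a, 'e::euclidean_space) riem \<Rightarrow> bool" where
  "nonzero_scalar_curvature M \<longleftrightarrow>
     (\<forall>c\<in>atlas M. \<forall>x\<in>chart_image c. scalar_curvature M c x \<noteq> 0)"

definition nabla_end ::
    "('a, 'e::euclidean_space) riem \<Rightarrow> ('a, 'e) chart \<Rightarrow> ('e \<Rightarrow> 'e endo) \<Rightarrow> 'e \<Rightarrow> 'e \<Rightarrow> 'e endo" where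
  "nabla_end M c J x Y =
     frechet_derivative J (at x) Y + (christoffel M c x Y o\<^sub>L J x) - (J x o\<^sub>L christoffel M c x Y)"


section \<open>Two-forms\<close>

type_synonym ('a, 'e) form2 = "('a, 'e) chart \<Rightarrow> 'e \<Rightarrow> 'e bilin"

definition alternating :: "'e::euclidean_space bilin \<Rightarrow> bool" where
  "alternating b \<longleftrightarrow> (\<forall>v w. b v w = - b w v)"

definition two_form :: "('a, 'e::euclidean_space) riem \<Rightarrow> ('a, 'e) form2 \<Rightarrow> bool" where
  "two_form M \<psi> \<longleftrightarrow> bilinear_tensor_field (atlas M) \<psi> \<and>
     (\<forall>c\<in>atlas M. \<forall>x\<in>chart_image c. alternating (\<psi> c x))"

text \<open>\<open>nabla_form M \<psi> c x Y v w\<close> is \<open>(\<nabla>\<^sub>Y \<psi>)(v, w)\<close>.\<close>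

definition nabla_form ::
    "('a, 'e::euclidean_space) riem \<Rightarrow> ('a, 'e) form2 \<Rightarrow> ('a, 'e) chart \<Rightarrow> 'e \<Rightarrow> 'e \<Rightarrow> 'e \<Rightarrow> 'e \<Rightarrow> real"
  where
  "nabla_form M \<psi> c x Y v w =
     (let \<Gamma> = christoffel M c x
      in frechet_derivative (\<psi> c) (at x) Y v w - \<psi> c x (\<Gamma> Y v) w - \<psi> c x v (\<Gamma> Y w))"

text \<open>Exterior derivative evaluated on the constant (hence commuting) coordinate fields
  \<open>u, v, w\<close>; no combinatorial factor, i.e. \<open>d\<psi> = \<Sum>\<^sub>k e\<^sub>k \<and> \<nabla>\<^bsub>e\<^sub>k\<^esub> \<psi>\<close>.\<close>

definition ext_deriv ::
    "('a, 'e::euclidean_space) form2 \<Rightarrow> ('a, 'e) chart \<Rightarrow> 'e \<Rightarrow> 'e \<Rightarrow> 'e \<Rightarrow> 'e \<Rightarrow> real" where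
  "ext_deriv \<psi> c x u v w =
     (let D = frechet_derivative (\<psi> c) (at x) in D u v w - D v u w + D w u v)"

definition codifferential ::
    "('a, 'e::euclidean_space) riem \<Rightarrow> ('a, 'e) form2 \<Rightarrow> ('a, 'e) chart \<Rightarrow> 'e \<Rightarrow> 'e \<Rightarrow> real" where
  "codifferential M \<psi> c x v =
     (let B = (SOME B. orthonormal_frame (metric M c x) B)
      in - (\<Sum>e\<in>B. nabla_form M \<psi> c x e e v))"

definition wedge :: "('e \<Rightarrow> real) \<Rightarrow> ('e \<Rightarrow> real) \<Rightarrow> 'e \<Rightarrow> 'e \<Rightarrow> real" where
  "wedge \<alpha> \<beta> v w = \<alpha> v * \<beta> w - \<alpha> w * \<beta> v"

definition conformal_killing :: "('a, 'e::euclidean_space) riem \<Rightarrow> ('a, 'e) form2 \<Rightarrow> bool" where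
  "conformal_killing M \<psi> \<longleftrightarrow> (\<forall>c\<in>atlas M. \<forall>x\<in>chart_image c. \<forall>Y v w.
     nabla_form M \<psi> c x Y v w =
       1 / 3 * ext_deriv \<psi> c x Y v w
       - 1 / (real DIM('e) - 1) * wedge (metric M c x Y) (codifferential M \<psi> c x) v w)"

definition parallel_form :: "('a, 'e::euclidean_space) riem \<Rightarrow> ('a, 'e) form2 \<Rightarrow> bool" where
  "parallel_form M \<psi> \<longleftrightarrow>
     (\<forall>c\<in>atlas M. \<forall>x\<in>chart_image c. \<forall>Y v w. nabla_form M \<psi> c x Y v w = 0)"


section \<open>Quaternionic-Kaehler structures\<close>

text \<open>\<open>quat_triple b F J1 J2 J3\<close>: the \<open>J\<^sub>i\<close> are anti-commuting \<open>b\<close>-orthogonal complex structures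
  with \<open>J\<^sub>3 = J\<^sub>1 J\<^sub>2\<close>, and they span \<open>F\<close>.\<close>

definition quat_triple ::
    "'e::euclidean_space bilin \<Rightarrow> 'e endo set \<Rightarrow> 'e endo \<Rightarrow> 'e endo \<Rightarrow> 'e endo \<Rightarrow> bool" where
  "quat_triple b F J1 J2 J3 \<longleftrightarrow>
     (\<forall>J\<in>{J1, J2, J3}. J o\<^sub>L J = - id_blinfun \<and> (\<forall>v w. b (J v) (J w) = b v w)) \<and>
     J1 o\<^sub>L J2 = - (J2 o\<^sub>L J1) \<and> J1 o\<^sub>L J3 = - (J3 o\<^sub>L J1) \<and> J2 o\<^sub>L J3 = - (J3 o\<^sub>L J2) \<and>
     J3 = J1 o\<^sub>L J2 \<and> F = span {J1, J2, J3}"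

text \<open>\<open>Q c x\<close> is the coordinate representation of the fibre of the rank three bundle of
  endomorphisms. The condition on \<open>nabla_end\<close> says that \<open>\<nabla>\<close> preserves sections of \<open>Q\<close>.\<close>

definition quaternionic_kaehler ::
    "('a, 'e::euclidean_space) riem \<Rightarrow> (('a, 'e) chart \<Rightarrow> 'e \<Rightarrow> 'e endo set) \<Rightarrow> bool" where
  "quaternionic_kaehler M Q \<longleftrightarrow> riemannian_manifold M \<and> 4 dvd DIM('e) \<and> 8 \<le> DIM('e) \<and>
     (\<forall>c\<in>atlas M. \<forall>c'\<in>atlas M. \<forall>x\<in>overlap c c'.
        Q c' (transition c c' x) =
          {J' :: 'e endo. \<exists>J\<in>Q c x. \<forall>v. J' (jac c c' x v) = jac c c' x (J v)}) \<and>
     (\<forall>c\<in>atlas M. \<forall>x\<in>chart_image c. \<exists>V J1 J2 J3.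
        open V \<and> x \<in> V \<and> V \<subseteq> chart_image c \<and>
        smooth_on J1 V \<and> smooth_on J2 V \<and> smooth_on J3 V \<and>
        (\<forall>y\<in>V. quat_triple (metric M c y) (Q c y) (J1 y) (J2 y) (J3 y))) \<and>
     (\<forall>c\<in>atlas M. \<forall>V J. open V \<and> V \<subseteq> chart_image c \<and> smooth_on J V \<and> (\<forall>y\<in>V. J y \<in> Q c y) \<longrightarrow>
        (\<forall>y\<in>V. \<forall>Y. nabla_end M c J y Y \<in> Q c y))"

text \<open>Fibres of the bundles \<open>S\<^sup>2H\<close> and \<open>S\<^sup>2E\<close>; \<open>b o\<^sub>L J\<close> is the form \<open>b (J \<cdot>) \<cdot>\<close>.\<close>

definition S2H :: "'e::euclidean_space bilin \<Rightarrow> 'e endo set \<Rightarrow> 'e bilin set" where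
  "S2H b F = {\<psi>. \<exists>J1 J2 J3. quat_triple b F J1 J2 J3 \<and> \<psi> \<in> span {b o\<^sub>L J1, b o\<^sub>L J2, b o\<^sub>L J3}}"

definition S2E :: "'e::euclidean_space bilin \<Rightarrow> 'e endo set \<Rightarrow> 'e bilin set" where
  "S2E b F = {\<psi>. alternating \<psi> \<and> (\<forall>J1 J2 J3. quat_triple b F J1 J2 J3 \<longrightarrow>
     (\<forall>J\<in>{J1, J2, J3}. \<forall>v w. \<psi> (J v) (J w) = \<psi> v w))}"

definition compatible ::
    "('a, 'e::euclidean_space) riem \<Rightarrow> (('a, 'e) chart \<Rightarrow> 'e \<Rightarrow> 'e endo set) \<Rightarrow> ('a, 'e) form2 \<Rightarrow> bool"
  where
  "compatible M Q \<psi> \<longleftrightarrow> (\<forall>c\<in>atlas M. \<forall>x\<in>chart_image c.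
     \<exists>\<alpha>\<in>S2H (metric M c x) (Q c x). \<exists>\<beta>\<in>S2E (metric M c x) (Q c x). \<psi> c x = \<alpha> + \<beta>)"


section \<open>Parallel transport and holonomy\<close>

text \<open>Intervals on which a curve, with finite set \<open>S\<close> of break points, stays in one chart and has
  no break point in the interior.\<close>

definition chart_segment ::
    "(real \<Rightarrow> 'a) \<Rightarrow> real set \<Rightarrow> ('a, 'e) chart \<Rightarrow> real \<Rightarrow> real \<Rightarrow> bool" where
  "chart_segment \<gamma> S c a b \<longleftrightarrow>
     0 \<le> a \<and> a < b \<and> b \<le> 1 \<and> {a<..<b} \<inter> S = {} \<and> \<gamma> ` {a..b} \<subseteq> fst c"

text \<open>Each piece is required to be \<open>C\<^sup>1\<close> up to and including its end points (one-sided derivatives);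
  \<open>piecewise_C1_differentiable_on\<close> does not demand this.\<close>

definition piecewise_C1_curve ::
    "('a, 'e::euclidean_space) riem \<Rightarrow> (real \<Rightarrow> 'a) \<Rightarrow> real set \<Rightarrow> bool" where
  "piecewise_C1_curve M \<gamma> S \<longleftrightarrow> pathin (mtop M) \<gamma> \<and> finite S \<and>
     (\<forall>c\<in>atlas M. \<forall>a b. chart_segment \<gamma> S c a b \<longrightarrow>
        (\<exists>D. continuous_on {a..b} D \<and>
           (\<forall>t\<in>{a..b}. ((snd c \<circ> \<gamma>) has_vector_derivative D t) (at t within {a..b}))))"

text \<open>A vector field along \<open>\<gamma>\<close> is given by its components \<open>X c t\<close> in every chart \<open>c\<close> around \<open>\<gamma> t\<close>.\<close>

definition parallel_along ::
    "('a, 'e::euclidean_space) riem \<Rightarrow> (real \<Rightarrow> 'a) \<Rightarrow> real set \<Rightarrow> (('a, 'e) chart \<Rightarrow> real \<Rightarrow> 'e) \<Rightarrow> bool"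
  where
  "parallel_along M \<gamma> S X \<longleftrightarrow>
     (\<forall>c\<in>atlas M. \<forall>c'\<in>atlas M. \<forall>t\<in>{0..1}. \<gamma> t \<in> fst c \<inter> fst c' \<longrightarrow>
        X c' t = jac c c' (snd c (\<gamma> t)) (X c t)) \<and>
     (\<forall>c\<in>atlas M. \<forall>a b. chart_segment \<gamma> S c a b \<longrightarrow>
        (\<forall>t\<in>{a..b}. (X c has_vector_derivative
           - christoffel M c (snd c (\<gamma> t))
               (vector_derivative (snd c \<circ> \<gamma>) (at t within {a..b})) (X c t))
           (at t within {a..b})))"

text \<open>The holonomy group at \<open>p\<close>, acting on the tangent space at \<open>p\<close>, which is identified with the
  model space by the chart \<open>c\<close> around \<open>p\<close>.\<close>

definition holonomy ::
    "('a, 'e::euclidean_space) riem \<Rightarrow> ('a, 'e) chart \<Rightarrow> 'a \<Rightarrow> ('e \<Rightarrow> 'e) set" where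
  "holonomy M c p = {P. \<exists>\<gamma> S. piecewise_C1_curve M \<gamma> S \<and> \<gamma> 0 = p \<and> \<gamma> 1 = p \<and>
     (\<forall>v. \<exists>X. parallel_along M \<gamma> S X \<and> X c 0 = v \<and> X c 1 = P v)}"


section \<open>The group Sp(1)Sp(n)\<close>

text \<open>The pair \<open>(a, b)\<close> stands for the quaternion \<open>a + b j\<close>; the norm of the product type is the
  quaternionic norm.\<close>

type_synonym quat = "complex \<times> complex"

definition qmult :: "quat \<Rightarrow> quat \<Rightarrow> quat" where
  "qmult p q = (fst p * fst q - snd p * cnj (snd q), fst p * snd q + snd p * cnj (fst q))"

definition rscale :: "quat \<Rightarrow> quat ^ 'n \<Rightarrow> quat ^ 'n" where
  "rscale q v = (\<chi> i. qmult (v $ i) q)"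

text \<open>\<open>Sp(n)\<close> consists of the isometries of the right quaternionic vector space \<open>H\<^sup>n\<close> which are
  quaternionic linear; \<open>Sp(1)\<close> acts by right multiplication with unit quaternions.\<close>

definition Sp :: "(quat ^ 'n \<Rightarrow> quat ^ 'n) set" where
  "Sp = {f. orthogonal_transformation f \<and> (\<forall>q v. f (rscale q v) = rscale q (f v))}"

definition Sp1Sp :: "(quat ^ 'n \<Rightarrow> quat ^ 'n) set" where
  "Sp1Sp = {f \<circ> rscale q |f q. f \<in> Sp \<and> norm q = 1}"

text \<open>The holonomy group is only defined up to the choice of a linear isometry of the tangent space
  with the model space.\<close>

definition holonomy_is_Sp1Sp :: "('a, quat ^ 'n) riem \<Rightarrow> bool" where
  "holonomy_is_Sp1Sp M \<longleftrightarrow> (\<forall>c\<in>atlas M. \<forall>p\<in>fst c. \<exists>L :: quat ^ 'n \<Rightarrow> quat ^ 'n.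
     linear L \<and> bij L \<and> (\<forall>v w. L v \<bullet> L w = metric M c (snd c p) v w) \<and>
     (\<lambda>P. L \<circ> P \<circ> inv L) ` holonomy M c p = Sp1Sp)"

end

theory Submission
  imports Defs
begin

text \<open>Write \<open>\<psi> = g(\<Psi> \<cdot>, \<cdot>)\<close>. Compatibility turns the conformal Killing equation into
  \<open>\<nabla>\<^sub>Y \<Psi> = N(\<theta>, Y)\<close>, with \<open>\<theta>\<close> a multiple of the codifferential and \<open>N\<close> algebraic. The Ricci identity
  for \<open>\<Psi>\<close> then expresses \<open>A = \<nabla>\<theta>\<close> through \<open>\<Psi>\<close>, shows that \<open>A\<close> is skew, and yields Kostant's formula
  \<open>\<nabla>\<^sub>Y A = - R(\<theta>, Y)\<close>. Let \<open>V\<close> be an element of \<open>sp(1) + sp(n)\<close> orthogonal to the parallel translates of all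
  curvature endomorphisms. Its parallel translates along a line satisfy the same pointwise condition,
  which forces them to commute with \<open>A\<close>; differentiating, \<open>V\<close> commutes with \<open>R(\<theta>, Y)\<close>. Since
  \<open>R = \<kappa> (\<dots>) + W\<close> with \<open>\<kappa> \<noteq> 0\<close> and \<open>W\<close> of hyperkaehler type, this is only possible for \<open>V = 0\<close> wherever
  \<open>\<theta> \<noteq> 0\<close>.

  Consequently the velocities at the identity of curves in the holonomy group fill \<open>sp(1) + sp(n)\<close>: the
  curvature endomorphisms are velocities of holonomies around small squares, and conjugation by
  parallel transport gives their translates. By Sussmann's open mapping theorem the holonomy
  group contains a neighbourhood of the identity of \<open>Sp(1)Sp(n)\<close>, and such a neighbourhood generates that
  group because each element of \<open>Sp(n)\<close> is a product of quaternionic reflections, which lie on spheres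
  through the identity. No Lie group structure on the holonomy group is needed.\<close>

section \<open>Calculus of smooth maps\<close>

text \<open>Members of \<open>holonomy\<close> are bare functions: each vector has its own parallel
  field, and nothing in the definition says that the resulting map is linear, isometric or
  compatible with Q. These properties are recovered from parallel tensors. The metric gives
  isometry, and a map preserving two inner products is linear; the frame-independent tensor \<Sum>
  Ji \<otimes> Ji gives invariance of Q, so that no connection forms of the local frame J1, J2, J3
  have to be handled.

  The curvature argument is confined to one point and its first order neighbourhood. The annihilator
  condition is differentiated once, so parallel translation along short coordinate rays suffices.
  The point is any one where \<nabla>\<psi> does not vanish, because \<theta> is then non-zero
  there. Connectedness carries the result to all other points by conjugation.

  Velocities take the place of a Lie algebra: products and rescalings of curves that are
  differentiable at a single time show that they form a linear space. Dimension at least 8 enters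
  through a unit vector orthogonal to a given quaternionic line.\<close>

lemma Ck_on_continuous: "Ck_on k f S \<Longrightarrow> continuous_on S f"
 by (cases k) (auto intro!: differentiable_imp_continuous_on differentiable_at_imp_differentiable_on)

lemma Ck_on_mono: "Ck_on (Suc k) f S \<Longrightarrow> Ck_on k f S"
proof (induction k arbitrary: f)
 case 0
 then show ?case using Ck_on_continuous by (metis Ck_on.simps(1))
next
 case (Suc k)
 then show ?case by (metis Ck_on.simps(2))
qed

lemma Ck_on_subset: "Ck_on k f S \<Longrightarrow> T \<subseteq> S \<Longrightarrow> Ck_on k f T"
proof (induction k arbitrary: f)
 case 0
 then show ?case by (auto intro: continuous_on_subset)
qed auto

lemma Ck_on_cong:
 assumes "open S" "\<And>x. x \<in> S \<Longrightarrow> f x = g x"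
 shows "Ck_on k f S \<longleftrightarrow> Ck_on k g S"
 using assms(2)
proof (induction k arbitrary: f g)
 case 0
 then show ?case by (simp cong: continuous_on_cong)
next
 case (Suc k)
 have D: "(f has_derivative F) (at x) \<longleftrightarrow> (g has_derivative F) (at x)" if "x \<in> S" for x F
  using has_derivative_transform_within_open[of f F x UNIV S g] 
   has_derivative_transform_within_open[of g F x UNIV S f] assms(1) that Suc.prems by auto
 have "frechet_derivative f (at x) = frechet_derivative g (at x)" if "x \<in> S" for x
  unfolding frechet_derivative_def by (simp add: D that)
 moreover have "f differentiable (at x) \<longleftrightarrow> g differentiable (at x)" if "x \<in> S" for x
  by (simp add: differentiable_def D that)
 ultimately show ?case using Suc.IH by (metis (no_types, lifting) Ck_on.simps(2))
qed

text \<open>\<open>Ck_on\<close> refers to \<open>frechet_derivative\<close>; this rule replaces it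
  by an explicit formula f'. Openness of S lets equality on S carry over to derivatives. The closure
  properties below are inductions on k through it.\<close>

lemma Ck_on_SucI:
 assumes "open S" "\<And>x. x \<in> S \<Longrightarrow> (f has_derivative f' x) (at x)"
  "\<And>v. Ck_on k (\<lambda>x. f' x v) S"
 shows "Ck_on (Suc k) f S"
proof -
 have "frechet_derivative f (at x) = f' x" if "x \<in> S" for x
  using assms(2)[OF that] frechet_derivative_at by metis
 then have "Ck_on k (\<lambda>x. frechet_derivative f (at x) v) S" for v
  using Ck_on_cong[OF assms(1), of "\<lambda>x. frechet_derivative f (at x) v" "\<lambda>x. f' x v"] assms(3) by simp
 then show ?thesis using assms(2) by (auto simp: differentiable_def)
qed

lemma Ck_on_SucD:
 assumes "Ck_on (Suc k) f S" "x \<in> S"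
 shows "(f has_derivative frechet_derivative f (at x)) (at x)"
 using assms frechet_derivative_works by auto

lemma Ck_on_const: "open S \<Longrightarrow> Ck_on k (\<lambda>x. c) S"
proof (induction k arbitrary: c)
 case (Suc k)
 then show ?case by (intro Ck_on_SucI[where f' = "\<lambda>x v. 0"]) auto
qed simp

lemma Ck_on_linear:
 assumes "bounded_linear L" "open S" "Ck_on k f S"
 shows "Ck_on k (\<lambda>x. L (f x)) S"
 using assms(3)
proof (induction k arbitrary: f)
 case 0
 then show ?case using assms(1) by (simp add: bounded_linear.continuous_on)
next
 case (Suc k)
 show ?case
  by (rule Ck_on_SucI[OF assms(2), where f' = "\<lambda>x v. L (frechet_derivative f (at x) v)"])
   (use Suc in \<open>auto intro!: bounded_linear.has_derivative[OF assms(1)] Ck_on_SucD[OF Suc.prems]\<close>)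
qed

lemma Ck_on_add:
 assumes "open S" "Ck_on k f S" "Ck_on k g S"
 shows "Ck_on k (\<lambda>x. f x + g x) S"
 using assms(2,3)
proof (induction k arbitrary: f g)
 case 0
 then show ?case by (simp add: continuous_on_add)
next
 case (Suc k)
 show ?case
  by (rule Ck_on_SucI[OF assms(1), where f' = "\<lambda>x v. frechet_derivative f (at x) v + frechet_derivative g (at x) v"])
   (use Suc in \<open>auto intro!: has_derivative_add Ck_on_SucD[OF Suc.prems(1)] Ck_on_SucD[OF Suc.prems(2)]\<close>)
qed

lemma Ck_on_bilinear:
 assumes "bounded_bilinear p" "open S" "Ck_on k f S" "Ck_on k g S"
 shows "Ck_on k (\<lambda>x. p (f x) (g x)) S"
 using assms(3,4)
proof (induction k arbitrary: f g)
 case 0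
 then show ?case using assms(1) by (simp add: bounded_bilinear.continuous_on)
next
 case (Suc k)
 show ?case
 proof (rule Ck_on_SucI[OF assms(2), where f' = "\<lambda>x v. p (f x) (frechet_derivative g (at x) v)
    + p (frechet_derivative f (at x) v) (g x)"])
  show "((\<lambda>x. p (f x) (g x)) has_derivative
    (\<lambda>v. p (f x) (frechet_derivative g (at x) v) + p (frechet_derivative f (at x) v) (g x))) (at x)"
   if "x \<in> S" for x
   by (intro bounded_bilinear.FDERIV[OF assms(1)] Ck_on_SucD[OF Suc.prems(1)] Ck_on_SucD[OF Suc.prems(2)] that)
  show "Ck_on k (\<lambda>x. p (f x) (frechet_derivative g (at x) v) + p (frechet_derivative f (at x) v) (g x)) S" for v
   using Suc.prems by (intro Ck_on_add[OF assms(2)] Suc.IH Ck_on_mono[of k f] Ck_on_mono[of k g]) auto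
 qed
qed

lemma smooth_on_subset: "smooth_on f S \<Longrightarrow> T \<subseteq> S \<Longrightarrow> smooth_on f T"
 unfolding smooth_on_def using Ck_on_subset by blast

lemma smooth_on_cong: "open S \<Longrightarrow> (\<And>x. x \<in> S \<Longrightarrow> f x = g x) \<Longrightarrow> smooth_on f S \<longleftrightarrow> smooth_on g S"
 unfolding smooth_on_def using Ck_on_cong by blast

lemma smooth_on_deriv: "smooth_on f S \<Longrightarrow> x \<in> S \<Longrightarrow> (f has_derivative frechet_derivative f (at x)) (at x)"
 unfolding smooth_on_def using Ck_on_SucD by blast

lemma smooth_on_frechet: "smooth_on f S \<Longrightarrow> smooth_on (\<lambda>x. frechet_derivative f (at x) v) S"
 unfolding smooth_on_def by (metis Ck_on.simps(2))

lemma smooth_on_continuous: "smooth_on f S \<Longrightarrow> continuous_on S f"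
 unfolding smooth_on_def using Ck_on_continuous by blast

lemma smooth_on_const: "open S \<Longrightarrow> smooth_on (\<lambda>x. c) S"
 unfolding smooth_on_def using Ck_on_const by blast

lemma smooth_on_linear: "bounded_linear L \<Longrightarrow> open S \<Longrightarrow> smooth_on f S \<Longrightarrow> smooth_on (\<lambda>x. L (f x)) S"
 unfolding smooth_on_def using Ck_on_linear by blast

lemma smooth_on_add: "open S \<Longrightarrow> smooth_on f S \<Longrightarrow> smooth_on g S \<Longrightarrow> smooth_on (\<lambda>x. f x + g x) S"
 unfolding smooth_on_def using Ck_on_add by blast

lemma smooth_on_minus: "open S \<Longrightarrow> smooth_on f S \<Longrightarrow> smooth_on (\<lambda>x. - f x) S"
 by (rule smooth_on_linear[OF bounded_linear_minus[OF bounded_linear_ident]])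

lemma smooth_on_diff: "open S \<Longrightarrow> smooth_on f S \<Longrightarrow> smooth_on g S \<Longrightarrow> smooth_on (\<lambda>x. f x - g x) S"
 using smooth_on_add[of S f "\<lambda>x. - g x"] smooth_on_minus by fastforce

lemma smooth_on_bilinear:
 "bounded_bilinear p \<Longrightarrow> open S \<Longrightarrow> smooth_on f S \<Longrightarrow> smooth_on g S \<Longrightarrow> smooth_on (\<lambda>x. p (f x) (g x)) S"
 unfolding smooth_on_def using Ck_on_bilinear by blast

lemmas smooth_on_scaleR = smooth_on_bilinear[OF bounded_bilinear_scaleR]
lemmas smooth_on_inner = smooth_on_bilinear[OF bounded_bilinear_inner]
lemmas smooth_on_blinfun_apply = smooth_on_bilinear[OF bounded_bilinear_blinfun_apply]
lemmas smooth_on_compose = smooth_on_bilinear[OF bounded_bilinear_blinfun_compose]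

lemma smooth_on_sum:
 assumes "open S" "finite I" "\<And>i. i \<in> I \<Longrightarrow> smooth_on (f i) S"
 shows "smooth_on (\<lambda>x. \<Sum>i\<in>I. f i x) S"
 using assms(2,3)
 by (induction I rule: finite_induct) (auto intro!: smooth_on_const smooth_on_add assms(1))

lemma blinfun_basis_sum:
 fixes f :: "'a::euclidean_space \<Rightarrow>\<^sub>L 'b::real_normed_vector"
 shows "f = (\<Sum>i\<in>Basis. blinfun_scaleR_left (f i) o\<^sub>L blinfun_inner_left i)"
proof (rule blinfun_eqI)
 fix v
 have "f v = f (\<Sum>i\<in>Basis. (v \<bullet> i) *\<^sub>R i)" by (simp add: euclidean_representation)
 then show "f v = (\<Sum>i\<in>Basis. blinfun_scaleR_left (f i) o\<^sub>L blinfun_inner_left i) v"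
  by (simp add: blinfun.sum_left blinfun.sum_right blinfun.scaleR_right inner_commute[of v])
qed

text \<open>By \<open>blinfun_basis_sum\<close> an operator-valued map is a finite sum of fixed
  linear images of its values on a basis, so smoothness can be tested one basis vector at a time.
  Used twice, it treats Christoffel tensors.\<close>

lemma smooth_on_blinfunI:
 fixes f :: "'e::real_normed_vector \<Rightarrow> 'a::euclidean_space \<Rightarrow>\<^sub>L 'b::real_normed_vector"
 assumes S: "open S" and "\<And>i. i \<in> Basis \<Longrightarrow> smooth_on (\<lambda>x. f x i) S"
 shows "smooth_on f S"
proof -
 have "smooth_on (\<lambda>x. \<Sum>i\<in>Basis. blinfun_scaleR_left (f x i) o\<^sub>L blinfun_inner_left i) S"
  by (intro smooth_on_sum S finite_Basis assms(2) smooth_on_compose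
    smooth_on_linear[OF bounded_linear_blinfun_scaleR_left] smooth_on_const)
 then show ?thesis using blinfun_basis_sum[of "f _"] by (simp add: fun_eq_iff[symmetric])
qed

text \<open>The derivative of an inverse is \<open>- H \<circ> D G \<circ> H\<close>.\<close>

lemma smooth_on_left_inverse:
 fixes G H :: "'x::real_normed_vector \<Rightarrow> 'e::real_normed_vector \<Rightarrow>\<^sub>L 'e"
 assumes S: "open S" and G: "smooth_on G S" and H: "continuous_on S H"
  and HG: "\<And>x. x \<in> S \<Longrightarrow> H x o\<^sub>L G x = id_blinfun" and GH: "\<And>x. x \<in> S \<Longrightarrow> G x o\<^sub>L H x = id_blinfun"
 shows "smooth_on H S"
proof -
 let ?D = "\<lambda>x v. - (H x o\<^sub>L (frechet_derivative G (at x) v o\<^sub>L H x))"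
 have D: "(H has_derivative ?D x) (at x)" if x: "x \<in> S" for x
 proof -
  let ?dG = "frechet_derivative G (at x)"
  have dG: "(G has_derivative ?dG) (at x)" by (rule smooth_on_deriv[OF G x])
  have lin: "bounded_linear ?dG" using dG has_derivative_bounded_linear by blast
  have bl: "bounded_linear (?D x)"
   by (intro bounded_linear_minus bounded_linear_compose[OF bounded_bilinear.bounded_linear_right[OF bounded_bilinear_blinfun_compose]]
     bounded_linear_compose[OF bounded_bilinear.bounded_linear_left[OF bounded_bilinear_blinfun_compose]] lin)
  have tend: "(H \<longlongrightarrow> H x) (at x)" using H S x by (simp add: continuous_on_eq_continuous_at isCont_def)
  obtain \<epsilon> where eps: "(\<epsilon> \<longlongrightarrow> 0) (at x)" and
   G_eq: "\<And>y. G y = G x + ?dG (y - x) + norm (y - x) *\<^sub>R \<epsilon> y"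
  proof
   let ?e = "\<lambda>y. (G y - G x - ?dG (y - x)) /\<^sub>R norm (y - x)"
   show "(?e \<longlongrightarrow> 0) (at x)" using dG unfolding has_derivative_iff_norm
    by (subst tendsto_norm_zero_iff[symmetric]) (simp add: divide_inverse mult.commute)
   show "G y = G x + ?dG (y - x) + norm (y - x) *\<^sub>R ?e y" for y
    using linear_0[OF bounded_linear.linear[OF lin]] by (cases "y = x") auto
  qed
  obtain K where K: "K > 0" "\<And>v. norm (?dG v) \<le> norm v * K"
   using bounded_linear.pos_bounded[OF lin] by blast
  \<comment> \<open>The resolvent identity H y - H x = - H y (G y - G x) H x, with G y expanded to
    first order. The remainder splits into a term with the factor H x - H y and one with the factor
    \<epsilon> y.\<close>
  have eq: "(H y - H x - ?D x (y - x)) /\<^sub>R norm (y - x) =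
    ((H x - H y) o\<^sub>L (((1 / norm (y - x)) *\<^sub>R ?dG (y - x)) o\<^sub>L H x)) - (H y o\<^sub>L (\<epsilon> y o\<^sub>L H x))"
   if "y \<in> S" "y \<noteq> x" for y
  proof -
   have "H y - H x = (H y o\<^sub>L (G x o\<^sub>L H x)) - ((H y o\<^sub>L G y) o\<^sub>L H x)"
    unfolding HG[OF that(1)] GH[OF x] by (intro blinfun_eqI) (simp add: blinfun.diff_left)
   also have "\<dots> = - (H y o\<^sub>L ((?dG (y - x) + norm (y - x) *\<^sub>R \<epsilon> y) o\<^sub>L H x))"
    by (subst G_eq[of y]) (auto intro!: blinfun_eqI simp: blinfun.bilinear_simps)
   finally have *: "H y - H x = \<dots>" .
   show ?thesis unfolding * using that
    by (auto intro!: blinfun_eqI simp: blinfun.bilinear_simps algebra_simps divide_inverse)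
  qed
  have bnd: "norm ((1 / norm (y - x)) *\<^sub>R ?dG (y - x)) \<le> K" for y
   using K(2)[of "y - x"] K(1) by (cases "y = x") (auto simp: field_simps)
  have t1: "((\<lambda>y. (H x - H y) o\<^sub>L (((1 / norm (y - x)) *\<^sub>R ?dG (y - x)) o\<^sub>L H x)) \<longlongrightarrow> 0) (at x)"
  proof (rule Lim_null_comparison)
   have "((\<lambda>y. norm (H x - H y) * (K * norm (H x))) \<longlongrightarrow> norm (H x - H x) * (K * norm (H x))) (at x)"
    by (intro tendsto_intros tend)
   then show "((\<lambda>y. norm (H x - H y) * (K * norm (H x))) \<longlongrightarrow> 0) (at x)" by simp
   have "norm ((H x - H y) o\<^sub>L (((1 / norm (y - x)) *\<^sub>R ?dG (y - x)) o\<^sub>L H x))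
     \<le> norm (H x - H y) * (K * norm (H x))" for y
    using norm_blinfun_compose[of "(1 / norm (y - x)) *\<^sub>R ?dG (y - x)" "H x"] bnd[of y]
    by (meson norm_blinfun_compose[THEN order_trans] mult_left_mono mult_right_mono norm_ge_zero order_trans)
   then show "\<forall>\<^sub>F y in at x. norm ((H x - H y) o\<^sub>L (((1 / norm (y - x)) *\<^sub>R ?dG (y - x)) o\<^sub>L H x))
     \<le> norm (H x - H y) * (K * norm (H x))" by simp
  qed
  have "((\<lambda>y. H y o\<^sub>L (\<epsilon> y o\<^sub>L H x)) \<longlongrightarrow> H x o\<^sub>L (0 o\<^sub>L H x)) (at x)"
   by (intro bounded_bilinear.tendsto[OF bounded_bilinear_blinfun_compose] tend eps tendsto_const)
  then have "((\<lambda>y. ((H x - H y) o\<^sub>L (((1 / norm (y - x)) *\<^sub>R ?dG (y - x)) o\<^sub>L H x)) - (H y o\<^sub>L (\<epsilon> y o\<^sub>L H x))) \<longlongrightarrow> 0 - (H x o\<^sub>L (0 o\<^sub>L H x))) (at x)"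
   by (intro tendsto_diff t1)
  then have *: "((\<lambda>y. ((H x - H y) o\<^sub>L (((1 / norm (y - x)) *\<^sub>R ?dG (y - x)) o\<^sub>L H x)) - (H y o\<^sub>L (\<epsilon> y o\<^sub>L H x))) \<longlongrightarrow> 0) (at x)"
   by simp
  have "((\<lambda>y. (H y - H x - ?D x (y - x)) /\<^sub>R norm (y - x)) \<longlongrightarrow> 0) (at x)"
   by (rule Lim_transform_within_open[OF * S x], rule eq[symmetric])
  then show ?thesis using bl unfolding has_derivative_at_within netlimit_at by (simp add: scaleR_minus_right)
 qed
 \<comment> \<open>Bootstrapping: the formula for the derivative involves H only through products,
   so class k of H gives class k + 1.\<close>
 have "Ck_on k H S" for k
 proof (induction k)
  case 0
  then show ?case using H by simp
 next
  case (Suc k)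
  have "Ck_on k (\<lambda>x. frechet_derivative G (at x) v) S" for v
   using smooth_on_frechet[OF G] unfolding smooth_on_def by blast
  then show ?case
   by (intro Ck_on_SucI[OF S D] Ck_on_linear[OF bounded_linear_minus[OF bounded_linear_ident] S]
     Ck_on_bilinear[OF bounded_bilinear_blinfun_compose S] Suc)
 qed
 then show ?thesis unfolding smooth_on_def by blast
qed

section \<open>Mean value estimates and the symmetry of second derivatives\<close>

lemma mean_value_bound:
 fixes f :: "real \<Rightarrow> 'b::real_normed_vector"
 assumes ab: "a \<le> b" and f: "\<And>t. t \<in> {a..b} \<Longrightarrow> (f has_vector_derivative f' t) (at t within {a..b})"
  and B: "\<And>t. t \<in> {a..b} \<Longrightarrow> norm (f' t - c) \<le> B"
 shows "norm (f b - f a - (b - a) *\<^sub>R c) \<le> (b - a) * B"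
proof -
 have "norm ((f b - b *\<^sub>R c) - (f a - a *\<^sub>R c)) \<le> B * norm (b - a)"
 proof (rule differentiable_bound[where S = "{a..b}" and f' = "\<lambda>t h. h *\<^sub>R (f' t - c)"])
  show "((\<lambda>t. f t - t *\<^sub>R c) has_derivative (\<lambda>h. h *\<^sub>R (f' t - c))) (at t within {a..b})" if "t \<in> {a..b}" for t
   using f[OF that] unfolding has_vector_derivative_def
   by (auto intro!: derivative_eq_intros simp: algebra_simps)
  show "onorm (\<lambda>h. h *\<^sub>R (f' t - c)) \<le> B" if "t \<in> {a..b}" for t
   using B[OF that] by (intro onorm_le) (simp add: mult.commute[of B] mult_left_mono)
 qed (use ab in auto)
 then show ?thesis using ab by (simp add: algebra_simps)
qed

lemma has_derivative_line:
 assumes "(f has_derivative f') (at (x + t *\<^sub>R u))"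
 shows "((\<lambda>t. f (x + t *\<^sub>R u)) has_vector_derivative f' u) (at t within T)"
proof -
 have lin: "linear f'" using assms has_derivative_linear by blast
 have "((\<lambda>t. x + t *\<^sub>R u) has_derivative (\<lambda>h. h *\<^sub>R u)) (at t within T)"
  by (auto intro!: derivative_eq_intros)
 from has_derivative_compose[OF this assms] show ?thesis
  unfolding has_vector_derivative_def by (simp add: linear_cmul[OF lin])
qed

text \<open>The classical argument of Schwarz: the mean value estimate is applied along u to a
  difference of f in direction v, and then along v to the derivative in direction u. Continuity of g
  at x controls the error.\<close>

lemma second_difference_bound:
 fixes f :: "'a::real_normed_vector \<Rightarrow> 'b::real_normed_vector" and u v :: 'a
 assumes S: "open S" "x \<in> S" and sm: "smooth_on f S" and e: "\<epsilon> > 0"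
 defines "g \<equiv> \<lambda>y. frechet_derivative (\<lambda>y. frechet_derivative f (at y) u) (at y)"
 shows "\<exists>\<delta>>0. \<forall>t. 0 < t \<and> t < \<delta> \<longrightarrow>
  norm (f (x + t *\<^sub>R u + t *\<^sub>R v) - f (x + t *\<^sub>R u) - f (x + t *\<^sub>R v) + f x - (t * t) *\<^sub>R g x v) \<le> \<epsilon> * (t * t)"
proof -
 define f' where "f' y = frechet_derivative f (at y)" for y
 have f: "(f has_derivative f' y) (at y)" if "y \<in> S" for y unfolding f'_def by (rule smooth_on_deriv[OF sm that])
 have g: "((\<lambda>y. f' y u) has_derivative g y) (at y)" if "y \<in> S" for y
  unfolding f'_def g_def by (rule smooth_on_deriv[OF smooth_on_frechet[OF sm] that])
 have c: "continuous (at x) (\<lambda>y. g y v)" unfolding g_def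
  using smooth_on_continuous[OF smooth_on_frechet[OF smooth_on_frechet[OF sm]]] S by (simp add: continuous_on_eq_continuous_at)
 obtain r1 where r1: "r1 > 0" "ball x r1 \<subseteq> S" using S openE by blast
 obtain r2 where r2: "r2 > 0" "\<And>y. dist y x < r2 \<Longrightarrow> dist (g y v) (g x v) < \<epsilon>"
  using c e unfolding continuous_at_eps_delta by blast
 \<comment> \<open>For t < \<delta> the parallelogram spanned by t u and t v stays in S and in the
   ball where g y v is \<epsilon>-close to g x v. The summand 1 keeps the denominator
   positive.\<close>
 define \<delta> where "\<delta> = min r1 r2 / (norm u + norm v + 1)"
 have pos: "norm u + norm v + 1 > 0" by (simp add: add_nonneg_pos)
 have d: "\<delta> > 0" unfolding \<delta>_def using r1 r2 pos by simp
 have near: "dist (x + s *\<^sub>R u + s' *\<^sub>R v) x < min r1 r2" if "0 \<le> s" "s \<le> t" "0 \<le> s'" "s' \<le> t" "t < \<delta>" for s s' t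
 proof -
  have "dist (x + s *\<^sub>R u + s' *\<^sub>R v) x \<le> s * norm u + s' * norm v"
   using norm_triangle_ineq[of "s *\<^sub>R u" "s' *\<^sub>R v"] that by (simp add: dist_norm)
  also have "\<dots> \<le> t * norm u + t * norm v" using that by (intro add_mono mult_right_mono) auto
  also have "\<dots> \<le> t * (norm u + norm v + 1)" using that by (simp add: algebra_simps)
  also have "\<dots> < min r1 r2" using that pos by (simp add: \<delta>_def pos_less_divide_eq)
  finally show ?thesis .
 qed
 have S': "x + s *\<^sub>R u + s' *\<^sub>R v \<in> S" if "0 \<le> s" "s \<le> t" "0 \<le> s'" "s' \<le> t" "t < \<delta>" for s s' t
  using near[OF that] r1 by (auto simp: dist_commute)
 have gb: "norm (g (x + s *\<^sub>R u + s' *\<^sub>R v) v - g x v) \<le> \<epsilon>"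
  if "0 \<le> s" "s \<le> t" "0 \<le> s'" "s' \<le> t" "t < \<delta>" for s s' t
  using near[OF that] r2(2) by (force simp: dist_norm less_imp_le)
 show ?thesis
 proof (intro exI[of _ \<delta>] conjI d allI impI)
  fix t assume t: "0 < t \<and> t < \<delta>"
  define p where "p s = f' (x + s *\<^sub>R u + t *\<^sub>R v) u - f' (x + s *\<^sub>R u) u" for s
  have inner: "norm (p s - t *\<^sub>R g x v) \<le> t * \<epsilon>" if s: "s \<in> {0..t}" for s
  proof -
   have "norm (f' (x + s *\<^sub>R u + t *\<^sub>R v) u - f' (x + s *\<^sub>R u + 0 *\<^sub>R v) u - (t - 0) *\<^sub>R g x v) \<le> (t - 0) * \<epsilon>"
   proof (rule mean_value_bound[where f = "\<lambda>s'. f' (x + s *\<^sub>R u + s' *\<^sub>R v) u"])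
    show "((\<lambda>s'. f' (x + s *\<^sub>R u + s' *\<^sub>R v) u) has_vector_derivative g (x + s *\<^sub>R u + s' *\<^sub>R v) v)
      (at s' within {0..t})" if "s' \<in> {0..t}" for s'
     by (rule has_derivative_line, rule g, rule S') (use s t that in auto)
    show "norm (g (x + s *\<^sub>R u + s' *\<^sub>R v) v - g x v) \<le> \<epsilon>" if "s' \<in> {0..t}" for s'
     by (rule gb) (use s t that in auto)
   qed (use t in auto)
   then show ?thesis by (simp add: p_def)
  qed
  have "norm ((f (x + t *\<^sub>R u + t *\<^sub>R v) - f (x + t *\<^sub>R u)) - (f (x + 0 *\<^sub>R u + t *\<^sub>R v) - f (x + 0 *\<^sub>R u))
    - (t - 0) *\<^sub>R (t *\<^sub>R g x v)) \<le> (t - 0) * (t * \<epsilon>)"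
  proof (rule mean_value_bound[where f = "\<lambda>s. f (x + s *\<^sub>R u + t *\<^sub>R v) - f (x + s *\<^sub>R u)"])
   fix s assume s: "s \<in> {0..t}"
   have "((\<lambda>s. f (x + t *\<^sub>R v + s *\<^sub>R u)) has_vector_derivative f' (x + t *\<^sub>R v + s *\<^sub>R u) u) (at s within {0..t})"
    by (rule has_derivative_line, rule f) (use S'[of s t t] s t in \<open>simp add: add.commute add.left_commute\<close>)
   moreover have "((\<lambda>s. f (x + s *\<^sub>R u)) has_vector_derivative f' (x + s *\<^sub>R u) u) (at s within {0..t})"
    by (rule has_derivative_line, rule f) (use S'[of s t 0] s t in simp)
   ultimately show "((\<lambda>s. f (x + s *\<^sub>R u + t *\<^sub>R v) - f (x + s *\<^sub>R u)) has_vector_derivative p s) (at s within {0..t})"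
    unfolding p_def add.assoc[of x] add.commute[of "_ *\<^sub>R u" "t *\<^sub>R v"]
    by (simp add: add.assoc has_vector_derivative_diff)
   show "norm (p s - t *\<^sub>R g x v) \<le> t * \<epsilon>" by (rule inner[OF s])
  qed (use t in auto)
  then show "norm (f (x + t *\<^sub>R u + t *\<^sub>R v) - f (x + t *\<^sub>R u) - f (x + t *\<^sub>R v) + f x - (t * t) *\<^sub>R g x v) \<le> \<epsilon> * (t * t)"
   by (simp add: algebra_simps)
 qed
qed

text \<open>The second difference is symmetric in u and v, so both mixed derivatives, multiplied by
  t^2, lie within e/2 * t^2 of the same vector.\<close>

lemma smooth_on_second_symmetric:
 fixes f :: "'a::real_normed_vector \<Rightarrow> 'b::real_normed_vector"
 assumes S: "open S" "x \<in> S" and f: "smooth_on f S"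
 shows "frechet_derivative (\<lambda>y. frechet_derivative f (at y) u) (at x) v =
  frechet_derivative (\<lambda>y. frechet_derivative f (at y) v) (at x) u" (is "?a = ?b")
proof -
 have "norm (?a - ?b) \<le> 0 + e" if e: "e > 0" for e
 proof -
  have e2: "e / 2 > 0" using e by simp
  obtain d1 where d1: "d1 > 0" "\<And>t. 0 < t \<and> t < d1 \<Longrightarrow>
   norm (f (x + t *\<^sub>R u + t *\<^sub>R v) - f (x + t *\<^sub>R u) - f (x + t *\<^sub>R v) + f x - (t * t) *\<^sub>R ?a) \<le> e / 2 * (t * t)"
   using second_difference_bound[OF S f e2] by blast
  obtain d2 where d2: "d2 > 0" "\<And>t. 0 < t \<and> t < d2 \<Longrightarrow>
   norm (f (x + t *\<^sub>R v + t *\<^sub>R u) - f (x + t *\<^sub>R v) - f (x + t *\<^sub>R u) + f x - (t * t) *\<^sub>R ?b) \<le> e / 2 * (t * t)"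
   using second_difference_bound[OF S f e2] by blast
  define t where "t = min d1 d2 / 2"
  have t: "0 < t" "t < d1" "t < d2" using d1 d2 by (auto simp: t_def)
  let ?D = "f (x + t *\<^sub>R u + t *\<^sub>R v) - f (x + t *\<^sub>R u) - f (x + t *\<^sub>R v) + f x"
  have a: "norm (?D - (t * t) *\<^sub>R ?a) \<le> e / 2 * (t * t)" using d1(2) t by blast
  have D: "?D = f (x + t *\<^sub>R v + t *\<^sub>R u) - f (x + t *\<^sub>R v) - f (x + t *\<^sub>R u) + f x"
   by (simp add: algebra_simps)
  have b: "norm (?D - (t * t) *\<^sub>R ?b) \<le> e / 2 * (t * t)" unfolding D using d2(2) t by blast
  have "norm ((t * t) *\<^sub>R (?a - ?b)) = norm ((?D - (t * t) *\<^sub>R ?b) - (?D - (t * t) *\<^sub>R ?a))"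
   by (simp add: algebra_simps)
  also have "\<dots> \<le> e * (t * t)" using norm_triangle_ineq4[of "?D - (t * t) *\<^sub>R ?b" "?D - (t * t) *\<^sub>R ?a"] a b by (simp add: field_simps)
  finally have "norm (?a - ?b) * (t * t) \<le> e * (t * t)" by (simp add: mult.commute abs_mult)
  then show ?thesis using t by simp
 qed
 then have "norm (?a - ?b) \<le> 0" by (rule field_le_epsilon)
 then show ?thesis by simp
qed

section \<open>Linear differential equations\<close>

text \<open>The functions P n are the terms of the Picard series, not its partial sums: n-fold
  iterated integrals of size at most |x0| (K t)^n / n!. Their sum gives the solution and its
  exponential bound together.\<close>

lemma linear_ode_exists:
 fixes L :: "real \<Rightarrow> 'x::banach \<Rightarrow>\<^sub>L 'x"
 assumes L: "continuous_on {0..T} L" and T: "0 \<le> T" and K: "\<And>t. t \<in> {0..T} \<Longrightarrow> norm (L t) \<le> K"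
 shows "\<exists>X. X 0 = x0 \<and> (\<forall>t\<in>{0..T}. (X has_vector_derivative L t (X t)) (at t within {0..T})) \<and>
  (\<forall>t\<in>{0..T}. norm (X t) \<le> norm x0 * exp (K * T))"
proof -
 have K0: "0 \<le> K" using order_trans[OF norm_ge_zero K[of 0]] T by simp
 define P where "P = rec_nat (\<lambda>t. x0) (\<lambda>n p t. integral {0..t} (\<lambda>s. L s (p s)))"
 have P0: "P 0 t = x0" and PS: "P (Suc n) t = integral {0..t} (\<lambda>s. L s (P n s))" for n t by (simp_all add: P_def)
 have cont: "continuous_on {0..T} (P n)" for n
 proof (induction n)
  case (Suc n)
  have c: "continuous_on {0..T} (\<lambda>s. L s (P n s))" by (intro continuous_intros L Suc)
  show ?case unfolding PS using integrable_continuous_real[OF c] by (rule indefinite_integral_continuous_1)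
 qed (simp add: P0[abs_def])
 define p where "p n t = (case n of 0 \<Rightarrow> 0 | Suc m \<Rightarrow> L t (P m t))" for n t
 have der: "(P n has_vector_derivative p n t) (at t within {0..T})" if "t \<in> {0..T}" for n t
 proof (cases n)
  case (Suc m)
  have c: "continuous_on {0..T} (\<lambda>s. L s (P m s))" by (intro continuous_intros L cont)
  show ?thesis unfolding Suc p_def using integral_has_vector_derivative[OF c that]
   by (simp add: PS[abs_def])
 qed (simp add: p_def P0[abs_def])
 have der': "(P n has_vector_derivative p n t) (at t)" if "0 < t" "t < T" for n t
  using der[of t n] that at_within_Icc_at[of 0 t T] by simp
 \<comment> \<open>Induction by comparing derivatives: the derivative of each majorant is K times
   the previous one, which bounds the derivative of the next term.\<close>
 have bnd: "norm (P n t) \<le> norm x0 * ((K * t) ^ n / fact n)" if "t \<in> {0..T}" for n t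
  using that
 proof (induction n arbitrary: t)
  case (Suc n)
  show ?case
  proof (cases "t = 0")
   case False
   then have t: "0 < t" "t \<le> T" using Suc.prems by auto
   have "norm (P (Suc n) t - P (Suc n) 0) \<le> (\<lambda>t. norm x0 * ((K * t) ^ Suc n / fact (Suc n))) t -
     (\<lambda>t. norm x0 * ((K * t) ^ Suc n / fact (Suc n))) 0"
   proof (rule differentiable_bound_general[OF t(1), where f = "P (Suc n)" and f' = "p (Suc n)"
      and \<phi> = "\<lambda>t. norm x0 * ((K * t) ^ Suc n / fact (Suc n))" and \<phi>' = "\<lambda>s. norm x0 * (K * ((K * s) ^ n / fact n))"])
    show "continuous_on {0..t} (P (Suc n))" by (rule continuous_on_subset[OF cont]) (use t in auto)
    show "continuous_on {0..t} (\<lambda>t. norm x0 * ((K * t) ^ Suc n / fact (Suc n)))"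
     by (intro continuous_on_mult continuous_on_divide continuous_on_power continuous_on_const continuous_on_id) simp
    show "(P (Suc n) has_vector_derivative p (Suc n) s) (at s)" if "0 < s" "s < t" for s
     by (rule der') (use that t in auto)
    show "((\<lambda>t. norm x0 * ((K * t) ^ Suc n / fact (Suc n))) has_vector_derivative
      norm x0 * (K * ((K * s) ^ n / fact n))) (at s)" if "0 < s" "s < t" for s
     unfolding has_real_derivative_iff_has_vector_derivative[symmetric]
    proof -
     have "((\<lambda>t. norm x0 * ((K * t) ^ Suc n / fact (Suc n))) has_real_derivative
       norm x0 * ((of_nat (Suc n) * (K * (K * s) ^ n)) / fact (Suc n))) (at s)"
      using DERIV_cmult[OF DERIV_cdivide[OF DERIV_power[OF DERIV_cmult_Id[of K s UNIV], of "Suc n"]], of "norm x0" "fact (Suc n)"]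
      by (simp only: diff_Suc_Suc diff_zero)
     moreover have "(of_nat (Suc n) * (K * (K * s) ^ n)) / fact (Suc n) = K * ((K * s) ^ n / fact n)"
      by (simp del: of_nat_Suc)
     ultimately show "((\<lambda>t. norm x0 * ((K * t) ^ Suc n / fact (Suc n))) has_real_derivative
      norm x0 * (K * ((K * s) ^ n / fact n))) (at s)" by (simp only:)
    qed
    show "norm (p (Suc n) s) \<le> norm x0 * (K * ((K * s) ^ n / fact n))" if s: "0 < s" "s < t" for s
    proof -
     have "norm (p (Suc n) s) \<le> norm (L s) * norm (P n s)" by (simp add: p_def norm_blinfun)
     also have "\<dots> \<le> K * (norm x0 * ((K * s) ^ n / fact n))"
      using s t by (intro mult_mono K Suc.IH K0) auto
     finally show ?thesis by (simp add: algebra_simps)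
    qed
   qed
   then show ?thesis by (simp add: PS)
  qed (simp add: PS)
 qed (simp add: P0)
 have bndT: "norm (P n t) \<le> norm x0 * ((K * T) ^ n / fact n)" if "t \<in> {0..T}" for n t
  using that K0 by (intro order_trans[OF bnd[OF that]] mult_left_mono divide_right_mono power_mono) auto
 have sumE: "summable (\<lambda>n. (K * T) ^ n / fact n)"
  using summable_exp[of "K * T"] by (simp add: divide_inverse mult.commute)
 have sumM: "summable (\<lambda>n. norm x0 * ((K * T) ^ n / fact n))" using sumE by (rule summable_mult)
 \<comment> \<open>Majorants for the derivatives p n. The index is shifted by one, since p (n + 1)
   is L applied to P n and p 0 is zero.\<close>
 define q where "q n = (case n of 0 \<Rightarrow> 0 | Suc m \<Rightarrow> K * (norm x0 * ((K * T) ^ m / fact m)))" for n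
 have pq: "norm (p n t) \<le> q n" if "t \<in> {0..T}" for n t
 proof (cases n)
  case (Suc m)
  have "norm (L t (P m t)) \<le> norm (L t) * norm (P m t)" by (rule norm_blinfun)
  also have "\<dots> \<le> K * (norm x0 * ((K * T) ^ m / fact m))" by (intro mult_mono K bndT K0 that) auto
  finally show ?thesis by (simp add: p_def q_def Suc)
 qed (simp add: p_def q_def)
 have sumq: "summable q"
 proof -
  have "summable (\<lambda>n. q (Suc n))" using summable_mult[OF sumM, of K] by (simp add: q_def)
  then show ?thesis by (simp add: summable_Suc_iff)
 qed
 define X where "X t = (\<Sum>n. P n t)" for t
 have sumP: "summable (\<lambda>n. P n t)" if "t \<in> {0..T}" for t
  by (rule summable_comparison_test'[OF sumM, of 0]) (use bndT that in blast)
 have ul: "uniform_limit {0..T} (\<lambda>n t. \<Sum>i<n. p i t) (\<lambda>t. \<Sum>i. p i t) sequentially"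
  by (rule Weierstrass_m_test[OF pq sumq])
 have "\<exists>g. \<forall>x\<in>{0..T}. (\<lambda>n. P n x) sums (g x) \<and> (g has_derivative (\<lambda>h. h *\<^sub>R (\<Sum>i. p i x))) (at x within {0..T})"
 proof (rule has_derivative_series[where f' = "\<lambda>n x h. h *\<^sub>R p n x" and x = 0])
  show "\<And>n x. x \<in> {0..T} \<Longrightarrow> (P n has_derivative (\<lambda>h. h *\<^sub>R p n x)) (at x within {0..T})"
   using der unfolding has_vector_derivative_def .
  fix e :: real assume "e > 0"
  from uniform_limitD[OF ul this] 
  show "\<forall>\<^sub>F n in sequentially. \<forall>x\<in>{0..T}. \<forall>h. norm ((\<Sum>i<n. h *\<^sub>R p i x) - h *\<^sub>R (\<Sum>i. p i x)) \<le> e * norm h"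
  proof eventually_elim
   case (elim n)
   show ?case
   proof (intro ballI allI)
    fix x h assume "x \<in> {0..T}"
    then have "norm ((\<Sum>i<n. p i x) - (\<Sum>i. p i x)) \<le> e" using elim by (auto simp: dist_norm less_imp_le)
    then show "norm ((\<Sum>i<n. h *\<^sub>R p i x) - h *\<^sub>R (\<Sum>i. p i x)) \<le> e * norm h"
     by (simp add: scaleR_right.sum[symmetric] scaleR_diff_right[symmetric] mult.commute[of e] mult_left_mono)
   qed
  qed
 qed (use T sumP[of 0] in \<open>auto simp: summable_sums\<close>)
 then obtain g where g: "\<And>x. x \<in> {0..T} \<Longrightarrow> (\<lambda>n. P n x) sums (g x)"
  "\<And>x. x \<in> {0..T} \<Longrightarrow> (g has_derivative (\<lambda>h. h *\<^sub>R (\<Sum>i. p i x))) (at x within {0..T})" by blast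
 have sp: "(\<Sum>i. p i t) = L t (g t)" if t: "t \<in> {0..T}" for t
 proof -
  have "(\<lambda>n. L t (P n t)) sums L t (g t)" by (rule blinfun.bounded_linear_right[THEN bounded_linear.sums, OF g(1)[OF t]])
  then have "(\<lambda>n. p (Suc n) t) sums L t (g t)" by (simp add: p_def)
  then have "(\<lambda>n. p n t) sums (L t (g t) + p 0 t)" by (rule sums_Suc)
  then show ?thesis by (simp add: p_def sums_iff)
 qed
 have g0: "g 0 = x0"
 proof -
  have "P n 0 = 0" if "n \<noteq> 0" for n using that by (cases n) (auto simp: PS)
  then have "(\<lambda>n. P n 0) sums P 0 0" using sums_finite[of "{0}" "\<lambda>n. P n 0"] by simp
  then show ?thesis using g(1)[of 0] T sums_unique2[of "\<lambda>n. P n 0" "P 0 0" "g 0"] by (simp add: P0)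
 qed
 have gb: "norm (g t) \<le> norm x0 * exp (K * T)" if t: "t \<in> {0..T}" for t
 proof -
  have "norm (g t) \<le> (\<Sum>n. norm x0 * ((K * T) ^ n / fact n))"
   using norm_suminf_le[OF bndT[OF t] sumM] g(1)[OF t] by (simp add: sums_iff)
  also have "\<dots> = norm x0 * exp (K * T)"
   using suminf_mult[OF sumE] by (simp add: exp_def divide_inverse mult.commute)
  finally show ?thesis .
 qed
 show ?thesis
  using g0 g(2) gb by (intro exI[of _ g]) (auto simp: has_vector_derivative_def sp)
qed

text \<open>\<open>\<Psi>\<close> is the inverse of the fundamental solution \<open>\<Phi>\<close>, obtained as the solution of the adjoint equation.\<close>

lemma fundamental_solution:
 fixes M :: "real \<Rightarrow> 'e::euclidean_space \<Rightarrow>\<^sub>L 'e"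
 assumes M: "continuous_on {0..T} M" and T: "0 \<le> T" and K: "\<And>t. t \<in> {0..T} \<Longrightarrow> norm (M t) \<le> K"
 obtains \<Phi> \<Psi> where "\<Phi> 0 = id_blinfun" "\<Psi> 0 = id_blinfun"
  "\<And>t. t \<in> {0..T} \<Longrightarrow> (\<Phi> has_vector_derivative (M t o\<^sub>L \<Phi> t)) (at t within {0..T})"
  "\<And>t. t \<in> {0..T} \<Longrightarrow> (\<Psi> has_vector_derivative - (\<Psi> t o\<^sub>L M t)) (at t within {0..T})"
  "\<And>t. t \<in> {0..T} \<Longrightarrow> \<Psi> t o\<^sub>L \<Phi> t = id_blinfun" "\<And>t. t \<in> {0..T} \<Longrightarrow> \<Phi> t o\<^sub>L \<Psi> t = id_blinfun"
  "\<And>t. t \<in> {0..T} \<Longrightarrow> norm (\<Phi> t) \<le> exp (K * T)" "\<And>t. t \<in> {0..T} \<Longrightarrow> norm (\<Psi> t) \<le> exp (K * T)"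
proof -
 note bb = bounded_bilinear_blinfun_compose
 \<comment> \<open>Left and right multiplication as operators on the Banach space of endomorphisms;
   the equations for \<Phi> and \<Psi> become instances of \<open>linear_ode_exists\<close>.\<close>
 define Lf :: "('e \<Rightarrow>\<^sub>L 'e) \<Rightarrow> ('e \<Rightarrow>\<^sub>L 'e) \<Rightarrow>\<^sub>L ('e \<Rightarrow>\<^sub>L 'e)" where "Lf = bounded_bilinear.prod_right (o\<^sub>L)"
 define Rf :: "('e \<Rightarrow>\<^sub>L 'e) \<Rightarrow> ('e \<Rightarrow>\<^sub>L 'e) \<Rightarrow>\<^sub>L ('e \<Rightarrow>\<^sub>L 'e)" where "Rf = bounded_bilinear.prod_left (o\<^sub>L)"
 have Lf: "Lf A B = A o\<^sub>L B" and Rf: "Rf A B = B o\<^sub>L A" for A B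
  by (simp_all add: Lf_def Rf_def bounded_bilinear.prod_right.rep_eq[OF bb] bounded_bilinear.prod_left.rep_eq[OF bb])
 have bl: "bounded_linear Lf" "bounded_linear Rf"
  unfolding Lf_def Rf_def by (rule bounded_bilinear.bounded_linear_prod_right[OF bb] bounded_bilinear.bounded_linear_prod_left[OF bb])+
 have nL: "norm (Lf A) \<le> norm A" "norm (Rf A) \<le> norm A" for A
  by (rule norm_blinfun_bound[OF norm_ge_zero], metis Lf norm_blinfun_compose,
    rule norm_blinfun_bound[OF norm_ge_zero], metis Rf norm_blinfun_compose mult.commute)
 have id1: "norm (id_blinfun :: 'e \<Rightarrow>\<^sub>L 'e) = 1" by simp
 have cL: "continuous_on {0..T} (\<lambda>t. Lf (M t))" by (rule bounded_linear.continuous_on[OF bl(1) M])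
 have kL: "norm (Lf (M t)) \<le> K" if "t \<in> {0..T}" for t using nL(1)[of "M t"] K[OF that] by simp
 have cR: "continuous_on {0..T} (\<lambda>t. Rf (- M t))" by (intro bounded_linear.continuous_on[OF bl(2)] continuous_intros M)
 have kR: "norm (Rf (- M t)) \<le> K" if "t \<in> {0..T}" for t using nL(2)[of "- M t"] K[OF that] by simp
 obtain \<Phi> where \<Phi>: "\<Phi> 0 = id_blinfun"
  "\<And>t. t \<in> {0..T} \<Longrightarrow> (\<Phi> has_vector_derivative (M t o\<^sub>L \<Phi> t)) (at t within {0..T})"
  "\<And>t. t \<in> {0..T} \<Longrightarrow> norm (\<Phi> t) \<le> exp (K * T)"
  using linear_ode_exists[OF cL T kL, of id_blinfun] unfolding id1 Lf by auto
 obtain \<Psi> where \<Psi>: "\<Psi> 0 = id_blinfun"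
  "\<And>t. t \<in> {0..T} \<Longrightarrow> (\<Psi> has_vector_derivative (\<Psi> t o\<^sub>L - M t)) (at t within {0..T})"
  "\<And>t. t \<in> {0..T} \<Longrightarrow> norm (\<Psi> t) \<le> exp (K * T)"
  using linear_ode_exists[OF cR T kR, of id_blinfun] unfolding id1 Rf by auto
 have m: "X o\<^sub>L - Y = - (X o\<^sub>L Y)" for X Y :: "'e \<Rightarrow>\<^sub>L 'e" by (rule blinfun_eqI) (simp add: blinfun.minus_left blinfun.minus_right)
 \<comment> \<open>The two terms in the derivative of \<Psi> \<Phi> cancel, so the product keeps its
   initial value. Finite dimension then turns the left inverse into a two-sided one.\<close>
 have inv: "\<Psi> t o\<^sub>L \<Phi> t = id_blinfun" if t: "t \<in> {0..T}" for t
 proof -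
  have "((\<lambda>t. \<Psi> t o\<^sub>L \<Phi> t) has_derivative (\<lambda>h. 0)) (at s within {0..T})" if "s \<in> {0..T}" for s
  proof -
   have "((\<lambda>t. \<Psi> t o\<^sub>L \<Phi> t) has_vector_derivative (\<Psi> s o\<^sub>L (M s o\<^sub>L \<Phi> s)) + ((\<Psi> s o\<^sub>L - M s) o\<^sub>L \<Phi> s)) (at s within {0..T})"
    by (rule bounded_bilinear.has_vector_derivative[OF bb \<Psi>(2)[OF that] \<Phi>(2)[OF that]])
   moreover have "(\<Psi> s o\<^sub>L (M s o\<^sub>L \<Phi> s)) + ((\<Psi> s o\<^sub>L - M s) o\<^sub>L \<Phi> s) = 0"
    by (rule blinfun_eqI) (simp add: blinfun.bilinear_simps)
   ultimately show ?thesis by (simp add: has_vector_derivative_def)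
  qed
  then have "\<Psi> t o\<^sub>L \<Phi> t = \<Psi> 0 o\<^sub>L \<Phi> 0"
   using has_derivative_zero_unique[of "{0..T}" "\<lambda>t. \<Psi> t o\<^sub>L \<Phi> t" 0 t] T t by simp
  then show ?thesis using \<Phi>(1) \<Psi>(1) by (auto intro: blinfun_eqI)
 qed
 have inv': "\<Phi> t o\<^sub>L \<Psi> t = id_blinfun" if t: "t \<in> {0..T}" for t
 proof -
  have 1: "\<Psi> t (\<Phi> t v) = v" for v using inv[OF t] by (metis blinfun_apply_blinfun_compose blinfun_apply_id_blinfun)
  then have "inj (\<Phi> t)" by (metis injI)
  then have "surj (\<Phi> t)" using linear_injective_imp_surjective blinfun.bounded_linear_right bounded_linear.linear by blast
  then have "\<Phi> t (\<Psi> t w) = w" for w using 1 by (metis surjD)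
  then show ?thesis by (auto intro: blinfun_eqI)
 qed
 show ?thesis by (rule that[OF \<Phi>(1) \<Psi>(1) \<Phi>(2) \<Psi>(2)[unfolded m] inv inv' \<Phi>(3) \<Psi>(3)])
qed

section \<open>Quaternionic Hermitian vector spaces\<close>

lemma double_eq_iff: "x + x = y + y \<longleftrightarrow> x = y" for x y :: "'v::real_vector"
proof
 assume "x + x = y + y"
 then have "(1 / 2) *\<^sub>R (2 *\<^sub>R x) = (1 / 2) *\<^sub>R (2 *\<^sub>R y)" by (simp only: scaleR_2)
 then show "x = y" by simp
qed simp

lemma neg_eq_self_iff: "- x = x \<longleftrightarrow> x = 0" for x :: "'v::real_vector"
proof
 assume "- x = x"
 then have "x + x = 0 + 0" by (metis add.left_inverse add_0)
 then show "x = 0" by (simp only: double_eq_iff)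
qed simp

lemma scaleR_double: "(c * 2) *\<^sub>R x = c *\<^sub>R x + c *\<^sub>R x" "(2 * c) *\<^sub>R x = c *\<^sub>R x + c *\<^sub>R x"
 for x :: "'v::real_vector"
 by (simp_all only: mult_2 mult_2_right scaleR_left_distrib)

section \<open>One tangent space: sp(1), sp(n) and the normaliser of the quaternionic
  structure\<close>

definition skew :: "'e::euclidean_space bilin \<Rightarrow> 'e endo \<Rightarrow> bool" where
 "skew b K \<longleftrightarrow> (\<forall>v w. b (K v) w = - b v (K w))"

lemma skewD: "skew b K \<Longrightarrow> b (K v) w = - b v (K w)"
 by (simp add: skew_def)

definition curvature_like :: "'e::euclidean_space bilin \<Rightarrow> ('e \<Rightarrow> 'e \<Rightarrow> 'e endo) \<Rightarrow> bool" where
 "curvature_like b R \<longleftrightarrow> bilinear R \<and> (\<forall>u v. R u v = - R v u) \<and> (\<forall>u v. skew b (R u v)) \<and>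
  (\<forall>u v w. R u v w + R v w u + R w u v = 0)"

locale quat_hermitian =
 fixes b :: "'e::euclidean_space bilin" and J1 J2 J3 :: "'e endo"
 assumes sym: "b v w = b w v" and pos: "v \<noteq> 0 \<Longrightarrow> b v v > 0"
  and triple: "quat_triple b (span {J1, J2, J3}) J1 J2 J3"
begin

lemma J_squares: "J1 (J1 v) = - v" "J2 (J2 v) = - v" "J3 (J3 v) = - v"
 and J_isom: "b (J1 v) (J1 w) = b v w" "b (J2 v) (J2 w) = b v w" "b (J3 v) (J3 w) = b v w"
 and J_anti: "J1 (J2 v) = - J2 (J1 v)" "J1 (J3 v) = - J3 (J1 v)" "J2 (J3 v) = - J3 (J2 v)"
 and J3_eq: "J3 v = J1 (J2 v)"
 using triple unfolding quat_triple_def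
 by (auto dest!: arg_cong[where f = blinfun_apply] simp: fun_eq_iff blinfun.minus_left)

lemma J_products: "J1 (J2 v) = J3 v" "J2 (J1 v) = - J3 v" "J1 (J3 v) = - J2 v" "J3 (J1 v) = J2 v"
  "J2 (J3 v) = J1 v" "J3 (J2 v) = - J1 v"
proof -
 show 12: "J1 (J2 v) = J3 v" for v by (simp add: J3_eq)
 show 21: "J2 (J1 v) = - J3 v" for v using J_anti(1)[of v] 12[of v] by (metis minus_equation_iff)
 show 13: "J1 (J3 v) = - J2 v" for v by (simp add: J3_eq J_squares)
 show 31: "J3 (J1 v) = J2 v" using J_anti(2)[of v] 13[of v] by simp
 show 23: "J2 (J3 v) = J1 v" using J_anti(1)[of "J2 v"] by (simp add: J3_eq J_squares blinfun.minus_right)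
 show "J3 (J2 v) = - J1 v" by (simp add: J3_eq J_squares blinfun.minus_right)
qed

lemma J_skew: "b (J1 v) w = - b v (J1 w)" "b (J2 v) w = - b v (J2 w)" "b (J3 v) w = - b v (J3 w)"
 using J_isom(1)[of v "J1 w"] J_isom(2)[of v "J2 w"] J_isom(3)[of v "J3 w"]
 by (simp_all add: J_squares blinfun.minus_right)

lemma J_self: "b v (J1 v) = 0" "b v (J2 v) = 0" "b v (J3 v) = 0"
 using J_skew(1)[of v v] J_skew(2)[of v v] J_skew(3)[of v v] sym[of v "J1 v"] sym[of v "J2 v"] sym[of v "J3 v"] by auto

lemmas bl = blinfun.bilinear_simps
lemmas J_simps = J_squares J_products J_skew J_self

text \<open>The relations among J1, J2, J3 are cyclically symmetric. Statements about the
  coefficient of J2 transfer to J3 and J1 by interpreting the locale again.\<close>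

lemma cycle: "quat_hermitian b J2 J3 J1"
proof (unfold_locales; (fact sym pos)?)
 have "{J2, J3, J1} = {J1, J2, J3}" by auto
 then show "quat_triple b (span {J2, J3, J1}) J2 J3 J1"
  unfolding quat_triple_def
  by (auto intro!: blinfun_eqI simp: J_squares J_products J_isom blinfun.minus_left)
qed

lemma zeroI: "(\<And>w. b v w = 0) \<Longrightarrow> v = 0"
 using pos[of v] by (cases "v = 0") force+

lemma nondegenerate: "(\<And>w. b v w = b v' w) \<Longrightarrow> v = v'"
 using zeroI[of "v - v'"] by (simp add: bl)

lemma self_eq_0 [simp]: "b v v = 0 \<longleftrightarrow> v = 0"
 using pos[of v] by (cases "v = 0") (auto simp: bl)

text \<open>The four vectors are mutually orthogonal and of equal length, so pairing with each of
  them isolates one coefficient. This turns identities between endomorphisms into identities between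
  coefficients.\<close>

lemma J_independent:
 assumes "v \<noteq> 0" "c0 *\<^sub>R v + c1 *\<^sub>R J1 v + c2 *\<^sub>R J2 v + c3 *\<^sub>R J3 v = 0"
 shows "c0 = 0" "c1 = 0" "c2 = 0" "c3 = 0"
proof -
 let ?z = "c0 *\<^sub>R v + c1 *\<^sub>R J1 v + c2 *\<^sub>R J2 v + c3 *\<^sub>R J3 v"
 have nz: "b v v \<noteq> 0" using assms(1) by simp
 have "b v ?z = 0" "b (J1 v) ?z = 0" "b (J2 v) ?z = 0" "b (J3 v) ?z = 0"
  unfolding assms(2) by (simp_all add: bl)
 then show "c0 = 0" "c1 = 0" "c2 = 0" "c3 = 0"
  using nz by (simp_all add: bl J_simps)
qed

definition commuting :: "'e endo \<Rightarrow> bool" where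
 "commuting E \<longleftrightarrow> (\<forall>v. E (J1 v) = J1 (E v) \<and> E (J2 v) = J2 (E v) \<and> E (J3 v) = J3 (E v))"

lemma commutingD:
 fixes E :: "'e endo"
 shows "commuting E \<Longrightarrow> E (J1 v) = J1 (E v)" "commuting E \<Longrightarrow> E (J2 v) = J2 (E v)"
  "commuting E \<Longrightarrow> E (J3 v) = J3 (E v)"
 by (simp_all add: commuting_def)

lemma commutingI:
 fixes E :: "'e endo"
 shows "(\<And>v. E (J1 v) = J1 (E v)) \<Longrightarrow> (\<And>v. E (J2 v) = J2 (E v)) \<Longrightarrow> commuting E"
 unfolding commuting_def by (simp add: J3_eq)

definition spn :: "'e endo \<Rightarrow> bool" where
 "spn E \<longleftrightarrow> skew b E \<and> commuting E"

definition ims :: "real \<Rightarrow> real \<Rightarrow> real \<Rightarrow> 'e endo" where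
 "ims c1 c2 c3 = c1 *\<^sub>R J1 + c2 *\<^sub>R J2 + c3 *\<^sub>R J3"

lemma ims_apply: "ims c1 c2 c3 v = c1 *\<^sub>R J1 v + c2 *\<^sub>R J2 v + c3 *\<^sub>R J3 v"
 by (simp add: ims_def bl)

lemma ims_skew: "skew b (ims c1 c2 c3)"
 unfolding skew_def by (simp add: ims_apply bl J_skew algebra_simps)

lemma span_J: "K \<in> span {J1, J2, J3} \<longleftrightarrow> (\<exists>c1 c2 c3. K = ims c1 c2 c3)"
proof -
 have "K \<in> span {J1, J2, J3} \<longleftrightarrow> (\<exists>c1 c2 c3. K - c1 *\<^sub>R J1 - c2 *\<^sub>R J2 = c3 *\<^sub>R J3)"
  by (auto simp: span_insert span_singleton image_iff span_breakdown_eq)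
 also have "\<dots> \<longleftrightarrow> (\<exists>c1 c2 c3. K = ims c1 c2 c3)" by (simp add: ims_def algebra_simps)
 finally show ?thesis .
qed

text \<open>An imaginary quaternion commuting with J1 and J2 vanishes, because its brackets with
  them repeat its coefficients twice. Later this separates sp(1) components from commuting
  ones.\<close>

lemma ims_plus_commuting_eq_0:
 assumes E: "commuting E" and "ims c1 c2 c3 + E = 0" and "(v::'e) \<noteq> 0"
 shows "c1 = 0" "c2 = 0" "c3 = 0" "E = 0"
proof -
 have Ev: "E v = - ims c1 c2 c3 v" for v
  using assms(2) by (metis add.commute add_eq_0_iff blinfun.minus_left)
 have "E (J1 v) - J1 (E v) = 0" "E (J2 v) - J2 (E v) = 0" using commutingD[OF E] by simp_all
 then have "0 *\<^sub>R v + 0 *\<^sub>R J1 v + (- c3) *\<^sub>R J2 v + c2 *\<^sub>R J3 v = 0"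
  "0 *\<^sub>R v + c3 *\<^sub>R J1 v + 0 *\<^sub>R J2 v + (- c1) *\<^sub>R J3 v = 0"
  unfolding Ev ims_apply by (simp_all add: bl J_simps algebra_simps double_eq_iff)
 from J_independent[OF assms(3) this(1)] J_independent[OF assms(3) this(2)]
 show c: "c1 = 0" "c2 = 0" "c3 = 0" by auto
 then show "E = 0" using assms(2) by (simp add: ims_def)
qed

text \<open>Bracketing with K is a derivation, and the anticommutators of the Ji are multiples of
  the identity, so its matrix on their span is skew. A skew matrix in dimension three is the bracket
  with an imaginary element; subtracting that element leaves something commuting with all
  Ji.\<close>

lemma normalizer_decomp:
 assumes K: "skew b K" and N: "\<And>J. J \<in> {J1, J2, J3} \<Longrightarrow> (K o\<^sub>L J) - (J o\<^sub>L K) \<in> span {J1, J2, J3}"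
  and ne: "(x::'e) \<noteq> 0"
 shows "\<exists>c1 c2 c3 E. K = ims c1 c2 c3 + E \<and> spn E"
proof -
 obtain a1 a2 a3 where a: "(K o\<^sub>L J1) - (J1 o\<^sub>L K) = ims a1 a2 a3" using N[of J1] span_J by auto
 obtain e1 e2 e3 where e: "(K o\<^sub>L J2) - (J2 o\<^sub>L K) = ims e1 e2 e3" using N[of J2] span_J by auto
 have KJ1: "K (J1 v) = J1 (K v) + (a1 *\<^sub>R J1 v + a2 *\<^sub>R J2 v + a3 *\<^sub>R J3 v)" for v
  using arg_cong[OF a, of "\<lambda>A. A v"] by (simp add: bl ims_apply algebra_simps)
 have KJ2: "K (J2 v) = J2 (K v) + (e1 *\<^sub>R J1 v + e2 *\<^sub>R J2 v + e3 *\<^sub>R J3 v)" for v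
  using arg_cong[OF e, of "\<lambda>A. A v"] by (simp add: bl ims_apply algebra_simps)
 \<comment> \<open>Applying the derivation to J1 J1 = -1 kills a diagonal coefficient. The same is
   done with J2 J2 = -1, and J1 J2 + J2 J1 = 0 makes an off-diagonal pair opposite.\<close>
 have "K (J1 (J1 x)) + K x = 0" by (simp add: J_simps bl)
 then have "(- a1) *\<^sub>R x + 0 *\<^sub>R J1 x + 0 *\<^sub>R J2 x + 0 *\<^sub>R J3 x = 0"
  unfolding KJ1 by (simp add: bl J_simps algebra_simps neg_eq_self_iff)
 from J_independent[OF ne this] have a1: "a1 = 0" by simp
 have "K (J2 (J2 x)) + K x = 0" by (simp add: J_simps bl)
 then have "(- e2) *\<^sub>R x + 0 *\<^sub>R J1 x + 0 *\<^sub>R J2 x + 0 *\<^sub>R J3 x = 0"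
  unfolding KJ2 by (simp add: bl J_simps algebra_simps neg_eq_self_iff)
 from J_independent[OF ne this] have e2: "e2 = 0" by simp
 have "K (J1 (J2 x)) + K (J2 (J1 x)) = 0" by (simp add: J_simps bl)
 then have "(a2 + e1) *\<^sub>R x + (a2 + e1) *\<^sub>R x = 0 + 0"
  unfolding KJ1 KJ2 by (simp add: bl J_simps algebra_simps KJ1 KJ2)
   (simp add: eq_neg_iff_add_eq_0 neg_eq_iff_add_eq_0 algebra_simps)
 then have "(a2 + e1) *\<^sub>R x + 0 *\<^sub>R J1 x + 0 *\<^sub>R J2 x + 0 *\<^sub>R J3 x = 0"
  unfolding double_eq_iff by simp
 from J_independent(1)[OF ne this] have ae: "e1 = - a2" by simp
 \<comment> \<open>Halves, because brackets such as [J1, J2] = 2 J3 double the coefficients of the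
   element sought.\<close>
 obtain p q r where pqr: "e3 = p + p" "a3 = q + q" "a2 = r + r"
  using field_sum_of_halves by metis
 define E where "E = K - ims p (- q) r"
 have Ev: "E v = K v - (p *\<^sub>R J1 v - q *\<^sub>R J2 v + r *\<^sub>R J3 v)" for v
  by (simp add: E_def bl ims_apply)
 have "commuting E"
  by (rule commutingI; unfold Ev KJ1 KJ2 a1 e2 ae pqr; simp add: bl J_simps algebra_simps scaleR_double)
 moreover have "skew b E" unfolding skew_def E_def using K ims_skew
  by (simp add: skew_def bl)
 ultimately show ?thesis by (intro exI[of _ p] exI[of _ "- q"] exI[of _ r] exI[of _ E])
   (simp add: spn_def E_def)
qed

subsection \<open>Orthogonal quaternionic lines\<close>

definition perp :: "'e \<Rightarrow> 'e \<Rightarrow> bool" where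
 "perp v w \<longleftrightarrow> b v w = 0 \<and> b v (J1 w) = 0 \<and> b v (J2 w) = 0 \<and> b v (J3 w) = 0"

lemma perp_sym: "perp v w \<Longrightarrow> perp w v"
 unfolding perp_def using sym[of w] J_skew[of v w] by (simp add: sym[of w])

lemma perp_J: "perp v w \<Longrightarrow> perp v (J1 w)" "perp v w \<Longrightarrow> perp v (J2 w)" "perp v w \<Longrightarrow> perp v (J3 w)"
 unfolding perp_def by (simp_all add: J_simps bl)

lemma exists_orthogonal:
 assumes "finite S" "card S < DIM('e)"
 shows "\<exists>v. v \<noteq> 0 \<and> (\<forall>s\<in>S. b s v = 0)"
proof -
 \<comment> \<open>The Riesz map of b with respect to the ambient inner product translates
   b-orthogonality into ordinary orthogonality.\<close>
 define G where "G v = (\<Sum>i\<in>Basis. b v i *\<^sub>R i)" for v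
 have G: "G v \<bullet> w = b v w" for v w
 proof -
  have "b v w = b v (\<Sum>i\<in>Basis. (w \<bullet> i) *\<^sub>R i)" by (simp add: euclidean_representation)
  also have "\<dots> = G v \<bullet> w"
   by (simp add: G_def blinfun.sum_right blinfun.scaleR_right inner_sum_left inner_commute[of w] mult.commute)
  finally show ?thesis by simp
 qed
 have "dim (G ` S) \<le> card (G ` S)" using assms(1) by (intro dim_le_card') simp
 also have "\<dots> < DIM('e)" using card_image_le[OF assms(1), of G] assms(2) by simp
 finally have "span (G ` S) \<noteq> UNIV" by (metis dim_UNIV dim_span less_irrefl)
 then obtain v where "v \<noteq> 0" "\<And>x. x \<in> span (G ` S) \<Longrightarrow> orthogonal v x"
  using orthogonal_to_subspace_exists[of "G ` S"] \<open>dim (G ` S) \<le> _\<close> \<open>card (G ` S) < _\<close> by auto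
 moreover have "b s v = 0" if "s \<in> S" for s
  using calculation(2)[of "G s"] that G[of s v] by (simp add: span_base orthogonal_def inner_commute)
 ultimately show ?thesis by blast
qed

text \<open>A quaternionic line has real dimension at most 4, so dimension 8 leaves room. With y = 0
  the lemma supplies unit vectors.\<close>

lemma exists_perp:
 assumes "DIM('e) \<ge> 8"
 shows "\<exists>t. perp t y \<and> b t t = 1"
proof -
 have "card {y, J1 y, J2 y, J3 y} < DIM('e)"
  using assms card_length[of "[y, J1 y, J2 y, J3 y]"] by simp
 then obtain v where v: "v \<noteq> 0" "\<forall>s\<in>{y, J1 y, J2 y, J3 y}. b s v = 0"
  using exists_orthogonal[of "{y, J1 y, J2 y, J3 y}"] by auto
 then have p: "perp v y" unfolding perp_def by (simp add: sym[of v])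
 have "b v v > 0" by (rule pos[OF v(1)])
 then have "sqrt (b v v) * sqrt (b v v) = b v v" "sqrt (b v v) \<noteq> 0" by (simp, metis less_irrefl real_sqrt_eq_zero_cancel_iff)
 then have "b (v /\<^sub>R sqrt (b v v)) (v /\<^sub>R sqrt (b v v)) = 1" by (simp add: bl field_simps)
 moreover have "perp (v /\<^sub>R sqrt (b v v)) y" using p unfolding perp_def by (simp add: bl)
 ultimately show ?thesis by blast
qed

end

section \<open>The projection of bivectors to sp(n) and the algebraic form of the equation\<close>

context quat_hermitian begin

definition rk :: "'e \<Rightarrow> 'e \<Rightarrow> 'e endo" where
 "rk u w = (blinfun_scaleR_left w o\<^sub>L b u)"

lemma rk_apply: "rk u w v = b u v *\<^sub>R w"
 by (simp add: rk_def)

text \<open>The projection of \<open>u \<and> v\<close> to \<open>sp(n)\<close>.\<close>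

definition U :: "'e \<Rightarrow> 'e \<Rightarrow> 'e endo" where
 "U u v = (1 / 4) *\<^sub>R ((rk u v - rk v u) + (rk (J1 u) (J1 v) - rk (J1 v) (J1 u)) +
  (rk (J2 u) (J2 v) - rk (J2 v) (J2 u)) + (rk (J3 u) (J3 v) - rk (J3 v) (J3 u)))"

lemma U_apply: "U u v w = (1 / 4) *\<^sub>R ((b u w *\<^sub>R v - b v w *\<^sub>R u) + (b (J1 u) w *\<^sub>R J1 v - b (J1 v) w *\<^sub>R J1 u) +
  (b (J2 u) w *\<^sub>R J2 v - b (J2 v) w *\<^sub>R J2 u) + (b (J3 u) w *\<^sub>R J3 v - b (J3 v) w *\<^sub>R J3 u))"
 by (simp add: U_def bl rk_apply)

lemma U_bilinear: "bilinear U"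
 unfolding bilinear_def linear_iff
 by (auto intro!: blinfun_eqI simp: U_apply bl algebra_simps)

lemma U_antisym: "U u v = - U v u"
 by (rule blinfun_eqI) (simp add: U_apply bl algebra_simps)

lemma U_J: "U (J1 u) (J1 v) = U u v" "U (J2 u) (J2 v) = U u v" "U (J3 u) (J3 v) = U u v"
 by (rule blinfun_eqI; simp add: U_apply bl J_simps algebra_simps)+

lemma U_J_left: "U (J1 u) v = - U u (J1 v)" "U (J2 u) v = - U u (J2 v)" "U (J3 u) v = - U u (J3 v)"
 using U_J(1)[of u "J1 v"] U_J(2)[of u "J2 v"] U_J(3)[of u "J3 v"]
 by (simp_all add: J_squares bilinear_rneg[OF U_bilinear] minus_equation_iff)

lemma U_spn: "spn (U u v)"
 unfolding spn_def
proof
 show "skew b (U u v)" unfolding skew_def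
  by (auto simp: U_apply bl algebra_simps sym)
 show "commuting (U u v)"
  by (rule commutingI; simp add: U_apply bl J_simps algebra_simps)
qed

text \<open>Infinitesimal form of the equivariance of U under Sp(n).\<close>

lemma spn_bracket_U:
 assumes "spn V"
 shows "V (U u v w) - U u v (V w) = U (V u) v w + U u (V v) w"
 using assms unfolding spn_def
 by (auto simp: U_apply bl commutingD[symmetric] skewD algebra_simps)

subsection \<open>The algebraic form of the conformal Killing equation\<close>

text \<open>The sp(1) and sp(n) parts are weighted such that N t y y equals b(t, y) y - b(y, y) t.
  This is what the conformal Killing equation gives when two of its arguments agree, while N t y
  stays in sp(1) + sp(n).\<close>

definition N :: "'e \<Rightarrow> 'e \<Rightarrow> 'e endo" where
 "N t y = ims (- b (J1 t) y) (- b (J2 t) y) (- b (J3 t) y) + 4 *\<^sub>R U t y"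

lemma N_apply: "N t y w = (b t w *\<^sub>R y - b y w *\<^sub>R t)
 - (b (J1 t) y *\<^sub>R J1 w + b (J2 t) y *\<^sub>R J2 w + b (J3 t) y *\<^sub>R J3 w)
 + (b (J1 t) w *\<^sub>R J1 y + b (J2 t) w *\<^sub>R J2 y + b (J3 t) w *\<^sub>R J3 y)
 - (b (J1 y) w *\<^sub>R J1 t + b (J2 y) w *\<^sub>R J2 t + b (J3 y) w *\<^sub>R J3 t)"
 by (simp add: N_def bl U_apply ims_apply algebra_simps)

text \<open>The hypotheses describe a 3-form g all of whose contractions are compatible. On
  orthogonal quaternionic lines invariance under J conflicts with antisymmetry, which removes the
  sp(1) part. Afterwards J1 passes from slot to slot with a sign, and three slots make the signs
  inconsistent.\<close>

lemma alternating_compatible_eq_0: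
 fixes G :: "'e \<Rightarrow> 'e endo"
 assumes dim: "DIM('e) \<ge> 8" and lin: "linear G" and alt: "\<And>y. G y y = 0"
  and G: "\<And>y. G y = ims (f1 y) (f2 y) (f3 y) + E y" and E: "\<And>y. spn (E y)"
 shows "G y = 0"
proof -
 define g where "g y z t = b (G y z) t" for y z t
 have Gsk: "skew b (G y)" for y using E ims_skew unfolding G spn_def skew_def by (simp add: bl)
 have g23: "g y z t = - g y t z" for y z t unfolding g_def using skewD[OF Gsk, of y z t] sym by simp
 have GG: "G y z = - G z y" for y z
 proof -
  have "G (y + z) (y + z) = G y y + G y z + G z y + G z z"
   using linear_add[OF lin] by (simp add: bl)
  then show ?thesis by (simp add: alt add_eq_0_iff2)
 qed
 have g12: "g y z t = - g z y t" for y z t unfolding g_def by (subst GG) (simp add: bl)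
 have rot: "g y z t = g t y z" for y z t using g23[of y z t] g12[of y t z] by linarith
 have g0: "g y z y = 0" for y z using g23[of y z y] g12[of y z y] g23[of z y y] g12[of y y z] by linarith
 have gm0: "g (- y) z t = - g y z t" for y z t by (simp add: g_def linear_neg[OF lin] bl)
 have gm: "g y (- z) t = - g y z t" "g y z (- t) = - g y z t" for y z t by (simp_all add: g_def bl)
 have comm: "E y (J1 z) = J1 (E y z)" "E y (J2 z) = J2 (E y z)" "E y (J3 z) = J3 (E y z)" for y z
  using E commutingD unfolding spn_def by blast+
 have gJp: "g y (J1 z) (J1 t) = g y z t" "g y (J2 z) (J2 t) = g y z t" "g y (J3 z) (J3 t) = g y z t"
  if "perp z t" for y z t
  using that unfolding g_def G perp_def by (simp_all add: bl ims_apply J_simps comm)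
 have step: "f2 y = 0" "f3 y = 0" "f1 y = 0" for y
 proof -
  obtain t where t: "perp t y" "b t t = 1" using exists_perp[OF dim] by blast
  note t' = perp_sym[OF t(1)]
  have p: "perp y (J1 t)" "perp y (J2 t)" "perp y (J3 t)" using perp_J[OF t'] .
  have z: "g (J1 r) y r = 0" "g (J2 r) y r = 0" "g (J3 r) y r = 0" if "perp y r" for r
   using gJp(1)[OF that, of "J1 r"] gJp(2)[OF that, of "J2 r"] gJp(3)[OF that, of "J3 r"] g0 by simp_all
  have "g y t (J1 t) = 0" "g y t (J2 t) = 0" "g y t (J3 t) = 0"
   using z[OF t'] unfolding rot[of y t] by simp_all
  moreover have "g y (J1 t) (J3 t) = 0" "g y (J2 t) (J1 t) = 0" "g y (J3 t) (J2 t) = 0"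
   using z(2)[OF p(1)] z(3)[OF p(2)] z(1)[OF p(3)]
   unfolding rot[of y "J1 t"] rot[of y "J2 t"] rot[of y "J3 t"] J_products gm0 by simp_all
  \<comment> \<open>The sp(n) part contributes equally to the evaluation on t and to the one on a
    rotated t, so the difference leaves twice one sp(1) coefficient.\<close>
  ultimately have "2 * f2 y * b t t = 0" "2 * f3 y * b t t = 0" "2 * f1 y * b t t = 0"
   unfolding g_def G by (simp_all add: bl ims_apply J_simps comm)
  then show "f2 y = 0" "f3 y = 0" "f1 y = 0" using t(2) by auto
 qed
 have gJ: "g y (J1 z) t = - g y z (J1 t)" for y z t
  unfolding g_def G step by (simp add: bl ims_apply comm J_simps)
 \<comment> \<open>Moving J1 from the first slot to the second costs one sign directly, but two
   signs by way of the third slot.\<close>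
 have "g y (J1 z) t = 0" for y z t
 proof -
  have "g (J1 y) z t = g y (J1 z) t"
   using g12[of "J1 y" z t] gJ[of z y t] g12[of z y "J1 t"] gJ[of y z t] by linarith
  moreover have "g (J1 y) z t = - g y (J1 z) t"
   using rot[of t "J1 y" z] gJ[of t y z] rot[of t y "J1 z"] rot[of "J1 y" z t] rot[of y "J1 z" t] by linarith
  ultimately show ?thesis by simp
 qed
 from this[of _ "- J1 z" for z] have "g y z t = 0" for y z t by (simp add: bl J_squares)
 then have "G y z = 0" for z using zeroI unfolding g_def by blast
 then show ?thesis by (simp add: blinfun_eqI)
qed

text \<open>F and N t agree on the diagonal, so their difference is alternating with compatible
  values and vanishes. The conformal Killing equation thus enters only through F y y, where the
  exterior derivative drops out.\<close>

lemma compatible_twistor_form: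
 fixes F :: "'e \<Rightarrow> 'e endo"
 assumes dim: "DIM('e) \<ge> 8" and lin: "linear F"
  and F: "\<And>y. F y = ims (f1 y) (f2 y) (f3 y) + E y" and E: "\<And>y. spn (E y)"
  and tw: "\<And>y z. b (F y y) z = b t y * b y z - b t z * b y y"
 shows "F y = N t y"
proof -
 have "F y - N t y = 0"
 proof (rule alternating_compatible_eq_0[OF dim, where G = "\<lambda>y. F y - N t y"])
  have "linear (N t)" unfolding linear_iff by (auto intro!: blinfun_eqI simp: N_apply bl algebra_simps)
  then show "linear (\<lambda>y. F y - N t y)" using lin linear_compose_sub by blast
  show "(F y - N t y) y = 0" for y
  proof (rule nondegenerate)
   show "b ((F y - N t y) y) w = b 0 w" for w
    by (simp add: bl tw N_apply J_simps) 
  qed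
  show "F y - N t y = ims (f1 y + b (J1 t) y) (f2 y + b (J2 t) y) (f3 y + b (J3 t) y) + (E y - 4 *\<^sub>R U t y)" for y
   by (simp add: F N_def ims_def algebra_simps)
  show "spn (E y - 4 *\<^sub>R U t y)" for y
   using E[of y] U_spn[of t y] unfolding spn_def skew_def commuting_def by (simp add: bl)
 qed
 then show ?thesis by simp
qed

end

subsection \<open>The curvature tensor\<close>

lemma scaleR_halves:
 "(c / 2) *\<^sub>R x + (c / 2) *\<^sub>R x = c *\<^sub>R x" "(c / 2) *\<^sub>R x + ((c / 2) *\<^sub>R x + y) = c *\<^sub>R x + y"
 for x y :: "'v::real_vector"
 by (simp_all add: field_sum_of_halves flip: scaleR_left_distrib add.assoc)

lemma curvature_likeD:
 assumes "curvature_like b R"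
 shows "bilinear R" "R u v = - R v u" "skew b (R u v)" "R u v w + R v w u + R w u v = 0"
 using assms unfolding curvature_like_def by blast+

context quat_hermitian begin

lemma curvature_like_antisym:
 assumes "curvature_like b R"
 shows "b (R u v w) z = - b (R v u w) z" "b (R u v w) z = - b (R u v z) w"
  "b (R u v w) z + b (R v w u) z + b (R w u v) z = 0"
proof -
 show "b (R u v w) z = - b (R v u w) z"
  by (subst curvature_likeD(2)[OF assms]) (simp add: bl)
 show "b (R u v w) z = - b (R u v z) w"
  using skewD[OF curvature_likeD(3)[OF assms], of u v w z] sym[of w "R u v z"] by linarith
 have "b (R u v w + R v w u + R w u v) z = 0" by (simp add: curvature_likeD(4)[OF assms] bl)
 then show "b (R u v w) z + b (R v w u) z + b (R w u v) z = 0" by (simp add: bl)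
qed

text \<open>The octahedron argument: combine four Bianchi identities, one for each choice of the
  last argument.\<close>

lemma curvature_like_pair_sym:
 assumes "curvature_like b R"
 shows "b (R u v w) z = b (R w z u) v"
proof -
 note A = curvature_like_antisym(1)[OF assms] note A' = curvature_like_antisym(2)[OF assms]
 note B = curvature_like_antisym(3)[OF assms]
 show ?thesis
  using B[of u v w z] B[of v w z u] B[of w z u v] B[of z u v w]
   A'[of v w z u] A'[of u v z w] A'[of w z v u] A'[of z u w v] A[of u w z v] A'[of w u z v]
   A[of z v w u] A'[of v z w u] by linarith
qed

definition curv_decomp where
 "curv_decomp R a1 a2 a3 E \<longleftrightarrow> curvature_like b R \<and>
  (\<forall>u v. R u v = ims (a1 u v) (a2 u v) (a3 u v) + E u v \<and> commuting (E u v))"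

text \<open>Curvature of t against the whole quaternionic line of y, summed. Its symmetry in t and y
  is what relates the sp(1) coefficients at different vectors.\<close>

definition sect :: "('e \<Rightarrow> 'e \<Rightarrow> 'e endo) \<Rightarrow> 'e \<Rightarrow> 'e \<Rightarrow> real" where
 "sect R t y = b (R y t t) y + b (R (J1 y) t t) (J1 y) + b (R (J2 y) t t) (J2 y) + b (R (J3 y) t t) (J3 y)"

text \<open>Between vectors on orthogonal quaternionic lines the sp(1) part of R u v is invisible,
  so a J can be moved from one to the other. With the Bianchi identity and pair symmetry everything
  reduces to terms K u t t v, which are symmetric in u and v.\<close>

lemma curv_decomp_sect:
 fixes R :: "'e \<Rightarrow> 'e \<Rightarrow> 'e endo"
 assumes D: "curv_decomp R a1 a2 a3 E" and p: "perp t y"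
 shows "2 * a2 y (J2 y) * b t t = - sect R t y" "a2 y (J1 y) * b t t = 0" "a2 y (J3 y) * b t t = 0"
  "sect R t y = sect R y t"
proof -
 define K where "K u v w z = b (R u v w) z" for u v w z
 have cl: "curvature_like b R" and R: "R u v = ims (a1 u v) (a2 u v) (a3 u v) + E u v" "commuting (E u v)" for u v
  using D unfolding curv_decomp_def by auto
 note A1 = curvature_like_antisym(1)[OF cl, folded K_def] note A2 = curvature_like_antisym(2)[OF cl, folded K_def]
 note B = curvature_like_antisym(3)[OF cl, folded K_def]
 note P = curvature_like_pair_sym[OF cl, folded K_def]
 note comm = commutingD[OF R(2)]
 have neg: "K (- u) v w z = - K u v w z" "K u (- v) w z = - K u v w z" "K u v (- w) z = - K u v w z"
  "K u v w (- z) = - K u v w z" for u v w z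
  by (simp_all add: K_def bl bilinear_lneg[OF curvature_likeD(1)[OF cl]] bilinear_rneg[OF curvature_likeD(1)[OF cl]])
 \<comment> \<open>The part E contributes equally on w and on J1 w; the difference isolates the
   coefficient of J2.\<close>
 have key: "2 * a2 u v * b w w = K u v w (J2 w) - K u v (J1 w) (J3 w)" for u v w
  unfolding K_def R(1) by (simp add: bl ims_apply J_simps comm)
 have KJ: "K u v (J1 w) (J1 z) = K u v w z" "K u v (J2 w) (J2 z) = K u v w z" "K u v (J3 w) (J3 z) = K u v w z"
  if "perp w z" for u v w z
  using that unfolding K_def R(1) perp_def by (simp_all add: bl ims_apply J_simps comm)
 \<comment> \<open>Bianchi in t, J2 t, y; in each resulting term the J2 is then moved off t across
   orthogonal lines.\<close>
 have c1: "K t (J2 t) y s = - K (J2 y) t t s + K y t t (J2 s)" if "perp t y" "perp t s" for t y s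
 proof -
  have "K y t (J2 t) s = - K y t t (J2 s)" using KJ(2)[OF perp_J(2)[OF that(2)], of y t] by (simp add: J_squares neg)
  moreover have "K t s y (J2 t) = - K t s (J2 y) t"
   using KJ(2)[OF perp_J(2)[OF perp_sym[OF that(1)]], of t s] by (simp add: J_squares neg)
  ultimately show ?thesis
   using B[of t "J2 t" y s] A1[of "J2 t" y t s] P[of y "J2 t" t s] P[of "J2 y" t t s] by linarith
 qed
 have c2: "K a (J1 t) (J1 t) s = K (J1 a) t t (J1 s)" "K a (J2 t) (J2 t) s = K (J2 a) t t (J2 s)"
  "K a (J3 t) (J3 t) s = K (J3 a) t t (J3 s)" if "perp t a" "perp t s" for a s
 proof -
  have "K a (J1 t) (J1 t) s = - K a (J1 t) t (J1 s)" "K a (J2 t) (J2 t) s = - K a (J2 t) t (J2 s)"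
    "K a (J3 t) (J3 t) s = - K a (J3 t) t (J3 s)"
   using KJ(1)[OF perp_J(1)[OF that(2)], of a "J1 t"] KJ(2)[OF perp_J(2)[OF that(2)], of a "J2 t"]
    KJ(3)[OF perp_J(3)[OF that(2)], of a "J3 t"] by (simp_all add: J_squares neg)
  moreover have "K t (J1 s) a (J1 t) = - K t (J1 s) (J1 a) t" "K t (J2 s) a (J2 t) = - K t (J2 s) (J2 a) t"
   "K t (J3 s) a (J3 t) = - K t (J3 s) (J3 a) t"
   using KJ(1)[OF perp_J(1)[OF perp_sym[OF that(1)]], of t "J1 s"] KJ(2)[OF perp_J(2)[OF perp_sym[OF that(1)]], of t "J2 s"]
    KJ(3)[OF perp_J(3)[OF perp_sym[OF that(1)]], of t "J3 s"] by (simp_all add: J_squares neg)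
  ultimately show "K a (J1 t) (J1 t) s = K (J1 a) t t (J1 s)" "K a (J2 t) (J2 t) s = K (J2 a) t t (J2 s)"
   "K a (J3 t) (J3 t) s = K (J3 a) t t (J3 s)"
   using P[of a "J1 t" t "J1 s"] P[of a "J2 t" t "J2 s"] P[of a "J3 t" t "J3 s"] 
    P[of "J1 a" t t "J1 s"] P[of "J2 a" t t "J2 s"] P[of "J3 a" t t "J3 s"] by linarith+
 qed
 have symr: "K u t t v = K v t t u" for u v using P[of u t t v] A1[of t v u t] A2[of v t u t] by linarith
 have p1: "perp (J1 t) y" using perp_sym[OF perp_J(1)[OF perp_sym[OF p]]] .
 have gen: "2 * a2 y s * b t t = - K (J2 y) t t s + K y t t (J2 s) - K (J1 (J2 y)) t t (J1 s) + K (J1 y) t t (J1 (J2 s))"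
  if s: "perp t s" for s
 proof -
  have s1: "perp (J1 t) s" using perp_sym[OF perp_J(1)[OF perp_sym[OF s]]] .
  have "2 * a2 y s * b t t = K t (J2 t) y s - K (J1 t) (J3 t) y s"
   using key[of y s t] P[of y s t "J2 t"] P[of y s "J1 t" "J3 t"] by linarith
  also have "K (J1 t) (J3 t) y s = - K (J1 t) (J2 (J1 t)) y s" by (simp add: J_products neg)
  finally show ?thesis
   using c1[OF p s] c1[OF p1 s1] c2(1)[OF perp_J(2)[OF p] s] c2(1)[OF p perp_J(2)[OF s]] by linarith
 qed
 show "2 * a2 y (J2 y) * b t t = - sect R t y"
  unfolding gen[OF perp_J(2)[OF p]] sect_def K_def[symmetric] by (simp add: J_squares J_products neg bl)
 show "a2 y (J1 y) * b t t = 0"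
  using gen[OF perp_J(1)[OF p]] symr[of "J2 y" "J1 y"] symr[of "J3 y" y]
  by (simp add: J_squares J_products neg bl)
 show "a2 y (J3 y) * b t t = 0"
  using gen[OF perp_J(3)[OF p]] symr[of "J2 y" "J3 y"] symr[of "J1 y" y]
  by (simp add: J_squares J_products neg bl)
 show "sect R t y = sect R y t"
  unfolding sect_def K_def[symmetric]
  using c2(1)[OF p p] c2(2)[OF p p] c2(3)[OF p p] P[of "J1 t" y y "J1 t"] P[of "J2 t" y y "J2 t"] P[of "J3 t" y y "J3 t"]
   P[of t y y t] by linarith
qed

lemma curv_decomp_coeff:
 assumes "curv_decomp R a1 a2 a3 E"
 shows "2 * a2 u v * b w w = b (R u v w) (J2 w) - b (R u v (J1 w)) (J3 w)"
proof -
 have R: "R u v = ims (a1 u v) (a2 u v) (a3 u v) + E u v" "commuting (E u v)"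
  using assms unfolding curv_decomp_def by auto
 show ?thesis unfolding R(1) by (simp add: bl ims_apply J_simps commutingD[OF R(2)])
qed

text \<open>The coefficients arise by a choice for each pair u, v; the formula for a2 in terms of R
  shows that the choices fit together.\<close>

lemma curv_decomp_coeff_bilinear:
 assumes D: "curv_decomp R a1 a2 a3 E" and ne: "(w::'e) \<noteq> 0"
 shows "bilinear a2" "a2 u v = - a2 v u"
proof -
 have cl: "curvature_like b R" using D unfolding curv_decomp_def by auto
 have w: "b w w \<noteq> 0" using ne by simp
 have eq: "a2 u v = (b (R u v w) (J2 w) - b (R u v (J1 w)) (J3 w)) / (2 * b w w)" for u v
  using curv_decomp_coeff[OF D, of u v w] w by (simp add: field_simps)
 note bil = curvature_likeD(1)[OF cl]
 show "bilinear a2" unfolding bilinear_def linear_iff eq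
  by (simp add: bl bilinear_ladd[OF bil] bilinear_radd[OF bil] bilinear_lmul[OF bil] bilinear_rmul[OF bil]
    add_divide_distrib diff_divide_distrib algebra_simps)
 show "a2 u v = - a2 v u"
  unfolding eq using curvature_like_antisym(1)[OF cl, of u v w "J2 w"] curvature_like_antisym(1)[OF cl, of u v "J1 w" "J3 w"]
  by (simp add: diff_divide_distrib)
qed

text \<open>For unit vectors y0 and t0 on orthogonal lines, split y into a part p on the line of y0
  and a part r orthogonal to it. The hypothesis compares p with t0 and r with y0; only the mixed
  term of p and r needs a further argument.\<close>

lemma perp_lines_quadratic:
 fixes \<beta> :: "'e \<Rightarrow> 'e \<Rightarrow> real"
 assumes dim: "DIM('e) \<ge> 8" and bil: "bilinear \<beta>"
  and h: "\<And>t y. perp t y \<Longrightarrow> \<beta> y y * b t t = \<beta> t t * b y y"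
 shows "\<exists>\<kappa>. \<forall>y. \<beta> y y = \<kappa> * b y y"
proof -
 obtain y0 where y0: "b y0 y0 = 1" using exists_perp[OF dim, of 0] by blast
 obtain t0 where t0: "perp t0 y0" "b t0 t0 = 1" using exists_perp[OF dim, of y0] by blast
 define \<kappa> where "\<kappa> = \<beta> y0 y0"
 have k: "\<beta> t0 t0 = \<kappa>" using h[OF t0(1)] t0(2) y0 by (simp add: \<kappa>_def)
 have exp: "\<beta> (u + s *\<^sub>R v) (u + s *\<^sub>R v) = \<beta> u u + s * (\<beta> u v + \<beta> v u) + s * s * \<beta> v v" for u v s
  by (simp add: bilinear_ladd[OF bil] bilinear_radd[OF bil] bilinear_lmul[OF bil] bilinear_rmul[OF bil] algebra_simps)
 have "\<beta> y y = \<kappa> * b y y" for y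
 proof -
  define p where "p = b y y0 *\<^sub>R y0 + b y (J1 y0) *\<^sub>R J1 y0 + b y (J2 y0) *\<^sub>R J2 y0 + b y (J3 y0) *\<^sub>R J3 y0"
  define r where "r = y - p"
  have y: "y = p + 1 *\<^sub>R r" by (simp add: r_def)
  have r0: "perp r y0" unfolding perp_def r_def p_def using y0 by (simp add: bl J_simps)
  have rp: "perp r p" using r0 unfolding perp_def p_def by (simp add: bl J_simps)
  have tp: "perp t0 p" using t0(1) unfolding perp_def p_def by (simp add: bl J_simps)
  have qp: "\<beta> p p = \<kappa> * b p p" using h[OF tp] t0(2) k by simp
  have qr: "\<beta> r r = \<kappa> * b r r" using h[OF r0] y0 by (simp add: \<kappa>_def)
  have "\<beta> p r + \<beta> r p = 0"
  proof (cases "p = 0 \<or> r = 0")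
   case True
   then show ?thesis by (auto simp: bilinear_lzero[OF bil] bilinear_rzero[OF bil])
  next
   case False
   then have pos': "b p p > 0" "b r r > 0" using pos by auto
   \<comment> \<open>Scaling r to the length of p places p + s r and p - s r on orthogonal
     quaternionic lines. So \<beta> takes equal values on them and the mixed term vanishes.\<close>
   define s where "s = sqrt (b p p / b r r)"
   have s: "s \<noteq> 0" "s * s * b r r = b p p" unfolding s_def using pos' by (auto simp flip: power2_eq_square)
   have rp0: "b r p = 0" "b p r = 0" using rp sym[of p r] by (auto simp: perp_def)
   have rpJ: "b p (J1 r) = 0" "b p (J2 r) = 0" "b p (J3 r) = 0" "b r (J1 p) = 0" "b r (J2 p) = 0" "b r (J3 p) = 0"
    using rp perp_sym[OF rp] by (auto simp: perp_def)
   have "perp (p + s *\<^sub>R r) (p + (- s) *\<^sub>R r)"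
    using s(2) rp0 rpJ unfolding perp_def by (simp add: bl J_self algebra_simps)
   from h[OF this] have "\<beta> (p + (- s) *\<^sub>R r) (p + (- s) *\<^sub>R r) * (b p p + s * s * b r r) =
     \<beta> (p + s *\<^sub>R r) (p + s *\<^sub>R r) * (b p p + s * s * b r r)"
    using rp0 by (simp add: bl algebra_simps)
   then have "\<beta> (p + (- s) *\<^sub>R r) (p + (- s) *\<^sub>R r) = \<beta> (p + s *\<^sub>R r) (p + s *\<^sub>R r)"
    using s(2) pos' False by simp
   then show ?thesis unfolding exp using s(1) by simp
  qed
  moreover have "b y y = b p p + b r r" 
   unfolding y using rp sym[of p r] by (simp add: bl perp_def)
  ultimately show ?thesis using qp qr exp[of p 1 r] y by (simp add: algebra_simps)
 qed
 then show ?thesis by blast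
qed

text \<open>Polarisation gives d u (J v) = d (J u) v, hence d (J u) (J v) = - d u v for each of the
  three J. Since J3 = J1 J2, two such signs must equal one.\<close>

lemma alternating_J_eq_0:
 fixes d :: "'e \<Rightarrow> 'e \<Rightarrow> real"
 assumes bil: "bilinear d" and alt: "\<And>u v. d u v = - d v u"
  and 0: "\<And>y. d y (J1 y) = 0" "\<And>y. d y (J2 y) = 0" "\<And>y. d y (J3 y) = 0"
 shows "d u v = 0"
proof -
 have pol: "d y (J z) = d (J y) z" if "\<And>y. d y (J y) = 0" for J :: "'e endo" and y z
 proof -
  have "d (y + z) (J (y + z)) = d y (J y) + d y (J z) + d z (J y) + d z (J z)"
   by (simp add: bl bilinear_ladd[OF bil] bilinear_radd[OF bil])
  then show ?thesis using alt[of z "J y"] by (simp add: that)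
 qed
 have "d (J3 u) (J3 v) = d u (J3 (J3 v))" by (rule pol[OF 0(3), symmetric])
 then have 1: "d (J3 u) (J3 v) = - d u v" by (simp add: J_squares bilinear_rneg[OF bil])
 have "d (J3 u) (J3 v) = d (J1 (J2 u)) (J1 (J2 v))" by (simp add: J_products)
 also have "\<dots> = d (J2 u) (J1 (J1 (J2 v)))" by (rule pol[OF 0(1), symmetric])
 also have "\<dots> = - d (J2 u) (J2 v)" by (simp only: J_squares bilinear_rneg[OF bil])
 also have "d (J2 u) (J2 v) = d u (J2 (J2 v))" by (rule pol[OF 0(2), symmetric])
 finally show ?thesis using 1 by (simp add: J_squares bilinear_rneg[OF bil])
qed

lemma J_form_antisym: "b (J1 u) v = - b (J1 v) u" "b (J2 u) v = - b (J2 v) u" "b (J3 u) v = - b (J3 v) u"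
 using sym[of u "J1 v"] sym[of u "J2 v"] sym[of u "J3 v"] by (simp_all only: J_skew(1)[of u v] J_skew(2)[of u v] J_skew(3)[of u v])

text \<open>A multiple of the curvature of quaternionic projective space plus a tensor of
  hyperkaehler type. The sp(1) coefficients are determined first; the factor 2 * \<kappa> before U
  is the one for which the model part satisfies the Bianchi identity by itself.\<close>

lemma curvature_decomposition:
 fixes R :: "'e \<Rightarrow> 'e \<Rightarrow> 'e endo"
 assumes dim: "DIM('e) \<ge> 8" and cl: "curvature_like b R"
  and N: "\<And>u v J. J \<in> {J1, J2, J3} \<Longrightarrow> (R u v o\<^sub>L J) - (J o\<^sub>L R u v) \<in> span {J1, J2, J3}"
 obtains \<kappa> W where "curvature_like b W" "\<And>u v. commuting (W u v)"
  "\<And>u v. R u v = ims (\<kappa> * b (J1 u) v) (\<kappa> * b (J2 u) v) (\<kappa> * b (J3 u) v) + ((2 * \<kappa>) *\<^sub>R U u v + W u v)"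
proof -
 obtain x :: 'e where x: "b x x = 1" using exists_perp[OF dim] by blast
 then have ne: "x \<noteq> 0" by auto
 have "\<forall>u v. \<exists>c1 c2 c3 E. R u v = ims c1 c2 c3 + E \<and> spn E"
  using normalizer_decomp[OF curvature_likeD(3)[OF cl] N ne] by blast
 then obtain a1 a2 a3 E where R: "\<And>u v. R u v = ims (a1 u v) (a2 u v) (a3 u v) + E u v" and E: "\<And>u v. spn (E u v)"
  by metis
 have D2: "curv_decomp R a1 a2 a3 E" using cl R E unfolding curv_decomp_def spn_def by blast
 interpret C: quat_hermitian b J2 J3 J1 by (rule cycle)
 interpret CC: quat_hermitian b J3 J1 J2 by (rule C.cycle)
 have D3: "C.curv_decomp R a2 a3 a1 E" and D1: "CC.curv_decomp R a3 a1 a2 E"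
  using cl R E unfolding C.curv_decomp_def CC.curv_decomp_def spn_def C.commuting_def CC.commuting_def commuting_def
   C.ims_def CC.ims_def ims_def by (simp_all add: algebra_simps)
 have Cp: "C.perp t y" "CC.perp t y" if "perp t y" for t y
  using that unfolding perp_def C.perp_def CC.perp_def by simp_all
 have Cs: "C.sect R t y = sect R t y" "CC.sect R t y = sect R t y" for t y
  unfolding sect_def C.sect_def CC.sect_def by simp_all
 \<comment> \<open>All three diagonal coefficients are given by the same symmetric expression, so a
   single \<kappa> serves for them.\<close>
 have q: "2 * a1 y (J1 y) * b t t = - sect R t y" "2 * a2 y (J2 y) * b t t = - sect R t y" "2 * a3 y (J3 y) * b t t = - sect R t y"
  if "perp t y" for t y
  using CC.curv_decomp_sect(1)[OF D1 Cp(2)[OF that]] curv_decomp_sect(1)[OF D2 that]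
   C.curv_decomp_sect(1)[OF D3 Cp(1)[OF that]] by (simp_all add: Cs)
 have qs: "sect R t y = sect R y t" if "perp t y" for t y by (rule curv_decomp_sect(4)[OF D2 that])
 have off: "a2 y (J1 y) = 0" "a2 y (J3 y) = 0" "a3 y (J2 y) = 0" "a3 y (J1 y) = 0" "a1 y (J3 y) = 0" "a1 y (J2 y) = 0" for y
 proof -
  obtain t where t: "perp t y" "b t t = 1" using exists_perp[OF dim, of y] by blast
  show "a2 y (J1 y) = 0" "a2 y (J3 y) = 0" "a3 y (J2 y) = 0" "a3 y (J1 y) = 0" "a1 y (J3 y) = 0" "a1 y (J2 y) = 0"
   using CC.curv_decomp_sect(2,3)[OF D1 Cp(2)[OF t(1)]] curv_decomp_sect(2,3)[OF D2 t(1)]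
    C.curv_decomp_sect(2,3)[OF D3 Cp(1)[OF t(1)]] t(2) by simp_all
 qed
 note bil = CC.curv_decomp_coeff_bilinear[OF D1 ne] curv_decomp_coeff_bilinear[OF D2 ne] C.curv_decomp_coeff_bilinear[OF D3 ne]
 have bilJ: "bilinear (\<lambda>y z. a1 y (J1 z))"
  using bil(1) unfolding bilinear_def linear_iff by (simp add: bl)
 obtain \<kappa> where k1: "\<And>y. a1 y (J1 y) = \<kappa> * b y y"
 proof -
  have "\<exists>\<kappa>. \<forall>y. a1 y (J1 y) = \<kappa> * b y y"
  proof (rule perp_lines_quadratic[OF dim bilJ])
   fix t y assume p: "perp t y"
   show "a1 y (J1 y) * b t t = a1 t (J1 t) * b y y"
    using q(1)[OF p] q(1)[OF perp_sym[OF p]] qs[OF p] by simp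
  qed
  then show ?thesis using that by blast
 qed
 have k23: "a2 y (J2 y) = \<kappa> * b y y" "a3 y (J3 y) = \<kappa> * b y y" for y
 proof -
  obtain t where t: "perp t y" "b t t = 1" using exists_perp[OF dim, of y] by blast
  show "a2 y (J2 y) = \<kappa> * b y y" "a3 y (J3 y) = \<kappa> * b y y" using q[OF t(1)] t(2) k1[of y] by simp_all
 qed
 have a1: "a1 u v = \<kappa> * b (J1 u) v" for u v
 proof -
  \<comment> \<open>The difference from the expected value is alternating and vanishes on every pair
    y, Ji y.\<close>
  have "a1 u v - \<kappa> * b (J1 u) v = 0"
  proof (rule alternating_J_eq_0[where d = "\<lambda>u v. a1 u v - \<kappa> * b (J1 u) v"])
   show "bilinear (\<lambda>u v. a1 u v - \<kappa> * b (J1 u) v)"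
    using bil(1) unfolding bilinear_def linear_iff by (simp add: bl algebra_simps)
   show "a1 u v - \<kappa> * b (J1 u) v = - (a1 v u - \<kappa> * b (J1 v) u)" for u v
    using bil(2)[of u v] J_form_antisym(1)[of u v] by simp
  qed (simp_all add: k1 off J_simps bl)
  then show ?thesis by simp
 qed
 have a2: "a2 u v = \<kappa> * b (J2 u) v" for u v
 proof -
  have "a2 u v - \<kappa> * b (J2 u) v = 0"
  proof (rule alternating_J_eq_0[where d = "\<lambda>u v. a2 u v - \<kappa> * b (J2 u) v"])
   show "bilinear (\<lambda>u v. a2 u v - \<kappa> * b (J2 u) v)"
    using bil(3) unfolding bilinear_def linear_iff by (simp add: bl algebra_simps)
   show "a2 u v - \<kappa> * b (J2 u) v = - (a2 v u - \<kappa> * b (J2 v) u)" for u v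
    using bil(4)[of u v] J_form_antisym(2)[of u v] by simp
  qed (simp_all add: k23 off J_simps bl)
  then show ?thesis by simp
 qed
 have a3: "a3 u v = \<kappa> * b (J3 u) v" for u v
 proof -
  have "a3 u v - \<kappa> * b (J3 u) v = 0"
  proof (rule alternating_J_eq_0[where d = "\<lambda>u v. a3 u v - \<kappa> * b (J3 u) v"])
   show "bilinear (\<lambda>u v. a3 u v - \<kappa> * b (J3 u) v)"
    using bil(5) unfolding bilinear_def linear_iff by (simp add: bl algebra_simps)
   show "a3 u v - \<kappa> * b (J3 u) v = - (a3 v u - \<kappa> * b (J3 v) u)" for u v
    using bil(6)[of u v] J_form_antisym(3)[of u v] by simp
  qed (simp_all add: k23 off J_simps bl)
  then show ?thesis by simp
 qed
 define W where "W u v = E u v - (2 * \<kappa>) *\<^sub>R U u v" for u v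
 have RW: "R u v = ims (\<kappa> * b (J1 u) v) (\<kappa> * b (J2 u) v) (\<kappa> * b (J3 u) v) + ((2 * \<kappa>) *\<^sub>R U u v + W u v)" for u v
  unfolding R a1 a2 a3 W_def by simp
 then have W: "W u v = R u v - ims (\<kappa> * b (J1 u) v) (\<kappa> * b (J2 u) v) (\<kappa> * b (J3 u) v) - (2 * \<kappa>) *\<^sub>R U u v" for u v
  by simp
 have cW: "commuting (W u v)" for u v
  using E[of u v] U_spn[of u v] unfolding W_def spn_def commuting_def by (simp add: bl)
 have "curvature_like b W"
  unfolding curvature_like_def
 proof (intro conjI allI)
  show "bilinear W" using curvature_likeD(1)[OF cl] U_bilinear unfolding W bilinear_def linear_iff
   by (auto simp: ims_def bl algebra_simps)
  show "W u v = - W v u" for u v unfolding W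
   by (subst curvature_likeD(2)[OF cl], subst U_antisym) (simp add: ims_def J_form_antisym[of u v] algebra_simps)
  show "skew b (W u v)" for u v
   using E[of u v] U_spn[of u v] unfolding W_def spn_def skew_def by (simp add: bl)
  show "W u v w + W v w u + W w u v = 0" for u v w
  proof -
   have "W u v w + W v w u + W w u v = (R u v w + R v w u + R w u v) -
    (ims (\<kappa> * b (J1 u) v) (\<kappa> * b (J2 u) v) (\<kappa> * b (J3 u) v) w + (2 * \<kappa>) *\<^sub>R U u v w
    + (ims (\<kappa> * b (J1 v) w) (\<kappa> * b (J2 v) w) (\<kappa> * b (J3 v) w) u + (2 * \<kappa>) *\<^sub>R U v w u)
    + (ims (\<kappa> * b (J1 w) u) (\<kappa> * b (J2 w) u) (\<kappa> * b (J3 w) u) v + (2 * \<kappa>) *\<^sub>R U w u v))"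
    unfolding W by (simp add: bl)
   also have "\<dots> = 0" unfolding curvature_likeD(4)[OF cl]
    using sym[of v u] sym[of w u] sym[of w v] sym[of v "J1 u"] sym[of v "J2 u"] sym[of v "J3 u"]
     sym[of w "J1 u"] sym[of w "J2 u"] sym[of w "J3 u"]  sym[of w "J1 v"] sym[of w "J2 v"] sym[of w "J3 v"]
    by (simp add: ims_apply U_apply J_skew algebra_simps scaleR_halves)
   finally show ?thesis .
  qed
 qed
 then show ?thesis using that cW RW by blast
qed

end

subsection \<open>Traces\<close>

locale quat_hermitian_frame = quat_hermitian +
 fixes B :: "'a set"
 assumes frame: "orthonormal_frame b B"
begin

lemma frame_expansion: "(\<Sum>k\<in>B. b v k *\<^sub>R k) = v"
proof -
 have card: "card B = DIM('a)" and on: "\<And>u v. u \<in> B \<Longrightarrow> v \<in> B \<Longrightarrow> b u v = (if u = v then 1 else 0)"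
  using frame unfolding orthonormal_frame_def by auto
 have fin: "finite B" using card card.infinite by fastforce
 have pair: "b (\<Sum>k\<in>B. c k *\<^sub>R k) u = c u" if "u \<in> B" for c u
 proof -
  have "b (\<Sum>k\<in>B. c k *\<^sub>R k) u = (\<Sum>k\<in>B. c k * b k u)" by (simp add: bl blinfun.sum_left)
  also have "\<dots> = (\<Sum>k\<in>B. if k = u then c k else 0)" by (intro sum.cong) (use on that in auto)
  finally show ?thesis using that fin by simp
 qed
 have "independent B"
 proof (rule independent_if_scalars_zero[OF fin])
  fix c :: "'a \<Rightarrow> real" and u assume "(\<Sum>k\<in>B. c k *\<^sub>R k) = 0" "u \<in> B"
  then show "c u = 0" using pair[of u c] by simp
 qed
 then have "span B = UNIV"
  using card_ge_dim_independent[of B UNIV] card by auto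
 define w where "w = v - (\<Sum>k\<in>B. b v k *\<^sub>R k)"
 have bw: "b w u = 0" if "u \<in> B" for u using pair[OF that, of "b v"] by (simp add: w_def bl)
 have "b w x = 0" if "x \<in> span B" for x
  using that by (induction rule: span_induct_alt) (auto simp: bl bw)
 then have "b w w = 0" using \<open>span B = UNIV\<close> by blast
 then show ?thesis by (simp add: w_def)
qed

lemma frame_linear: "linear h \<Longrightarrow> (\<Sum>k\<in>B. b v k *\<^sub>R h k) = h v"
 using arg_cong[OF frame_expansion[of v], of h] by (simp add: linear_sum linear_cmul)

text \<open>Expand A k in the frame, exchange the sums and contract again. This replaces arguments
  by change of frame.\<close>

lemma frame_adjoint:
 fixes h :: "'a \<Rightarrow> 'a \<Rightarrow> 'v::real_vector"
 assumes h: "bilinear h" and A: "\<And>v w. b (A v) w = b v (A' w)"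
 shows "(\<Sum>k\<in>B. h (A k) k) = (\<Sum>k\<in>B. h k (A' k))"
proof -
 have "(\<Sum>k\<in>B. h (A k) k) = (\<Sum>k\<in>B. \<Sum>l\<in>B. b (A k) l *\<^sub>R h l k)"
  by (intro sum.cong refl frame_linear[symmetric]) (use h in \<open>simp add: bilinear_def\<close>)
 also have "\<dots> = (\<Sum>l\<in>B. \<Sum>k\<in>B. b (A k) l *\<^sub>R h l k)" by (rule sum.swap)
 also have "\<dots> = (\<Sum>l\<in>B. \<Sum>k\<in>B. b (A' l) k *\<^sub>R h l k)" by (simp add: A sym[of _ "A' _"])
 also have "\<dots> = (\<Sum>l\<in>B. h l (A' l))"
  by (intro sum.cong refl frame_linear) (use h in \<open>simp add: bilinear_def\<close>)
 finally show ?thesis .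
qed

lemma frame_J:
 fixes h :: "'a \<Rightarrow> 'a \<Rightarrow> 'v::real_vector"
 assumes h: "bilinear h"
 shows "(\<Sum>k\<in>B. h (J1 k) (J1 k)) = (\<Sum>k\<in>B. h k k)" "(\<Sum>k\<in>B. h (J2 k) (J2 k)) = (\<Sum>k\<in>B. h k k)"
  "(\<Sum>k\<in>B. h (J3 k) (J3 k)) = (\<Sum>k\<in>B. h k k)"
proof -
 have *: "bilinear (\<lambda>x y. h x (J y))" for J :: "'a endo" using h unfolding bilinear_def linear_iff by (simp add: bl)
 show "(\<Sum>k\<in>B. h (J1 k) (J1 k)) = (\<Sum>k\<in>B. h k k)"
  using frame_adjoint[OF *, of J1 "\<lambda>w. - J1 w" J1] by (simp add: J_simps bl)
 show "(\<Sum>k\<in>B. h (J2 k) (J2 k)) = (\<Sum>k\<in>B. h k k)"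
  using frame_adjoint[OF *, of J2 "\<lambda>w. - J2 w" J2] by (simp add: J_simps bl)
 show "(\<Sum>k\<in>B. h (J3 k) (J3 k)) = (\<Sum>k\<in>B. h k k)"
  using frame_adjoint[OF *, of J3 "\<lambda>w. - J3 w" J3] by (simp add: J_simps bl)
qed

text \<open>Rotating the frame by another of the J reverses the sign of the given one and leaves A
  unchanged.\<close>

lemma trace_J_commuting:
 assumes "commuting A"
 shows "(\<Sum>k\<in>B. b (J1 k) (A k)) = 0" "(\<Sum>k\<in>B. b (J2 k) (A k)) = 0" "(\<Sum>k\<in>B. b (J3 k) (A k)) = 0"
proof -
 note c = commutingD[OF assms]
 have bil: "bilinear (\<lambda>x y. b (J x) (A y))" for J :: "'a endo" unfolding bilinear_def linear_iff by (simp add: bl algebra_simps)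
 have "(\<Sum>k\<in>B. b (J1 k) (A k)) = - (\<Sum>k\<in>B. b (J1 k) (A k))"
  using frame_J(2)[OF bil, of J1] by (simp add: c J_simps bl sum_negf)
 then show "(\<Sum>k\<in>B. b (J1 k) (A k)) = 0" by simp
 have "(\<Sum>k\<in>B. b (J2 k) (A k)) = - (\<Sum>k\<in>B. b (J2 k) (A k))"
  using frame_J(1)[OF bil, of J2] by (simp add: c J_simps bl sum_negf)
 then show "(\<Sum>k\<in>B. b (J2 k) (A k)) = 0" by simp
 have "(\<Sum>k\<in>B. b (J3 k) (A k)) = - (\<Sum>k\<in>B. b (J3 k) (A k))"
  using frame_J(1)[OF bil, of J3] by (simp add: c J_simps bl sum_negf)
 then show "(\<Sum>k\<in>B. b (J3 k) (A k)) = 0" by simp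
qed

text \<open>Trace the Bianchi identity against J: the trace of J with W y z vanishes, which leaves r
  z (J y) = r y (J z). So r changes sign under each J, and J3 = J1 J2 forces r = 0.\<close>

lemma ricci_flat:
 assumes cl: "curvature_like b W" and comm: "\<And>u v. commuting (W u v)"
 shows "(\<Sum>k\<in>B. b (W y k k) v) = 0"
proof -
 define r where "r y v = (\<Sum>k\<in>B. b (W y k k) v)" for y v
 note bilW = curvature_likeD(1)[OF cl]
 note c = commutingD[OF comm]
 note A = curvature_like_antisym[OF cl] note P = curvature_like_pair_sym[OF cl]
 have bil: "bilinear r" unfolding r_def bilinear_def linear_iff
  by (simp add: bl bilinear_ladd[OF bilW] bilinear_lmul[OF bilW] sum.distrib sum_distrib_left)
 have rs: "r y v = r v y" for y v unfolding r_def
 proof (intro sum.cong refl)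
  fix k show "b (W y k k) v = b (W v k k) y"
   using P[of y k k v] A(1)[of k v y k] A(2)[of v k y k] by linarith
 qed
 have gen: "r z (J y) = r y (J z)"
  if "(\<Sum>k\<in>B. b (J k) (W y z k)) = 0" and sk: "\<And>v w. b (J v) w = - b v (J w)"
   and cJ: "\<And>u v w. W u v (J w) = J (W u v w)" for J :: "'a endo" and y z
 proof -
  have e: "b (W z k y) (J k) = b (W z k k) (J y)" for z k y
   using A(2)[of z k "J y" k] sk[of "W z k y" k] by (simp add: cJ)
  have "b (J k) (W y z k) = - b (W z k k) (J y) + b (W y k k) (J z)" for k
   using A(3)[of y z k "J k"] A(1)[of k y z "J k"] e[of z k y] e[of y k z] sym[of "J k" "W y z k"] by linarith
  then have "0 = (\<Sum>k\<in>B. - b (W z k k) (J y) + b (W y k k) (J z))" using that(1) by simp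
  then show ?thesis unfolding r_def sum.distrib sum_negf by linarith
 qed
 have g: "r z (J1 y) = r y (J1 z)" "r z (J2 y) = r y (J2 z)" "r z (J3 y) = r y (J3 z)" for y z
  by (rule gen; (fact trace_J_commuting[OF comm] J_skew c)?)+
 have J: "r (J1 y) (J1 z) = - r y z" "r (J2 y) (J2 z) = - r y z" "r (J3 y) (J3 z) = - r y z" for y z
  using g[of z] rs[of z] by (simp_all add: g(1)[of "J1 y" z] g(2)[of "J2 y" z] g(3)[of "J3 y" z] J_squares bilinear_rneg[OF bil])
 have "r (J1 (J2 y)) (J1 (J2 v)) = r y v" by (simp only: J minus_minus)
 then show ?thesis using J(3)[of y v] unfolding r_def[symmetric] by (simp add: J_products)
qed

text \<open>Each of the four averaged bivectors in U contributes 2 V to the contraction, and the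
  factor 1/4 turns 8 V into 2 V.\<close>

lemma U_frame_sum:
 assumes V: "spn V"
 shows "(\<Sum>k\<in>B. U k (V k)) = 2 *\<^sub>R V"
proof (rule blinfun_eqI)
 fix w
 have s: "b (V v) w = - b v (V w)" for v w using V unfolding spn_def skew_def by blast
 have c: "V (J1 v) = J1 (V v)" "V (J2 v) = J2 (V v)" "V (J3 v) = J3 (V v)" for v
  using V commutingD unfolding spn_def by blast+
 have lin: "linear (\<lambda>k. V k)" "linear (\<lambda>k. k)" "linear (\<lambda>k. J1 k)" "linear (\<lambda>k. J2 k)" "linear (\<lambda>k. J3 k)"
  "linear (\<lambda>k. J1 (V k))" "linear (\<lambda>k. J2 (V k))" "linear (\<lambda>k. J3 (V k))"
  unfolding linear_iff by (simp_all add: bl)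
 have t: "U k (V k) w = (1 / 4) *\<^sub>R ((b w k *\<^sub>R V k + b (V w) k *\<^sub>R k)
   - (b (J1 (V w)) k *\<^sub>R J1 k + b (J1 w) k *\<^sub>R J1 (V k))
   - (b (J2 (V w)) k *\<^sub>R J2 k + b (J2 w) k *\<^sub>R J2 (V k))
   - (b (J3 (V w)) k *\<^sub>R J3 k + b (J3 w) k *\<^sub>R J3 (V k)))" for k
 proof -
  have "b k w = b w k" "b (V k) w = - b (V w) k" 
   "b (J1 k) w = - b (J1 w) k" "b (J2 k) w = - b (J2 w) k" "b (J3 k) w = - b (J3 w) k"
   by (simp_all only: sym[of k w] s[of k w] sym[of k "V w"] J_form_antisym[of k w])
  moreover have "b (J1 (V k)) w = b (J1 (V w)) k" "b (J2 (V k)) w = b (J2 (V w)) k" "b (J3 (V k)) w = b (J3 (V w)) k"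
   by (simp_all only: J_skew[of "V k" w] s[of k] c sym[of k "J1 (V w)"] sym[of k "J2 (V w)"] sym[of k "J3 (V w)"] minus_minus blinfun.minus_right)
  ultimately show ?thesis by (simp add: U_apply algebra_simps)
 qed
 have eight: "x + x - (- x - x) - (- x - x) - (- x - x) = 8 *\<^sub>R x" for x :: 'a
  using scaleR_left_distrib[of 4 4 x] scaleR_left_distrib[of 2 2 x] by (simp add: scaleR_2)
 show "(\<Sum>k\<in>B. U k (V k)) w = (2 *\<^sub>R V) w"
  unfolding blinfun.sum_left t
  by (simp add: scaleR_right.sum[symmetric] sum.distrib sum_subtractf frame_linear[OF lin(1)] frame_linear[OF lin(2)]
   frame_linear[OF lin(3)] frame_linear[OF lin(4)] frame_linear[OF lin(5)] frame_linear[OF lin(6)] frame_linear[OF lin(7)]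
   frame_linear[OF lin(8)] bl c J_squares eight)
qed

lemma scalar_flat:
 assumes "curvature_like b W" "\<And>u v. commuting (W u v)"
 shows "(\<Sum>e\<in>B. \<Sum>f\<in>B. b (W e f f) e) = 0"
 using ricci_flat[OF assms] by simp

end

subsection \<open>The pointwise holonomy argument\<close>

context quat_hermitian begin

text \<open>The relation \<open>ric\<close> is compared componentwise. Its sp(1) components make C =
  A - \<kappa> p pair symmetrically with every Ji, which forces C into sp(n); its commuting
  component is the last claim. Up to scale, p1, p2, p3 is the quaternionic moment map of the Killing
  field \<theta>.\<close>

lemma moment_map_decomp:
 fixes A P :: "'e endo" and RE R :: "'e \<Rightarrow> 'e \<Rightarrow> 'e endo"
 assumes RE: "\<And>u v. commuting (RE u v)" and P: "commuting P"
  and R: "\<And>u v. R u v = ims (\<kappa> * b (J1 u) v) (\<kappa> * b (J2 u) v) (\<kappa> * b (J3 u) v) + RE u v"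
  and ric: "\<And>u v. (R u v o\<^sub>L (ims p1 p2 p3 + P)) - ((ims p1 p2 p3 + P) o\<^sub>L R u v) = N (A u) v - N (A v) u"
  and ne: "(x::'e) \<noteq> 0"
 obtains C :: "'e endo" where "A = \<kappa> *\<^sub>R ims p1 p2 p3 + C" "spn C"
  "\<And>u v. (RE u v o\<^sub>L P) - (P o\<^sub>L RE u v) = 4 *\<^sub>R (U (C u) v + U u (C v))"
proof -
 define C where "C = A - \<kappa> *\<^sub>R ims p1 p2 p3"
 have A: "A = \<kappa> *\<^sub>R ims p1 p2 p3 + C" by (simp add: C_def)
 note cc = commutingD[OF RE] commutingD[OF P] note cU = U_spn[unfolded spn_def, THEN conjunct2, THEN commutingD(1)]
  U_spn[unfolded spn_def, THEN conjunct2, THEN commutingD(2)] U_spn[unfolded spn_def, THEN conjunct2, THEN commutingD(3)]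
 \<comment> \<open>q1, q2, q3 are the sp(1) components of the difference of the two sides of
   \<open>ric\<close>, and Z is the commuting remainder; all of them vanish by directness of the
   sum.\<close>
 define q1 where "q1 u v = 2 * \<kappa> * (b (J2 u) v * p3 - b (J3 u) v * p2) + b (J1 (A u)) v - b (J1 (A v)) u" for u v
 define q2 where "q2 u v = 2 * \<kappa> * (b (J3 u) v * p1 - b (J1 u) v * p3) + b (J2 (A u)) v - b (J2 (A v)) u" for u v
 define q3 where "q3 u v = 2 * \<kappa> * (b (J1 u) v * p2 - b (J2 u) v * p1) + b (J3 (A u)) v - b (J3 (A v)) u" for u v
 define Z where "Z u v = ((RE u v o\<^sub>L P) - (P o\<^sub>L RE u v)) - 4 *\<^sub>R (U (A u) v - U (A v) u)" for u v
 have cZ: "commuting (Z u v)" for u v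
  by (rule commutingI) (simp_all add: Z_def bl cc cU)
 have dbl: "(a * (c * (2 * d))) *\<^sub>R z = (a * (c * d)) *\<^sub>R z + (a * (c * d)) *\<^sub>R z" for a c d and z :: 'e
  using scaleR_double(2)[of "a * (c * d)" z] by (simp add: mult_ac)
 have qZ: "ims (q1 u v) (q2 u v) (q3 u v) + Z u v = 0" for u v
 proof -
  have "ims (q1 u v) (q2 u v) (q3 u v) + Z u v =
   ((R u v o\<^sub>L (ims p1 p2 p3 + P)) - ((ims p1 p2 p3 + P) o\<^sub>L R u v)) - (N (A u) v - N (A v) u)"
   by (rule blinfun_eqI)
    (simp add: R Z_def N_def q1_def q2_def q3_def bl ims_apply cc J_squares J_products algebra_simps scaleR_double dbl)
  then show ?thesis unfolding ric by simp
 qed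
 note q = ims_plus_commuting_eq_0[OF cZ qZ ne]
 have ct: "b (J1 (C u)) v = b (J1 (C v)) u" "b (J2 (C u)) v = b (J2 (C v)) u" "b (J3 (C u)) v = b (J3 (C v)) u" for u v
 proof -
  have "b (J1 (C u)) v - b (J1 (C v)) u = q1 u v" "b (J2 (C u)) v - b (J2 (C v)) u = q2 u v"
   "b (J3 (C u)) v - b (J3 (C v)) u = q3 u v"
   using J_form_antisym[of u v] sym[of u v]
   by (simp_all add: C_def q1_def q2_def q3_def bl ims_apply J_squares J_products algebra_simps)
  then show "b (J1 (C u)) v = b (J1 (C v)) u" "b (J2 (C u)) v = b (J2 (C v)) u" "b (J3 (C u)) v = b (J3 (C v)) u"
   using q[of u v] by simp_all
 qed
 have ct': "b (C u) (J1 v) = b (C v) (J1 u)" "b (C u) (J2 v) = b (C v) (J2 u)" "b (C u) (J3 v) = b (C v) (J3 u)" for u v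
  using ct[of u v] by (simp_all add: J_skew)
 have JJ: "b (C (J1 u)) (J1 v) = - b (C v) u" "b (C (J2 u)) (J2 v) = - b (C v) u" "b (C (J3 u)) (J3 v) = - b (C v) u" for u v
  using ct'[of "J1 u" v] ct'[of "J2 u" v] ct'[of "J3 u" v] by (simp_all add: J_squares bl)
 \<comment> \<open>Applying the sign rule for J2 and then J1 gives b (C u) v, while the rule for J3
   gives - b (C v) u for the same expression.\<close>
 have skew: "b (C u) v = - b (C v) u" for u v
 proof -
  have "b (C (J1 (J2 u))) (J1 (J2 v)) = b (C u) v" by (simp only: JJ minus_minus)
  then show ?thesis using JJ(3)[of u v] by (simp add: J_products)
 qed
 have "spn C" unfolding spn_def
 proof
  show "skew b C" unfolding skew_def using skew sym by metis
  show "commuting C"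
  proof (rule commutingI; rule nondegenerate)
   fix v w
   have "b (C (J1 v)) (J1 (- J1 w)) = b (J1 (C v)) (J1 (- J1 w))" 
    unfolding JJ(1) J_isom skew[of "- J1 w"] by simp
   then show "b (C (J1 v)) w = b (J1 (C v)) w" by (simp add: bl J_squares)
   have "b (C (J2 v)) (J2 (- J2 w)) = b (J2 (C v)) (J2 (- J2 w))" 
    unfolding JJ(2) J_isom skew[of "- J2 w"] by simp
   then show "b (C (J2 v)) w = b (J2 (C v)) w" by (simp add: bl J_squares)
  qed
 qed
 moreover have "(RE u v o\<^sub>L P) - (P o\<^sub>L RE u v) = 4 *\<^sub>R (U (C u) v + U u (C v))" for u v
 proof -
  have "U (C v) u = - U u (C v)" by (rule U_antisym)
  \<comment> \<open>Moving Ji across U and exchanging the arguments give a sign each, so the sp(1)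
    part of A drops out after antisymmetrising.\<close>
  moreover have "U (ims p1 p2 p3 u) v = U (ims p1 p2 p3 v) u"
   unfolding ims_apply bilinear_ladd[OF U_bilinear] bilinear_lmul[OF U_bilinear] U_J_left
   by (simp add: U_antisym[of u "J1 v"] U_antisym[of u "J2 v"] U_antisym[of u "J3 v"] U_J_left)
  ultimately have "U (A u) v - U (A v) u = U (C u) v + U u (C v)"
   unfolding A by (simp add: bl bilinear_ladd[OF U_bilinear] bilinear_lmul[OF U_bilinear])
  then show ?thesis using q(4)[of u v] unfolding Z_def by simp
 qed
 ultimately show ?thesis using that A by blast
qed

end

context quat_hermitian_frame begin

text \<open>Pair symmetry turns \<open>ann\<close> into the vanishing of the contraction of R with
  V. As \<kappa> is non-zero, the sp(1) part says that V has trace zero against each Ji, which is v1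
  = v2 = v3 = 0; the commuting part is the second claim.\<close>

lemma annihilator_sp:
 fixes V VE :: "'a endo" and RE R :: "'a \<Rightarrow> 'a \<Rightarrow> 'a endo"
 assumes RE: "\<And>u v. commuting (RE u v)" and cl: "curvature_like b R"
  and R: "\<And>u v. R u v = ims (\<kappa> * b (J1 u) v) (\<kappa> * b (J2 u) v) (\<kappa> * b (J3 u) v) + RE u v"
  and V: "V = ims v1 v2 v3 + VE" "spn VE" and k: "\<kappa> \<noteq> 0" and ne: "(x::'a) \<noteq> 0"
  and ann: "\<And>u v. (\<Sum>k\<in>B. b (R u v k) (V k)) = 0"
 shows "spn V" "(\<Sum>k\<in>B. RE k (V k)) = 0"
proof -
 have "(\<Sum>k\<in>B. R k (V k)) = 0"
 proof (rule blinfun_eqI, rule nondegenerate)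
  fix y z
  have "b ((\<Sum>k\<in>B. R k (V k)) y) z = (\<Sum>k\<in>B. b (R y z k) (V k))"
   unfolding blinfun.sum_left blinfun.sum_right
   by (intro sum.cong refl curvature_like_pair_sym[OF cl])
  then show "b ((\<Sum>k\<in>B. R k (V k)) y) z = b ((0 :: 'a endo) y) z" by (simp add: ann bl)
 qed
 then have a: "ims (\<kappa> * (\<Sum>k\<in>B. b (J1 k) (V k))) (\<kappa> * (\<Sum>k\<in>B. b (J2 k) (V k))) (\<kappa> * (\<Sum>k\<in>B. b (J3 k) (V k)))
   + (\<Sum>k\<in>B. RE k (V k)) = 0"
  unfolding R ims_def by (simp add: sum.distrib scaleR_left.sum sum_distrib_left)
 have c: "commuting (\<Sum>k\<in>B. RE k (V k))"
  using RE unfolding commuting_def by (simp add: blinfun.sum_left blinfun.sum_right)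
 note q = ims_plus_commuting_eq_0[OF c a ne]
 have z: "(\<Sum>k\<in>B. b (J1 k) (V k)) = 0" "(\<Sum>k\<in>B. b (J2 k) (V k)) = 0" "(\<Sum>k\<in>B. b (J3 k) (V k)) = 0"
  and RE0: "(\<Sum>k\<in>B. RE k (V k)) = 0"
  using q k by simp_all
 show "(\<Sum>k\<in>B. RE k (V k)) = 0" by (rule RE0)
 have on: "b k k = 1" if "k \<in> B" for k using frame that unfolding orthonormal_frame_def by auto
 have card: "real (card B) \<noteq> 0" using frame unfolding orthonormal_frame_def by simp
 note tr = trace_J_commuting[OF V(2)[unfolded spn_def, THEN conjunct2]]
 have "(\<Sum>k\<in>B. b (J1 k) (V k)) = (\<Sum>k\<in>B. v1 * b k k + b (J1 k) (VE k))"
  "(\<Sum>k\<in>B. b (J2 k) (V k)) = (\<Sum>k\<in>B. v2 * b k k + b (J2 k) (VE k))"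
  "(\<Sum>k\<in>B. b (J3 k) (V k)) = (\<Sum>k\<in>B. v3 * b k k + b (J3 k) (VE k))"
  unfolding V(1) by (simp_all add: bl ims_apply J_simps)
 then have "v1 * real (card B) = 0" "v2 * real (card B) = 0" "v3 * real (card B) = 0"
  using z by (auto simp: sum.distrib tr on)
 then have "v1 = 0" "v2 = 0" "v3 = 0" using card by simp_all
 then show "spn V" using V by (simp add: ims_def)
qed

text \<open>Put u = k, v = V k in \<open>ric\<close> and sum over the frame. The left side vanishes
  by \<open>RE0\<close>; by equivariance of U the right side is 8 times the bracket of C and
  V.\<close>

lemma commutes_with_moment:
 fixes C P V :: "'a endo" and RE :: "'a \<Rightarrow> 'a \<Rightarrow> 'a endo"
 assumes C: "spn C" and V: "spn V" and RE0: "(\<Sum>k\<in>B. RE k (V k)) = 0"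
  and ric: "\<And>u v. (RE u v o\<^sub>L P) - (P o\<^sub>L RE u v) = 4 *\<^sub>R (U (C u) v + U u (C v))"
 shows "C (V w) = V (C w)"
proof -
 have "(\<Sum>k\<in>B. U (C k) (V k) + U k (C (V k))) w = (\<Sum>k\<in>B. C (U k (V k) w) - U k (V k) (C w))"
  by (simp add: blinfun.sum_left bl spn_bracket_U[OF C, of _ _ w])
 also have "\<dots> = C ((\<Sum>k\<in>B. U k (V k)) w) - (\<Sum>k\<in>B. U k (V k)) (C w)"
  by (simp add: sum_subtractf blinfun.sum_left blinfun.sum_right)
 finally have 1: "(\<Sum>k\<in>B. U (C k) (V k) + U k (C (V k))) w = 2 *\<^sub>R (C (V w) - V (C w))"
  unfolding U_frame_sum[OF V] by (simp add: bl algebra_simps)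
 have "4 *\<^sub>R (\<Sum>k\<in>B. U (C k) (V k) + U k (C (V k))) = (\<Sum>k\<in>B. (RE k (V k) o\<^sub>L P) - (P o\<^sub>L RE k (V k)))"
  by (simp add: scaleR_right.sum ric)
 also have "\<dots> = ((\<Sum>k\<in>B. RE k (V k)) o\<^sub>L P) - (P o\<^sub>L (\<Sum>k\<in>B. RE k (V k)))"
  by (rule blinfun_eqI) (simp add: sum_subtractf blinfun.sum_left blinfun.sum_right bl)
 also have "\<dots> = 0" unfolding RE0 by (rule blinfun_eqI) (simp add: bl)
 finally show ?thesis using 1 by (simp add: bl)
qed

text \<open>The contraction of the commutation relation over \<open>a\<close> below gives \<open>(n + 2) \<rho> V X = 0\<close>.\<close>

lemma holonomy_core:
 fixes V :: "'a endo" and RE W :: "'a \<Rightarrow> 'a \<Rightarrow> 'a endo"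
 assumes cl: "curvature_like b W" and comm: "\<And>u v. commuting (W u v)" and V: "spn V"
  and RE: "\<And>u v. RE u v = \<rho> *\<^sub>R U u v + W u v" and rho: "\<rho> \<noteq> 0"
  and RE0: "(\<Sum>k\<in>B. RE k (V k)) = 0" and VX: "\<And>y z. RE X y (V z) = V (RE X y z)" and X: "X \<noteq> 0"
 shows "V = 0"
proof -
 have s: "b (V v) w = - b v (V w)" for v w using V unfolding spn_def skew_def by blast
 have c: "V (J1 v) = J1 (V v)" "V (J2 v) = J2 (V v)" "V (J3 v) = J3 (V v)" for v
  using V commutingD unfolding spn_def by blast+
 note cW = commutingD[OF comm]
 note A = curvature_like_antisym[OF cl] note P = curvature_like_pair_sym[OF cl]
 note bilW = curvature_likeD(1)[OF cl]
 have Upair: "b (U u v w) z = b (U w z u) v" for u v w z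
  using J_form_antisym[of w u] J_form_antisym[of v z]  J_form_antisym[of w v] J_form_antisym[of u z] sym[of w u] sym[of v z] sym[of w v] sym[of u z]
  by (simp add: U_apply bl)
 have REpair: "b (RE u v w) z = b (RE w z u) v" for u v w z
  using Upair[of u v w z] P[of u v w z] by (simp add: RE bl)
 \<comment> \<open>Pair symmetry converts commutation of V with all RE X y into a condition on the
   first two slots.\<close>
 have swap: "RE (V a) d X + RE a (V d) X = 0" for a d
 proof (rule zeroI)
  fix y
  have "b (RE (V a) d X) y = b (V (RE X y a)) d" using REpair[of "V a" d X y] VX by simp
  moreover have "b (RE a (V d) X) y = - b (V (RE X y a)) d" using REpair[of a "V d" X y] s by simp
  ultimately show "b (RE (V a) d X + RE a (V d) X) y = 0" by (simp add: bl)
 qed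
 have sumW: "(\<Sum>k\<in>B. W k (V k)) = - (2 * \<rho>) *\<^sub>R V"
  using RE0 unfolding RE sum.distrib scaleR_right.sum[symmetric] U_frame_sum[OF V]
  by (simp add: add_eq_0_iff2 algebra_simps)
 \<comment> \<open>Bianchi with two slots contracted by V: two of the terms agree, and the third is
   known from \<open>RE0\<close>.\<close>
 have T: "(\<Sum>k\<in>B. W X k (V k)) = \<rho> *\<^sub>R V X"
 proof -
  have bil: "bilinear (\<lambda>x y. W x X y)" using bilW unfolding bilinear_def linear_iff by (simp add: bl)
  have "(\<Sum>k\<in>B. W (V k) X k) = (\<Sum>k\<in>B. W k X (- V k))"
   by (rule frame_adjoint[OF bil]) (simp add: s bl)
  also have "\<dots> = (\<Sum>k\<in>B. W X k (V k))"
   by (intro sum.cong refl, subst curvature_likeD(2)[OF cl]) (simp add: bl)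
  finally have 1: "(\<Sum>k\<in>B. W (V k) X k) = (\<Sum>k\<in>B. W X k (V k))" .
  have "(\<Sum>k\<in>B. W X k (V k) + W k (V k) X + W (V k) X k) = 0"
   using curvature_likeD(4)[OF cl] by simp
  then have "(\<Sum>k\<in>B. W X k (V k)) + (\<Sum>k\<in>B. W X k (V k)) = - (\<Sum>k\<in>B. W k (V k)) X"
   by (simp add: sum.distrib 1 blinfun.sum_left eq_neg_iff_add_eq_0 add.commute add.left_commute)
  also have "\<dots> = \<rho> *\<^sub>R V X + \<rho> *\<^sub>R V X" unfolding sumW by (simp add: bl scaleR_double)
  finally show ?thesis by (simp only: double_eq_iff)
 qed
 have "V X = 0"
 proof (rule zeroI)
  fix d
  have W1: "(\<Sum>k\<in>B. b (W (V k) d X) k) = \<rho> * b (V X) d"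
  proof -
   have "(\<Sum>k\<in>B. b (W (V k) d X) k) = (\<Sum>k\<in>B. b (W X k (V k)) d)" by (intro sum.cong refl P)
   also have "\<dots> = b (\<Sum>k\<in>B. W X k (V k)) d" by (simp add: blinfun.sum_left blinfun.sum_right)
   finally show ?thesis by (simp add: T bl)
  qed
  \<comment> \<open>This contraction is a Ricci trace of the hyperkaehler part.\<close>
  have W2: "(\<Sum>k\<in>B. b (W k (V d) X) k) = 0"
  proof -
   have "b (W k (V d) X) k = b (W (V d) k k) X" for k using A(1)[of k "V d" X k] A(2)[of "V d" k X k] by linarith
   then show ?thesis using ricci_flat[OF cl comm, of "V d" X] by simp
  qed
  have lin: "linear (\<lambda>k. b k (V X))" "linear (\<lambda>k. b k (V (J1 X)))" "linear (\<lambda>k. b k (V (J2 X)))" "linear (\<lambda>k. b k (V (J3 X)))"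
   "linear (\<lambda>k. b k X)" "linear (\<lambda>k. b k (J1 X))" "linear (\<lambda>k. b k (J2 X))" "linear (\<lambda>k. b k (J3 X))"
   by (simp_all add: linear_iff bl)
  have on: "b k k = 1" if "k \<in> B" for k using frame that unfolding orthonormal_frame_def by auto
  have card: "card B = DIM('a)" using frame unfolding orthonormal_frame_def by blast
  have sV: "b (V k) k = 0" for k using s[of k k] sym[of k "V k"] by simp
  note tr = trace_J_commuting[OF V[unfolded spn_def, THEN conjunct2]]
  note fl = frame_linear[OF lin(1)] frame_linear[OF lin(2)] frame_linear[OF lin(3)] frame_linear[OF lin(4)]
   frame_linear[OF lin(5)] frame_linear[OF lin(6)] frame_linear[OF lin(7)] frame_linear[OF lin(8)]
  have U1: "4 * (\<Sum>k\<in>B. b (U (V k) d X) k) = 2 * b (V X) d"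
  proof -
   have "4 * b (U (V k) d X) k = - (b d k * b k (V X)) + (b (J1 d) k * b k (V (J1 X)) + b (J1 d) X * b (J1 k) (V k))
    + (b (J2 d) k * b k (V (J2 X)) + b (J2 d) X * b (J2 k) (V k))
    + (b (J3 d) k * b k (V (J3 X)) + b (J3 d) X * b (J3 k) (V k))" for k
    by (simp add: U_apply bl sV J_skew s[of k] c sym[of "V k" "J1 k"] sym[of "V k" "J2 k"] sym[of "V k" "J3 k"])
   then have "4 * (\<Sum>k\<in>B. b (U (V k) d X) k) = - b d (V X) + b (J1 d) (V (J1 X)) + b (J2 d) (V (J2 X)) + b (J3 d) (V (J3 X))"
    using fl(1)[of d] fl(2)[of "J1 d"] fl(3)[of "J2 d"] fl(4)[of "J3 d"]
    by (simp add: sum_distrib_left sum.distrib sum_subtractf sum_negf sum_distrib_left[symmetric] tr)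
   then show ?thesis by (simp add: c J_isom sym[of d])
  qed
  have U2: "4 * (\<Sum>k\<in>B. b (U k (V d) X) k) = (2 + real DIM('a)) * b (V X) d"
  proof -
   have "4 * b (U k (V d) X) k = b (V d) k * b k X - b (V d) X * b k k - (b (J1 (V d)) k * b k (J1 X))
    - (b (J2 (V d)) k * b k (J2 X)) - (b (J3 (V d)) k * b k (J3 X))" for k
    by (simp add: U_apply bl J_self J_skew(1)[of k] J_skew(2)[of k] J_skew(3)[of k])
   then have "4 * (\<Sum>k\<in>B. b (U k (V d) X) k) = b (V d) X - b (V d) X * real DIM('a) 
    - b (J1 (V d)) (J1 X) - b (J2 (V d)) (J2 X) - b (J3 (V d)) (J3 X)"
    using fl(5)[of "V d"] fl(6)[of "J1 (V d)"] fl(7)[of "J2 (V d)"] fl(8)[of "J3 (V d)"]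
    by (simp add: sum_distrib_left sum.distrib sum_subtractf sum_distrib_left[symmetric] on card)
   also have "\<dots> = (2 + real DIM('a)) * b (V X) d"
    by (simp add: J_isom s[of d] sym[of d] algebra_simps)
   finally show ?thesis .
  qed
  have "0 = (\<Sum>k\<in>B. b (RE (V k) d X + RE k (V d) X) k)" by (simp add: swap bl)
  also have "\<dots> = \<rho> * (\<Sum>k\<in>B. b (U (V k) d X) k) + (\<Sum>k\<in>B. b (W (V k) d X) k) +
   \<rho> * (\<Sum>k\<in>B. b (U k (V d) X) k) + (\<Sum>k\<in>B. b (W k (V d) X) k)"
   by (simp add: RE bl sum.distrib sum_distrib_left)
  \<comment> \<open>The U-terms contribute 2/4 and (2 + dim)/4, the W-term contributes 1; the sum is
    multiplied by 4.\<close>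
  finally have "\<rho> * b (V X) d * (8 + real DIM('a)) = 0" using U1 U2 unfolding W1 W2 by algebra
  moreover have "8 + real DIM('a) > 0" by simp
  ultimately show "b (V X) d = 0" using rho by auto
 qed
 \<comment> \<open>With V X = 0, the swap relation at d = X and d = J1 X computes W on V a, and
   Bianchi makes W (J1 X) X act on the image of V as a multiple of J1. That operator commutes with
   J2, whereas J1 anticommutes with it.\<close>
 have "V a = 0" for a
 proof -
  have *: "W (V a) X X = (\<rho> / 4 * b X X) *\<^sub>R V a \<and> W (V a) (J1 X) X = - (\<rho> / 4 * b X X) *\<^sub>R J1 (V a)" for a
  proof -
   have z: "b (V a) X = 0" "b (V a) (J1 X) = 0" "b (V a) (J2 X) = 0" "b (V a) (J3 X) = 0"
    using \<open>V X = 0\<close> by (simp_all add: s c bl)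
   have XJ: "b (J1 X) X = 0" "b (J2 X) X = 0" "b (J3 X) X = 0" by (simp_all add: J_skew J_self)
   have "U (V a) X X = - (b X X / 4) *\<^sub>R V a"
    by (simp add: U_apply z J_skew J_self bl)
   moreover have "U (V a) (J1 X) X = (b X X / 4) *\<^sub>R J1 (V a)"
    by (simp add: U_apply z J_skew J_self J_squares J_products bl)
   moreover have "RE (V a) X X = 0" "RE (V a) (J1 X) X = 0"
    using swap[of a X] swap[of a "J1 X"] \<open>V X = 0\<close>
    by (simp_all add: RE c bl bilinear_rzero[OF U_bilinear] bilinear_rzero[OF bilW])
   then have "\<rho> *\<^sub>R U (V a) X X + W (V a) X X = 0" "\<rho> *\<^sub>R U (V a) (J1 X) X + W (V a) (J1 X) X = 0"
    unfolding RE by (simp_all only: bl)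
   then have "W (V a) X X = - (\<rho> *\<^sub>R U (V a) X X)" "W (V a) (J1 X) X = - (\<rho> *\<^sub>R U (V a) (J1 X) X)"
    unfolding add_eq_0_iff by simp_all
   ultimately show ?thesis by simp
  qed
  have "W (J1 X) X (V a) = (\<rho> / 2 * b X X) *\<^sub>R J1 (V a)" for a
  proof -
   have "W X (V a) (J1 X) = - J1 (W (V a) X X)" by (subst curvature_likeD(2)[OF cl]) (simp add: bl cW)
   then have "(- (\<rho> / 4 * b X X)) *\<^sub>R J1 (V a) + W (J1 X) X (V a) - (\<rho> / 4 * b X X) *\<^sub>R J1 (V a) = 0"
    using curvature_likeD(4)[OF cl, of "V a" "J1 X" X] * by (simp add: bl)
   then have "W (J1 X) X (V a) = (\<rho> / 4 * b X X + \<rho> / 4 * b X X) *\<^sub>R J1 (V a)"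
    unfolding scaleR_left_distrib by (simp add: eq_neg_iff_add_eq_0 algebra_simps)
   moreover have "\<rho> / 4 * b X X + \<rho> / 4 * b X X = \<rho> / 2 * b X X" by simp
   ultimately show ?thesis by (simp only:)
  qed
  note 1 = this
  have "(\<rho> / 2 * b X X) *\<^sub>R J1 (J2 (V a)) = W (J1 X) X (V (J2 a))"
   unfolding c(2) by (rule 1[of "J2 a", unfolded c(2), symmetric])
  also have "\<dots> = J2 (W (J1 X) X (V a))" by (simp only: c(2) cW(2))
  also have "\<dots> = (\<rho> / 2 * b X X) *\<^sub>R J2 (J1 (V a))" by (simp only: 1 blinfun.scaleR_right)
  finally have "(\<rho> / 2 * b X X) *\<^sub>R J1 (J2 (V a)) = (\<rho> / 2 * b X X) *\<^sub>R J2 (J1 (V a))" .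
  then have "J1 (J2 (V a)) = J2 (J1 (V a))" using rho X by simp
  then have "- J3 (V a) = J3 (V a)" by (simp only: J_products)
  then have "J3 (V a) = 0" unfolding neg_eq_self_iff .
  then have "J3 (J3 (V a)) = 0" by (simp add: bl)
  then show ?thesis by (simp add: J_squares)
 qed
 then show ?thesis by (intro blinfun_eqI) simp
qed

end

section \<open>Riemannian geometry in a coordinate domain\<close>

text \<open>The inverse metric is obtained by choice at each point, so its continuity must be
  derived. A perturbation estimate bounds H near x, and then H y - H x = - H y (G y - G x) H
  x.\<close>

lemma continuous_on_inverse_blinfun:
 fixes G H :: "'x::metric_space \<Rightarrow> 'e::real_normed_vector \<Rightarrow>\<^sub>L 'e"
 assumes G: "continuous_on S G"
  and HG: "\<And>x. x \<in> S \<Longrightarrow> H x o\<^sub>L G x = id_blinfun" and GH: "\<And>x. x \<in> S \<Longrightarrow> G x o\<^sub>L H x = id_blinfun"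
 shows "continuous_on S H"
 unfolding continuous_on_def
proof
 fix x assume x: "x \<in> S"
 define m where "m = norm (H x) + 1"
 have m: "m > 0" unfolding m_def by (simp add: add_nonneg_pos)
 have inv: "H y (G y v) = v" "G y (H y v) = v" if "y \<in> S" for y v
  using HG[OF that] GH[OF that] by (metis blinfun_apply_blinfun_compose blinfun_apply_id_blinfun)+
 have G': "(G \<longlongrightarrow> G x) (at x within S)" using G x unfolding continuous_on_def by blast
 then have ev: "\<forall>\<^sub>F y in at x within S. norm (G y - G x) < 1 / (2 * m)"
  using m tendstoD[of G "G x" "at x within S" "1 / (2 * m)"] by (simp add: dist_norm)
 have evS: "\<forall>\<^sub>F y in at x within S. y \<in> S" by (simp add: eventually_at_filter)
 have bound: "norm (H y) \<le> 2 * m" if y: "y \<in> S" and n: "norm (G y - G x) < 1 / (2 * m)" for y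
 proof (rule norm_blinfun_bound)
  show "0 \<le> 2 * m" using m by simp
  fix w
  define v where "v = H y w"
  have w: "w = G y v" using inv(2)[OF y] by (simp add: v_def)
  have "norm v \<le> norm (H x) * norm (G x v)" using norm_blinfun[of "H x" "G x v"] inv(1)[OF x] by simp
  also have "\<dots> \<le> m * (norm (G y v) + norm ((G y - G x) v))"
   using norm_triangle_ineq4[of "G y v" "(G y - G x) v"] m
   by (intro mult_mono) (auto simp: m_def blinfun.diff_left)
  also have "norm ((G y - G x) v) \<le> 1 / (2 * m) * norm v"
   using norm_blinfun[of "G y - G x" v] n mult_right_mono[of "norm (G y - G x)" "1 / (2 * m)" "norm v"] by simp
  finally have "norm v \<le> m * norm (G y v) + norm v / 2" using m by (simp add: algebra_simps)
  then show "norm (H y w) \<le> 2 * m * norm w" by (simp add: w inv(1)[OF y])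
 qed
 have eq: "H y - H x = - (H y o\<^sub>L ((G y - G x) o\<^sub>L H x))" if "y \<in> S" for y
  by (rule blinfun_eqI) (simp add: blinfun.bilinear_simps inv[OF that] inv[OF x])
 have est: "norm (H y - H x) \<le> 2 * m * m * norm (G y - G x)" if y: "y \<in> S" and n: "norm (G y - G x) < 1 / (2 * m)" for y
 proof -
  have "norm (H y - H x) \<le> norm (H y) * (norm (G y - G x) * norm (H x))"
   unfolding eq[OF y] norm_minus_cancel
   by (rule order_trans[OF norm_blinfun_compose mult_left_mono[OF norm_blinfun_compose norm_ge_zero]])
  also have "\<dots> \<le> (2 * m) * (norm (G y - G x) * m)"
   using m by (intro mult_mono bound[OF y n]) (auto simp: m_def)
  finally show ?thesis by (simp add: mult_ac)
 qed
 have "((\<lambda>y. 2 * m * m * norm (G y - G x)) \<longlongrightarrow> 2 * m * m * norm (G x - G x)) (at x within S)"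
  by (intro tendsto_intros G')
 then have z: "((\<lambda>y. 2 * m * m * norm (G y - G x)) \<longlongrightarrow> 0) (at x within S)" by simp
 have "\<forall>\<^sub>F y in at x within S. norm (H y - H x) \<le> 2 * m * m * norm (G y - G x)"
  using eventually_conj[OF ev evS] by (rule eventually_mono) (use est in blast)
 from Lim_null_comparison[OF this z] have "((\<lambda>y. H y - H x) \<longlongrightarrow> 0) (at x within S)" .
 then show "(H \<longlongrightarrow> H x) (at x within S)" by (rule LIM_zero_cancel)
qed

text \<open>A coordinate domain free of charts and topology. Smaller domains are instances again, as
  required for local quaternionic frames.\<close>

locale local_metric =
 fixes S :: "'e::euclidean_space set" and g :: "'e \<Rightarrow> 'e bilin" and \<Gamma> :: "'e \<Rightarrow> 'e \<Rightarrow>\<^sub>L 'e \<Rightarrow>\<^sub>L 'e"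
 assumes open_S: "open S" and smooth_g: "smooth_on g S"
  and g_sym: "x \<in> S \<Longrightarrow> g x v w = g x w v" and g_pos: "x \<in> S \<Longrightarrow> v \<noteq> 0 \<Longrightarrow> g x v v > 0"
  and \<Gamma>_sym: "x \<in> S \<Longrightarrow> \<Gamma> x u v = \<Gamma> x v u"
  and \<Gamma>_metric: "x \<in> S \<Longrightarrow> frechet_derivative g (at x) u v w = g x (\<Gamma> x u v) w + g x v (\<Gamma> x u w)"
begin

lemmas bl = blinfun.bilinear_simps

text \<open>The Gram operator of g x with respect to the ambient inner product; its inverse
  \<open>raise\<close> is index raising.\<close>

definition lower :: "'e \<Rightarrow> 'e endo" where
 "lower x = (\<Sum>i\<in>Basis. blinfun_scaleR_left i o\<^sub>L (blinfun_inner_right 0 + (g x) i))"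

lemma g_nondegenerate: "x \<in> S \<Longrightarrow> (\<And>w. g x v w = g x v' w) \<Longrightarrow> v = v'"
 using g_pos[of x "v - v'"] by (cases "v = v'") (auto simp: bl)

lemma lower_inner: "x \<in> S \<Longrightarrow> lower x v \<bullet> w = g x v w"
proof -
 assume x: "x \<in> S"
 have "g x v w = g x v (\<Sum>i\<in>Basis. (w \<bullet> i) *\<^sub>R i)" by (simp add: euclidean_representation)
 also have "\<dots> = (\<Sum>i\<in>Basis. (w \<bullet> i) * g x i v)" by (simp add: blinfun.sum_right bl g_sym[OF x, of v])
 also have "\<dots> = lower x v \<bullet> w"
  by (simp add: lower_def blinfun.sum_left bl inner_sum_left inner_commute[of w] mult.commute)
 finally show ?thesis by simp
qed

definition raise :: "'e \<Rightarrow> 'e endo" where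
 "raise x = (SOME H. H o\<^sub>L lower x = id_blinfun \<and> lower x o\<^sub>L H = id_blinfun)"

lemma raise_lower: assumes x: "x \<in> S"
 shows "raise x o\<^sub>L lower x = id_blinfun" "lower x o\<^sub>L raise x = id_blinfun"
proof -
 have lin: "linear (lower x)" by (simp add: blinfun.bounded_linear_right bounded_linear.linear)
 have "inj (lower x)"
  by (rule injI, rule g_nondegenerate[OF x]) (metis lower_inner[OF x])
 then have "bij (lower x)" using linear_injective_imp_surjective[OF lin] by (simp add: bij_def)
 then obtain h where h: "linear h" "h \<circ> lower x = id" "lower x \<circ> h = id"
  using linear_injective_isomorphism[OF lin] by (metis bij_def comp_apply eq_id_iff linear_injective_left_inverse[OF lin] linear_inverse_left[OF lin])
 then have "blinfun_apply (Blinfun h) = h"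
  by (intro bounded_linear_Blinfun_apply) (simp add: linear_conv_bounded_linear)
 then have "Blinfun h o\<^sub>L lower x = id_blinfun \<and> lower x o\<^sub>L Blinfun h = id_blinfun"
  using h by (auto intro!: blinfun_eqI simp: fun_eq_iff)
 then have "raise x o\<^sub>L lower x = id_blinfun \<and> lower x o\<^sub>L raise x = id_blinfun"
  unfolding raise_def by (rule someI)
 then show "raise x o\<^sub>L lower x = id_blinfun" "lower x o\<^sub>L raise x = id_blinfun" by auto
qed

lemma raise: assumes x: "x \<in> S" shows "g x (raise x v) w = v \<bullet> w" "raise x (lower x v) = v"
proof -
 show "raise x (lower x v) = v" using raise_lower(1)[OF x] by (metis blinfun_apply_blinfun_compose blinfun_apply_id_blinfun)
 have "lower x (raise x v) = v" using raise_lower(2)[OF x] by (metis blinfun_apply_blinfun_compose blinfun_apply_id_blinfun)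
 then show "g x (raise x v) w = v \<bullet> w" using lower_inner[OF x, of "raise x v" w] by simp
qed

lemma raiseI: "x \<in> S \<Longrightarrow> (\<And>i. i \<in> Basis \<Longrightarrow> g x v i = c i) \<Longrightarrow> v = raise x (\<Sum>i\<in>Basis. c i *\<^sub>R i)"
proof (rule g_nondegenerate)
 fix w assume x: "x \<in> S" and c: "\<And>i. i \<in> Basis \<Longrightarrow> g x v i = c i"
 have "g x v w = g x v (\<Sum>i\<in>Basis. (w \<bullet> i) *\<^sub>R i)" by (simp add: euclidean_representation)
 also have "\<dots> = (\<Sum>i\<in>Basis. c i * (i \<bullet> w))" using c by (simp add: blinfun.sum_right bl inner_commute mult.commute)
 finally show "g x v w = g x (raise x (\<Sum>i\<in>Basis. c i *\<^sub>R i)) w" by (simp add: raise[OF x] inner_sum_left)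
qed

lemma smooth_lower: "smooth_on lower S"
proof (rule smooth_on_blinfunI[OF open_S])
 fix i :: 'e
 have "smooth_on (\<lambda>x. \<Sum>j\<in>Basis. g x j i *\<^sub>R j) S"
  by (intro smooth_on_sum open_S finite_Basis smooth_on_scaleR smooth_on_const smooth_on_blinfun_apply smooth_g)
 then show "smooth_on (\<lambda>x. lower x i) S"
  by (simp add: lower_def blinfun.sum_left bl)
qed

lemma smooth_raise: "smooth_on raise S"
 using smooth_on_left_inverse[OF open_S smooth_lower _ raise_lower]
  continuous_on_inverse_blinfun[OF smooth_on_continuous[OF smooth_lower] raise_lower] by blast

text \<open>\<Gamma> is given only by its defining equations at each point. Koszul's formula
  expresses it by first derivatives of g and the smooth inverse \<open>raise\<close>.\<close>

lemma smooth_\<Gamma>: "smooth_on \<Gamma> S"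
proof (rule smooth_on_blinfunI[OF open_S], rule smooth_on_blinfunI[OF open_S])
 fix u v :: 'e
 let ?D = "\<lambda>x. frechet_derivative g (at x)"
 let ?K = "\<lambda>x w. (1 / 2) *\<^sub>R (?D x u v w + ?D x v u w - ?D x w u v)"
 have a: "\<Gamma> x u v = raise x (\<Sum>w\<in>Basis. ?K x w *\<^sub>R w)" if x: "x \<in> S" for x
 proof (rule raiseI[OF x])
  fix w
  show "g x (\<Gamma> x u v) w = ?K x w"
   unfolding \<Gamma>_metric[OF x] using \<Gamma>_sym[OF x, of v u] \<Gamma>_sym[OF x, of w u] \<Gamma>_sym[OF x, of w v]
    g_sym[OF x, of v "\<Gamma> x u w"] g_sym[OF x, of u "\<Gamma> x v w"] by simp
 qed
 have "smooth_on (\<lambda>x. raise x (\<Sum>w\<in>Basis. ?K x w *\<^sub>R w)) S"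
  by (intro smooth_on_blinfun_apply smooth_raise smooth_on_sum open_S finite_Basis smooth_on_scaleR
   smooth_on_const smooth_on_add smooth_on_diff smooth_on_frechet smooth_g)
 then show "smooth_on (\<lambda>x. \<Gamma> x u v) S"
  apply (subst smooth_on_cong[OF open_S a]) apply assumption apply assumption done
qed

definition Rm :: "'e \<Rightarrow> 'e \<Rightarrow> 'e \<Rightarrow> 'e endo" where
 "Rm x u v = frechet_derivative \<Gamma> (at x) u v - frechet_derivative \<Gamma> (at x) v u +
  (\<Gamma> x u o\<^sub>L \<Gamma> x v) - (\<Gamma> x v o\<^sub>L \<Gamma> x u)"

lemma Rm_apply: "Rm x u v w = frechet_derivative \<Gamma> (at x) u v w - frechet_derivative \<Gamma> (at x) v u w +
  \<Gamma> x u (\<Gamma> x v w) - \<Gamma> x v (\<Gamma> x u w)"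
 by (simp add: Rm_def bl)

lemma derivative_unique:
 assumes "(f has_derivative f') (at x)" "(f has_derivative f'') (at x)"
 shows "f' u = f'' u"
 using has_derivative_unique[OF assms] by simp

lemma D_\<Gamma>: "x \<in> S \<Longrightarrow> (\<Gamma> has_derivative frechet_derivative \<Gamma> (at x)) (at x)"
 by (rule smooth_on_deriv[OF smooth_\<Gamma>])

lemma D_g: "x \<in> S \<Longrightarrow> (g has_derivative frechet_derivative g (at x)) (at x)"
 by (rule smooth_on_deriv[OF smooth_g])

lemma frechetI: "(f has_derivative f') (at x) \<Longrightarrow> frechet_derivative f (at x) u = f' u"
 using frechet_derivative_at by metis

lemma DD_commute:
 assumes "smooth_on f S" "x \<in> S"
  and "((\<lambda>y. frechet_derivative f (at y) u) has_derivative Fu) (at x)"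
  and "((\<lambda>y. frechet_derivative f (at y) v) has_derivative Fv) (at x)"
 shows "Fu v = Fv u"
 using smooth_on_second_symmetric[OF open_S assms(2,1), of u v] frechetI[OF assms(3)] frechetI[OF assms(4)] by simp

lemma has_derivative_cong:
 assumes "(f has_derivative f') (at x)" "x \<in> S" "\<And>y. y \<in> S \<Longrightarrow> f y = h y"
 shows "(h has_derivative f') (at x)"
 using has_derivative_transform_within_open[OF assms(1) open_S assms(2)] assms(3) by blast

lemma D\<Gamma>_sym: assumes "x \<in> S" shows "frechet_derivative \<Gamma> (at x) u v w = frechet_derivative \<Gamma> (at x) u w v"
proof -
 have "((\<lambda>y. \<Gamma> y v w) has_derivative (\<lambda>u. frechet_derivative \<Gamma> (at x) u v w)) (at x)" for v w
  by (auto intro!: derivative_eq_intros D_\<Gamma> assms)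
 from derivative_unique[OF this[of v w] has_derivative_cong[OF this[of w v] assms]] show ?thesis
  using \<Gamma>_sym by blast
qed

lemma linear_D: "x \<in> S \<Longrightarrow> smooth_on f S \<Longrightarrow> linear (frechet_derivative f (at x))"
 using smooth_on_deriv has_derivative_linear by blast

text \<open>Second derivatives of the function g a c commute. Each first derivative is rewritten by
  metric compatibility before differentiating again; the antisymmetric part is the claim.\<close>

lemma Rm_skew: assumes x: "x \<in> S" shows "skew (g x) (Rm x u v)"
 unfolding skew_def
proof (intro allI)
 fix a c
 let ?G = "\<Gamma> x" and ?D = "frechet_derivative \<Gamma> (at x)"
 have der: "((\<lambda>y. frechet_derivative g (at y) u a c) has_derivative
  (\<lambda>v. (g x (?G v (?G u a)) c + g x (?G u a) (?G v c)) + g x (?D v u a) c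
    + ((g x (?G v a) (?G u c) + g x a (?G v (?G u c))) + g x a (?D v u c)))) (at x)" for u
 proof (rule has_derivative_cong[OF _ x])
  show "((\<lambda>y. g y (\<Gamma> y u a) c + g y a (\<Gamma> y u c)) has_derivative
  (\<lambda>v. (g x (?G v (?G u a)) c + g x (?G u a) (?G v c)) + g x (?D v u a) c
    + ((g x (?G v a) (?G u c) + g x a (?G v (?G u c))) + g x a (?D v u c)))) (at x)"
   by (rule derivative_eq_intros D_g[OF x] D_\<Gamma>[OF x] refl)+ (simp add: \<Gamma>_metric[OF x] fun_eq_iff bl)
 qed (simp add: \<Gamma>_metric)
 have s: "smooth_on (\<lambda>y. g y a c) S"
  by (intro smooth_on_blinfun_apply smooth_g smooth_on_const open_S)
 have e: "frechet_derivative (\<lambda>y. g y a c) (at y) u = frechet_derivative g (at y) u a c" if "y \<in> S" for y u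
  by (rule frechetI) (auto intro!: derivative_eq_intros D_g that)
 have der': "((\<lambda>y. frechet_derivative (\<lambda>y. g y a c) (at y) u) has_derivative
  (\<lambda>v. (g x (?G v (?G u a)) c + g x (?G u a) (?G v c)) + g x (?D v u a) c
    + ((g x (?G v a) (?G u c) + g x a (?G v (?G u c))) + g x a (?D v u c)))) (at x)" for u
  by (rule has_derivative_cong[OF der x]) (simp add: e)
 from DD_commute[OF s x der'[of u] der'[of v]]
 show "g x (Rm x u v a) c = - g x a (Rm x u v c)"
  by (simp add: Rm_apply bl)
qed

lemma Rm_curvature_like: assumes x: "x \<in> S" shows "curvature_like (g x) (Rm x)"
 unfolding curvature_like_def
proof (intro conjI allI)
 have lin: "linear (frechet_derivative \<Gamma> (at x))" by (rule linear_D[OF x smooth_\<Gamma>])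
 show "bilinear (Rm x)" unfolding bilinear_def linear_iff
  by (auto intro!: blinfun_eqI simp: Rm_apply bl linear_add[OF lin] linear_cmul[OF lin] algebra_simps)
 show "Rm x u v = - Rm x v u" for u v by (rule blinfun_eqI) (simp add: Rm_apply bl)
 show "skew (g x) (Rm x u v)" for u v by (rule Rm_skew[OF x])
 show "Rm x u v w + Rm x v w u + Rm x w u v = 0" for u v w
  unfolding Rm_apply using D\<Gamma>_sym[OF x, of u w v] D\<Gamma>_sym[OF x, of v u w] D\<Gamma>_sym[OF x, of w u v]
   \<Gamma>_sym[OF x, of w v] \<Gamma>_sym[OF x, of v u] \<Gamma>_sym[OF x, of w u]
  by (simp add: algebra_simps)
qed

definition nabv :: "('e \<Rightarrow> 'e) \<Rightarrow> 'e \<Rightarrow> 'e \<Rightarrow> 'e" where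
 "nabv s x u = frechet_derivative s (at x) u + \<Gamma> x u (s x)"

definition nabe :: "('e \<Rightarrow> 'e endo) \<Rightarrow> 'e \<Rightarrow> 'e \<Rightarrow> 'e endo" where
 "nabe A x u = frechet_derivative A (at x) u + (\<Gamma> x u o\<^sub>L A x) - (A x o\<^sub>L \<Gamma> x u)"

lemma smooth_nabv: "smooth_on s S \<Longrightarrow> smooth_on (\<lambda>x. nabv s x u) S"
 unfolding nabv_def by (intro smooth_on_add smooth_on_frechet smooth_on_blinfun_apply smooth_\<Gamma> smooth_on_const open_S)

lemma smooth_nabe: "smooth_on A S \<Longrightarrow> smooth_on (\<lambda>x. nabe A x u) S"
 unfolding nabe_def
 by (intro smooth_on_add smooth_on_diff smooth_on_frechet smooth_on_compose smooth_on_blinfun_apply smooth_\<Gamma> smooth_on_const open_S)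

text \<open>The directions u and v are constant coordinate fields, so there is no bracket term; the
  second derivatives of s cancel by symmetry.\<close>

lemma ricci_vector:
 assumes s: "smooth_on s S" and x: "x \<in> S"
 shows "nabv (\<lambda>y. nabv s y v) x u - nabv (\<lambda>y. nabv s y u) x v = Rm x u v (s x)"
proof -
 let ?DD = "\<lambda>v u. frechet_derivative (\<lambda>y. frechet_derivative s (at y) v) (at x) u"
 have "frechet_derivative (\<lambda>y. nabv s y v) (at x) u = ?DD v u
   + (\<Gamma> x v (frechet_derivative s (at x) u) + frechet_derivative \<Gamma> (at x) u v (s x))" for u v
  unfolding nabv_def
  by (rule frechetI)
   (rule derivative_eq_intros smooth_on_deriv[OF smooth_on_frechet[OF s] x] D_\<Gamma>[OF x] smooth_on_deriv[OF s x] refl | simp)+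
 then show ?thesis
  using smooth_on_second_symmetric[OF open_S x s, of u v] by (simp add: nabv_def Rm_apply bl)
qed

lemma ricci_endo:
 assumes A: "smooth_on A S" and x: "x \<in> S"
 shows "nabe (\<lambda>y. nabe A y v) x u - nabe (\<lambda>y. nabe A y u) x v = (Rm x u v o\<^sub>L A x) - (A x o\<^sub>L Rm x u v)"
proof -
 let ?DD = "\<lambda>v u. frechet_derivative (\<lambda>y. frechet_derivative A (at y) v) (at x) u"
 have "frechet_derivative (\<lambda>y. nabe A y v) (at x) u = ?DD v u
   + ((\<Gamma> x v o\<^sub>L frechet_derivative A (at x) u) + (frechet_derivative \<Gamma> (at x) u v o\<^sub>L A x))
   - ((A x o\<^sub>L frechet_derivative \<Gamma> (at x) u v) + (frechet_derivative A (at x) u o\<^sub>L \<Gamma> x v))" for u v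
 proof -
  have dG: "((\<lambda>y. \<Gamma> y v) has_derivative (\<lambda>u. frechet_derivative \<Gamma> (at x) u v)) (at x)"
   by (auto intro!: derivative_eq_intros D_\<Gamma> x)
  show ?thesis unfolding nabe_def
   by (rule frechetI[OF has_derivative_diff[OF has_derivative_add[OF smooth_on_deriv[OF smooth_on_frechet[OF A] x]
     bounded_bilinear.FDERIV[OF bounded_bilinear_blinfun_compose dG smooth_on_deriv[OF A x]]]
     bounded_bilinear.FDERIV[OF bounded_bilinear_blinfun_compose smooth_on_deriv[OF A x] dG]]])
 qed
 note d = this
 show ?thesis
 proof (rule blinfun_eqI)
  fix w
  have "?DD v u w = ?DD u v w" using smooth_on_second_symmetric[OF open_S x A, of v u] by simp
  then show "(nabe (\<lambda>y. nabe A y v) x u - nabe (\<lambda>y. nabe A y u) x v) w =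
    ((Rm x u v o\<^sub>L A x) - (A x o\<^sub>L Rm x u v)) w"
   unfolding nabe_def[of "\<lambda>y. nabe A y _"] d by (simp add: nabe_def Rm_apply bl)
 qed
qed

end

subsection \<open>Covariant differentiation along curves\<close>

lemma has_vector_derivative_curve:
 assumes "(f has_derivative f') (at (c t))" "(c has_vector_derivative c') (at t within T)"
 shows "((\<lambda>t. f (c t)) has_vector_derivative f' c') (at t within T)"
proof -
 have "(f \<circ> c has_vector_derivative f' c') (at t within T)"
  by (rule vector_derivative_diff_chain_within[OF assms(2) has_derivative_at_withinI[OF assms(1)]])
 then show ?thesis by (simp add: o_def)
qed

lemmas has_vector_derivative_apply = bounded_bilinear.has_vector_derivative[OF bounded_bilinear_blinfun_apply]

context local_metric begin

text \<open>Derivatives are taken within T, so that the rule also covers end points of segments,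
  where curves have one-sided derivatives.\<close>

lemma metric_along:
 fixes X Y :: "real \<Rightarrow> 'e"
 assumes c: "c t \<in> S" "(c has_vector_derivative c') (at t within T)"
  and X: "(X has_vector_derivative X') (at t within T)" and Y: "(Y has_vector_derivative Y') (at t within T)"
 shows "((\<lambda>t. g (c t) (X t) (Y t)) has_vector_derivative
  g (c t) (X' + \<Gamma> (c t) c' (X t)) (Y t) + g (c t) (X t) (Y' + \<Gamma> (c t) c' (Y t))) (at t within T)"
 by (rule has_vector_derivative_eq_rhs[OF has_vector_derivative_apply[OF has_vector_derivative_apply[OF
   has_vector_derivative_curve[where f = g, OF D_g[OF c(1)] c(2)] X] Y]])
  (simp add: \<Gamma>_metric[OF c(1)] bl)

lemma endo_along:
 fixes A :: "'e \<Rightarrow> 'e endo" and X :: "real \<Rightarrow> 'e"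
 assumes A: "smooth_on A S" and c: "c t \<in> S" "(c has_vector_derivative c') (at t within T)"
  and X: "(X has_vector_derivative X') (at t within T)"
 shows "((\<lambda>t. A (c t) (X t)) has_vector_derivative
  nabe A (c t) c' (X t) + A (c t) (X' + \<Gamma> (c t) c' (X t)) - \<Gamma> (c t) c' (A (c t) (X t))) (at t within T)"
 by (rule has_vector_derivative_eq_rhs[OF has_vector_derivative_apply[OF
   has_vector_derivative_curve[where f = A, OF smooth_on_deriv[OF A c(1)] c(2)] X]])
  (simp add: nabe_def bl)

end

section \<open>Quaternionic frames over a coordinate domain\<close>

locale local_qk = local_metric +
 fixes J1 J2 J3 :: "'a \<Rightarrow> 'a endo"
 assumes dim: "DIM('a) \<ge> 8"
  and smooth_J: "smooth_on J1 S" "smooth_on J2 S" "smooth_on J3 S"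
  and triple: "x \<in> S \<Longrightarrow> quat_triple (g x) (span {J1 x, J2 x, J3 x}) (J1 x) (J2 x) (J3 x)"
  and parallel: "smooth_on J S \<Longrightarrow> (\<And>y. y \<in> S \<Longrightarrow> J y \<in> span {J1 y, J2 y, J3 y}) \<Longrightarrow> x \<in> S \<Longrightarrow>
   nabe J x u \<in> span {J1 x, J2 x, J3 x}"
begin

lemma qh: "x \<in> S \<Longrightarrow> quat_hermitian (g x) (J1 x) (J2 x) (J3 x)"
 by unfold_locales (auto intro: g_sym g_pos triple)

lemma nonzero_vector: obtains v :: 'a where "v \<noteq> 0"
 using that SOME_Basis nonzero_Basis by blast

text \<open>The Ricci identity for the sections Ji: both second covariant derivatives remain in the
  parallel bundle.\<close>

lemma Rm_normalizes:
 assumes x: "x \<in> S" and J: "J \<in> {J1 x, J2 x, J3 x}"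
 shows "(Rm x u v o\<^sub>L J) - (J o\<^sub>L Rm x u v) \<in> span {J1 x, J2 x, J3 x}"
proof -
 have *: "(Rm x u v o\<^sub>L A x) - (A x o\<^sub>L Rm x u v) \<in> span {J1 x, J2 x, J3 x}"
  if A: "smooth_on A S" "\<And>y. y \<in> S \<Longrightarrow> A y \<in> span {J1 y, J2 y, J3 y}" for A :: "'a \<Rightarrow> 'a endo"
  unfolding ricci_endo[OF A(1) x, symmetric]
  by (intro span_diff parallel smooth_nabe A x)
 show ?thesis using J *[OF smooth_J(1)] *[OF smooth_J(2)] *[OF smooth_J(3)] by (auto simp: span_base)
qed

text \<open>The connection coefficients of the frame \<open>J1, J2, J3\<close> are skew, so \<open>\<Sum> J\<^sub>i \<otimes> J\<^sub>i\<close> is parallel.\<close>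

lemma casimir_parallel:
 fixes \<beta> :: "'a endo \<Rightarrow> 'a endo \<Rightarrow> 'v::real_vector"
 assumes x: "x \<in> S" and \<beta>: "bilinear \<beta>"
 shows "(\<beta> (nabe J1 x u) (J1 x) + \<beta> (J1 x) (nabe J1 x u)) + (\<beta> (nabe J2 x u) (J2 x) + \<beta> (J2 x) (nabe J2 x u))
  + (\<beta> (nabe J3 x u) (J3 x) + \<beta> (J3 x) (nabe J3 x u)) = 0"
proof -
 interpret Q: quat_hermitian "g x" "J1 x" "J2 x" "J3 x" by (rule qh[OF x])
 obtain w where w: "g x w w = 1" using Q.exists_perp[OF dim, of 0] by blast
 \<comment> \<open>Differentiating a relation A C + C A = k; its values at v and at \<Gamma> x u v
   make the Christoffel terms cancel.\<close>
 have anti: "nabe A x u (C x v) + A x (nabe C x u v) + nabe C x u (A x v) + C x (nabe A x u v) = 0"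
  if AC: "smooth_on A S" "smooth_on C S" "\<And>y v. y \<in> S \<Longrightarrow> A y (C y v) + C y (A y v) = k *\<^sub>R v" for A C :: "'a \<Rightarrow> 'a endo" and k v
 proof -
  let ?F = "\<lambda>y. (A y o\<^sub>L C y) + (C y o\<^sub>L A y)"
  let ?A = "frechet_derivative A (at x) u" and ?C = "frechet_derivative C (at x) u"
  have "?F y = k *\<^sub>R id_blinfun" if "y \<in> S" for y
   by (rule blinfun_eqI) (simp add: bl AC(3)[OF that])
  then have z: "(?F has_derivative (\<lambda>u. 0)) (at x)"
   using has_derivative_cong[OF has_derivative_const x, of "k *\<^sub>R id_blinfun" ?F] by simp
  note bb = bounded_bilinear.FDERIV[OF bounded_bilinear_blinfun_compose]
  have "(?F has_derivative (\<lambda>u. ((A x o\<^sub>L frechet_derivative C (at x) u) + (frechet_derivative A (at x) u o\<^sub>L C x)) +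
    ((C x o\<^sub>L frechet_derivative A (at x) u) + (frechet_derivative C (at x) u o\<^sub>L A x)))) (at x)"
   by (intro has_derivative_add bb smooth_on_deriv[OF _ x] AC)
  from derivative_unique[OF z this, of u]
  have "(((A x o\<^sub>L ?C) + (?A o\<^sub>L C x)) + ((C x o\<^sub>L ?A) + (?C o\<^sub>L A x))) v = 0" by simp
  then have 1: "A x (?C v) + ?A (C x v) + (C x (?A v) + ?C (A x v)) = 0" by (simp add: bl)
  have 2: "\<Gamma> x u (A x (C x v)) + \<Gamma> x u (C x (A x v)) = A x (C x (\<Gamma> x u v)) + C x (A x (\<Gamma> x u v))"
   using AC(3)[OF x, of v] AC(3)[OF x, of "\<Gamma> x u v"] by (metis blinfun.add_right blinfun.scaleR_right)
  show ?thesis using 1 2 unfolding nabe_def by (simp add: bl algebra_simps)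
 qed
 have Jy: "J1 y (J1 y v) = - v" "J2 y (J2 y v) = - v" "J3 y (J3 y v) = - v"
  "J1 y (J2 y v) = J3 y v" "J2 y (J1 y v) = - J3 y v" "J1 y (J3 y v) = - J2 y v" "J3 y (J1 y v) = J2 y v"
  "J2 y (J3 y v) = J1 y v" "J3 y (J2 y v) = - J1 y v" if "y \<in> S" for y v
 proof -
  interpret Y: quat_hermitian "g y" "J1 y" "J2 y" "J3 y" by (rule qh[OF that])
  show "J1 y (J1 y v) = - v" "J2 y (J2 y v) = - v" "J3 y (J3 y v) = - v"
   "J1 y (J2 y v) = J3 y v" "J2 y (J1 y v) = - J3 y v" "J1 y (J3 y v) = - J2 y v" "J3 y (J1 y v) = J2 y v"
   "J2 y (J3 y v) = J1 y v" "J3 y (J2 y v) = - J1 y v" by (simp_all add: Y.J_simps)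
 qed
 obtain a1 a2 a3 where a: "nabe J1 x u = Q.ims a1 a2 a3"
  using parallel[OF smooth_J(1) span_base x, of u] Q.span_J by auto
 obtain c1 c2 c3 where c: "nabe J2 x u = Q.ims c1 c2 c3"
  using parallel[OF smooth_J(2) span_base x, of u] Q.span_J by auto
 obtain d1 d2 d3 where d: "nabe J3 x u = Q.ims d1 d2 d3"
  using parallel[OF smooth_J(3) span_base x, of u] Q.span_J by auto
 have r: "g x (nabe A x u (C x w) + A x (nabe C x u w) + nabe C x u (A x w) + C x (nabe A x u w)) w = 0"
  if "smooth_on A S" "smooth_on C S" "\<And>y v. y \<in> S \<Longrightarrow> A y (C y v) + C y (A y v) = k *\<^sub>R v" for A C :: "'a \<Rightarrow> 'a endo" and k
  by (subst anti[OF that]) (simp_all add: bl)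
 have k: "J1 y (J1 y v) + J1 y (J1 y v) = (- 2) *\<^sub>R v" "J2 y (J2 y v) + J2 y (J2 y v) = (- 2) *\<^sub>R v"
  "J3 y (J3 y v) + J3 y (J3 y v) = (- 2) *\<^sub>R v" "J1 y (J2 y v) + J2 y (J1 y v) = 0 *\<^sub>R v"
  "J1 y (J3 y v) + J3 y (J1 y v) = 0 *\<^sub>R v" "J2 y (J3 y v) + J3 y (J2 y v) = 0 *\<^sub>R v" if "y \<in> S" for y v
  by (simp_all add: Jy[OF that] scaleR_2)
 \<comment> \<open>Pairing the differentiated relations with the unit vector w shows that the
   coefficient matrix is skew.\<close>
 have "a1 = 0" using r[OF smooth_J(1) smooth_J(1) k(1)] unfolding a by (simp add: Q.ims_apply Q.bl Q.J_simps w)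
 moreover have "c2 = 0" using r[OF smooth_J(2) smooth_J(2) k(2)] unfolding c by (simp add: Q.ims_apply Q.bl Q.J_simps w)
 moreover have "d3 = 0" using r[OF smooth_J(3) smooth_J(3) k(3)] unfolding d by (simp add: Q.ims_apply Q.bl Q.J_simps w)
 moreover have "c1 = - a2" using r[OF smooth_J(1) smooth_J(2) k(4)]
  unfolding a c by (simp add: Q.ims_apply Q.bl Q.J_simps w)
 moreover have "d1 = - a3" using r[OF smooth_J(1) smooth_J(3) k(5)]
  unfolding a d by (simp add: Q.ims_apply Q.bl Q.J_simps w)
 moreover have "d2 = - c3" using r[OF smooth_J(2) smooth_J(3) k(6)]
  unfolding c d by (simp add: Q.ims_apply Q.bl Q.J_simps w)
 ultimately have "a1 = 0" "c2 = 0" "d3 = 0" "c1 = - a2" "d1 = - a3" "d2 = - c3" by auto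
 then show ?thesis unfolding a c d Q.ims_def
  by (simp add: bilinear_ladd[OF \<beta>] bilinear_radd[OF \<beta>] bilinear_lmul[OF \<beta>] bilinear_rmul[OF \<beta>]
   bilinear_lsub[OF \<beta>] bilinear_rsub[OF \<beta>] bilinear_lneg[OF \<beta>] bilinear_rneg[OF \<beta>])
qed

text \<open>A contraction of \<Sum> Ji \<otimes> Ji, which is parallel although the single Ji are
  not.\<close>

definition m :: "'a \<Rightarrow> 'a \<Rightarrow> 'a \<Rightarrow> 'a \<Rightarrow> 'a" where
 "m x a c d = g x (J1 x a) c *\<^sub>R J1 x d + g x (J2 x a) c *\<^sub>R J2 x d + g x (J3 x a) c *\<^sub>R J3 x d"

lemma m_along:
 fixes X Y Z :: "real \<Rightarrow> 'a"
 assumes c: "c t \<in> S" "(c has_vector_derivative c') (at t within T)"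
  and X: "(X has_vector_derivative X') (at t within T)" and Y: "(Y has_vector_derivative Y') (at t within T)"
  and Z: "(Z has_vector_derivative Z') (at t within T)"
 shows "((\<lambda>t. m (c t) (X t) (Y t) (Z t)) has_vector_derivative
  m (c t) (X' + \<Gamma> (c t) c' (X t)) (Y t) (Z t) + m (c t) (X t) (Y' + \<Gamma> (c t) c' (Y t)) (Z t)
  + m (c t) (X t) (Y t) (Z' + \<Gamma> (c t) c' (Z t)) - \<Gamma> (c t) c' (m (c t) (X t) (Y t) (Z t))) (at t within T)"
proof -
 let ?G = "\<Gamma> (c t) c'" and ?x = "c t"
 have JX: "((\<lambda>t. g (c t) (J (c t) (X t)) (Y t) *\<^sub>R J (c t) (Z t)) has_vector_derivative
   g ?x (J ?x (X t)) (Y t) *\<^sub>R (nabe J ?x c' (Z t) + J ?x (Z' + ?G (Z t)) - ?G (J ?x (Z t)))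
  + (g ?x ((nabe J ?x c' (X t) + J ?x (X' + ?G (X t)) - ?G (J ?x (X t))) + ?G (J ?x (X t))) (Y t)
    + g ?x (J ?x (X t)) (Y' + ?G (Y t))) *\<^sub>R J ?x (Z t)) (at t within T)"
  if "smooth_on J S" for J :: "'a \<Rightarrow> 'a endo"
  by (rule bounded_bilinear.has_vector_derivative[OF bounded_bilinear_scaleR
   metric_along[OF c endo_along[OF that c X] Y] endo_along[OF that c Z]])
 have bil: "bilinear (\<lambda>(A :: 'a endo) (C :: 'a endo). g ?x (A (X t)) (Y t) *\<^sub>R C (Z t))"
  unfolding bilinear_def linear_iff by (simp add: bl algebra_simps)
 show ?thesis unfolding m_def
  by (rule has_vector_derivative_eq_rhs[OF has_vector_derivative_add[OF has_vector_derivative_add[OF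
    JX[OF smooth_J(1)] JX[OF smooth_J(2)]] JX[OF smooth_J(3)]]])
   (use casimir_parallel[OF c(1) bil, of c'] in \<open>simp add: bl algebra_simps\<close>)
qed

text \<open>N rewritten through g and m alone, so that it inherits their parallelism:
  \<open>NN_along\<close> is a Leibniz rule with no term differentiating the tensor.\<close>

definition NN :: "'a \<Rightarrow> 'a \<Rightarrow> 'a \<Rightarrow> 'a \<Rightarrow> 'a" where
 "NN x a z v = - m x a z v + m x a v z - m x z v a + (g x a v *\<^sub>R z - g x z v *\<^sub>R a)"

lemma NN_eq: assumes "x \<in> S" shows "quat_hermitian.N (g x) (J1 x) (J2 x) (J3 x) a z v = NN x a z v"
proof -
 interpret Q: quat_hermitian "g x" "J1 x" "J2 x" "J3 x" by (rule qh[OF assms])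
 show ?thesis unfolding Q.N_apply NN_def m_def by (simp add: algebra_simps)
qed

lemma NN_along:
 fixes X Y Z :: "real \<Rightarrow> 'a"
 assumes c: "c t \<in> S" "(c has_vector_derivative c') (at t within T)"
  and X: "(X has_vector_derivative X') (at t within T)" and Y: "(Y has_vector_derivative Y') (at t within T)"
  and Z: "(Z has_vector_derivative Z') (at t within T)"
 shows "((\<lambda>t. NN (c t) (X t) (Y t) (Z t)) has_vector_derivative
  NN (c t) (X' + \<Gamma> (c t) c' (X t)) (Y t) (Z t) + NN (c t) (X t) (Y' + \<Gamma> (c t) c' (Y t)) (Z t)
  + NN (c t) (X t) (Y t) (Z' + \<Gamma> (c t) c' (Z t)) - \<Gamma> (c t) c' (NN (c t) (X t) (Y t) (Z t))) (at t within T)"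
proof -
 have s: "((\<lambda>t. g (c t) (X t) (Z t) *\<^sub>R Y t) has_vector_derivative
  g (c t) (X t) (Z t) *\<^sub>R Y' + (g (c t) (X' + \<Gamma> (c t) c' (X t)) (Z t) + g (c t) (X t) (Z' + \<Gamma> (c t) c' (Z t))) *\<^sub>R Y t) (at t within T)"
  if "(X has_vector_derivative X') (at t within T)" "(Y has_vector_derivative Y') (at t within T)" "(Z has_vector_derivative Z') (at t within T)" 
  for X Y Z :: "real \<Rightarrow> 'a" and X' Y' Z'
  by (rule bounded_bilinear.has_vector_derivative[OF bounded_bilinear_scaleR metric_along[OF c that(1,3)] that(2)])
 show ?thesis unfolding NN_def
  by (rule has_vector_derivative_eq_rhs[OF has_vector_derivative_add[OF
   has_vector_derivative_diff[OF has_vector_derivative_add[OF has_vector_derivative_minus[OF m_along[OF c X Y Z]]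
     m_along[OF c X Z Y]] m_along[OF c Y Z X]]
   has_vector_derivative_diff[OF s[OF X Y Z] s[OF Y X Z]]]])
   (simp add: bl algebra_simps)
qed

end

subsection \<open>Conformal Killing forms and curvature\<close>

locale local_ck = local_qk +
 fixes \<Psi> :: "'a \<Rightarrow> 'a endo" and \<theta> :: "'a \<Rightarrow> 'a"
 assumes smooth_\<Psi>: "smooth_on \<Psi> S" and smooth_\<theta>: "smooth_on \<theta> S"
  and ck: "x \<in> S \<Longrightarrow> nabe \<Psi> x u v = NN x (\<theta> x) u v"
  and compat: "x \<in> S \<Longrightarrow> \<exists>j P. \<Psi> x = j + P \<and> j \<in> span {J1 x, J2 x, J3 x} \<and>
   quat_hermitian.commuting (J1 x) (J2 x) (J3 x) P"
  and scal: "x \<in> S \<Longrightarrow> \<exists>B. orthonormal_frame (g x) B \<and> (\<Sum>e\<in>B. \<Sum>f\<in>B. g x (Rm x e f f) e) \<noteq> 0"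
begin

definition A :: "'a \<Rightarrow> 'a endo" where
 "A x = Blinfun (nabv \<theta> x)"

lemma A_apply: assumes x: "x \<in> S" shows "A x u = nabv \<theta> x u"
proof -
 have "linear (nabv \<theta> x)"
  unfolding nabv_def linear_iff using linear_D[OF x smooth_\<theta>] by (simp add: linear_add linear_cmul bl algebra_simps)
 then show ?thesis unfolding A_def
  by (subst bounded_linear_Blinfun_apply) (simp_all add: linear_conv_bounded_linear)
qed

lemma smooth_A: "smooth_on A S"
proof (rule smooth_on_blinfunI[OF open_S])
 fix i
 have "smooth_on (\<lambda>x. nabv \<theta> x i) S" by (rule smooth_nabv[OF smooth_\<theta>])
 then show "smooth_on (\<lambda>x. A x i) S"
  by (subst smooth_on_cong[OF open_S A_apply]) assumption+
qed

lemma line_derivative: "((\<lambda>t. x + t *\<^sub>R u) has_vector_derivative u) (at t within T)" for x u :: 'a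
 by (auto intro!: derivative_eq_intros)

lemma const_derivative: "((\<lambda>t. v) has_vector_derivative 0) (at t within T)" for v :: 'a
 by simp

text \<open>As N is parallel, differentiating \<nabla>\<Psi> = N(\<theta>, .) differentiates
  \<theta> only. Antisymmetrising produces the curvature, and the terms with \<Gamma> x u v cancel
  by symmetry of \<Gamma>.\<close>

lemma ricci_form:
 assumes x: "x \<in> S"
 shows "((Rm x u v o\<^sub>L \<Psi> x) - (\<Psi> x o\<^sub>L Rm x u v)) w = NN x (A x u) v w - NN x (A x v) u w"
proof -
 have 1: "nabe (\<lambda>y. nabe \<Psi> y v) x u w = NN x (A x u) v w + NN x (\<theta> x) (\<Gamma> x u v) w" for u v
 proof -
  have c: "x + 0 *\<^sub>R u \<in> S" using x by simp
  have d\<theta>: "((\<lambda>t. \<theta> (x + t *\<^sub>R u)) has_vector_derivative frechet_derivative \<theta> (at x) u) (at 0)"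
   using has_vector_derivative_curve[OF smooth_on_deriv[OF smooth_\<theta> c] line_derivative[of x u 0]] by simp
  have s: "smooth_on (\<lambda>y. nabe \<Psi> y v) S" by (rule smooth_nabe[OF smooth_\<Psi>])
  have "((\<lambda>t. nabe \<Psi> (x + t *\<^sub>R u) v w) has_vector_derivative
   nabe (\<lambda>y. nabe \<Psi> y v) x u w + nabe \<Psi> x v (\<Gamma> x u w) - \<Gamma> x u (nabe \<Psi> x v w)) (at 0)"
   using endo_along[OF s c line_derivative const_derivative] by simp
  moreover have "((\<lambda>t. NN (x + t *\<^sub>R u) (\<theta> (x + t *\<^sub>R u)) v w) has_vector_derivative
    NN x (A x u) v w + NN x (\<theta> x) (\<Gamma> x u v) w + NN x (\<theta> x) v (\<Gamma> x u w) - \<Gamma> x u (NN x (\<theta> x) v w)) (at 0)"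
   using NN_along[OF c line_derivative d\<theta> const_derivative const_derivative, of v w]
   by (simp add: A_apply[OF x] nabv_def)
  moreover have "((\<lambda>t. nabe \<Psi> (x + t *\<^sub>R u) v w) has_vector_derivative D) (at 0) \<longleftrightarrow>
   ((\<lambda>t. NN (x + t *\<^sub>R u) (\<theta> (x + t *\<^sub>R u)) v w) has_vector_derivative D) (at 0)" for D
  proof -
   have "open ((\<lambda>t. x + t *\<^sub>R u) -` S)" by (intro open_vimage open_S continuous_intros)
   then show ?thesis
    using has_vector_derivative_transform_within_open[of _ D 0 "(\<lambda>t. x + t *\<^sub>R u) -` S"] x ck
    by (smt (verit) add.right_neutral scale_zero_left vimage_eq)
  qed
  ultimately have "nabe (\<lambda>y. nabe \<Psi> y v) x u w + nabe \<Psi> x v (\<Gamma> x u w) - \<Gamma> x u (nabe \<Psi> x v w) =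
   NN x (A x u) v w + NN x (\<theta> x) (\<Gamma> x u v) w + NN x (\<theta> x) v (\<Gamma> x u w) - \<Gamma> x u (NN x (\<theta> x) v w)"
   using vector_derivative_unique_at by blast
  then show ?thesis by (simp add: ck[OF x])
 qed
 show ?thesis unfolding ricci_endo[OF smooth_\<Psi> x, symmetric] blinfun.diff_left 1
  by (simp add: \<Gamma>_sym[OF x, of v u])
qed

lemma curvature_structure:
 assumes x: "x \<in> S"
 obtains \<kappa> W C where "\<kappa> \<noteq> 0" "curvature_like (g x) W" "\<And>u v. quat_hermitian.commuting (J1 x) (J2 x) (J3 x) (W u v)"
  "\<And>u v. Rm x u v = quat_hermitian.ims (J1 x) (J2 x) (J3 x) (\<kappa> * g x (J1 x u) v) (\<kappa> * g x (J2 x u) v) (\<kappa> * g x (J3 x u) v)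
   + ((2 * \<kappa>) *\<^sub>R quat_hermitian.U (g x) (J1 x) (J2 x) (J3 x) u v + W u v)"
  "quat_hermitian.spn (g x) (J1 x) (J2 x) (J3 x) C"
  "A x - C \<in> span {J1 x, J2 x, J3 x}"
  "\<exists>P. \<forall>u v. (((2 * \<kappa>) *\<^sub>R quat_hermitian.U (g x) (J1 x) (J2 x) (J3 x) u v + W u v) o\<^sub>L P)
   - (P o\<^sub>L ((2 * \<kappa>) *\<^sub>R quat_hermitian.U (g x) (J1 x) (J2 x) (J3 x) u v + W u v))
   = 4 *\<^sub>R (quat_hermitian.U (g x) (J1 x) (J2 x) (J3 x) (C u) v + quat_hermitian.U (g x) (J1 x) (J2 x) (J3 x) u (C v))"
proof -
 interpret Q: quat_hermitian "g x" "J1 x" "J2 x" "J3 x" by (rule qh[OF x])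
 obtain w :: 'a where w: "w \<noteq> 0" by (rule nonzero_vector)
 obtain \<kappa> W where W: "curvature_like (g x) W" "\<And>u v. Q.commuting (W u v)"
  and R: "\<And>u v. Rm x u v = Q.ims (\<kappa> * g x (J1 x u) v) (\<kappa> * g x (J2 x u) v) (\<kappa> * g x (J3 x u) v)
   + ((2 * \<kappa>) *\<^sub>R Q.U u v + W u v)"
  by (rule Q.curvature_decomposition[OF dim Rm_curvature_like[OF x] Rm_normalizes[OF x]], assumption, rule that; assumption)
 \<comment> \<open>For \<kappa> = 0 the curvature would be of hyperkaehler type and hence
   scalar-flat.\<close>
 have k: "\<kappa> \<noteq> 0"
 proof
  assume "\<kappa> = 0"
  then have R0: "Rm x u v = W u v" for u v by (simp add: R Q.ims_def)
  obtain B where B: "orthonormal_frame (g x) B" "(\<Sum>e\<in>B. \<Sum>f\<in>B. g x (Rm x e f f) e) \<noteq> 0"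
   using scal[OF x] by blast
  interpret F: quat_hermitian_frame "g x" "J1 x" "J2 x" "J3 x" B by unfold_locales (rule B)
  show False using F.scalar_flat[OF W] B(2) by (simp add: R0)
 qed
 obtain j P where P: "\<Psi> x = j + P" "j \<in> span {J1 x, J2 x, J3 x}" "Q.commuting P" using compat[OF x] by blast
 obtain p1 p2 p3 where j: "j = Q.ims p1 p2 p3" using P(2) Q.span_J by blast
 define RE where "RE u v = (2 * \<kappa>) *\<^sub>R Q.U u v + W u v" for u v
 have RE: "Q.commuting (RE u v)" for u v
  using W(2)[of u v] Q.U_spn[of u v] unfolding RE_def Q.spn_def Q.commuting_def by (simp add: bl)
 have ric: "(Rm x u v o\<^sub>L (Q.ims p1 p2 p3 + P)) - ((Q.ims p1 p2 p3 + P) o\<^sub>L Rm x u v) = Q.N (A x u) v - Q.N (A x v) u" for u v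
 proof (rule blinfun_eqI)
  fix w
  show "((Rm x u v o\<^sub>L (Q.ims p1 p2 p3 + P)) - ((Q.ims p1 p2 p3 + P) o\<^sub>L Rm x u v)) w = (Q.N (A x u) v - Q.N (A x v) u) w"
   using ricci_form[OF x, of u v w] by (simp add: P(1) j blinfun.diff_left NN_eq[OF x])
 qed
 obtain C where C: "A x = \<kappa> *\<^sub>R Q.ims p1 p2 p3 + C" "Q.spn C"
  "\<And>u v. (RE u v o\<^sub>L P) - (P o\<^sub>L RE u v) = 4 *\<^sub>R (Q.U (C u) v + Q.U u (C v))"
  by (rule Q.moment_map_decomp[OF RE P(3) R[folded RE_def] ric w]) (rule that; assumption)
 have "A x - C \<in> span {J1 x, J2 x, J3 x}" unfolding C(1) by (simp add: span_scale P(2)[unfolded j])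
 then show ?thesis by (rule that[OF k W R C(2)]) (intro exI[of _ P] allI C(3)[unfolded RE_def])
qed

text \<open>A lies in sp(1) + sp(n). Geometrically, \<theta> is a Killing field.\<close>

lemma A_skew: assumes x: "x \<in> S" shows "skew (g x) (A x)"
proof -
 interpret Q: quat_hermitian "g x" "J1 x" "J2 x" "J3 x" by (rule qh[OF x])
 obtain C where C: "Q.spn C" "A x - C \<in> span {J1 x, J2 x, J3 x}" by (rule curvature_structure[OF x]) (rule that; assumption)
 then obtain c1 c2 c3 where "A x = Q.ims c1 c2 c3 + C" using Q.span_J[of "A x - C"] by (metis diff_add_cancel)
 then show ?thesis using C(1) Q.ims_skew unfolding Q.spn_def skew_def by (simp add: bl)
qed

text \<open>The Ricci identity for \<theta> makes \<nabla>A + R(\<theta>, .) symmetric in its first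
  two arguments, and skewness of A makes it skew in the last two. A trilinear form with both
  symmetries is zero.\<close>

lemma kostant: assumes x: "x \<in> S" shows "nabe A x u v = - Rm x (\<theta> x) u v"
proof -
 have DA: "nabe A x u v - nabe A x v u = Rm x u v (\<theta> x)" for u v
 proof -
  have e: "frechet_derivative (\<lambda>y. nabv \<theta> y v) (at x) u = frechet_derivative A (at x) u v" for u v
  proof (rule frechetI, rule has_derivative_cong[OF _ x])
   show "((\<lambda>y. A y v) has_derivative (\<lambda>u. frechet_derivative A (at x) u v)) (at x)"
    by (auto intro!: derivative_eq_intros smooth_on_deriv[OF smooth_A x])
  qed (rule A_apply)
  show ?thesis unfolding ricci_vector[OF smooth_\<theta> x, symmetric] nabe_def nabv_def[of "\<lambda>y. nabv \<theta> y _"] e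
   using \<Gamma>_sym[OF x, of u v] by (simp add: bl A_apply[OF x])
 qed
 have sk: "g x (nabe A x u a) c = - g x a (nabe A x u c)" for u a c
 proof -
  have c0: "x + 0 *\<^sub>R u \<in> S" using x by simp
  have h: "((\<lambda>t. A (x + t *\<^sub>R u) a) has_vector_derivative nabe A x u a + A x (\<Gamma> x u a) - \<Gamma> x u (A x a)) (at 0)" for a
   using endo_along[OF smooth_A c0 line_derivative const_derivative] by simp
  have d1: "((\<lambda>t. g (x + t *\<^sub>R u) (A (x + t *\<^sub>R u) a) c) has_vector_derivative
    g x (nabe A x u a + A x (\<Gamma> x u a)) c + g x (A x a) (\<Gamma> x u c)) (at 0)" for a c
   using metric_along[OF c0 line_derivative h const_derivative] by simp
  have s: "g (x + t *\<^sub>R u) (A (x + t *\<^sub>R u) a) c = - g (x + t *\<^sub>R u) (A (x + t *\<^sub>R u) c) a" if "x + t *\<^sub>R u \<in> S" for t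
   using skewD[OF A_skew[OF that], of a c] g_sym[OF that, of a] by simp
  have op: "open ((\<lambda>t. x + t *\<^sub>R u) -` S)" by (intro open_vimage open_S continuous_intros)
  have d2: "((\<lambda>t. g (x + t *\<^sub>R u) (A (x + t *\<^sub>R u) a) c) has_vector_derivative
    - (g x (nabe A x u c + A x (\<Gamma> x u c)) a + g x (A x c) (\<Gamma> x u a))) (at 0)"
   by (rule has_vector_derivative_transform_within_open[OF has_vector_derivative_minus[OF d1] op])
    (use x s in auto)
  show ?thesis
   using vector_derivative_unique_at[OF d1 d2, unfolded blinfun.add_left blinfun.add_right]
    skewD[OF A_skew[OF x], of "\<Gamma> x u a" c] skewD[OF A_skew[OF x], of "\<Gamma> x u c" a]
    g_sym[OF x, of "A x a" "\<Gamma> x u c"] g_sym[OF x, of "A x c" "\<Gamma> x u a"] g_sym[OF x, of "nabe A x u c" a]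
   by linarith
 qed
 define t where "t u v w = g x (nabe A x u v) w + g x (Rm x (\<theta> x) u v) w" for u v w
 interpret Q: quat_hermitian "g x" "J1 x" "J2 x" "J3 x" by (rule qh[OF x])
 note cl = Rm_curvature_like[OF x]
 have t1: "t u v w = - t u w v" for u v w
  unfolding t_def using sk[of u v w] g_sym[OF x, of v "nabe A x u w"] Q.curvature_like_antisym(2)[OF cl, of "\<theta> x" u v w]
  by linarith
 have t2: "t u v w = t v u w" for u v w
 proof -
  have "g x (nabe A x u v) w - g x (nabe A x v u) w = g x (Rm x u v (\<theta> x)) w"
   using DA[of u v] by (metis blinfun.diff_left blinfun.diff_right)
  then show ?thesis unfolding t_def
   using Q.curvature_like_antisym(3)[OF cl, of "\<theta> x" u v w] Q.curvature_like_antisym(1)[OF cl, of v "\<theta> x" u w] by linarith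
 qed
 have "t u v w = 0" for u v w
  using t1[of u v w] t2[of u w v] t1[of w u v] t2[of w v u] t1[of v w u] t2[of v u w] by linarith
 then have "nabe A x u v + Rm x (\<theta> x) u v = 0"
  using Q.zeroI[of "nabe A x u v + Rm x (\<theta> x) u v"] unfolding t_def by (simp add: bl)
 then show ?thesis by (simp add: eq_neg_iff_add_eq_0)
qed

text \<open>Membership in sp(1) + sp(n), expressed as a normaliser condition, and orthogonality to
  the curvature in the trace form. No decomposition is mentioned, so the condition can be verified
  after parallel translation.\<close>

definition annihilates :: "'a \<Rightarrow> 'a endo \<Rightarrow> bool" where
 "annihilates x V \<longleftrightarrow> skew (g x) V \<and> (\<forall>J\<in>{J1 x, J2 x, J3 x}. (V o\<^sub>L J) - (J o\<^sub>L V) \<in> span {J1 x, J2 x, J3 x}) \<and>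
  (\<exists>B. orthonormal_frame (g x) B \<and> (\<forall>u v. (\<Sum>k\<in>B. g x (Rm x u v k) (V k)) = 0))"

lemma annihilator_commutes:
 assumes x: "x \<in> S" and V: "annihilates x V"
 shows "quat_hermitian.spn (g x) (J1 x) (J2 x) (J3 x) V" "A x (V w) = V (A x w)"
  "\<theta> x \<noteq> 0 \<Longrightarrow> (\<And>u z. Rm x (\<theta> x) u (V z) = V (Rm x (\<theta> x) u z)) \<Longrightarrow> V = 0"
proof -
 obtain B where B: "orthonormal_frame (g x) B" and ann: "\<And>u v. (\<Sum>k\<in>B. g x (Rm x u v k) (V k)) = 0"
  using V unfolding annihilates_def by blast
 interpret Q: quat_hermitian "g x" "J1 x" "J2 x" "J3 x" by (rule qh[OF x])
 interpret F: quat_hermitian_frame "g x" "J1 x" "J2 x" "J3 x" B by unfold_locales (rule B)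
 obtain w' :: 'a where w': "w' \<noteq> 0" by (rule nonzero_vector)
 obtain \<kappa> W C where k: "\<kappa> \<noteq> 0" and W: "curvature_like (g x) W" "\<And>u v. Q.commuting (W u v)"
  and R: "\<And>u v. Rm x u v = Q.ims (\<kappa> * g x (J1 x u) v) (\<kappa> * g x (J2 x u) v) (\<kappa> * g x (J3 x u) v)
   + ((2 * \<kappa>) *\<^sub>R Q.U u v + W u v)" and C: "Q.spn C" "A x - C \<in> span {J1 x, J2 x, J3 x}"
  and ric': "\<exists>P. \<forall>u v. (((2 * \<kappa>) *\<^sub>R Q.U u v + W u v) o\<^sub>L P) - (P o\<^sub>L ((2 * \<kappa>) *\<^sub>R Q.U u v + W u v))
   = 4 *\<^sub>R (Q.U (C u) v + Q.U u (C v))"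
  by (rule curvature_structure[OF x]) (rule that; assumption)
 obtain P where ric: "\<And>u v. (((2 * \<kappa>) *\<^sub>R Q.U u v + W u v) o\<^sub>L P) - (P o\<^sub>L ((2 * \<kappa>) *\<^sub>R Q.U u v + W u v))
   = 4 *\<^sub>R (Q.U (C u) v + Q.U u (C v))" using ric' by auto
 define RE where "RE u v = (2 * \<kappa>) *\<^sub>R Q.U u v + W u v" for u v
 have RE: "Q.commuting (RE u v)" for u v
  using W(2)[of u v] Q.U_spn[of u v] unfolding RE_def Q.spn_def Q.commuting_def by (simp add: bl)
 have "skew (g x) V" "\<And>J. J \<in> {J1 x, J2 x, J3 x} \<Longrightarrow> (V o\<^sub>L J) - (J o\<^sub>L V) \<in> span {J1 x, J2 x, J3 x}"
  using V unfolding annihilates_def by auto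
 from Q.normalizer_decomp[OF this w'] obtain v1 v2 v3 VE where VE: "V = Q.ims v1 v2 v3 + VE" "Q.spn VE" by blast
 note sp = F.annihilator_sp[OF RE Rm_curvature_like[OF x] R[folded RE_def] VE k w' ann]
 show spV: "Q.spn V" by (rule sp(1))
 have cV: "V (J1 x v) = J1 x (V v)" "V (J2 x v) = J2 x (V v)" "V (J3 x v) = J3 x (V v)" for v
  using spV Q.commutingD unfolding Q.spn_def by blast+
 have CV: "C (V w) = V (C w)" for w
  by (rule F.commutes_with_moment[OF C(1) sp(1) sp(2) ric[folded RE_def]])
 obtain c1 c2 c3 where "A x = Q.ims c1 c2 c3 + C" using C(2) Q.span_J[of "A x - C"] by (metis diff_add_cancel)
 then show "A x (V w) = V (A x w)" by (simp add: bl CV Q.ims_apply cV)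
 assume \<theta>: "\<theta> x \<noteq> 0" and comm: "\<And>u z. Rm x (\<theta> x) u (V z) = V (Rm x (\<theta> x) u z)"
 have "RE (\<theta> x) y (V z) = V (RE (\<theta> x) y z)" for y z
  using comm[of y z] unfolding R RE_def[symmetric] by (simp add: bl Q.ims_apply cV)
 then show "V = 0"
  using F.holonomy_core[OF W spV, of RE "2 * \<kappa>" "\<theta> x"] k \<theta> sp(2) by (simp add: RE_def)
qed

text \<open>V t is required to be parallel only to first order at 0. Differentiating the vanishing
  bracket of A with V t gives the bracket of \<nabla>A with V0, which Kostant's formula turns into a
  bracket with R(\<theta>, u).\<close>

lemma annihilator_zero:
 assumes x: "x \<in> S" and \<theta>: "\<theta> x \<noteq> 0"
  and V: "\<And>u. \<exists>\<epsilon>>0. \<exists>V. V 0 = V0 \<and> (V has_vector_derivative ((V0 o\<^sub>L \<Gamma> x u) - (\<Gamma> x u o\<^sub>L V0))) (at 0 within {0..\<epsilon>}) \<and>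
   (\<forall>t\<in>{0..\<epsilon>}. x + t *\<^sub>R u \<in> S \<and> annihilates (x + t *\<^sub>R u) (V t))"
 shows "V0 = 0"
proof -
 have V0: "annihilates x V0" using V[of 0] by force
 have "Rm x (\<theta> x) u (V0 z) = V0 (Rm x (\<theta> x) u z)" for u z
 proof -
  obtain \<epsilon> V where e: "\<epsilon> > 0" and V: "V 0 = V0"
   "(V has_vector_derivative ((V0 o\<^sub>L \<Gamma> x u) - (\<Gamma> x u o\<^sub>L V0))) (at 0 within {0..\<epsilon>})"
   "\<And>t. t \<in> {0..\<epsilon>} \<Longrightarrow> x + t *\<^sub>R u \<in> S \<and> annihilates (x + t *\<^sub>R u) (V t)" using V[of u] by blast
  let ?dA = "frechet_derivative A (at x) u" and ?dV = "(V0 o\<^sub>L \<Gamma> x u) - (\<Gamma> x u o\<^sub>L V0)"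
  have x0: "x + 0 *\<^sub>R u \<in> S" using x by simp
  have dA: "((\<lambda>t. A (x + t *\<^sub>R u)) has_vector_derivative ?dA) (at 0 within {0..\<epsilon>})"
   using has_vector_derivative_curve[OF smooth_on_deriv[OF smooth_A x0] line_derivative[of x u 0]] by simp
  note bb = bounded_bilinear.has_vector_derivative[OF bounded_bilinear_blinfun_compose]
  have d: "((\<lambda>t. (A (x + t *\<^sub>R u) o\<^sub>L V t) - (V t o\<^sub>L A (x + t *\<^sub>R u))) has_vector_derivative
   ((A x o\<^sub>L ?dV) + (?dA o\<^sub>L V0)) - ((V0 o\<^sub>L ?dA) + (?dV o\<^sub>L A x))) (at 0 within {0..\<epsilon>})"
   using has_vector_derivative_diff[OF bb[OF dA V(2)] bb[OF V(2) dA]] by (simp add: V(1))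
  have c: "(A (x + t *\<^sub>R u) o\<^sub>L V t) - (V t o\<^sub>L A (x + t *\<^sub>R u)) = 0" if "t \<in> {0..\<epsilon>}" for t
   by (rule blinfun_eqI) (use annihilator_commutes(2) V(3)[OF that] in \<open>simp add: bl\<close>)
  have "((\<lambda>t. 0) has_vector_derivative
   ((A x o\<^sub>L ?dV) + (?dA o\<^sub>L V0)) - ((V0 o\<^sub>L ?dA) + (?dV o\<^sub>L A x))) (at 0 within {0..\<epsilon>})"
   by (rule has_vector_derivative_transform[OF _ _ d]) (use e c in auto)
  moreover have "at 0 within {0..\<epsilon>} \<noteq> bot"
   using e by (simp add: trivial_limit_within islimpt_Icc)
  ultimately have z: "((A x o\<^sub>L ?dV) + (?dA o\<^sub>L V0)) - ((V0 o\<^sub>L ?dA) + (?dV o\<^sub>L A x)) = 0"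
   using vector_derivative_unique_within has_vector_derivative_const by blast
  \<comment> \<open>The \<Gamma>-terms in \<open>?dV\<close> complete \<open>?dA\<close> to the
    covariant derivative, because A x commutes with V0.\<close>
  have "nabe A x u (V0 z) - V0 (nabe A x u z) = (((A x o\<^sub>L ?dV) + (?dA o\<^sub>L V0)) - ((V0 o\<^sub>L ?dA) + (?dV o\<^sub>L A x))) z"
   by (simp add: nabe_def bl annihilator_commutes(2)[OF x V0] algebra_simps)
  then have "nabe A x u (V0 z) = V0 (nabe A x u z)" unfolding z by (simp add: bl)
  then show ?thesis by (simp add: kostant[OF x] bl)
 qed
 then show ?thesis by (rule annihilator_commutes(3)[OF x V0 \<theta>])
qed

end

section \<open>Change of charts\<close>

locale riem_manifold =
 fixes M :: "('a, 'e::euclidean_space) riem"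
 assumes manifold: "riemannian_manifold M"
begin

abbreviation "\<A> \<equiv> atlas M"
abbreviation "\<Gamma> \<equiv> christoffel M"
abbreviation "g \<equiv> metric M"

lemmas bl = blinfun.bilinear_simps

lemma chart:
 assumes "c \<in> \<A>"
 shows "openin (mtop M) (fst c)" "open (chart_image c)"
  "homeomorphic_map (subtopology (mtop M) (fst c)) (top_of_set (chart_image c)) (snd c)"
 using manifold assms unfolding riemannian_manifold_def smooth_atlas_def by blast+

lemma chart_cover: "p \<in> topspace (mtop M) \<Longrightarrow> \<exists>c\<in>\<A>. p \<in> fst c"
 using manifold unfolding riemannian_manifold_def smooth_atlas_def by blast

lemma chart_subset: "c \<in> \<A> \<Longrightarrow> fst c \<subseteq> topspace (mtop M)"
 using chart(1) openin_subset by blast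

lemma chart_inj: "c \<in> \<A> \<Longrightarrow> inj_on (snd c) (fst c)"
 using homeomorphic_imp_injective_map[OF chart(3)] chart_subset by (fastforce simp: Int_absorb1)

lemma chart_inv: "c \<in> \<A> \<Longrightarrow> p \<in> fst c \<Longrightarrow> inv_into (fst c) (snd c) (snd c p) = p"
 by (rule inv_into_f_f[OF chart_inj])

lemma chart_open_image:
 assumes c: "c \<in> \<A>" and W: "openin (mtop M) W" "W \<subseteq> fst c"
 shows "open (snd c ` W)"
proof -
 have "openin (subtopology (mtop M) (fst c)) W"
  using W openin_subtopology_alt by (metis Int_absorb1 image_eqI openin_subtopology inf.absorb_iff2 inf_commute)
 then have "openin (top_of_set (chart_image c)) (snd c ` W)"
  using homeomorphic_imp_open_map[OF chart(3)[OF c]] unfolding open_map_def by blast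
 then show ?thesis using chart(2)[OF c] openin_open_trans by blast
qed

lemma open_overlap: "c \<in> \<A> \<Longrightarrow> c' \<in> \<A> \<Longrightarrow> open (overlap c c')"
 unfolding overlap_def by (intro chart_open_image openin_Int chart) auto

lemma overlapI: "p \<in> fst c \<Longrightarrow> p \<in> fst c' \<Longrightarrow> snd c p \<in> overlap c c'"
 unfolding overlap_def by blast

lemma overlap_subset: "overlap c c' \<subseteq> chart_image c"
 unfolding overlap_def chart_image_def by blast

lemma transition_chart: "c \<in> \<A> \<Longrightarrow> p \<in> fst c \<Longrightarrow> transition c c' (snd c p) = snd c' p"
 unfolding transition_def by (simp add: chart_inv)

lemma transition_overlap: "c \<in> \<A> \<Longrightarrow> x \<in> overlap c c' \<Longrightarrow> transition c c' x \<in> overlap c' c"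
 unfolding overlap_def by (auto simp: transition_chart)

lemma smooth_transition: "c \<in> \<A> \<Longrightarrow> c' \<in> \<A> \<Longrightarrow> smooth_on (transition c c') (overlap c c')"
 using manifold unfolding riemannian_manifold_def smooth_atlas_def by blast

lemma jac_deriv: "c \<in> \<A> \<Longrightarrow> c' \<in> \<A> \<Longrightarrow> x \<in> overlap c c' \<Longrightarrow> (transition c c' has_derivative jac c c' x) (at x)"
 unfolding jac_def by (rule smooth_on_deriv[OF smooth_transition])

lemma jac_chain:
 assumes c: "c \<in> \<A>" "c' \<in> \<A>" "c'' \<in> \<A>" and p: "p \<in> fst c" "p \<in> fst c'" "p \<in> fst c''"
 shows "jac c' c'' (snd c' p) (jac c c' (snd c p) v) = jac c c'' (snd c p) v"
proof -
 let ?W = "fst c \<inter> fst c' \<inter> fst c''"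
 have op: "open (snd c ` ?W)" by (intro chart_open_image openin_Int chart c) auto
 have x: "snd c p \<in> snd c ` ?W" using p by blast
 have "((\<lambda>y. transition c' c'' (transition c c' y)) has_derivative (\<lambda>v. jac c' c'' (transition c c' (snd c p)) (jac c c' (snd c p) v))) (at (snd c p))"
  by (rule has_derivative_compose[OF jac_deriv jac_deriv]) (auto simp: c p overlapI transition_chart)
 then have "(transition c c'' has_derivative (\<lambda>v. jac c' c'' (transition c c' (snd c p)) (jac c c' (snd c p) v))) (at (snd c p))"
  by (rule has_derivative_transform_within_open[OF _ op x]) (auto simp: c transition_chart)
 from has_derivative_unique[OF this jac_deriv[OF c(1,3) overlapI[OF p(1,3)]]]
 show ?thesis using c p by (simp add: transition_chart fun_eq_iff)
qed

lemma jac_refl: assumes c: "c \<in> \<A>" and p: "p \<in> fst c" shows "jac c c (snd c p) v = v"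
proof -
 have "((\<lambda>x. x) has_derivative (\<lambda>v. v)) (at (snd c p))" by (rule has_derivative_ident)
 then have "(transition c c has_derivative (\<lambda>v. v)) (at (snd c p))"
  by (rule has_derivative_transform_within_open[OF _ chart(2)[OF c]])
   (use c p in \<open>auto simp: transition_chart chart_image_def\<close>)
 from has_derivative_unique[OF this jac_deriv[OF c c overlapI[OF p p]]] show ?thesis by (simp add: fun_eq_iff)
qed

lemma jac_inverse:
 assumes "c \<in> \<A>" "c' \<in> \<A>" "p \<in> fst c" "p \<in> fst c'"
 shows "jac c' c (snd c' p) (jac c c' (snd c p) v) = v"
 using jac_chain[OF assms(1,2,1,3,4,3)] jac_refl[OF assms(1,3)] by simp

lemma metric_sym: "c \<in> \<A> \<Longrightarrow> x \<in> chart_image c \<Longrightarrow> g c x v w = g c x w v"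
 and metric_pos: "c \<in> \<A> \<Longrightarrow> x \<in> chart_image c \<Longrightarrow> v \<noteq> 0 \<Longrightarrow> g c x v v > 0"
 and smooth_metric: "c \<in> \<A> \<Longrightarrow> smooth_on (g c) (chart_image c)"
 and metric_transition: "c \<in> \<A> \<Longrightarrow> c' \<in> \<A> \<Longrightarrow> x \<in> overlap c c' \<Longrightarrow>
    g c' (transition c c' x) (jac c c' x v) (jac c c' x w) = g c x v w"
 using manifold unfolding riemannian_manifold_def bilinear_tensor_field_def by blast+

lemma metric_jac:
 assumes "c \<in> \<A>" "c' \<in> \<A>" "p \<in> fst c" "p \<in> fst c'"
 shows "g c' (snd c' p) (jac c c' (snd c p) v) (jac c c' (snd c p) w) = g c (snd c p) v w"
 using metric_transition[OF assms(1,2) overlapI[OF assms(3,4)]] by (simp add: transition_chart assms)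

lemma local_metric_chart:
 assumes c: "c \<in> \<A>" shows "local_metric (chart_image c) (g c) (\<Gamma> c)"
proof
 show "open (chart_image c)" by (rule chart(2)[OF c])
 show "smooth_on (g c) (chart_image c)" by (rule smooth_metric[OF c])
 fix x assume x: "x \<in> chart_image c"
 have "(\<forall>u v. \<Gamma> c x u v = \<Gamma> c x v u) \<and>
  (\<forall>u v w. frechet_derivative (g c) (at x) u v w = g c x (\<Gamma> c x u v) w + g c x v (\<Gamma> c x u w))"
  unfolding christoffel_def by (rule theI'[OF christoffel_ex1[OF manifold c x]])
 then show "\<Gamma> c x u v = \<Gamma> c x v u"
  "frechet_derivative (g c) (at x) u v w = g c x (\<Gamma> c x u v) w + g c x v (\<Gamma> c x u w)" for u v w by blast+
qed (auto intro: metric_sym[OF c] metric_pos[OF c])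

text \<open>The Jacobian as an element of the operator space, where it can itself be
  differentiated.\<close>

definition jacb :: "('a, 'e) chart \<Rightarrow> ('a, 'e) chart \<Rightarrow> 'e \<Rightarrow> 'e endo" where
 "jacb c c' x = Blinfun (jac c c' x)"

lemma jacb: "c \<in> \<A> \<Longrightarrow> c' \<in> \<A> \<Longrightarrow> x \<in> overlap c c' \<Longrightarrow> jacb c c' x v = jac c c' x v"
 unfolding jacb_def by (subst bounded_linear_Blinfun_apply) (auto intro: has_derivative_bounded_linear[OF jac_deriv])

lemma smooth_jacb: assumes c: "c \<in> \<A>" "c' \<in> \<A>" shows "smooth_on (jacb c c') (overlap c c')"
proof (rule smooth_on_blinfunI[OF open_overlap[OF c]])
 fix i
 have "smooth_on (\<lambda>x. jac c c' x i) (overlap c c')"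
  unfolding jac_def by (rule smooth_on_frechet[OF smooth_transition[OF c]])
 then show "smooth_on (\<lambda>x. jacb c c' x i) (overlap c c')"
  by (subst smooth_on_cong[OF open_overlap[OF c] jacb[OF c]]) assumption+
qed

abbreviation hess :: "('a, 'e) chart \<Rightarrow> ('a, 'e) chart \<Rightarrow> 'e \<Rightarrow> 'e \<Rightarrow> 'e endo" where
 "hess c c' x \<equiv> frechet_derivative (jacb c c') (at x)"

lemma hess_sym: assumes c: "c \<in> \<A>" "c' \<in> \<A>" and x: "x \<in> overlap c c'" shows "hess c c' x u v = hess c c' x v u"
proof -
 have e: "frechet_derivative (\<lambda>y. frechet_derivative (transition c c') (at y) v) (at x) u = hess c c' x u v" for u v
 proof -
  have "((\<lambda>y. jacb c c' y v) has_derivative (\<lambda>u. hess c c' x u v)) (at x)"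
   by (auto intro!: derivative_eq_intros smooth_on_deriv[OF smooth_jacb[OF c] x])
  then have "((\<lambda>y. jac c c' y v) has_derivative (\<lambda>u. hess c c' x u v)) (at x)"
   by (rule has_derivative_transform_within_open[OF _ open_overlap[OF c] x]) (rule jacb[OF c])
  then show ?thesis unfolding jac_def using frechet_derivative_at by metis
 qed
 show ?thesis using smooth_on_second_symmetric[OF open_overlap[OF c] x smooth_transition[OF c], of u v]
  unfolding e by simp
qed

lemma jac_along:
 fixes X :: "real \<Rightarrow> 'e"
 assumes c: "c \<in> \<A>" "c' \<in> \<A>" and x: "x t \<in> overlap c c'" "(x has_vector_derivative D) (at t within T)"
  and X: "(X has_vector_derivative X') (at t within T)"
 shows "((\<lambda>t. jacb c c' (x t) (X t)) has_vector_derivative jacb c c' (x t) X' + hess c c' (x t) D (X t)) (at t within T)"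
 by (rule has_vector_derivative_apply[OF has_vector_derivative_curve[where f = "jacb c c'", OF
   smooth_on_deriv[OF smooth_jacb[OF c] x(1)] x(2)] X])

lemma transition_along:
 assumes c: "c \<in> \<A>" "c' \<in> \<A>" and x: "x t \<in> overlap c c'" "(x has_vector_derivative D) (at t within T)"
 shows "((\<lambda>t. transition c c' (x t)) has_vector_derivative jac c c' (x t) D) (at t within T)"
 by (rule has_vector_derivative_curve[where f = "transition c c'", OF jac_deriv[OF c x(1)] x(2)])

text \<open>Uniqueness of the Levi-Civita connection: the difference T of the two sides is
  symmetric, by symmetry of \<Gamma> and of second derivatives, and skew, by differentiating the
  metric in both charts. The law makes parallelism independent of the chart.\<close>

lemma christoffel_transition:
 assumes c: "c \<in> \<A>" "c' \<in> \<A>" and x: "x \<in> overlap c c'"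
 shows "jac c c' x (\<Gamma> c x u v) = hess c c' x u v + \<Gamma> c' (transition c c' x) (jac c c' x u) (jac c c' x v)"
proof -
 interpret C: local_metric "chart_image c" "g c" "\<Gamma> c" by (rule local_metric_chart[OF c(1)])
 interpret C': local_metric "chart_image c'" "g c'" "\<Gamma> c'" by (rule local_metric_chart[OF c(2)])
 let ?J = "jac c c' x" and ?x' = "transition c c' x"
 have xc: "x \<in> chart_image c" by (rule subsetD[OF overlap_subset x])
 have x': "?x' \<in> chart_image c'" by (rule subsetD[OF overlap_subset transition_overlap[OF c(1) x]])
 define T where "T u v = ?J (\<Gamma> c x u v) - (hess c c' x u v + \<Gamma> c' ?x' (?J u) (?J v))" for u v
 have T_sym: "T u v = T v u" for u v
  unfolding T_def by (simp add: C.\<Gamma>_sym[OF xc, of u v] hess_sym[OF c x, of u v] C'.\<Gamma>_sym[OF x', of "?J u" "?J v"])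
 have T_skew: "g c' ?x' (T u v) (?J w) + g c' ?x' (?J v) (T u w) = 0" for u v w
 proof -
  let ?l = "\<lambda>t::real. x + t *\<^sub>R u"
  have l: "(?l has_vector_derivative u) (at 0)" by (auto intro!: derivative_eq_intros)
  have l0: "?l 0 \<in> overlap c c'" "?l 0 \<in> chart_image c" "transition c c' (?l 0) \<in> chart_image c'" using x xc x' by simp_all
  have d1: "((\<lambda>t. g c (?l t) v w) has_vector_derivative g c x (\<Gamma> c x u v) w + g c x v (\<Gamma> c x u w)) (at 0)"
   using C.metric_along[OF l0(2) l has_vector_derivative_const has_vector_derivative_const, of v w] by simp
  have "((\<lambda>t. g c' (transition c c' (?l t)) (jacb c c' (?l t) v) (jacb c c' (?l t) w)) has_vector_derivative
    g c' ?x' (hess c c' x u v + \<Gamma> c' ?x' (?J u) (?J v)) (?J w) + g c' ?x' (?J v) (hess c c' x u w + \<Gamma> c' ?x' (?J u) (?J w))) (at 0)"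
   using C'.metric_along[where c = "\<lambda>t. transition c c' (?l t)", OF l0(3) transition_along[OF c l0(1) l]
    jac_along[OF c l0(1) l has_vector_derivative_const] jac_along[OF c l0(1) l has_vector_derivative_const], of v w]
   by (simp add: jacb[OF c x] bl)
  moreover have op: "open (?l -` overlap c c')" by (intro open_vimage open_overlap[OF c] continuous_intros)
  ultimately have d2: "((\<lambda>t. g c (?l t) v w) has_vector_derivative
    g c' ?x' (hess c c' x u v + \<Gamma> c' ?x' (?J u) (?J v)) (?J w) + g c' ?x' (?J v) (hess c c' x u w + \<Gamma> c' ?x' (?J u) (?J w))) (at 0)"
   by (rule has_vector_derivative_transform_within_open) (use x in \<open>auto simp: jacb[OF c] metric_transition[OF c]\<close>)
  from vector_derivative_unique_at[OF d1 d2]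
  show ?thesis unfolding T_def using metric_transition[OF c x, of "\<Gamma> c x u v" w] metric_transition[OF c x, of v "\<Gamma> c x u w"]
   by (simp add: blinfun.diff_left blinfun.diff_right)
 qed
 have z: "g c' ?x' (T u v) (?J w) = 0" for u v w
  using T_skew[of u v w] T_skew[of v w u] T_skew[of w u v] T_sym[of u v] T_sym[of v w] T_sym[of w u]
   metric_sym[OF c(2) x', of "?J v" "T u w"] metric_sym[OF c(2) x', of "?J w" "T v u"] metric_sym[OF c(2) x', of "?J u" "T w v"]
   metric_sym[OF c(2) x', of "?J v" "T w u"] metric_sym[OF c(2) x', of "?J w" "T u v"] metric_sym[OF c(2) x', of "?J u" "T v w"]
  by (simp; linarith)
 obtain p where p: "p \<in> fst c" "p \<in> fst c'" "x = snd c p" using x unfolding overlap_def by blast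
 have "T u v = ?J (jac c' c ?x' (T u v))"
  using jac_inverse[OF c(2,1) p(2,1)] by (simp add: p(3) transition_chart[OF c(1) p(1)])
 then have "g c' ?x' (T u v) (T u v) = 0" using z[of u v "jac c' c ?x' (T u v)"] by simp
 then have "T u v = 0" using metric_pos[OF c(2) x', of "T u v"] by force
 then show ?thesis unfolding T_def by simp
qed

end

section \<open>Parallel transport\<close>

context riem_manifold begin

text \<open>The velocity D is carried as a witness, so the notion passes to subintervals and
  reparametrisations without mentioning \<open>vector_derivative\<close>.\<close>

definition par_seg :: "('a, 'e) chart \<Rightarrow> (real \<Rightarrow> 'a) \<Rightarrow> (('a, 'e) chart \<Rightarrow> real \<Rightarrow> 'e) \<Rightarrow> real \<Rightarrow> real \<Rightarrow> bool" where
 "par_seg c \<gamma> X a b \<longleftrightarrow> (\<exists>D. continuous_on {a..b} D \<and> (\<forall>t\<in>{a..b}.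
  ((\<lambda>t. snd c (\<gamma> t)) has_vector_derivative D t) (at t within {a..b}) \<and>
  (X c has_vector_derivative - \<Gamma> c (snd c (\<gamma> t)) (D t) (X c t)) (at t within {a..b})))"

definition coherent :: "(real \<Rightarrow> 'a) \<Rightarrow> (('a, 'e) chart \<Rightarrow> real \<Rightarrow> 'e) \<Rightarrow> bool" where
 "coherent \<gamma> X \<longleftrightarrow> (\<forall>c\<in>\<A>. \<forall>c'\<in>\<A>. \<forall>t\<in>{0..1}. \<gamma> t \<in> fst c \<inter> fst c' \<longrightarrow>
    X c' t = jac c c' (snd c (\<gamma> t)) (X c t))"

lemma coherentD:
 assumes "coherent \<gamma> X" "c \<in> \<A>" "c' \<in> \<A>" "0 \<le> t" "t \<le> 1" "\<gamma> t \<in> fst c" "\<gamma> t \<in> fst c'"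
 shows "X c' t = jac c c' (snd c (\<gamma> t)) (X c t)"
 by (rule assms(1)[unfolded coherent_def, rule_format, OF assms(2,3)]) (use assms(4-) in auto)

lemma at_within_Icc_nontrivial: "a < b \<Longrightarrow> t \<in> {a..b} \<Longrightarrow> at t within {a..b} \<noteq> bot" for a b t :: real
 by (simp add: trivial_limit_within islimpt_Icc)

lemma parallel_along_imp_par_seg:
 assumes C: "piecewise_C1_curve M \<gamma> S" and P: "parallel_along M \<gamma> S X" and c: "c \<in> \<A>" and s: "chart_segment \<gamma> S c a b"
 shows "par_seg c \<gamma> X a b"
proof -
 have ab: "a < b" using s unfolding chart_segment_def by simp
 obtain D where D: "continuous_on {a..b} D" "\<And>t. t \<in> {a..b} \<Longrightarrow> ((snd c \<circ> \<gamma>) has_vector_derivative D t) (at t within {a..b})"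
  using C c s unfolding piecewise_C1_curve_def by blast
 have "vector_derivative (snd c \<circ> \<gamma>) (at t within {a..b}) = D t" if "t \<in> {a..b}" for t
  by (rule vector_derivative_within[OF at_within_Icc_nontrivial[OF ab that] D(2)[OF that]])
 moreover have "(X c has_vector_derivative - \<Gamma> c (snd c (\<gamma> t))
       (vector_derivative (snd c \<circ> \<gamma>) (at t within {a..b})) (X c t)) (at t within {a..b})" if "t \<in> {a..b}" for t
  using P c s that unfolding parallel_along_def by blast
 ultimately show ?thesis using D unfolding par_seg_def by (intro exI[of _ D]) (auto simp: o_def)
qed

lemma parallel_alongI:
 assumes "pathin (mtop M) \<gamma>" "finite S" "coherent \<gamma> X"
  and seg: "\<And>c a b. c \<in> \<A> \<Longrightarrow> chart_segment \<gamma> S c a b \<Longrightarrow> par_seg c \<gamma> X a b"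
 shows "piecewise_C1_curve M \<gamma> S" "parallel_along M \<gamma> S X"
proof -
 show "piecewise_C1_curve M \<gamma> S"
  unfolding piecewise_C1_curve_def
 proof (intro conjI assms ballI allI impI)
  fix c a b assume "c \<in> \<A>" "chart_segment \<gamma> S c a b"
  from seg[OF this] show "\<exists>D. continuous_on {a..b} D \<and> (\<forall>t\<in>{a..b}. ((snd c \<circ> \<gamma>) has_vector_derivative D t) (at t within {a..b}))"
   unfolding par_seg_def o_def by blast
 qed
 show "parallel_along M \<gamma> S X"
  unfolding parallel_along_def
 proof (intro conjI ballI allI impI)
  show "X c' t = jac c c' (snd c (\<gamma> t)) (X c t)" if "c \<in> \<A>" "c' \<in> \<A>" "t \<in> {0..1}" "\<gamma> t \<in> fst c \<inter> fst c'" for c c' t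
   by (rule coherentD[OF assms(3) that(1,2)]) (use that in auto)
  fix c a b t assume *: "c \<in> \<A>" "chart_segment \<gamma> S c a b" "t \<in> {a..b}"
  obtain D where D: "((\<lambda>t. snd c (\<gamma> t)) has_vector_derivative D t) (at t within {a..b})"
   "(X c has_vector_derivative - \<Gamma> c (snd c (\<gamma> t)) (D t) (X c t)) (at t within {a..b})"
   using seg[OF *(1,2)] *(3) unfolding par_seg_def by blast
  have "a < b" using *(2) unfolding chart_segment_def by simp
  then have "vector_derivative (snd c \<circ> \<gamma>) (at t within {a..b}) = D t"
   using vector_derivative_within[OF at_within_Icc_nontrivial D(1)] *(3) by (simp add: o_def)
  then show "(X c has_vector_derivative - \<Gamma> c (snd c (\<gamma> t))
       (vector_derivative (snd c \<circ> \<gamma>) (at t within {a..b})) (X c t)) (at t within {a..b})"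
   using D(2) by simp
 qed
qed

lemma par_seg_subset:
 assumes "par_seg c \<gamma> X a b" "a \<le> a'" "b' \<le> b"
 shows "par_seg c \<gamma> X a' b'"
proof -
 obtain D where D: "continuous_on {a..b} D" "\<And>t. t \<in> {a..b} \<Longrightarrow>
  ((\<lambda>t. snd c (\<gamma> t)) has_vector_derivative D t) (at t within {a..b}) \<and>
  (X c has_vector_derivative - \<Gamma> c (snd c (\<gamma> t)) (D t) (X c t)) (at t within {a..b})"
  using assms(1) unfolding par_seg_def by blast
 have sub: "{a'..b'} \<subseteq> {a..b}" using assms by auto
 show ?thesis unfolding par_seg_def
  by (intro exI[of _ D] conjI continuous_on_subset[OF D(1) sub] ballI)
   (use D(2) sub has_vector_derivative_within_subset in blast)+
qed

text \<open>Slopes 2 and -1 occur later, for concatenation and for reversal of curves.\<close>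

lemma par_seg_affine:
 fixes \<alpha> \<beta> :: real
 assumes "par_seg c \<gamma> X a0 b0" and sub: "\<And>t. t \<in> {a..b} \<Longrightarrow> \<alpha> * t + \<beta> \<in> {a0..b0}"
  and \<gamma>': "\<And>t. t \<in> {a..b} \<Longrightarrow> \<gamma>' t = \<gamma> (\<alpha> * t + \<beta>)" and X': "\<And>t. t \<in> {a..b} \<Longrightarrow> X' c t = X c (\<alpha> * t + \<beta>)"
 shows "par_seg c \<gamma>' X' a b"
proof -
 let ?f = "\<lambda>t. \<alpha> * t + \<beta>"
 obtain D where D: "continuous_on {a0..b0} D" "\<And>t. t \<in> {a0..b0} \<Longrightarrow>
  ((\<lambda>t. snd c (\<gamma> t)) has_vector_derivative D t) (at t within {a0..b0}) \<and>
  (X c has_vector_derivative - \<Gamma> c (snd c (\<gamma> t)) (D t) (X c t)) (at t within {a0..b0})"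
  using assms(1) unfolding par_seg_def by blast
 have im: "?f ` {a..b} \<subseteq> {a0..b0}" using sub by blast
 have f: "(?f has_vector_derivative \<alpha>) (at t within {a..b})" for t
  unfolding has_real_derivative_iff_has_vector_derivative[symmetric] by (auto intro!: derivative_eq_intros)
 have chain: "((\<lambda>t. h (?f t)) has_vector_derivative \<alpha> *\<^sub>R h') (at t within {a..b})"
  if "(h has_vector_derivative h') (at (?f t) within {a0..b0})" for h :: "real \<Rightarrow> 'e" and h' t
  using vector_diff_chain_within[OF f has_vector_derivative_within_subset[OF that im]] by (simp add: o_def)
 show ?thesis unfolding par_seg_def
 proof (intro exI[of _ "\<lambda>t. \<alpha> *\<^sub>R D (?f t)"] conjI ballI)
  show "continuous_on {a..b} (\<lambda>t. \<alpha> *\<^sub>R D (?f t))"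
   by (intro continuous_intros continuous_on_compose2[OF D(1) _ im])
  fix t assume t: "t \<in> {a..b}"
  show "((\<lambda>t. snd c (\<gamma>' t)) has_vector_derivative \<alpha> *\<^sub>R D (?f t)) (at t within {a..b})"
   by (rule has_vector_derivative_transform[OF t _ chain[where h = "\<lambda>t. snd c (\<gamma> t)"]]) (use \<gamma>' D(2) sub[OF t] in auto)
  have "((\<lambda>t. X c (?f t)) has_vector_derivative \<alpha> *\<^sub>R - \<Gamma> c (snd c (\<gamma> (?f t))) (D (?f t)) (X c (?f t))) (at t within {a..b})"
   by (rule chain) (use D(2) sub[OF t] in auto)
  then show "(X' c has_vector_derivative - \<Gamma> c (snd c (\<gamma>' t)) (\<alpha> *\<^sub>R D (?f t)) (X' c t)) (at t within {a..b})"
   by (rule has_vector_derivative_transform[OF t _ has_vector_derivative_eq_rhs, rotated])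
    (use \<gamma>' X' t in \<open>auto simp: bl\<close>)
 qed
qed

text \<open>The Hessian term from differentiating the Jacobian is absorbed by the transformation law
  of \<Gamma>.\<close>

lemma par_seg_chart_change:
 assumes c: "c \<in> \<A>" "c' \<in> \<A>" and im: "\<gamma> ` {a..b} \<subseteq> fst c \<inter> fst c'" and ab: "0 \<le> a" "b \<le> 1"
  and coh: "coherent \<gamma> X" and par: "par_seg c \<gamma> X a b"
 shows "par_seg c' \<gamma> X a b"
proof -
 obtain D where D: "continuous_on {a..b} D" "\<And>t. t \<in> {a..b} \<Longrightarrow> ((\<lambda>t. snd c (\<gamma> t)) has_vector_derivative D t) (at t within {a..b})"
  "\<And>t. t \<in> {a..b} \<Longrightarrow> (X c has_vector_derivative - \<Gamma> c (snd c (\<gamma> t)) (D t) (X c t)) (at t within {a..b})"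
  using par unfolding par_seg_def by blast
 let ?x = "\<lambda>t. snd c (\<gamma> t)"
 have x: "?x t \<in> overlap c c'" and tr: "transition c c' (?x t) = snd c' (\<gamma> t)" if "t \<in> {a..b}" for t
  using im that by (auto simp: overlapI transition_chart c image_subset_iff)
 have Xc': "X c' t = jacb c c' (?x t) (X c t)" if "t \<in> {a..b}" for t
  unfolding jacb[OF c x[OF that]] by (rule coherentD[OF coh c]) (use im that ab in auto)
 have contx: "continuous_on {a..b} ?x"
  using D(2) has_vector_derivative_continuous continuous_on_eq_continuous_within by blast
 show ?thesis unfolding par_seg_def
 proof (intro exI[of _ "\<lambda>t. jacb c c' (?x t) (D t)"] conjI ballI)
  show "continuous_on {a..b} (\<lambda>t. jacb c c' (?x t) (D t))"
   by (intro continuous_intros D(1) continuous_on_compose2[OF smooth_on_continuous[OF smooth_jacb[OF c]] contx]) (use x in auto)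
  fix t assume t: "t \<in> {a..b}"
  have "((\<lambda>t. transition c c' (?x t)) has_vector_derivative jacb c c' (?x t) (D t)) (at t within {a..b})"
   unfolding jacb[OF c x[OF t]] by (rule transition_along[OF c x[OF t] D(2)[OF t]])
  then show "((\<lambda>t. snd c' (\<gamma> t)) has_vector_derivative jacb c c' (?x t) (D t)) (at t within {a..b})"
   by (rule has_vector_derivative_transform[OF t, rotated]) (simp add: tr)
  have "((\<lambda>t. jacb c c' (?x t) (X c t)) has_vector_derivative
   jacb c c' (?x t) (- \<Gamma> c (?x t) (D t) (X c t)) + hess c c' (?x t) (D t) (X c t)) (at t within {a..b})"
   by (rule jac_along[OF c x[OF t] D(2)[OF t] D(3)[OF t]])
  also have "jacb c c' (?x t) (- \<Gamma> c (?x t) (D t) (X c t)) + hess c c' (?x t) (D t) (X c t) =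
   - \<Gamma> c' (snd c' (\<gamma> t)) (jacb c c' (?x t) (D t)) (X c' t)"
   unfolding Xc'[OF t] using christoffel_transition[OF c x[OF t], of "D t" "X c t"]
   by (simp add: jacb[OF c x[OF t]] bl tr[OF t])
  finally show "(X c' has_vector_derivative - \<Gamma> c' (snd c' (\<gamma> t)) (jacb c c' (?x t) (D t)) (X c' t)) (at t within {a..b})"
   by (rule has_vector_derivative_transform[OF t, rotated]) (simp add: Xc')
 qed
qed

text \<open>Like \<open>holonomy\<close>, but with two end points and two charts, so that transports
  can be composed.\<close>

definition transports where
 "transports c p c' q P \<longleftrightarrow> c \<in> \<A> \<and> c' \<in> \<A> \<and> p \<in> fst c \<and> q \<in> fst c' \<and>
  (\<exists>\<gamma> S. piecewise_C1_curve M \<gamma> S \<and> \<gamma> 0 = p \<and> \<gamma> 1 = q \<and>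
  (\<forall>v. \<exists>X. parallel_along M \<gamma> S X \<and> X c 0 = v \<and> X c' 1 = P v))"

lemma holonomy_iff: "c \<in> \<A> \<Longrightarrow> p \<in> fst c \<Longrightarrow> P \<in> holonomy M c p \<longleftrightarrow> transports c p c p P"
 unfolding holonomy_def transports_def by simp

lemma parallel_coherent: "parallel_along M \<gamma> S X \<Longrightarrow> coherent \<gamma> X"
 unfolding parallel_along_def coherent_def by blast

lemma transports_change_end:
 assumes T: "transports c p c' q P" and d: "d \<in> \<A>" "q \<in> fst d"
 shows "transports c p d q (\<lambda>v. jac c' d (snd c' q) (P v))"
proof -
 obtain \<gamma> S where C: "piecewise_C1_curve M \<gamma> S" "\<gamma> 0 = p" "\<gamma> 1 = q"
  and X: "\<And>v. \<exists>X. parallel_along M \<gamma> S X \<and> X c 0 = v \<and> X c' 1 = P v"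
  and c: "c \<in> \<A>" "c' \<in> \<A>" "p \<in> fst c" "q \<in> fst c'" using T unfolding transports_def by blast
 have "\<exists>X. parallel_along M \<gamma> S X \<and> X c 0 = v \<and> X d 1 = jac c' d (snd c' q) (P v)" for v
 proof -
  obtain X where "parallel_along M \<gamma> S X" "X c 0 = v" "X c' 1 = P v" using X by blast
  then show ?thesis using coherentD[OF parallel_coherent c(2) d(1), of \<gamma> S X 1] c d C by auto
 qed
 then show ?thesis using c C d unfolding transports_def by blast
qed

lemma pathin_join:
 assumes "pathin T f" "pathin T h" "f 1 = h 0"
 shows "pathin T (\<lambda>t::real. if t \<le> 1/2 then f (2 * t) else h (2 * t - 1))"
 unfolding pathin_def
proof (rule continuous_map_cases_le)
 let ?I = "top_of_set {0..1::real}"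
 have f: "continuous_map ?I T f" and h: "continuous_map ?I T h" using assms unfolding pathin_def by auto
 show "continuous_map ?I euclideanreal (\<lambda>t. t)" "continuous_map ?I euclideanreal (\<lambda>t. 1/2)" by auto
 have "continuous_map (subtopology ?I {x \<in> topspace ?I. x \<le> 1/2}) ?I (\<lambda>t. 2 * t)"
  by (auto simp: continuous_map_in_subtopology subtopology_subtopology intro!: continuous_intros)
 then show "continuous_map (subtopology ?I {x \<in> topspace ?I. x \<le> 1/2}) T (\<lambda>t. f (2 * t))"
  using continuous_map_compose[OF _ f] by (fastforce simp: o_def)
 have "continuous_map (subtopology ?I {x \<in> topspace ?I. 1/2 \<le> x}) ?I (\<lambda>t. 2 * t - 1)"
  by (auto simp: continuous_map_in_subtopology subtopology_subtopology intro!: continuous_intros)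
 then show "continuous_map (subtopology ?I {x \<in> topspace ?I. 1/2 \<le> x}) T (\<lambda>t. h (2 * t - 1))"
  using continuous_map_compose[OF _ h] by (fastforce simp: o_def)
 show "f (2 * x) = h (2 * x - 1)" if "x \<in> topspace ?I" "x = 1/2" for x unfolding that(2) using assms(3) by simp
qed

lemma transports_compose:
 assumes T1: "transports c p c' q P1" and T2: "transports c' q c'' r P2"
 shows "transports c p c'' r (\<lambda>v. P2 (P1 v))"
proof -
 obtain \<gamma>1 S1 where C1: "piecewise_C1_curve M \<gamma>1 S1" "\<gamma>1 0 = p" "\<gamma>1 1 = q"
  and X1: "\<And>v. \<exists>X. parallel_along M \<gamma>1 S1 X \<and> X c 0 = v \<and> X c' 1 = P1 v"
  and c: "c \<in> \<A>" "c' \<in> \<A>" "p \<in> fst c" "q \<in> fst c'" using T1 unfolding transports_def by blast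
 obtain \<gamma>2 S2 where C2: "piecewise_C1_curve M \<gamma>2 S2" "\<gamma>2 0 = q" "\<gamma>2 1 = r"
  and X2: "\<And>v. \<exists>X. parallel_along M \<gamma>2 S2 X \<and> X c' 0 = v \<and> X c'' 1 = P2 v"
  and c'': "c'' \<in> \<A>" "r \<in> fst c''" using T2 unfolding transports_def by blast
 define \<gamma> where "\<gamma> t = (if t \<le> 1/2 then \<gamma>1 (2 * t) else \<gamma>2 (2 * t - 1))" for t
 \<comment> \<open>The junction 1/2 is declared a break point, so every chart segment lies in one of
   the two halves.\<close>
 define S where "S = {1/2} \<union> (\<lambda>s. s / 2) ` S1 \<union> (\<lambda>s. (s + 1) / 2) ` S2"
 have path: "pathin (mtop M) \<gamma>" unfolding \<gamma>_def
  by (rule pathin_join) (use C1 C2 in \<open>auto simp: piecewise_C1_curve_def\<close>)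
 have fin: "finite S" unfolding S_def using C1 C2 by (auto simp: piecewise_C1_curve_def)
 have ex: "\<exists>X. piecewise_C1_curve M \<gamma> S \<and> parallel_along M \<gamma> S X \<and> X c 0 = v \<and> X c'' 1 = P2 (P1 v)" for v
 proof -
  obtain X1 where X1: "parallel_along M \<gamma>1 S1 X1" "X1 c 0 = v" "X1 c' 1 = P1 v" using X1 by blast
  obtain X2 where X2: "parallel_along M \<gamma>2 S2 X2" "X2 c' 0 = P1 v" "X2 c'' 1 = P2 (P1 v)" using X2 by blast
  note coh = parallel_coherent[OF X1(1)] parallel_coherent[OF X2(1)]
  define X where "X d t = (if t \<le> 1/2 then X1 d (2 * t) else X2 d (2 * t - 1))" for d t
  have mid: "X1 d 1 = X2 d 0" if "d \<in> \<A>" "q \<in> fst d" for d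
   using coherentD[OF coh(1) c(2) that(1), of 1] coherentD[OF coh(2) c(2) that(1), of 0] c that C1 C2 X1 X2 by simp
  have coh': "coherent \<gamma> X"
   unfolding coherent_def \<gamma>_def X_def using coh coherentD by auto
  have seg: "par_seg d \<gamma> X a b" if d: "d \<in> \<A>" and s: "chart_segment \<gamma> S d a b" for d a b
  proof -
   have ab: "0 \<le> a" "a < b" "b \<le> 1" and aS: "\<And>t. a < t \<Longrightarrow> t < b \<Longrightarrow> t \<notin> S" and im: "\<And>t. a \<le> t \<Longrightarrow> t \<le> b \<Longrightarrow> \<gamma> t \<in> fst d"
    using s unfolding chart_segment_def by (auto simp: image_subset_iff disjoint_iff)
   consider "b \<le> 1/2" | "1/2 \<le> a" using aS[of "1/2"] by (force simp: S_def)
   then show ?thesis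
   proof cases
    case 1
    have "chart_segment \<gamma>1 S1 d (2 * a) (2 * b)"
     unfolding chart_segment_def
    proof (intro conjI)
     have "t \<notin> S1" if "2 * a < t" "t < 2 * b" for t using aS[of "t / 2"] that by (auto simp: S_def)
     then show "{2 * a<..<2 * b} \<inter> S1 = {}" by auto
     have "\<gamma>1 t \<in> fst d" if "2 * a \<le> t" "t \<le> 2 * b" for t using im[of "t / 2"] that 1 by (simp add: \<gamma>_def)
     then show "\<gamma>1 ` {2 * a..2 * b} \<subseteq> fst d" by auto
    qed (use ab 1 in auto)
    from parallel_along_imp_par_seg[OF C1(1) X1(1) d this]
    show ?thesis by (rule par_seg_affine[where \<alpha> = 2 and \<beta> = 0]) (use 1 in \<open>auto simp: \<gamma>_def X_def\<close>)
   next
    case 2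
    \<comment> \<open>At the junction itself \<gamma> and X are defined by the first half; agreement
      of both halves there extends the second formula to the closed interval.\<close>
    have \<gamma>2: "\<gamma> t = \<gamma>2 (2 * t - 1)" if "a \<le> t" for t
    proof (cases "t = 1/2")
     case True
     show ?thesis unfolding True \<gamma>_def using C1 C2 by simp
    qed (use that 2 in \<open>auto simp: \<gamma>_def\<close>)
    have X2': "X d t = X2 d (2 * t - 1)" if "a \<le> t" "t \<le> b" for t
    proof (cases "t = 1/2")
     case True
     have "q \<in> fst d" using im[OF that] \<gamma>2[OF that(1)] C2 unfolding True by simp
     then show ?thesis unfolding True X_def using mid[OF d] by simp
    qed (use that 2 in \<open>auto simp: X_def\<close>)
    have "chart_segment \<gamma>2 S2 d (2 * a - 1) (2 * b - 1)"
     unfolding chart_segment_def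
    proof (intro conjI)
     have "t \<notin> S2" if "2 * a - 1 < t" "t < 2 * b - 1" for t using aS[of "(t + 1) / 2"] that by (auto simp: S_def)
     then show "{2 * a - 1<..<2 * b - 1} \<inter> S2 = {}" by auto
     have "\<gamma>2 t \<in> fst d" if "2 * a - 1 \<le> t" "t \<le> 2 * b - 1" for t
     proof -
      have "2 * ((t + 1) / 2) - 1 = t" by (simp add: field_simps)
      then have "\<gamma> ((t + 1) / 2) = \<gamma>2 t" using \<gamma>2[of "(t + 1) / 2"] that by (simp only:)
      then show ?thesis using im[of "(t + 1) / 2"] that by simp
     qed
     then show "\<gamma>2 ` {2 * a - 1..2 * b - 1} \<subseteq> fst d" by auto
    qed (use ab 2 in auto)
    from parallel_along_imp_par_seg[OF C2(1) X2(1) d this]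
    show ?thesis by (rule par_seg_affine[where \<alpha> = 2 and \<beta> = "-1"]) (use \<gamma>2 X2' in auto)
   qed
  qed
  note parallel_alongI[OF path fin coh' seg]
  moreover have "X c 0 = v" "X c'' 1 = P2 (P1 v)" using X1 X2 by (simp_all add: X_def)
  ultimately show ?thesis by blast
 qed
 have "\<gamma> 0 = p" "\<gamma> 1 = r" using C1 C2 by (simp_all add: \<gamma>_def)
 then show ?thesis unfolding transports_def using ex c c'' by blast
qed

lemma transports_reverse:
 assumes T: "transports c p c' q P" and inv: "\<And>v. P (P' v) = v"
 shows "transports c' q c p P'"
proof -
 obtain \<gamma>1 S1 where C1: "piecewise_C1_curve M \<gamma>1 S1" "\<gamma>1 0 = p" "\<gamma>1 1 = q"
  and X1: "\<And>v. \<exists>X. parallel_along M \<gamma>1 S1 X \<and> X c 0 = v \<and> X c' 1 = P v"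
  and c: "c \<in> \<A>" "c' \<in> \<A>" "p \<in> fst c" "q \<in> fst c'" using T unfolding transports_def by blast
 define \<gamma> where "\<gamma> t = \<gamma>1 (1 - t)" for t
 define S where "S = (\<lambda>s. 1 - s) ` S1"
 have m: "continuous_map (top_of_set {0..1::real}) (top_of_set {0..1}) (\<lambda>t. 1 - t)"
  by (auto simp: continuous_map_in_subtopology intro!: continuous_intros)
 have "continuous_map (top_of_set {0..1}) (mtop M) \<gamma>1" using C1(1) unfolding pathin_def piecewise_C1_curve_def by blast
 from continuous_map_compose[OF m this] have path: "pathin (mtop M) \<gamma>"
  unfolding \<gamma>_def[abs_def] pathin_def by (simp add: o_def)
 have fin: "finite S" unfolding S_def using C1 by (auto simp: piecewise_C1_curve_def)
 have ex: "\<exists>X. piecewise_C1_curve M \<gamma> S \<and> parallel_along M \<gamma> S X \<and> X c' 0 = v \<and> X c 1 = P' v" for v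
 proof -
  obtain X1 where X1: "parallel_along M \<gamma>1 S1 X1" "X1 c 0 = P' v" "X1 c' 1 = v" using X1[of "P' v"] inv by auto
  note coh = parallel_coherent[OF X1(1)]
  define X where "X d t = X1 d (1 - t)" for d t
  have coh': "coherent \<gamma> X"
   unfolding coherent_def \<gamma>_def X_def using coh coherentD by auto
  have seg: "par_seg d \<gamma> X a b" if d: "d \<in> \<A>" and s: "chart_segment \<gamma> S d a b" for d a b
  proof -
   have ab: "0 \<le> a" "a < b" "b \<le> 1" and aS: "\<And>t. a < t \<Longrightarrow> t < b \<Longrightarrow> t \<notin> S" and im: "\<And>t. a \<le> t \<Longrightarrow> t \<le> b \<Longrightarrow> \<gamma> t \<in> fst d"
    using s unfolding chart_segment_def by (auto simp: image_subset_iff disjoint_iff)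
   have "chart_segment \<gamma>1 S1 d (1 - b) (1 - a)"
    unfolding chart_segment_def
   proof (intro conjI)
    have "t \<notin> S1" if "1 - b < t" "t < 1 - a" for t using aS[of "1 - t"] that by (auto simp: S_def)
    then show "{1 - b<..<1 - a} \<inter> S1 = {}" by auto
    have "\<gamma>1 t \<in> fst d" if "1 - b \<le> t" "t \<le> 1 - a" for t using im[of "1 - t"] that by (simp add: \<gamma>_def)
    then show "\<gamma>1 ` {1 - b..1 - a} \<subseteq> fst d" by auto
   qed (use ab in auto)
   from parallel_along_imp_par_seg[OF C1(1) X1(1) d this]
   show ?thesis by (rule par_seg_affine[where \<alpha> = "-1" and \<beta> = 1]) (auto simp: \<gamma>_def X_def)
  qed
  note parallel_alongI[OF path fin coh' seg]
  moreover have "X c' 0 = v" "X c 1 = P' v" using X1 by (simp_all add: X_def)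
  ultimately show ?thesis by blast
 qed
 have "\<gamma> 0 = q" "\<gamma> 1 = p" using C1 by (simp_all add: \<gamma>_def)
 then show ?thesis unfolding transports_def using ex c by blast
qed

end

text \<open>The defects F (v + w) - F v - F w and F (r v) - r F v have length zero in b', hence
  vanish; bijectivity follows by dimension.\<close>

lemma isometry_linear:
 fixes b b' :: "'e::euclidean_space bilin" and F :: "'e \<Rightarrow> 'e"
 assumes pos: "\<And>v. v \<noteq> 0 \<Longrightarrow> b v v > 0" and pos': "\<And>v. v \<noteq> 0 \<Longrightarrow> b' v v > 0"
  and iso: "\<And>v w. b' (F v) (F w) = b v w"
 shows "linear F" "bij F"
proof -
 note bl = blinfun.bilinear_simps
 have 0: "v = 0" if "b' v v = 0" for v using pos'[of v] that by (cases "v = 0") auto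
 show lin: "linear F"
 proof (rule linearI)
  fix v w and r :: real
  have "b' (F (v + w) - (F v + F w)) (F (v + w) - (F v + F w)) = 0"
   by (simp add: bl iso)
  from 0[OF this] show "F (v + w) = F v + F w" by simp
  have "b' (F (r *\<^sub>R v) - r *\<^sub>R F v) (F (r *\<^sub>R v) - r *\<^sub>R F v) = 0"
   by (simp add: bl iso algebra_simps)
  from 0[OF this] show "F (r *\<^sub>R v) = r *\<^sub>R F v" by simp
 qed
 have "inj F" unfolding linear_injective_0[OF lin]
 proof (intro allI impI)
  fix v assume "F v = 0"
  then have "b v v = 0" using iso[of v v] by (simp add: bl)
  then show "v = 0" using pos[of v] by (cases "v = 0") auto
 qed
 then show "bij F" using linear_injective_imp_surjective[OF lin] by (simp add: bij_def)
qed

section \<open>Transport inside a chart and invariance of inner products\<close>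

context riem_manifold begin

definition pt :: "('a, 'e) chart \<Rightarrow> 'e \<Rightarrow> 'a" where
 "pt c x = inv_into (fst c) (snd c) x"

lemma pt: "c \<in> \<A> \<Longrightarrow> x \<in> chart_image c \<Longrightarrow> pt c x \<in> fst c" "c \<in> \<A> \<Longrightarrow> x \<in> chart_image c \<Longrightarrow> snd c (pt c x) = x"
 unfolding pt_def chart_image_def by (auto intro: inv_into_into f_inv_into_f)

lemma continuous_pt:
 assumes c: "c \<in> \<A>"
 shows "continuous_map (top_of_set (chart_image c)) (mtop M) (pt c)"
proof -
 obtain h where h: "homeomorphic_maps (subtopology (mtop M) (fst c)) (top_of_set (chart_image c)) (snd c) h"
  using chart(3)[OF c] homeomorphic_map_maps by metis
 then have "continuous_map (top_of_set (chart_image c)) (subtopology (mtop M) (fst c)) h"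
  and hx: "\<And>x. x \<in> chart_image c \<Longrightarrow> snd c (h x) = x"
  unfolding homeomorphic_maps_def by auto
 then have ch: "continuous_map (top_of_set (chart_image c)) (mtop M) h" and im: "\<And>x. x \<in> chart_image c \<Longrightarrow> h x \<in> fst c"
  by (auto simp: continuous_map_in_subtopology)
 have "h x = pt c x" if "x \<in> topspace (top_of_set (chart_image c))" for x
  using chart_inv[OF c im] hx that unfolding pt_def by simp
 then show ?thesis using continuous_map_eq[OF ch] by blast
qed

text \<open>The field is prescribed in c by the solution operator \<Phi> and in all other charts by
  the Jacobian, and \<open>par_seg_chart_change\<close> then handles segments in every
  chart.\<close>

lemma transports_chart:
 fixes x :: "real \<Rightarrow> 'e" and D :: "real \<Rightarrow> 'e" and \<Phi> :: "real \<Rightarrow> 'e endo"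
 assumes c: "c \<in> \<A>" and xc: "\<And>t. t \<in> {0..1} \<Longrightarrow> x t \<in> chart_image c"
  and x: "\<And>t. t \<in> {0..1} \<Longrightarrow> (x has_vector_derivative D t) (at t within {0..1})" and D: "continuous_on {0..1} D"
  and \<Phi>0: "\<Phi> 0 = id_blinfun"
  and \<Phi>: "\<And>t. t \<in> {0..1} \<Longrightarrow> (\<Phi> has_vector_derivative - (\<Gamma> c (x t) (D t) o\<^sub>L \<Phi> t)) (at t within {0..1})"
 shows "transports c (pt c (x 0)) c (pt c (x 1)) (\<Phi> 1)"
proof -
 define \<gamma> where "\<gamma> t = pt c (x t)" for t
 have sn: "snd c (\<gamma> t) = x t" "\<gamma> t \<in> fst c" if "t \<in> {0..1}" for t
  unfolding \<gamma>_def using pt[OF c xc[OF that]] by auto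
 have "continuous_on {0..1} x"
  using x has_vector_derivative_continuous continuous_on_eq_continuous_within by blast
 then have "continuous_map (top_of_set {0..1}) (top_of_set (chart_image c)) x"
  using xc by (auto simp: continuous_map_in_subtopology)
 from continuous_map_compose[OF this continuous_pt[OF c]] have path: "pathin (mtop M) \<gamma>"
  unfolding pathin_def \<gamma>_def[abs_def] by (simp add: o_def)
 have ex: "\<exists>X. piecewise_C1_curve M \<gamma> {} \<and> parallel_along M \<gamma> {} X \<and> X c 0 = v \<and> X c 1 = \<Phi> 1 v" for v
 proof -
  define X where "X c' t = jac c c' (x t) (\<Phi> t v)" for c' t
  have Xc: "X c t = \<Phi> t v" if "t \<in> {0..1}" for t
   unfolding X_def using jac_refl[OF c sn(2)[OF that]] sn(1)[OF that] by simp
  have coh: "coherent \<gamma> X"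
   unfolding coherent_def
  proof (intro ballI impI)
   fix c1 c2 t assume *: "c1 \<in> \<A>" "c2 \<in> \<A>" "t \<in> {0..1}" "\<gamma> t \<in> fst c1 \<inter> fst c2"
   show "X c2 t = jac c1 c2 (snd c1 (\<gamma> t)) (X c1 t)"
    using jac_chain[OF c *(1,2) sn(2)[OF *(3)]] * sn[OF *(3)] by (simp add: X_def)
  qed
  have pc: "par_seg c \<gamma> X a b" if "0 \<le> a" "b \<le> 1" for a b
  proof -
   have "par_seg c \<gamma> X 0 1" unfolding par_seg_def
   proof (intro exI[of _ D] conjI D ballI)
    fix t :: real assume t: "t \<in> {0..1}"
    show "((\<lambda>t. snd c (\<gamma> t)) has_vector_derivative D t) (at t within {0..1})"
     by (rule has_vector_derivative_transform[OF t _ x[OF t]]) (simp add: sn)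
    have "((\<lambda>t. \<Phi> t v) has_vector_derivative - \<Gamma> c (snd c (\<gamma> t)) (D t) (X c t)) (at t within {0..1})"
     using has_vector_derivative_apply[OF \<Phi>[OF t] has_vector_derivative_const[of v]]
     by (simp add: sn[OF t] Xc[OF t] bl)
    then show "(X c has_vector_derivative - \<Gamma> c (snd c (\<gamma> t)) (D t) (X c t)) (at t within {0..1})"
     by (rule has_vector_derivative_transform[OF t, rotated]) (simp add: Xc)
   qed
   then show ?thesis using that by (rule par_seg_subset)
  qed
  have seg: "par_seg d \<gamma> X a b" if d: "d \<in> \<A>" and s: "chart_segment \<gamma> {} d a b" for d a b
   by (rule par_seg_chart_change[OF c d _ _ _ coh pc]) (use s sn in \<open>auto simp: chart_segment_def image_subset_iff\<close>)
  show ?thesis using parallel_alongI[OF path _ coh seg] Xc[of 0] Xc[of 1] \<Phi>0 by (intro exI[of _ X]) auto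
 qed
 have "\<gamma> 0 = pt c (x 0)" "\<gamma> 1 = pt c (x 1)" "pt c (x 0) \<in> fst c" "pt c (x 1) \<in> fst c"
  using sn(2)[of 0] sn(2)[of 1] by (simp_all add: \<gamma>_def)
 then show ?thesis unfolding transports_def using ex c by blast
qed

text \<open>Connectedness of the unit interval. Near a only intervals ending at a are compared, so
  their interior avoids break points even when a is one.\<close>

lemma curve_local_to_global:
 fixes R :: "real \<Rightarrow> real \<Rightarrow> bool"
 assumes path: "pathin (mtop M) \<gamma>" and fin: "finite S"
  and refl: "\<And>t. t \<in> {0..1} \<Longrightarrow> R t t" and sym: "\<And>s t. R s t \<Longrightarrow> s \<in> {0..1} \<Longrightarrow> t \<in> {0..1} \<Longrightarrow> R t s"
  and trans: "\<And>s t r. R s t \<Longrightarrow> R t r \<Longrightarrow> s \<in> {0..1} \<Longrightarrow> t \<in> {0..1} \<Longrightarrow> r \<in> {0..1} \<Longrightarrow> R s r"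
  and loc: "\<And>p. p \<in> topspace (mtop M) \<Longrightarrow> \<exists>c\<in>\<A>. \<exists>W. openin (mtop M) W \<and> p \<in> W \<and> W \<subseteq> fst c \<and>
    (\<forall>a b. chart_segment \<gamma> S c a b \<longrightarrow> \<gamma> ` {a..b} \<subseteq> W \<longrightarrow> R a b)"
  and st: "s0 \<in> {0..1}" "t0 \<in> {0..1}"
 shows "R s0 t0"
proof (rule connected_equivalence_relation[where S = "{0..1::real}"])
 show "connected {0..1::real}" by simp
 fix a :: real assume a: "a \<in> {0..1}"
 have cm: "continuous_map (top_of_set {0..1}) (mtop M) \<gamma>" using path unfolding pathin_def .
 then have "\<gamma> a \<in> topspace (mtop M)" using a unfolding continuous_map_def by auto
 then obtain c W where c: "c \<in> \<A>" and W: "openin (mtop M) W" "\<gamma> a \<in> W" "W \<subseteq> fst c"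
  and R: "\<And>a b. chart_segment \<gamma> S c a b \<Longrightarrow> \<gamma> ` {a..b} \<subseteq> W \<Longrightarrow> R a b" using loc by metis
 have "openin (top_of_set {0..1}) {t \<in> {0..1}. \<gamma> t \<in> W}"
  using openin_continuous_map_preimage[OF cm W(1)] by simp
 then obtain \<epsilon> where e: "\<epsilon> > 0" "ball a \<epsilon> \<inter> {0..1} \<subseteq> {t \<in> {0..1}. \<gamma> t \<in> W}"
  using a W(2) unfolding openin_contains_ball by blast
 obtain \<delta> where d: "\<delta> > 0" "\<And>s. s \<in> S \<Longrightarrow> s \<noteq> a \<Longrightarrow> \<delta> \<le> dist a s" using finite_set_avoid[OF fin, of a] by blast
 define T where "T = ball a (min \<epsilon> \<delta>) \<inter> {0..1}"
 have seg: "R s t" if st: "s < t" "s \<in> T" "t \<in> T" "s = a \<or> t = a" for s t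
 proof (rule R)
  have *: "r \<in> T" if "s \<le> r" "r \<le> t" for r using that st(2,3) unfolding T_def by (auto simp: dist_real_def)
  have W': "\<gamma> r \<in> W" if "s \<le> r" "r \<le> t" for r using *[OF that] e(2) unfolding T_def by auto
  show "\<gamma> ` {s..t} \<subseteq> W" using W' by auto
  have "r \<notin> S" if r: "s < r" "r < t" for r
  proof
   assume "r \<in> S"
   then have "\<delta> \<le> dist a r" using d(2)[of r] st(4) r by auto
   then show False using *[of r] r unfolding T_def by auto
  qed
  then show "chart_segment \<gamma> S c s t" unfolding chart_segment_def
   using st W' W(3) unfolding T_def by (auto simp: image_subset_iff)
 qed
 show "\<exists>T. openin (top_of_set {0..1}) T \<and> a \<in> T \<and> (\<forall>t\<in>T. R a t)"
 proof (intro exI[of _ T] conjI ballI)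
  show "openin (top_of_set {0..1}) T" unfolding T_def by (metis Int_commute open_ball openin_open_Int)
  show aT: "a \<in> T" using a e d unfolding T_def by simp
  fix t assume t: "t \<in> T"
  then have "t \<in> {0..1}" unfolding T_def by simp
  then consider "t < a" | "t = a" | "a < t" by linarith
  then show "R a t"
  proof cases
   case 1
   show ?thesis by (rule sym[OF seg[OF 1 t aT]]) (use a \<open>t \<in> {0..1}\<close> in auto)
  next
   case 2
   show ?thesis unfolding 2 by (rule refl[OF a])
  next
   case 3
   show ?thesis by (rule seg[OF 3 aT t]) simp
  qed
 qed
qed (fact st | rule sym, assumption+ | rule trans, assumption+)+

lemma par_seg_same_velocity:
 assumes "par_seg c \<gamma> X a b" "par_seg c \<gamma> Y a b" "a < b"
 obtains D where "\<And>t. t \<in> {a..b} \<Longrightarrow> ((\<lambda>t. snd c (\<gamma> t)) has_vector_derivative D t) (at t within {a..b})"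
  "\<And>t. t \<in> {a..b} \<Longrightarrow> (X c has_vector_derivative - \<Gamma> c (snd c (\<gamma> t)) (D t) (X c t)) (at t within {a..b})"
  "\<And>t. t \<in> {a..b} \<Longrightarrow> (Y c has_vector_derivative - \<Gamma> c (snd c (\<gamma> t)) (D t) (Y c t)) (at t within {a..b})"
proof -
 obtain D where D: "\<And>t. t \<in> {a..b} \<Longrightarrow> ((\<lambda>t. snd c (\<gamma> t)) has_vector_derivative D t) (at t within {a..b})"
  "\<And>t. t \<in> {a..b} \<Longrightarrow> (X c has_vector_derivative - \<Gamma> c (snd c (\<gamma> t)) (D t) (X c t)) (at t within {a..b})"
  using assms(1) unfolding par_seg_def by blast
 obtain D' where D': "\<And>t. t \<in> {a..b} \<Longrightarrow> ((\<lambda>t. snd c (\<gamma> t)) has_vector_derivative D' t) (at t within {a..b})"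
  "\<And>t. t \<in> {a..b} \<Longrightarrow> (Y c has_vector_derivative - \<Gamma> c (snd c (\<gamma> t)) (D' t) (Y c t)) (at t within {a..b})"
  using assms(2) unfolding par_seg_def by blast
 have eq: "D' t = D t" if "t \<in> {a..b}" for t
  by (rule vector_derivative_unique_within[OF at_within_Icc_nontrivial[OF assms(3) that] D'(1)[OF that] D(1)[OF that]])
 have "\<And>t. t \<in> {a..b} \<Longrightarrow> (Y c has_vector_derivative - \<Gamma> c (snd c (\<gamma> t)) (D t) (Y c t)) (at t within {a..b})"
  using D'(2) eq by simp
 from that[OF D(1) D(2) this] show ?thesis by blast
qed

text \<open>On each segment the inner product has derivative zero;
  \<open>curve_local_to_global\<close> joins segments, charts and break points.\<close>

lemma parallel_isometry:
 assumes C: "piecewise_C1_curve M \<gamma> S" and X: "parallel_along M \<gamma> S X" and Y: "parallel_along M \<gamma> S Y"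
  and s: "s \<in> {0..1}" and t: "t \<in> {0..1}" and c: "c \<in> \<A>" "\<gamma> s \<in> fst c" and c': "c' \<in> \<A>" "\<gamma> t \<in> fst c'"
 shows "g c' (snd c' (\<gamma> t)) (X c' t) (Y c' t) = g c (snd c (\<gamma> s)) (X c s) (Y c s)"
proof -
 define f where "f c t = g c (snd c (\<gamma> t)) (X c t) (Y c t)" for c t
 define R where "R s t \<longleftrightarrow> (\<forall>c\<in>\<A>. \<forall>c'\<in>\<A>. \<gamma> s \<in> fst c \<longrightarrow> \<gamma> t \<in> fst c' \<longrightarrow> f c' t = f c s)" for s t
 note coh = parallel_coherent[OF X] parallel_coherent[OF Y]
 have indep: "f c' t = f c t" if "c \<in> \<A>" "c' \<in> \<A>" "t \<in> {0..1}" "\<gamma> t \<in> fst c" "\<gamma> t \<in> fst c'" for c c' t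
 proof -
  have "X c' t = jac c c' (snd c (\<gamma> t)) (X c t)" "Y c' t = jac c c' (snd c (\<gamma> t)) (Y c t)"
   using coherentD[OF coh(1) that(1,2)] coherentD[OF coh(2) that(1,2)] that by simp_all
  then show ?thesis unfolding f_def using metric_jac[OF that(1,2,4,5)] by simp
 qed
 have path: "pathin (mtop M) \<gamma>" and fin: "finite S" using C unfolding piecewise_C1_curve_def by blast+
 have top: "\<gamma> t \<in> topspace (mtop M)" if "t \<in> {0..1}" for t
  using path that unfolding pathin_def continuous_map_def by auto
 have "R s t"
 proof (rule curve_local_to_global[OF path fin _ _ _ _ s t])
  show "R t t" if "t \<in> {0..1}" for t unfolding R_def using indep that by blast
  show "R t s" if "R s t" for s t using that unfolding R_def by metis
  show "R s r" if "R s t" "R t r" "t \<in> {0..1}" for s t r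
   using that chart_cover[OF top[OF that(3)]] unfolding R_def by metis
  fix p assume p: "p \<in> topspace (mtop M)"
  obtain c where c: "c \<in> \<A>" "p \<in> fst c" using chart_cover[OF p] by blast
  have "R a b" if sg: "chart_segment \<gamma> S c a b" for a b
  proof -
   have ab: "0 \<le> a" "a < b" "b \<le> 1" and im: "\<And>t. t \<in> {a..b} \<Longrightarrow> \<gamma> t \<in> fst c"
    using sg unfolding chart_segment_def by (auto simp: image_subset_iff)
   obtain D where D: "\<And>t. t \<in> {a..b} \<Longrightarrow> ((\<lambda>t. snd c (\<gamma> t)) has_vector_derivative D t) (at t within {a..b})"
  "\<And>t. t \<in> {a..b} \<Longrightarrow> (X c has_vector_derivative - \<Gamma> c (snd c (\<gamma> t)) (D t) (X c t)) (at t within {a..b})"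
  "\<And>t. t \<in> {a..b} \<Longrightarrow> (Y c has_vector_derivative - \<Gamma> c (snd c (\<gamma> t)) (D t) (Y c t)) (at t within {a..b})"
    by (rule par_seg_same_velocity[OF parallel_along_imp_par_seg[OF C X c(1) sg] parallel_along_imp_par_seg[OF C Y c(1) sg] ab(2)])
     (rule that; assumption)
   interpret L: local_metric "chart_image c" "g c" "\<Gamma> c" by (rule local_metric_chart[OF c(1)])
   have "(f c has_vector_derivative 0) (at t within {a..b})" if t: "t \<in> {a..b}" for t
   proof -
    have "snd c (\<gamma> t) \<in> chart_image c" using im[OF t] unfolding chart_image_def by blast
    from L.metric_along[where c = "\<lambda>t. snd c (\<gamma> t)", OF this D(1)[OF t] D(2)[OF t] D(3)[OF t]]
    show ?thesis unfolding f_def[abs_def] by (simp add: bl)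
   qed
   then obtain k where "\<And>t. t \<in> {a..b} \<Longrightarrow> f c t = k"
    using has_vector_derivative_zero_constant[OF convex_real_interval(5)] by blast
   then have "f c a = f c b" using ab by simp
   moreover have "f c' t = f c t" if "c' \<in> \<A>" "\<gamma> t \<in> fst c'" "t = a \<or> t = b" for c' t
    by (rule indep) (use that ab im c in auto)
   ultimately show ?thesis unfolding R_def by metis
  qed
  then show "\<exists>c\<in>\<A>. \<exists>W. openin (mtop M) W \<and> p \<in> W \<and> W \<subseteq> fst c \<and>
    (\<forall>a b. chart_segment \<gamma> S c a b \<longrightarrow> \<gamma> ` {a..b} \<subseteq> W \<longrightarrow> R a b)"
   using c chart(1)[OF c(1)] by blast
 qed
 then show ?thesis using c c' unfolding R_def f_def by blast
qed

lemma transports_isometry: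
 assumes T: "transports c p c' q P"
 shows "g c' (snd c' q) (P v) (P w) = g c (snd c p) v w" "linear P" "bij P"
proof -
 obtain \<gamma> S where C: "piecewise_C1_curve M \<gamma> S" "\<gamma> 0 = p" "\<gamma> 1 = q"
  and X: "\<And>v. \<exists>X. parallel_along M \<gamma> S X \<and> X c 0 = v \<and> X c' 1 = P v"
  and c: "c \<in> \<A>" "c' \<in> \<A>" "p \<in> fst c" "q \<in> fst c'" using T unfolding transports_def by blast
 show iso: "g c' (snd c' q) (P v) (P w) = g c (snd c p) v w" for v w
  using X[of v] X[of w] parallel_isometry[OF C(1), of _ _ 0 1 c c'] c C by fastforce
 have "snd c p \<in> chart_image c" "snd c' q \<in> chart_image c'" using c unfolding chart_image_def by auto
 from isometry_linear[OF metric_pos[OF c(1) this(1)] metric_pos[OF c(2) this(2)] iso]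
 show "linear P" "bij P" by auto
qed

end

section \<open>Transport between arbitrary points of a connected manifold\<close>

context riem_manifold begin

lemma continuous_\<Gamma>: "c \<in> \<A> \<Longrightarrow> continuous_on (chart_image c) (\<Gamma> c)"
 using smooth_on_continuous[OF local_metric.smooth_\<Gamma>[OF local_metric_chart]] .

lemma openin_chart_preimage:
 assumes c: "c \<in> \<A>" and V: "open V" "V \<subseteq> chart_image c"
 shows "openin (mtop M) {q \<in> fst c. snd c q \<in> V}"
proof -
 have "continuous_map (subtopology (mtop M) (fst c)) (top_of_set (chart_image c)) (snd c)"
  using chart(3)[OF c] homeomorphic_imp_continuous_map by blast
 from openin_continuous_map_preimage[OF this open_openin_trans[OF chart(2)[OF c] V]]
 have "openin (subtopology (mtop M) (fst c)) {q \<in> fst c. snd c q \<in> V}"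
  using chart_subset[OF c] by (simp add: Int_absorb1)
 then show ?thesis using chart(1)[OF c] openin_trans_full by blast
qed

lemma segment_transport:
 assumes c: "c \<in> \<A>" and p: "p \<in> fst c" "q \<in> fst c"
  and seg: "closed_segment (snd c p) (snd c q) \<subseteq> chart_image c"
 shows "\<exists>P. transports c p c q P"
proof -
 define x where "x t = snd c p + t *\<^sub>R (snd c q - snd c p)" for t
 define d where "d = snd c q - snd c p"
 have xc: "x t \<in> chart_image c" if "t \<in> {0..1}" for t
  by (rule subsetD[OF seg]) (use that in \<open>auto simp: x_def closed_segment_def algebra_simps intro!: exI[of _ t]\<close>)
 have xd: "(x has_vector_derivative d) (at t within {0..1})" for t
  unfolding x_def[abs_def] d_def by (auto intro!: derivative_eq_intros)
 define L where "L t = - \<Gamma> c (x t) d" for t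
 have contx: "continuous_on {0..1} x" unfolding x_def by (intro continuous_intros)
 have "continuous_on {0..1} (\<lambda>t. \<Gamma> c (x t))"
  by (rule continuous_on_compose2[OF continuous_\<Gamma>[OF c] contx]) (use xc in auto)
 then have L: "continuous_on {0..1} L" unfolding L_def by (intro continuous_intros)
 obtain K where K: "\<And>t. t \<in> {0..1} \<Longrightarrow> norm (L t) \<le> K"
  using compact_imp_bounded[OF compact_continuous_image[OF L compact_Icc]] unfolding bounded_iff by (metis imageI)
 obtain \<Phi> \<Psi> where \<Phi>: "\<Phi> 0 = id_blinfun"
  "\<And>t. t \<in> {0..1} \<Longrightarrow> (\<Phi> has_vector_derivative (L t o\<^sub>L \<Phi> t)) (at t within {0..1})"
  by (rule fundamental_solution[OF L _ K]) auto
 have "transports c (pt c (x 0)) c (pt c (x 1)) (\<Phi> 1)"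
  by (rule transports_chart[where x = x and D = "\<lambda>_. d" and \<Phi> = \<Phi>, OF c xc xd _ \<Phi>(1)])
   (use \<Phi>(2) in \<open>auto simp: L_def bounded_bilinear.minus_left[OF bounded_bilinear_blinfun_compose]\<close>)
 then show ?thesis using p c by (auto simp: x_def pt_def chart_inv)
qed

text \<open>The points reachable from p form an open and closed set, because any two points of a
  coordinate ball are joined by a segment in it.\<close>

lemma connected_transport:
 assumes conn: "connected_space (mtop M)" and c: "c \<in> \<A>" "p \<in> fst c" and c': "c' \<in> \<A>" "q \<in> fst c'"
 shows "\<exists>P. transports c p c' q P"
proof -
 have loc: "\<exists>d\<in>\<A>. \<exists>W. openin (mtop M) W \<and> r \<in> W \<and> W \<subseteq> fst d \<and> (\<forall>y\<in>W. \<forall>z\<in>W. \<exists>P. transports d y d z P)"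
  if r: "r \<in> topspace (mtop M)" for r
 proof -
  obtain d where d: "d \<in> \<A>" "r \<in> fst d" using chart_cover[OF r] by blast
  have "snd d r \<in> chart_image d" using d unfolding chart_image_def by blast
  then obtain \<epsilon> where e: "\<epsilon> > 0" "ball (snd d r) \<epsilon> \<subseteq> chart_image d"
   using chart(2)[OF d(1)] open_contains_ball by blast
  define W where "W = {y \<in> fst d. snd d y \<in> ball (snd d r) \<epsilon>}"
  have W: "openin (mtop M) W" unfolding W_def by (rule openin_chart_preimage[OF d(1) open_ball e(2)])
  have "\<exists>P. transports d y d z P" if "y \<in> W" "z \<in> W" for y z
   by (rule segment_transport[OF d(1)])
    (use that e(2) closed_segment_subset[OF _ _ convex_ball, of "snd d y" "snd d r" \<epsilon> "snd d z"] in \<open>auto simp: W_def\<close>)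
  moreover have "r \<in> W" "W \<subseteq> fst d" using d e(1) unfolding W_def by auto
  ultimately show ?thesis using d(1) W by blast
 qed
 define T where "T = {r \<in> topspace (mtop M). \<exists>d P. transports c p d r P}"
 have ext: "z \<in> T" if y: "y \<in> T" and W: "d \<in> \<A>" "openin (mtop M) W" "W \<subseteq> fst d"
  "\<forall>y\<in>W. \<forall>z\<in>W. \<exists>P. transports d y d z P" "y \<in> W" "z \<in> W" for y z d W
 proof -
  obtain d' P where "transports c p d' y P" using y unfolding T_def by blast
  from transports_change_end[OF this W(1)] obtain P1 where "transports c p d y P1" using W by blast
  moreover obtain P2 where "transports d y d z P2" using W by blast
  ultimately have "\<exists>P. transports c p d z P" using transports_compose by blast
  then show ?thesis unfolding T_def using W(2,6) openin_subset by blast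
 qed
 have "openin (mtop M) T"
 proof (subst openin_subopen, intro ballI)
  fix y assume y: "y \<in> T"
  then have "y \<in> topspace (mtop M)" unfolding T_def by blast
  from loc[OF this] obtain d W where W: "d \<in> \<A>" "openin (mtop M) W" "y \<in> W" "W \<subseteq> fst d"
   "\<forall>y\<in>W. \<forall>z\<in>W. \<exists>P. transports d y d z P" by blast
  then have "W \<subseteq> T" using ext[OF y W(1,2,4,5,3)] by blast
  then show "\<exists>W. openin (mtop M) W \<and> y \<in> W \<and> W \<subseteq> T" using W by blast
 qed
 moreover have "closedin (mtop M) T" unfolding closedin_def
 proof
  show "openin (mtop M) (topspace (mtop M) - T)"
  proof (subst openin_subopen, intro ballI)
   fix y assume y: "y \<in> topspace (mtop M) - T"
   then have "y \<in> topspace (mtop M)" by blast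
   from loc[OF this] obtain d W where W: "d \<in> \<A>" "openin (mtop M) W" "y \<in> W" "W \<subseteq> fst d"
    "\<forall>y\<in>W. \<forall>z\<in>W. \<exists>P. transports d y d z P" by blast
   then have "W \<subseteq> topspace (mtop M) - T" using ext[OF _ W(1,2,4,5) _ W(3)] y openin_subset[OF W(2)] by blast
   then show "\<exists>W. openin (mtop M) W \<and> y \<in> W \<and> W \<subseteq> topspace (mtop M) - T" using W by blast
  qed
 qed (auto simp: T_def)
 moreover have "p \<in> T"
 proof -
  have p: "p \<in> topspace (mtop M)" using chart_subset c by blast
  from segment_transport[OF c c(2)] have "\<exists>P. transports c p c p P" using c unfolding chart_image_def by simp
  then show ?thesis unfolding T_def using p by blast
 qed
 ultimately have "T = topspace (mtop M)" using conn unfolding connected_space_clopen_in by blast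
 then have "q \<in> T" using chart_subset c' by blast
 then show ?thesis unfolding T_def using transports_change_end c' by blast
qed

end

section \<open>Quaternionic-Kaehler manifolds\<close>

locale qk_manifold = riem_manifold M for M :: "('a, 'e::euclidean_space) riem" +
 fixes Q :: "('a, 'e) chart \<Rightarrow> 'e \<Rightarrow> 'e endo set"
 assumes qk: "quaternionic_kaehler M Q"
begin

lemma local_triple:
 "c \<in> \<A> \<Longrightarrow> x \<in> chart_image c \<Longrightarrow> \<exists>V J1 J2 J3. open V \<and> x \<in> V \<and> V \<subseteq> chart_image c \<and>
  smooth_on J1 V \<and> smooth_on J2 V \<and> smooth_on J3 V \<and>
  (\<forall>y\<in>V. quat_triple (g c y) (Q c y) (J1 y) (J2 y) (J3 y))"
 and nabla_Q: "c \<in> \<A> \<Longrightarrow> open V \<Longrightarrow> V \<subseteq> chart_image c \<Longrightarrow> smooth_on J V \<Longrightarrow> (\<And>y. y \<in> V \<Longrightarrow> J y \<in> Q c y) \<Longrightarrow>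
  x \<in> V \<Longrightarrow> nabla_end M c J x u \<in> Q c x"
 and Q_transition: "c \<in> \<A> \<Longrightarrow> c' \<in> \<A> \<Longrightarrow> x \<in> overlap c c' \<Longrightarrow> Q c' (transition c c' x) =
     {J' :: 'e endo. \<exists>J\<in>Q c x. \<forall>v. J' (jac c c' x v) = jac c c' x (J v)}"
 and dim: "DIM('e) \<ge> 8"
 using qk unfolding quaternionic_kaehler_def by (meson, meson, meson, meson)

lemma local_qk_at:
 assumes c: "c \<in> \<A>" and x: "x \<in> chart_image c"
 obtains V J1 J2 J3 where "x \<in> V" "V \<subseteq> chart_image c" "local_qk V (g c) (\<Gamma> c) J1 J2 J3"
  "\<And>y. y \<in> V \<Longrightarrow> Q c y = span {J1 y, J2 y, J3 y}"
proof -
 obtain V J1 J2 J3 where V: "open V" "x \<in> V" "V \<subseteq> chart_image c"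
  and sm: "smooth_on J1 V" "smooth_on J2 V" "smooth_on J3 V"
  and tr: "\<And>y. y \<in> V \<Longrightarrow> quat_triple (g c y) (Q c y) (J1 y) (J2 y) (J3 y)"
  using local_triple[OF c x] by blast
 have Qs: "Q c y = span {J1 y, J2 y, J3 y}" if "y \<in> V" for y
  using tr[OF that] unfolding quat_triple_def by blast
 interpret C: local_metric "chart_image c" "g c" "\<Gamma> c" by (rule local_metric_chart[OF c])
 have "local_qk V (g c) (\<Gamma> c) J1 J2 J3"
 proof
  show "smooth_on (g c) V" by (rule smooth_on_subset[OF C.smooth_g V(3)])
  show "DIM('e) \<ge> 8" by (rule dim)
  fix x assume x: "x \<in> V"
  show "quat_triple (g c x) (span {J1 x, J2 x, J3 x}) (J1 x) (J2 x) (J3 x)" using tr[OF x] Qs[OF x] by simp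
  fix J u assume J: "smooth_on J V" "\<And>y. y \<in> V \<Longrightarrow> J y \<in> span {J1 y, J2 y, J3 y}"
  have "nabla_end M c J x u \<in> Q c x"
   by (rule nabla_Q[OF c V(1,3) J(1) _ x]) (use J(2) Qs in simp)
  then show "local_metric.nabe (\<Gamma> c) J x u \<in> span {J1 x, J2 x, J3 x}"
   unfolding Qs[OF x] C.nabe_def nabla_end_def .
 qed (use V sm C.g_sym C.g_pos C.\<Gamma>_sym C.\<Gamma>_metric in auto)
 then show ?thesis using that V Qs by blast
qed

text \<open>\<open>Q_transition\<close> finds a preimage for an element in the target chart; with
  the charts exchanged it finds an image.\<close>

lemma Q_change:
 assumes c: "c \<in> \<A>" "c' \<in> \<A>" and p: "p \<in> fst c" "p \<in> fst c'" and J: "J \<in> Q c (snd c p)"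
 shows "\<exists>J'\<in>Q c' (snd c' p). \<forall>v. J' (jac c c' (snd c p) v) = jac c c' (snd c p) (J v)"
proof -
 have "Q c (transition c' c (snd c' p)) =
     {J :: 'e endo. \<exists>J'\<in>Q c' (snd c' p). \<forall>v. J (jac c' c (snd c' p) v) = jac c' c (snd c' p) (J' v)}"
  by (rule Q_transition[OF c(2,1) overlapI[OF p(2,1)]])
 then obtain J' where J': "J' \<in> Q c' (snd c' p)" "\<And>v. J (jac c' c (snd c' p) v) = jac c' c (snd c' p) (J' v)"
  using J by (auto simp: transition_chart[OF c(2) p(2)])
 have "J' (jac c c' (snd c p) v) = jac c c' (snd c p) (J v)" for v
  using J'(2)[of "jac c c' (snd c p) v"] by (simp add: jac_inverse c p)
 then show ?thesis using J'(1) by blast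
qed

text \<open>An element J of Q can be recovered from the parallel tensor m, since m e (J e) z = |e|^2
  J z. As m of parallel fields is parallel, the same expression at the other end defines an element
  of Q there.\<close>

lemma transports_Q:
 assumes T: "transports c p c' q P" and J: "J \<in> Q c (snd c p)"
 shows "\<exists>J'\<in>Q c' (snd c' q). \<forall>v. J' (P v) = P (J v)"
proof -
 obtain \<gamma> S where C: "piecewise_C1_curve M \<gamma> S" "\<gamma> 0 = p" "\<gamma> 1 = q"
  and "\<And>v. \<exists>X. parallel_along M \<gamma> S X \<and> X c 0 = v \<and> X c' 1 = P v"
  and c: "c \<in> \<A>" "c' \<in> \<A>" "p \<in> fst c" "q \<in> fst c'" using T unfolding transports_def by blast
 then obtain X where X: "\<And>v. parallel_along M \<gamma> S (X v)" "\<And>v. X v c 0 = v" "\<And>v. X v c' 1 = P v" by metis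
 have path: "pathin (mtop M) \<gamma>" and fin: "finite S" using C unfolding piecewise_C1_curve_def by blast+
 have top: "\<gamma> t \<in> topspace (mtop M)" if "t \<in> {0..1}" for t
  using path that unfolding pathin_def continuous_map_def by auto
 have surj: "\<exists>v. X v d t = w" if "d \<in> \<A>" "t \<in> {0..1}" "\<gamma> t \<in> fst d" for d t w
 proof -
  have "snd c p \<in> chart_image c" "snd d (\<gamma> t) \<in> chart_image d" using c that unfolding chart_image_def by auto
  note im = this
  have iso: "g d (snd d (\<gamma> t)) (X v d t) (X w d t) = g c (snd c p) v w" for v w
   using parallel_isometry[OF C(1) X(1) X(1), of 0 t c d] that c C X(2) by auto
  have "bij (\<lambda>v. X v d t)"
   by (rule isometry_linear(2)[OF metric_pos[OF c(1) im(1)] metric_pos[OF that(1) im(2)] iso])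
  then show ?thesis by (metis bij_pointE)
 qed
 \<comment> \<open>Phrased by inner products of the parallel fields, with a chart at either end; in
   this form the relation is transitive without inverting transports.\<close>
 define E where "E d s d' t \<longleftrightarrow> (\<forall>J\<in>Q d (snd d (\<gamma> s)). \<exists>J'\<in>Q d' (snd d' (\<gamma> t)). \<forall>v w.
  g d' (snd d' (\<gamma> t)) (J' (X v d' t)) (X w d' t) = g d (snd d (\<gamma> s)) (J (X v d s)) (X w d s))" for d s d' t
 have E_trans: "E d s d'' r" if "E d s d' t" "E d' t d'' r" for d s d' t d'' r
  using that unfolding E_def by metis
 have E_change: "E d t d' t" if "d \<in> \<A>" "d' \<in> \<A>" "t \<in> {0..1}" "\<gamma> t \<in> fst d" "\<gamma> t \<in> fst d'" for d d' t
  unfolding E_def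
 proof
  fix J assume "J \<in> Q d (snd d (\<gamma> t))"
  from Q_change[OF that(1,2,4,5) this] obtain J' where J': "J' \<in> Q d' (snd d' (\<gamma> t))"
   "\<And>v. J' (jac d d' (snd d (\<gamma> t)) v) = jac d d' (snd d (\<gamma> t)) (J v)" by blast
  have co: "X v d' t = jac d d' (snd d (\<gamma> t)) (X v d t)" for v
   using coherentD[OF parallel_coherent[OF X(1)] that(1,2)] that by simp
  show "\<exists>J'\<in>Q d' (snd d' (\<gamma> t)). \<forall>v w.
  g d' (snd d' (\<gamma> t)) (J' (X v d' t)) (X w d' t) = g d (snd d (\<gamma> t)) (J (X v d t)) (X w d t)"
   by (intro bexI[OF _ J'(1)]) (simp add: co J'(2) metric_jac that)
 qed
 define D where "D s t \<longleftrightarrow> (\<forall>d\<in>\<A>. \<forall>d'\<in>\<A>. \<gamma> s \<in> fst d \<longrightarrow> \<gamma> t \<in> fst d' \<longrightarrow> E d s d' t)" for s t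
 define R where "R s t \<longleftrightarrow> D s t \<and> D t s" for s t
 have DI: "D s t" if "d \<in> \<A>" "s \<in> {0..1}" "t \<in> {0..1}" "\<gamma> s \<in> fst d" "\<gamma> t \<in> fst d" "E d s d t" for d s t
  unfolding D_def
 proof (intro ballI impI)
  fix d1 d2 assume "d1 \<in> \<A>" "d2 \<in> \<A>" "\<gamma> s \<in> fst d1" "\<gamma> t \<in> fst d2"
  then show "E d1 s d2 t" using E_trans[OF E_trans[OF E_change that(6)] E_change] that by blast
 qed
 have "R 0 1"
 proof (rule curve_local_to_global[OF path fin])
  show "R t t" if "t \<in> {0..1}" for t unfolding R_def D_def using E_change that by blast
  show "R t s" if "R s t" for s t using that unfolding R_def by blast
  show "R s r" if "R s t" "R t r" "t \<in> {0..1}" for s t r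
   using that chart_cover[OF top[OF that(3)]] E_trans unfolding R_def D_def by meson
  fix p assume p: "p \<in> topspace (mtop M)"
  obtain d where d: "d \<in> \<A>" "p \<in> fst d" using chart_cover[OF p] by blast
  then have "snd d p \<in> chart_image d" unfolding chart_image_def by blast
  from local_qk_at[OF d(1) this] obtain V J1 J2 J3 where V: "snd d p \<in> V" "V \<subseteq> chart_image d"
   and lq: "local_qk V (g d) (\<Gamma> d) J1 J2 J3" and QV: "\<And>y. y \<in> V \<Longrightarrow> Q d y = span {J1 y, J2 y, J3 y}" by blast
  interpret L: local_qk V "g d" "\<Gamma> d" J1 J2 J3 by (rule lq)
  define W where "W = {q \<in> fst d. snd d q \<in> V}"
  have W: "openin (mtop M) W" unfolding W_def by (rule openin_chart_preimage[OF d(1) L.open_S V(2)])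
  have "R a b" if sg: "chart_segment \<gamma> S d a b" and im: "\<gamma> ` {a..b} \<subseteq> W" for a b
  proof -
   have ab: "0 \<le> a" "a < b" "b \<le> 1" using sg unfolding chart_segment_def by auto
   have xV: "snd d (\<gamma> t) \<in> V" "\<gamma> t \<in> fst d" if "t \<in> {a..b}" for t using im that unfolding W_def image_subset_iff by auto
   define G where "G v w z y t = g d (snd d (\<gamma> t)) (L.m (snd d (\<gamma> t)) (X v d t) (X w d t) (X z d t)) (X y d t)" for v w z y t
   have G: "G v w z y s = G v w z y t" if "s \<in> {a..b}" "t \<in> {a..b}" for v w z y s t
   proof -
    note seg = parallel_along_imp_par_seg[OF C(1) X(1) d(1) sg]
    obtain D where D: "\<And>t. t \<in> {a..b} \<Longrightarrow> ((\<lambda>t. snd d (\<gamma> t)) has_vector_derivative D t) (at t within {a..b})"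
     using seg[of v] unfolding par_seg_def by blast
    have DX: "(X u d has_vector_derivative - \<Gamma> d (snd d (\<gamma> t)) (D t) (X u d t)) (at t within {a..b})" if t: "t \<in> {a..b}" for u t
    proof -
     obtain D' where D': "((\<lambda>t. snd d (\<gamma> t)) has_vector_derivative D' t) (at t within {a..b})"
      "(X u d has_vector_derivative - \<Gamma> d (snd d (\<gamma> t)) (D' t) (X u d t)) (at t within {a..b})"
      using seg[of u] t unfolding par_seg_def by blast
     then show ?thesis
      using vector_derivative_unique_within[OF at_within_Icc_nontrivial[OF ab(2) t] D'(1) D[OF t]] by simp
    qed
    have "(G v w z y has_vector_derivative 0) (at t within {a..b})" if t: "t \<in> {a..b}" for t
    proof -
     note x = xV(1)[OF t] D[OF t]
     have "((\<lambda>t. L.m (snd d (\<gamma> t)) (X v d t) (X w d t) (X z d t)) has_vector_derivative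
      - \<Gamma> d (snd d (\<gamma> t)) (D t) (L.m (snd d (\<gamma> t)) (X v d t) (X w d t) (X z d t))) (at t within {a..b})"
      using L.m_along[where c = "\<lambda>t. snd d (\<gamma> t)", OF x DX[OF t] DX[OF t] DX[OF t], of v w z]
      by (simp add: L.m_def bl)
     from L.metric_along[where c = "\<lambda>t. snd d (\<gamma> t)", OF x this DX[OF t]]
     show ?thesis unfolding G_def[abs_def] by (simp add: bl)
    qed
    then obtain k where "\<And>t. t \<in> {a..b} \<Longrightarrow> G v w z y t = k"
     using has_vector_derivative_zero_constant[OF convex_real_interval(5)] by blast
    then show ?thesis using that by simp
   qed
   have E: "E d s d t" if st: "s \<in> {a..b}" "t \<in> {a..b}" for s t
    unfolding E_def
   proof
    let ?x = "snd d (\<gamma> s)" and ?y = "snd d (\<gamma> t)"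
    interpret q: quat_hermitian "g d ?x" "J1 ?x" "J2 ?x" "J3 ?x" by (rule L.qh[OF xV(1)[OF st(1)]])
    fix J assume "J \<in> Q d ?x"
    then obtain a1 a2 a3 where J: "J = q.ims a1 a2 a3" unfolding QV[OF xV(1)[OF st(1)]] q.span_J by blast
    obtain e :: 'e where e: "e \<noteq> 0" by (rule L.nonzero_vector)
    have s01: "s \<in> {0..1}" using st ab by auto
    \<comment> \<open>The parallel fields through e and J e at time s; their inner products at time
      t give the coefficients of the transported element.\<close>
    obtain v0 v1 where v: "X v0 d s = e" "X v1 d s = J e" using surj[OF d(1) s01 xV(2)[OF st(1)]] by metis
    define k where "k = g d ?x e e"
    have k: "k > 0" unfolding k_def by (rule q.pos[OF e])
    define a where "a i = g d ?y (i (X v0 d t)) (X v1 d t) / k" for i :: "'e endo"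
    let ?J' = "a (J1 ?y) *\<^sub>R J1 ?y + a (J2 ?y) *\<^sub>R J2 ?y + a (J3 ?y) *\<^sub>R J3 ?y"
    have "?J' \<in> Q d ?y" unfolding QV[OF xV(1)[OF st(2)]]
     by (intro span_add span_scale span_base) auto
    moreover have "g d ?y (?J' (X z d t)) (X y d t) = g d ?x (J (X z d s)) (X y d s)" for z y
    proof -
     have "k * g d ?y (?J' (X z d t)) (X y d t) = G v0 v1 z y t"
      unfolding G_def L.m_def a_def using k by (simp add: bl distrib_left)
     also have "\<dots> = G v0 v1 z y s" by (rule G[OF st(2,1)])
     also have "\<dots> = k * g d ?x (J (X z d s)) (X y d s)"
      unfolding G_def L.m_def v J k_def by (simp add: q.ims_apply bl q.J_simps q.J_isom algebra_simps)
     finally show ?thesis using k by simp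
    qed
    ultimately show "\<exists>J'\<in>Q d ?y. \<forall>v w. g d ?y (J' (X v d t)) (X w d t) = g d ?x (J (X v d s)) (X w d s)" by blast
   qed
   show ?thesis unfolding R_def using DI[OF d(1) _ _ xV(2) xV(2) E] ab by auto
  qed
  then show "\<exists>c\<in>\<A>. \<exists>W. openin (mtop M) W \<and> p \<in> W \<and> W \<subseteq> fst c \<and>
    (\<forall>a b. chart_segment \<gamma> S c a b \<longrightarrow> \<gamma> ` {a..b} \<subseteq> W \<longrightarrow> R a b)"
   using d V W by (intro bexI[OF _ d(1)] exI[of _ W]) (auto simp: W_def)
 qed auto
 then obtain J' where J': "J' \<in> Q c' (snd c' q)" "\<And>v w. g c' (snd c' q) (J' (P v)) (P w) = g c (snd c p) (J v) w"
  using J c C X unfolding R_def D_def E_def by fastforce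
 interpret L: local_metric "chart_image c'" "g c'" "\<Gamma> c'" by (rule local_metric_chart[OF c(2)])
 have "J' (P v) = P (J v)" for v
 proof (rule L.g_nondegenerate)
  show "snd c' q \<in> chart_image c'" using c unfolding chart_image_def by blast
  fix w
  obtain w' where "w = P w'" using transports_isometry(3)[OF T] by (metis bij_pointE)
  then show "g c' (snd c' q) (J' (P v)) w = g c' (snd c' q) (P (J v)) w"
   using J'(2) transports_isometry(1)[OF T] by simp
 qed
 then show ?thesis using J'(1) by blast
qed

end

section \<open>Second order expansions of parallel transport\<close>

text \<open>The expansion a + s b + s^2 c + o(s^2). The limit ignores s = 0, whence the extra
  hypothesis in \<open>taylor2D\<close>.\<close>

definition taylor2 :: "(real \<Rightarrow> 'v::real_normed_vector) \<Rightarrow> 'v \<Rightarrow> 'v \<Rightarrow> 'v \<Rightarrow> bool" where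
 "taylor2 F a b c \<longleftrightarrow> ((\<lambda>s. (1 / s\<^sup>2) *\<^sub>R (F s - (a + s *\<^sub>R b + s\<^sup>2 *\<^sub>R c))) \<longlongrightarrow> 0) (at 0)"

lemma (in bounded_bilinear) taylor2:
 assumes "taylor2 F a b c" "taylor2 G a' b' c'"
 shows "taylor2 (\<lambda>s. prod (F s) (G s)) (prod a a') (prod a b' + prod b a') (prod a c' + prod b b' + prod c a')"
proof -
 define RF where "RF s = (1 / s\<^sup>2) *\<^sub>R (F s - (a + s *\<^sub>R b + s\<^sup>2 *\<^sub>R c))" for s
 define RG where "RG s = (1 / s\<^sup>2) *\<^sub>R (G s - (a' + s *\<^sub>R b' + s\<^sup>2 *\<^sub>R c'))" for s
 define TF where "TF s = a + s *\<^sub>R b + s\<^sup>2 *\<^sub>R c" for s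
 define TG where "TG s = a' + s *\<^sub>R b' + s\<^sup>2 *\<^sub>R c'" for s
 have T: "(TF \<longlongrightarrow> a) (at 0)" "(TG \<longlongrightarrow> a') (at 0)"
  unfolding TF_def TG_def by (auto intro!: tendsto_eq_intros)
 have lim: "((\<lambda>s. s *\<^sub>R (prod b c' + prod c b') + s\<^sup>2 *\<^sub>R prod c c' + prod (RF s) (TG s) + prod (TF s) (RG s)
   + s\<^sup>2 *\<^sub>R prod (RF s) (RG s)) \<longlongrightarrow> 0 *\<^sub>R (prod b c' + prod c b') + 0\<^sup>2 *\<^sub>R prod c c' + prod 0 a' + prod a 0 + 0\<^sup>2 *\<^sub>R prod 0 0) (at 0)"
  by (intro tendsto_add tendsto_scaleR tendsto_power tendsto_ident_at tendsto_const tendsto T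
    assms[unfolded taylor2_def, folded RF_def RG_def])
 have eq: "s *\<^sub>R (prod b c' + prod c b') + s\<^sup>2 *\<^sub>R prod c c' + prod (RF s) (TG s) + prod (TF s) (RG s)
   + s\<^sup>2 *\<^sub>R prod (RF s) (RG s) =
  (1 / s\<^sup>2) *\<^sub>R (prod (F s) (G s) - (prod a a' + s *\<^sub>R (prod a b' + prod b a') + s\<^sup>2 *\<^sub>R (prod a c' + prod b b' + prod c a')))"
  if s: "s \<noteq> 0" for s
 proof -
  have F: "F s = TF s + s\<^sup>2 *\<^sub>R RF s" and G: "G s = TG s + s\<^sup>2 *\<^sub>R RG s"
   unfolding RF_def RG_def TF_def TG_def using s by simp_all
  have "prod (TF s) (TG s) = prod a a' + s *\<^sub>R (prod a b' + prod b a') + s\<^sup>2 *\<^sub>R (prod a c' + prod b b' + prod c a')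
    + s\<^sup>2 *\<^sub>R (s *\<^sub>R (prod b c' + prod c b') + s\<^sup>2 *\<^sub>R prod c c')"
   unfolding TF_def TG_def by (simp add: add_left add_right scaleR_left scaleR_right algebra_simps power2_eq_square)
  then have "prod (F s) (G s) - (prod a a' + s *\<^sub>R (prod a b' + prod b a') + s\<^sup>2 *\<^sub>R (prod a c' + prod b b' + prod c a'))
   = s\<^sup>2 *\<^sub>R (s *\<^sub>R (prod b c' + prod c b') + s\<^sup>2 *\<^sub>R prod c c' + prod (RF s) (TG s) + prod (TF s) (RG s)
   + s\<^sup>2 *\<^sub>R prod (RF s) (RG s))"
   unfolding F G by (simp add: add_left add_right scaleR_left scaleR_right scaleR_add_right)
  then show ?thesis using s by simp
 qed
 have "eventually (\<lambda>s::real. s \<noteq> 0) (at 0)" by (simp add: eventually_at_filter)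
 then have "\<forall>\<^sub>F s in at 0. s *\<^sub>R (prod b c' + prod c b') + s\<^sup>2 *\<^sub>R prod c c' + prod (RF s) (TG s) + prod (TF s) (RG s)
   + s\<^sup>2 *\<^sub>R prod (RF s) (RG s) =
  (1 / s\<^sup>2) *\<^sub>R (prod (F s) (G s) - (prod a a' + s *\<^sub>R (prod a b' + prod b a') + s\<^sup>2 *\<^sub>R (prod a c' + prod b b' + prod c a')))"
  by eventually_elim (rule eq)
 from Lim_transform_eventually[OF lim this] show ?thesis unfolding taylor2_def by (simp only: zero_left zero_right) simp
qed

lemmas taylor2_compose = bounded_bilinear.taylor2[OF bounded_bilinear_blinfun_compose]

lemma dist_rescale: "dist ((1 / s\<^sup>2) *\<^sub>R x) 0 = norm x / s\<^sup>2" for s :: real and x :: "'v::real_normed_vector"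
 by (simp add: dist_norm)

lemma taylor2I:
 assumes "\<And>\<epsilon>. \<epsilon> > 0 \<Longrightarrow> \<exists>\<eta>>0. \<forall>s. \<bar>s\<bar> < \<eta> \<longrightarrow> norm (F s - (a + s *\<^sub>R b + s\<^sup>2 *\<^sub>R c)) \<le> \<epsilon> * s\<^sup>2"
 shows "taylor2 F a b c"
 unfolding taylor2_def LIM_def
proof (intro allI impI)
 fix r :: real assume r: "0 < r"
 obtain \<eta> where e: "\<eta> > 0" "\<And>s. \<bar>s\<bar> < \<eta> \<Longrightarrow> norm (F s - (a + s *\<^sub>R b + s\<^sup>2 *\<^sub>R c)) \<le> r / 2 * s\<^sup>2" using assms[of "r / 2"] r by auto
 have "dist ((1 / s\<^sup>2) *\<^sub>R (F s - (a + s *\<^sub>R b + s\<^sup>2 *\<^sub>R c))) 0 < r" if "s \<noteq> 0" "dist s 0 < \<eta>" for s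
 proof -
  have "norm (F s - (a + s *\<^sub>R b + s\<^sup>2 *\<^sub>R c)) / s\<^sup>2 \<le> r / 2" using e(2)[of s] that by (simp add: pos_divide_le_eq)
  then show ?thesis using r unfolding dist_rescale by linarith
 qed
 then show "\<exists>d>0. \<forall>s. s \<noteq> 0 \<and> dist s 0 < d \<longrightarrow> dist ((1 / s\<^sup>2) *\<^sub>R (F s - (a + s *\<^sub>R b + s\<^sup>2 *\<^sub>R c))) 0 < r"
  using e(1) by blast
qed

lemma taylor2D:
 assumes "taylor2 F a b c" "\<epsilon> > 0" and 0: "F 0 = a"
 shows "\<exists>\<eta>>0. \<forall>s. \<bar>s\<bar> < \<eta> \<longrightarrow> norm (F s - (a + s *\<^sub>R b + s\<^sup>2 *\<^sub>R c)) \<le> \<epsilon> * s\<^sup>2"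
proof -
 obtain \<eta> where e: "\<eta> > 0" "\<And>s. s \<noteq> 0 \<Longrightarrow> dist s 0 < \<eta> \<Longrightarrow> dist ((1 / s\<^sup>2) *\<^sub>R (F s - (a + s *\<^sub>R b + s\<^sup>2 *\<^sub>R c))) 0 < \<epsilon>"
  using assms(1,2) unfolding taylor2_def LIM_def by blast
 have "norm (F s - (a + s *\<^sub>R b + s\<^sup>2 *\<^sub>R c)) \<le> \<epsilon> * s\<^sup>2" if "\<bar>s\<bar> < \<eta>" for s
 proof (cases "s = 0")
  case False
  then have "norm (F s - (a + s *\<^sub>R b + s\<^sup>2 *\<^sub>R c)) / s\<^sup>2 < \<epsilon>" using e(2)[of s] that unfolding dist_rescale by simp
  then show ?thesis using False by (simp add: pos_divide_less_eq)
 qed (simp add: 0)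
 then show ?thesis using e(1) by blast
qed

definition time_one :: "(real \<Rightarrow> 'e::euclidean_space endo) \<Rightarrow> 'e endo \<Rightarrow> bool" where
 "time_one L A \<longleftrightarrow> (\<exists>\<Phi>. \<Phi> 0 = id_blinfun \<and> \<Phi> 1 = A \<and>
  (\<forall>r\<in>{0..1}. (\<Phi> has_vector_derivative (L r o\<^sub>L \<Phi> r)) (at r within {0..1})))"

lemma mean_value_unit:
 fixes f :: "real \<Rightarrow> 'b::real_normed_vector"
 assumes f: "\<And>t. t \<in> {0..1} \<Longrightarrow> (f has_vector_derivative f' t) (at t within {0..1})"
  and B: "\<And>t. t \<in> {0..1} \<Longrightarrow> norm (f' t - c) \<le> B" and r: "r \<in> {0..1}"
 shows "norm (f r - f 0 - r *\<^sub>R c) \<le> B"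
proof -
 have "norm (f r - f 0 - (r - 0) *\<^sub>R c) \<le> (r - 0) * B"
 proof (rule mean_value_bound)
  fix t assume t: "t \<in> {0..r}"
  then have t1: "t \<in> {0..1}" using r by auto
  show "(f has_vector_derivative f' t) (at t within {0..r})"
   by (rule has_vector_derivative_within_subset[OF f[OF t1]]) (use r in auto)
  show "norm (f' t - c) \<le> B" by (rule B[OF t1])
 qed (use r in simp)
 also have "\<dots> \<le> B" using r order_trans[OF norm_ge_zero B[OF r]] mult_right_mono[of r 1 B] by simp
 finally show ?thesis by simp
qed

lemma blinfun_compose_id: "f o\<^sub>L id_blinfun = f" "id_blinfun o\<^sub>L f = f"
 by (rule blinfun_eqI; simp)+

text \<open>The parameter s scales the generator while time stays in the unit interval. For the
  generator s B + s^2 (C + r D) + o(s^2) the first integral gives s B + s^2 (C + D/2), and the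
  iterated integral adds s^2 B^2 / 2.\<close>

lemma time_one_family:
 fixes M :: "real \<Rightarrow> real \<Rightarrow> 'e::euclidean_space endo"
 assumes d: "\<delta> > 0" and M: "continuous_on ({-\<delta>..\<delta>} \<times> {0..1}) (\<lambda>z. M (fst z) (snd z))"
 obtains F where "\<And>s. s \<in> {-\<delta>..\<delta>} \<Longrightarrow> time_one (M s) (F s)" "continuous_on {-\<delta>..\<delta>} F"
  "\<And>B C D. (\<And>\<epsilon>. \<epsilon> > 0 \<Longrightarrow> \<exists>\<eta>>0. \<forall>s. \<bar>s\<bar> < \<eta> \<longrightarrow> (\<forall>r\<in>{0..1}. norm (M s r - (s *\<^sub>R B + s\<^sup>2 *\<^sub>R (C + r *\<^sub>R D))) \<le> \<epsilon> * s\<^sup>2)) \<Longrightarrow>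
   taylor2 F id_blinfun B (C + (1/2) *\<^sub>R D + (1/2) *\<^sub>R (B o\<^sub>L B))"
proof -
 let ?I = "{-\<delta>..\<delta>} \<times> {0..1::real}"
 note bb = bounded_bilinear_blinfun_compose
 have comp: "compact ?I" by (intro compact_Times compact_Icc)
 obtain K where K: "\<And>s r. s \<in> {-\<delta>..\<delta>} \<Longrightarrow> r \<in> {0..1} \<Longrightarrow> norm (M s r) \<le> K"
  using compact_imp_bounded[OF compact_continuous_image[OF M comp]] unfolding bounded_iff by fastforce
 have cM: "continuous_on {0..1} (M s)" if "s \<in> {-\<delta>..\<delta>}" for s
 proof -
  have "continuous_on {0..1} (\<lambda>r. (s, r))" by (intro continuous_intros)
  from continuous_on_compose2[OF M this] show ?thesis using that by (simp add: image_subset_iff)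
 qed
 define G where "G s \<Phi> \<Psi> \<longleftrightarrow> \<Phi> 0 = id_blinfun \<and> \<Psi> 0 = id_blinfun \<and>
  (\<forall>t\<in>{0..1}. (\<Phi> has_vector_derivative (M s t o\<^sub>L \<Phi> t)) (at t within {0..1}) \<and>
   (\<Psi> has_vector_derivative - (\<Psi> t o\<^sub>L M s t)) (at t within {0..1}) \<and>
   \<Psi> t o\<^sub>L \<Phi> t = id_blinfun \<and> \<Phi> t o\<^sub>L \<Psi> t = id_blinfun \<and> norm (\<Phi> t) \<le> exp K \<and> norm (\<Psi> t) \<le> exp K)" for s \<Phi> \<Psi>
 have "\<exists>\<Phi> \<Psi>. G s \<Phi> \<Psi>"
  if s: "s \<in> {-\<delta>..\<delta>}" for s
 proof -
  obtain \<Phi> \<Psi> where *: "\<Phi> 0 = id_blinfun" "\<Psi> 0 = id_blinfun"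
  "\<And>t. t \<in> {0..1} \<Longrightarrow> (\<Phi> has_vector_derivative (M s t o\<^sub>L \<Phi> t)) (at t within {0..1})"
  "\<And>t. t \<in> {0..1} \<Longrightarrow> (\<Psi> has_vector_derivative - (\<Psi> t o\<^sub>L M s t)) (at t within {0..1})"
  "\<And>t. t \<in> {0..1} \<Longrightarrow> \<Psi> t o\<^sub>L \<Phi> t = id_blinfun" "\<And>t. t \<in> {0..1} \<Longrightarrow> \<Phi> t o\<^sub>L \<Psi> t = id_blinfun"
  "\<And>t. t \<in> {0..1} \<Longrightarrow> norm (\<Phi> t) \<le> exp (K * 1)" "\<And>t. t \<in> {0..1} \<Longrightarrow> norm (\<Psi> t) \<le> exp (K * 1)"
   by (rule fundamental_solution[OF cM[OF s] zero_le_one K[OF s]]) (assumption, (rule that; assumption))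
  then show ?thesis unfolding G_def by (intro exI[of _ \<Phi>] exI[of _ \<Psi>]) auto
 qed
 then obtain \<Phi> \<Psi> where G: "\<And>s. s \<in> {-\<delta>..\<delta>} \<Longrightarrow> G s (\<Phi> s) (\<Psi> s)" by metis
 have \<Phi>0: "\<And>s. s \<in> {-\<delta>..\<delta>} \<Longrightarrow> \<Phi> s 0 = id_blinfun" and \<Psi>0: "\<And>s. s \<in> {-\<delta>..\<delta>} \<Longrightarrow> \<Psi> s 0 = id_blinfun"
  and \<Phi>: "\<And>s t. s \<in> {-\<delta>..\<delta>} \<Longrightarrow> t \<in> {0..1} \<Longrightarrow> (\<Phi> s has_vector_derivative (M s t o\<^sub>L \<Phi> s t)) (at t within {0..1})"
  and \<Psi>: "\<And>s t. s \<in> {-\<delta>..\<delta>} \<Longrightarrow> t \<in> {0..1} \<Longrightarrow> (\<Psi> s has_vector_derivative - (\<Psi> s t o\<^sub>L M s t)) (at t within {0..1})"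
  and \<Phi>\<Psi>: "\<And>s t. s \<in> {-\<delta>..\<delta>} \<Longrightarrow> t \<in> {0..1} \<Longrightarrow> \<Phi> s t o\<^sub>L \<Psi> s t = id_blinfun"
  and nrm: "\<And>s t. s \<in> {-\<delta>..\<delta>} \<Longrightarrow> t \<in> {0..1} \<Longrightarrow> norm (\<Phi> s t) \<le> exp K"
   "\<And>s t. s \<in> {-\<delta>..\<delta>} \<Longrightarrow> t \<in> {0..1} \<Longrightarrow> norm (\<Psi> s t) \<le> exp K" using G unfolding G_def by blast+
 define F where "F s = \<Phi> s 1" for s
 have ncomp: "norm (x o\<^sub>L y) \<le> a * b" if "norm x \<le> a" "norm y \<le> b" for x y :: "'e endo" and a b
 proof -
  have "norm (x o\<^sub>L y) \<le> norm x * norm y" by (rule norm_blinfun_compose)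
  also have "\<dots> \<le> a * b" using that norm_ge_zero order_trans by (intro mult_mono) blast+
  finally show ?thesis .
 qed
 have "time_one (M s) (F s)" if "s \<in> {-\<delta>..\<delta>}" for s
  unfolding time_one_def F_def by (rule exI[of _ "\<Phi> s"]) (use \<Phi>0 \<Phi> that in auto)
 moreover have "continuous_on {-\<delta>..\<delta>} F"
  unfolding continuous_on_iff
 proof (intro ballI allI impI)
  fix s :: real and \<epsilon> :: real assume s: "s \<in> {-\<delta>..\<delta>}" and e: "\<epsilon> > 0"
  define k where "k = exp K * (exp K * exp K) + 1"
  have k: "k > 0" unfolding k_def by (simp add: add_pos_pos)
  have uc: "uniformly_continuous_on ?I (\<lambda>z. M (fst z) (snd z))" by (rule compact_uniformly_continuous[OF M comp])
  have "0 < \<epsilon> / k" using e k by simp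
  then obtain \<eta> where eta: "\<eta> > 0" "\<And>z z'. z \<in> ?I \<Longrightarrow> z' \<in> ?I \<Longrightarrow> dist z' z < \<eta> \<Longrightarrow>
    dist (M (fst z') (snd z')) (M (fst z) (snd z)) < \<epsilon> / k"
   using uc unfolding uniformly_continuous_on_def by meson
  have "dist (F s') (F s) < \<epsilon>" if s': "s' \<in> {-\<delta>..\<delta>}" "dist s' s < \<eta>" for s'
  proof -
   have Md: "norm (M s' r - M s r) \<le> \<epsilon> / k" if "r \<in> {0..1}" for r
    using eta(2)[of "(s, r)" "(s', r)"] s s' that by (simp add: dist_Pair_Pair dist_norm)
   \<comment> \<open>Variation of constants: the derivative contains only the difference of the two
     generators.\<close>
   have der: "((\<lambda>r. \<Psi> s r o\<^sub>L \<Phi> s' r) has_vector_derivative (\<Psi> s r o\<^sub>L ((M s' r - M s r) o\<^sub>L \<Phi> s' r))) (at r within {0..1})"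
    if r: "r \<in> {0..1}" for r
    by (rule has_vector_derivative_eq_rhs[OF bounded_bilinear.has_vector_derivative[OF bb \<Psi>[OF s r] \<Phi>[OF s'(1) r]]],
     rule blinfun_eqI) (simp add: blinfun.bilinear_simps)
   have "norm ((\<Psi> s 1 o\<^sub>L \<Phi> s' 1) - (\<Psi> s 0 o\<^sub>L \<Phi> s' 0) - 1 *\<^sub>R 0) \<le> exp K * (\<epsilon> / k * exp K)"
   proof (rule mean_value_unit[OF der])
    fix t :: real assume t: "t \<in> {0..1}"
    show "norm ((\<Psi> s t o\<^sub>L ((M s' t - M s t) o\<^sub>L \<Phi> s' t)) - 0) \<le> exp K * (\<epsilon> / k * exp K)"
     unfolding diff_zero by (intro ncomp nrm Md s s' t)
   qed auto
   then have 1: "norm ((\<Psi> s 1 o\<^sub>L \<Phi> s' 1) - id_blinfun) \<le> exp K * (\<epsilon> / k * exp K)"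
    using \<Phi>0[OF s'(1)] \<Psi>0[OF s] by (simp add: blinfun_compose_id)
   have "F s' - F s = \<Phi> s 1 o\<^sub>L ((\<Psi> s 1 o\<^sub>L \<Phi> s' 1) - id_blinfun)"
   proof (rule blinfun_eqI)
    fix v
    have "\<Phi> s 1 (\<Psi> s 1 w) = w" for w using \<Phi>\<Psi>[OF s, of 1] by (metis atLeastAtMost_iff blinfun_apply_blinfun_compose id_blinfun.rep_eq id_apply order_refl zero_le_one)
    then show "(F s' - F s) v = (\<Phi> s 1 o\<^sub>L ((\<Psi> s 1 o\<^sub>L \<Phi> s' 1) - id_blinfun)) v"
     by (simp add: F_def blinfun.bilinear_simps)
   qed
   also have "norm \<dots> \<le> exp K * (exp K * (\<epsilon> / k * exp K))" by (intro ncomp nrm 1 s) auto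
   also have "\<dots> = (k - 1) * \<epsilon> / k" unfolding k_def by simp
   also have "\<dots> < \<epsilon>" using e k by (simp add: field_simps)
   finally show ?thesis by (simp add: dist_norm)
  qed
  then show "\<exists>d>0. \<forall>x'\<in>{-\<delta>..\<delta>}. dist x' s < d \<longrightarrow> dist (F x') (F s) < \<epsilon>" using eta(1) by blast
 qed
 moreover have "taylor2 F id_blinfun B (C + (1/2) *\<^sub>R D + (1/2) *\<^sub>R (B o\<^sub>L B))"
  if H: "\<And>\<epsilon>. \<epsilon> > 0 \<Longrightarrow> \<exists>\<eta>>0. \<forall>s. \<bar>s\<bar> < \<eta> \<longrightarrow> (\<forall>r\<in>{0..1}. norm (M s r - (s *\<^sub>R B + s\<^sup>2 *\<^sub>R (C + r *\<^sub>R D))) \<le> \<epsilon> * s\<^sup>2)" for B C D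
 proof (rule taylor2I)
  fix \<epsilon> :: real assume e: "\<epsilon> > 0"
  define E where "E = exp K"
  define cd where "cd = norm C + norm D"
  define K1 where "K1 = norm B + cd + 1"
  define K2 where "K2 = (cd + 1) * E + norm B * (K1 * E)"
  define K3 where "K3 = norm B * K2 + cd * (K1 * E)"
  have pos: "E > 0" "cd \<ge> 0" "K1 > 0" "K2 \<ge> 0" "K3 \<ge> 0"
   unfolding E_def cd_def K1_def K2_def K3_def by (auto intro!: add_nonneg_nonneg mult_nonneg_nonneg add_nonneg_pos)
  obtain \<eta>1 where e1: "\<eta>1 > 0" "\<And>s r. \<bar>s\<bar> < \<eta>1 \<Longrightarrow> r \<in> {0..1} \<Longrightarrow> norm (M s r - (s *\<^sub>R B + s\<^sup>2 *\<^sub>R (C + r *\<^sub>R D))) \<le> 1 * s\<^sup>2"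
   using H[of 1] by auto
  have "0 < \<epsilon> / (2 * E)" using e pos by simp
  from H[OF this] obtain \<eta>2 where e2: "\<eta>2 > 0" "\<And>s r. \<bar>s\<bar> < \<eta>2 \<Longrightarrow> r \<in> {0..1} \<Longrightarrow>
   norm (M s r - (s *\<^sub>R B + s\<^sup>2 *\<^sub>R (C + r *\<^sub>R D))) \<le> \<epsilon> / (2 * E) * s\<^sup>2" by blast
  \<comment> \<open>The last entry absorbs the third order error K3 |s| s^2 into half of the
    permitted error.\<close>
  define \<eta> where "\<eta> = Min {\<delta>, 1, \<eta>1, \<eta>2, \<epsilon> / (2 * (K3 + 1))}"
  have eta: "\<eta> > 0" "\<eta> \<le> \<delta>" "\<eta> \<le> 1" "\<eta> \<le> \<eta>1" "\<eta> \<le> \<eta>2" "\<eta> \<le> \<epsilon> / (2 * (K3 + 1))"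
   unfolding \<eta>_def using d e1 e2 e pos by auto
  have "norm (F s - (id_blinfun + s *\<^sub>R B + s\<^sup>2 *\<^sub>R (C + (1/2) *\<^sub>R D + (1/2) *\<^sub>R (B o\<^sub>L B)))) \<le> \<epsilon> * s\<^sup>2" if s: "\<bar>s\<bar> < \<eta>" for s
  proof -
   have sI: "s \<in> {-\<delta>..\<delta>}" and s1: "\<bar>s\<bar> \<le> 1" using s eta by auto
   have s2: "s\<^sup>2 = \<bar>s\<bar> * \<bar>s\<bar>" by (simp add: power2_eq_square)
   have s2': "s\<^sup>2 \<le> \<bar>s\<bar>" unfolding s2 using mult_left_mono[OF s1, of "\<bar>s\<bar>"] by simp
   have CD: "norm (C + r *\<^sub>R D) \<le> cd" if "r \<in> {0..1}" for r
   proof -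
    have "norm (C + r *\<^sub>R D) \<le> norm C + r * norm D" using norm_triangle_ineq[of C "r *\<^sub>R D"] that by simp
    also have "\<dots> \<le> cd" unfolding cd_def using mult_right_mono[of r 1 "norm D"] that by simp
    finally show ?thesis .
   qed
   have MB: "norm (M s r - s *\<^sub>R B) \<le> (cd + 1) * s\<^sup>2" if r: "r \<in> {0..1}" for r
   proof -
    have "norm (M s r - s *\<^sub>R B) \<le> norm (M s r - (s *\<^sub>R B + s\<^sup>2 *\<^sub>R (C + r *\<^sub>R D))) + norm (s\<^sup>2 *\<^sub>R (C + r *\<^sub>R D))"
     using norm_triangle_ineq[of "M s r - (s *\<^sub>R B + s\<^sup>2 *\<^sub>R (C + r *\<^sub>R D))" "s\<^sup>2 *\<^sub>R (C + r *\<^sub>R D)"] by simp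
    also have "\<dots> \<le> 1 * s\<^sup>2 + s\<^sup>2 * cd"
     using e1(2)[OF _ r, of s] s eta mult_left_mono[OF CD[OF r], of "s\<^sup>2"] by (intro add_mono) auto
    finally show ?thesis by (simp add: algebra_simps)
   qed
   have M1: "norm (M s r) \<le> K1 * \<bar>s\<bar>" if r: "r \<in> {0..1}" for r
   proof -
    have "norm (M s r) \<le> norm (M s r - s *\<^sub>R B) + norm (s *\<^sub>R B)" using norm_triangle_ineq[of "M s r - s *\<^sub>R B" "s *\<^sub>R B"] by simp
    also have "\<dots> \<le> (cd + 1) * \<bar>s\<bar> + \<bar>s\<bar> * norm B"
    proof -
     have "(cd + 1) * s\<^sup>2 \<le> (cd + 1) * \<bar>s\<bar>" using mult_left_mono[OF s2', of "cd + 1"] pos(2) by linarith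
     then show ?thesis using MB[OF r] by simp
    qed
    finally show ?thesis unfolding K1_def by (simp add: algebra_simps)
   qed
   \<comment> \<open>Successive approximation: within O(s) of the identity, hence within O(s^2) of
     the linear part, hence a derivative of h bounded by \<epsilon> s^2.\<close>
   have P1: "norm (\<Phi> s r - id_blinfun) \<le> K1 * \<bar>s\<bar> * E" if r: "r \<in> {0..1}" for r
   proof -
    have "norm (\<Phi> s r - \<Phi> s 0 - r *\<^sub>R 0) \<le> K1 * \<bar>s\<bar> * E"
    proof (rule mean_value_unit[OF \<Phi>[OF sI] _ r])
     show "norm ((M s t o\<^sub>L \<Phi> s t) - 0) \<le> K1 * \<bar>s\<bar> * E" if t: "t \<in> {0..1}" for t
      unfolding E_def diff_zero by (intro ncomp M1 nrm sI t)
    qed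
    then show ?thesis using \<Phi>0[OF sI] by simp
   qed
   have P2: "norm (\<Phi> s r - id_blinfun - (r * s) *\<^sub>R B) \<le> K2 * s\<^sup>2" if r: "r \<in> {0..1}" for r
   proof -
    have "norm (\<Phi> s r - \<Phi> s 0 - r *\<^sub>R (s *\<^sub>R B)) \<le> K2 * s\<^sup>2"
    proof (rule mean_value_unit[OF \<Phi>[OF sI] _ r])
     fix t assume t1: "t \<in> {0..1::real}"
     have "(M s t o\<^sub>L \<Phi> s t) - s *\<^sub>R B = ((M s t - s *\<^sub>R B) o\<^sub>L \<Phi> s t) + ((s *\<^sub>R B) o\<^sub>L (\<Phi> s t - id_blinfun))"
      by (rule blinfun_eqI) (simp add: blinfun.bilinear_simps algebra_simps)
     also have "norm \<dots> \<le> (cd + 1) * s\<^sup>2 * E + \<bar>s\<bar> * norm B * (K1 * \<bar>s\<bar> * E)"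
      by (rule order_trans[OF norm_triangle_ineq add_mono[OF ncomp ncomp]]) (use MB P1 nrm sI t1 in \<open>auto simp: E_def\<close>)
     also have "\<dots> = K2 * s\<^sup>2" unfolding K2_def s2 by (simp add: algebra_simps)
     finally show "norm ((M s t o\<^sub>L \<Phi> s t) - s *\<^sub>R B) \<le> K2 * s\<^sup>2" .
    qed
    then show ?thesis using \<Phi>0[OF sI] by simp
   qed
   define h where "h r = \<Phi> s r - ((r * s) *\<^sub>R B + (s\<^sup>2 * r) *\<^sub>R C + (s\<^sup>2 * r\<^sup>2 / 2) *\<^sub>R (D + (B o\<^sub>L B)))" for r
   have "norm (h 1 - h 0 - (1 - 0) *\<^sub>R 0) \<le> (1 - 0) * (\<epsilon> * s\<^sup>2)"
   proof (rule mean_value_bound)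
    fix t :: real assume t: "t \<in> {0..1}"
    let ?h' = "(M s t o\<^sub>L \<Phi> s t) - (s *\<^sub>R B + s\<^sup>2 *\<^sub>R C + (s\<^sup>2 * t) *\<^sub>R (D + (B o\<^sub>L B)))"
    have q: "((\<lambda>r::real. s\<^sup>2 * r\<^sup>2 / 2) has_real_derivative s\<^sup>2 * t) (at t within {0..1})"
     "((\<lambda>r::real. r * s) has_real_derivative s) (at t within {0..1})"
     "((\<lambda>r::real. s\<^sup>2 * r) has_real_derivative s\<^sup>2) (at t within {0..1})"
     by (auto intro!: derivative_eq_intros)
    show "(h has_vector_derivative ?h') (at t within {0..1})"
     unfolding h_def[abs_def]
     by (rule has_vector_derivative_eq_rhs[OF has_vector_derivative_diff[OF \<Phi>[OF sI t]
      has_vector_derivative_add[OF has_vector_derivative_add[OF has_vector_derivative_scaleR[OF q(2) has_vector_derivative_const]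
       has_vector_derivative_scaleR[OF q(3) has_vector_derivative_const]] has_vector_derivative_scaleR[OF q(1) has_vector_derivative_const]]]]) simp
    have "?h' = ((M s t - (s *\<^sub>R B + s\<^sup>2 *\<^sub>R (C + t *\<^sub>R D))) o\<^sub>L \<Phi> s t) + ((s *\<^sub>R B) o\<^sub>L (\<Phi> s t - id_blinfun - (t * s) *\<^sub>R B))
      + ((s\<^sup>2 *\<^sub>R (C + t *\<^sub>R D)) o\<^sub>L (\<Phi> s t - id_blinfun))"
     by (rule blinfun_eqI) (simp add: blinfun.bilinear_simps algebra_simps power2_eq_square)
    also have "norm \<dots> \<le> (\<epsilon> / (2 * E) * s\<^sup>2) * E + (\<bar>s\<bar> * norm B) * (K2 * s\<^sup>2) + (s\<^sup>2 * cd) * (K1 * \<bar>s\<bar> * E)"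
    proof (rule order_trans[OF norm_triangle_ineq add_mono[OF order_trans[OF norm_triangle_ineq add_mono[OF ncomp ncomp]] ncomp]])
     show "norm (s\<^sup>2 *\<^sub>R (C + t *\<^sub>R D)) \<le> s\<^sup>2 * cd" using CD[OF t] by (simp add: mult_left_mono)
    qed (use e2(2)[OF _ t, of s] s eta P1[OF t] P2[OF t] nrm(1)[OF sI t] in \<open>auto simp: E_def\<close>)
    also have "\<dots> = \<epsilon> / 2 * s\<^sup>2 + K3 * \<bar>s\<bar> * s\<^sup>2" unfolding K3_def using pos by (simp add: field_simps)
    also have "\<dots> \<le> \<epsilon> / 2 * s\<^sup>2 + \<epsilon> / 2 * s\<^sup>2"
    proof -
     have "(K3 + 1) * \<bar>s\<bar> \<le> \<epsilon> / 2" 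
     proof -
      have "(K3 + 1) * \<bar>s\<bar> \<le> (K3 + 1) * (\<epsilon> / (2 * (K3 + 1)))" using s eta(6) pos by (intro mult_left_mono) auto
      also have "\<dots> = \<epsilon> / 2" using pos by (simp add: field_simps)
      finally show ?thesis .
     qed
     then have "K3 * \<bar>s\<bar> \<le> \<epsilon> / 2" by (simp add: algebra_simps)
     from mult_right_mono[OF this, of "s\<^sup>2"] show ?thesis by simp
    qed
    finally show "norm (?h' - 0) \<le> \<epsilon> * s\<^sup>2" by simp
   qed simp
   moreover have "h 1 - h 0 - (1 - 0) *\<^sub>R 0 = F s - (id_blinfun + s *\<^sub>R B + s\<^sup>2 *\<^sub>R (C + (1/2) *\<^sub>R D + (1/2) *\<^sub>R (B o\<^sub>L B)))"
    unfolding h_def F_def \<Phi>0[OF sI] by (simp add: scaleR_add_right)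
   ultimately show ?thesis by simp
  qed
  then show "\<exists>\<eta>>0. \<forall>s. \<bar>s\<bar> < \<eta> \<longrightarrow> norm (F s - (id_blinfun + s *\<^sub>R B + s\<^sup>2 *\<^sub>R (C + (1/2) *\<^sub>R D + (1/2) *\<^sub>R (B o\<^sub>L B)))) \<le> \<epsilon> * s\<^sup>2"
   using eta(1) by blast
 qed
 ultimately show ?thesis using that by blast
qed

lemma time_one_zero: assumes "time_one L A" "\<And>r. r \<in> {0..1} \<Longrightarrow> L r = 0" shows "A = id_blinfun"
proof -
 obtain \<Phi> where \<Phi>: "\<Phi> 0 = id_blinfun" "\<Phi> 1 = A"
  "\<And>r. r \<in> {0..1} \<Longrightarrow> (\<Phi> has_vector_derivative (L r o\<^sub>L \<Phi> r)) (at r within {0..1})"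
  using assms(1) unfolding time_one_def by blast
 have "(\<Phi> has_vector_derivative 0) (at r within {0..1})" if "r \<in> {0..1}" for r
  by (rule has_vector_derivative_eq_rhs[OF \<Phi>(3)[OF that]]) (simp add: assms(2)[OF that])
 then obtain k where "\<And>r. r \<in> {0..1} \<Longrightarrow> \<Phi> r = k"
  using has_vector_derivative_zero_constant[OF convex_real_interval(5)] by blast
 then show ?thesis using \<Phi>(1,2) by (metis atLeastAtMost_iff order_refl zero_le_one)
qed

section \<open>Transport around small parallelograms\<close>

context riem_manifold begin

lemma transports_line:
 assumes c: "c \<in> \<A>" and im: "\<And>r. r \<in> {0..1} \<Longrightarrow> a + r *\<^sub>R w \<in> chart_image c"
  and P: "time_one (\<lambda>r. - \<Gamma> c (a + r *\<^sub>R w) w) P"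
 shows "transports c (pt c a) c (pt c (a + w)) P"
proof -
 obtain \<Phi> where \<Phi>: "\<Phi> 0 = id_blinfun" "\<Phi> 1 = P"
  "\<And>r. r \<in> {0..1} \<Longrightarrow> (\<Phi> has_vector_derivative ((- \<Gamma> c (a + r *\<^sub>R w) w) o\<^sub>L \<Phi> r)) (at r within {0..1})"
  using P unfolding time_one_def by blast
 have d: "((\<lambda>r. a + r *\<^sub>R w) has_vector_derivative w) (at r within {0..1})" for r
  by (auto intro!: derivative_eq_intros)
 have "transports c (pt c (a + 0 *\<^sub>R w)) c (pt c (a + 1 *\<^sub>R w)) (\<Phi> 1)"
  by (rule transports_chart[where x = "\<lambda>r. a + r *\<^sub>R w" and D = "\<lambda>_. w" and \<Phi> = \<Phi>, OF c im d _ \<Phi>(1)])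
   (use \<Phi>(3) in \<open>auto simp: bounded_bilinear.minus_left[OF bounded_bilinear_blinfun_compose]\<close>)
 then show ?thesis by (simp add: \<Phi>(2))
qed

text \<open>The offset \<alpha> allows sides that do not start at x. Since s scales both position
  and velocity, the first order expansion of \<Gamma> at x supplies the data B, C, D of
  \<open>time_one_family\<close>.\<close>

lemma segment_family:
 assumes c: "c \<in> \<A>" and x: "x \<in> chart_image c"
 obtains \<delta> F where "\<delta> > 0" "continuous_on {-\<delta>..\<delta>} F" "F 0 = id_blinfun"
  "\<And>s. s \<in> {-\<delta>..\<delta>} \<Longrightarrow> transports c (pt c (x + s *\<^sub>R \<alpha>)) c (pt c (x + s *\<^sub>R (\<alpha> + w))) (F s)"
  "taylor2 F id_blinfun (- \<Gamma> c x w) (- frechet_derivative (\<Gamma> c) (at x) \<alpha> w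
   + (1/2) *\<^sub>R - frechet_derivative (\<Gamma> c) (at x) w w + (1/2) *\<^sub>R (\<Gamma> c x w o\<^sub>L \<Gamma> c x w))"
proof -
 interpret C: local_metric "chart_image c" "g c" "\<Gamma> c" by (rule local_metric_chart[OF c])
 let ?D = "frechet_derivative (\<Gamma> c) (at x)"
 obtain \<rho> where rho: "\<rho> > 0" "ball x \<rho> \<subseteq> chart_image c" using C.open_S x open_contains_ball by blast
 define m where "m = norm \<alpha> + norm w"
 have m: "m \<ge> 0" "norm (\<alpha> + r *\<^sub>R w) \<le> m" if "r \<in> {0..1}" for r
 proof -
  have "norm (\<alpha> + r *\<^sub>R w) \<le> norm \<alpha> + r * norm w" using norm_triangle_ineq[of \<alpha> "r *\<^sub>R w"] that by simp
  also have "\<dots> \<le> m" unfolding m_def using mult_right_mono[of r 1 "norm w"] that by simp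
  finally show "norm (\<alpha> + r *\<^sub>R w) \<le> m" .
 qed (simp add: m_def)
 have m0: "m \<ge> 0" unfolding m_def by simp
 define \<delta> where "\<delta> = \<rho> / (2 * (m + 1))"
 have d: "\<delta> > 0" unfolding \<delta>_def using rho m0 by simp
 have h: "norm (s *\<^sub>R (\<alpha> + r *\<^sub>R w)) \<le> \<bar>s\<bar> * m" if "r \<in> {0..1}" for s r
  using m(2)[OF that] by (simp add: mult_left_mono)
 have im: "x + s *\<^sub>R (\<alpha> + r *\<^sub>R w) \<in> chart_image c" if s: "s \<in> {-\<delta>..\<delta>}" and r: "r \<in> {0..1}" for s r
 proof (rule subsetD[OF rho(2)])
  have "\<bar>s\<bar> * m \<le> \<delta> * (m + 1)" using s m0 by (intro mult_mono) auto
  also have "\<dots> = \<rho> / 2" unfolding \<delta>_def using m0 by (simp add: field_simps)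
  also have "\<dots> < \<rho>" using rho(1) by simp
  finally have "norm (s *\<^sub>R (\<alpha> + r *\<^sub>R w)) < \<rho>" using h[OF r, of s] by linarith
  then show "x + s *\<^sub>R (\<alpha> + r *\<^sub>R w) \<in> ball x \<rho>" by (simp add: dist_norm)
 qed
 define L where "L s r = - \<Gamma> c (x + s *\<^sub>R (\<alpha> + r *\<^sub>R w)) (s *\<^sub>R w)" for s r
 have contL: "continuous_on ({-\<delta>..\<delta>} \<times> {0..1}) (\<lambda>z. L (fst z) (snd z))"
  unfolding L_def
  by (intro continuous_intros continuous_on_compose2[OF continuous_\<Gamma>[OF c]]) (use im in auto)
 obtain F where F: "\<And>s. s \<in> {-\<delta>..\<delta>} \<Longrightarrow> time_one (L s) (F s)" "continuous_on {-\<delta>..\<delta>} F"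
  "\<And>B C D. (\<And>\<epsilon>. \<epsilon> > 0 \<Longrightarrow> \<exists>\<eta>>0. \<forall>s. \<bar>s\<bar> < \<eta> \<longrightarrow> (\<forall>r\<in>{0..1}. norm (L s r - (s *\<^sub>R B + s\<^sup>2 *\<^sub>R (C + r *\<^sub>R D))) \<le> \<epsilon> * s\<^sup>2)) \<Longrightarrow>
   taylor2 F id_blinfun B (C + (1/2) *\<^sub>R D + (1/2) *\<^sub>R (B o\<^sub>L B))"
  by (rule time_one_family[OF d contL]) blast
 have "transports c (pt c (x + s *\<^sub>R \<alpha>)) c (pt c (x + s *\<^sub>R (\<alpha> + w))) (F s)" if s: "s \<in> {-\<delta>..\<delta>}" for s
 proof -
  have e: "x + s *\<^sub>R \<alpha> + r *\<^sub>R s *\<^sub>R w = x + s *\<^sub>R (\<alpha> + r *\<^sub>R w)" for r by (simp add: algebra_simps)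
  have "transports c (pt c (x + s *\<^sub>R \<alpha>)) c (pt c (x + s *\<^sub>R \<alpha> + s *\<^sub>R w)) (F s)"
   by (rule transports_line[OF c]; unfold e) (use im[OF s] F(1)[OF s] in \<open>simp_all add: L_def[abs_def]\<close>)
  then show ?thesis by (simp add: algebra_simps)
 qed
 moreover have "F 0 = id_blinfun" by (rule time_one_zero[OF F(1)]) (use d in \<open>auto simp: L_def\<close>)
 moreover have "taylor2 F id_blinfun (- \<Gamma> c x w) (- ?D \<alpha> w + (1/2) *\<^sub>R - ?D w w + (1/2) *\<^sub>R ((- \<Gamma> c x w) o\<^sub>L (- \<Gamma> c x w)))"
 proof (rule F(3))
  fix \<epsilon> :: real assume e: "\<epsilon> > 0"
  define k where "k = m * norm w + 1"
  have k: "k > 0" unfolding k_def using m0 by (simp add: add_nonneg_pos)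
  have "0 < \<epsilon> / k" using e k by simp
  then obtain \<eta> where eta: "\<eta> > 0" "\<And>y. norm (y - x) < \<eta> \<Longrightarrow> norm (\<Gamma> c y - \<Gamma> c x - ?D (y - x)) \<le> \<epsilon> / k * norm (y - x)"
   using C.D_\<Gamma>[OF x] unfolding has_derivative_at_alt by blast
  have lin: "linear ?D" using C.D_\<Gamma>[OF x] has_derivative_linear by blast
  have "norm (L s r - (s *\<^sub>R (- \<Gamma> c x w) + s\<^sup>2 *\<^sub>R (- ?D \<alpha> w + r *\<^sub>R - ?D w w))) \<le> \<epsilon> * s\<^sup>2"
   if s: "\<bar>s\<bar> < \<eta> / (m + 1)" and r: "r \<in> {0..1}" for s r
  proof -
   let ?h = "s *\<^sub>R (\<alpha> + r *\<^sub>R w)"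
   have "\<bar>s\<bar> * m \<le> \<bar>s\<bar> * (m + 1)" by (simp add: mult_left_mono)
   also have "\<dots> < \<eta>" using s m0 by (simp add: pos_less_divide_eq)
   finally have "norm ?h < \<eta>" using h[OF r, of s] by linarith
   then have E: "norm (\<Gamma> c (x + ?h) - \<Gamma> c x - ?D ?h) \<le> \<epsilon> / k * norm ?h" using eta(2)[of "x + ?h"] by simp
   have "?D ?h = s *\<^sub>R ?D \<alpha> + (s * r) *\<^sub>R ?D w"
    using linear_cmul[OF lin] linear_add[OF lin] by (simp add: scaleR_add_right)
   then have "L s r - (s *\<^sub>R (- \<Gamma> c x w) + s\<^sup>2 *\<^sub>R (- ?D \<alpha> w + r *\<^sub>R - ?D w w))
    = - s *\<^sub>R (\<Gamma> c (x + ?h) - \<Gamma> c x - ?D ?h) w"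
    unfolding L_def by (simp add: bl algebra_simps power2_eq_square)
   also have "norm \<dots> \<le> \<bar>s\<bar> * ((\<epsilon> / k * norm ?h) * norm w)"
    using mult_left_mono[OF order_trans[OF norm_blinfun mult_right_mono[OF E norm_ge_zero]], of "\<bar>s\<bar>" w] by simp
   also have "\<dots> \<le> \<bar>s\<bar> * ((\<epsilon> / k * (\<bar>s\<bar> * m)) * norm w)"
    using h[OF r, of s] e k by (intro mult_left_mono mult_right_mono) auto
   also have "\<dots> = (\<epsilon> * s\<^sup>2) * ((m * norm w) / k)" by (simp add: power2_eq_square)
   also have "\<dots> \<le> (\<epsilon> * s\<^sup>2) * 1" using e k by (intro mult_left_mono) (auto simp: k_def)
   finally show ?thesis by simp
  qed
  moreover have "\<eta> / (m + 1) > 0" using eta(1) m0 by simp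
  ultimately show "\<exists>\<eta>>0. \<forall>s. \<bar>s\<bar> < \<eta> \<longrightarrow> (\<forall>r\<in>{0..1}.
   norm (L s r - (s *\<^sub>R (- \<Gamma> c x w) + s\<^sup>2 *\<^sub>R (- ?D \<alpha> w + r *\<^sub>R - ?D w w))) \<le> \<epsilon> * s\<^sup>2)" by blast
 qed
 moreover have "(- \<Gamma> c x w) o\<^sub>L (- \<Gamma> c x w) = \<Gamma> c x w o\<^sub>L \<Gamma> c x w" by (rule blinfun_eqI) (simp add: bl)
 ultimately show ?thesis using that[OF d F(2)] by simp
qed

text \<open>The sides join 0, u, u + v, v, 0 in this order. First order terms cancel; in second
  order the derivatives of \<Gamma> and the products of its values assemble to the
  curvature.\<close>

lemma loop_family:
 assumes c: "c \<in> \<A>" and p: "p \<in> fst c"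
 obtains \<delta> P where "\<delta> > 0" "continuous_on {-\<delta>..\<delta>} P" "P 0 = id_blinfun"
  "\<And>s. s \<in> {-\<delta>..\<delta>} \<Longrightarrow> transports c p c p (P s)"
  "taylor2 P id_blinfun 0 (local_metric.Rm (\<Gamma> c) (snd c p) v u)"
proof -
 let ?x = "snd c p"
 have x: "?x \<in> chart_image c" using p unfolding chart_image_def by blast
 interpret C: local_metric "chart_image c" "g c" "\<Gamma> c" by (rule local_metric_chart[OF c])
 let ?D = "frechet_derivative (\<Gamma> c) (at ?x)" and ?G = "\<Gamma> c ?x"
 have lin: "linear ?D" using C.D_\<Gamma>[OF x] has_derivative_linear by blast
 obtain \<delta>1 F1 where F1: "\<delta>1 > 0" "continuous_on {-\<delta>1..\<delta>1} F1" "F1 0 = id_blinfun"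
  "\<And>s. s \<in> {-\<delta>1..\<delta>1} \<Longrightarrow> transports c (pt c (?x + s *\<^sub>R 0)) c (pt c (?x + s *\<^sub>R (0 + u))) (F1 s)"
  "taylor2 F1 id_blinfun (- ?G u) (- ?D 0 u + (1/2) *\<^sub>R - ?D u u + (1/2) *\<^sub>R (?G u o\<^sub>L ?G u))"
  by (rule segment_family[OF c x, where \<alpha> = 0 and w = u]) (rule that; assumption)
 obtain \<delta>2 F2 where F2: "\<delta>2 > 0" "continuous_on {-\<delta>2..\<delta>2} F2" "F2 0 = id_blinfun"
  "\<And>s. s \<in> {-\<delta>2..\<delta>2} \<Longrightarrow> transports c (pt c (?x + s *\<^sub>R u)) c (pt c (?x + s *\<^sub>R (u + v))) (F2 s)"
  "taylor2 F2 id_blinfun (- ?G v) (- ?D u v + (1/2) *\<^sub>R - ?D v v + (1/2) *\<^sub>R (?G v o\<^sub>L ?G v))"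
  by (rule segment_family[OF c x, where \<alpha> = u and w = v]) (rule that; assumption)
 obtain \<delta>3 F3 where F3: "\<delta>3 > 0" "continuous_on {-\<delta>3..\<delta>3} F3" "F3 0 = id_blinfun"
  "\<And>s. s \<in> {-\<delta>3..\<delta>3} \<Longrightarrow> transports c (pt c (?x + s *\<^sub>R (u + v))) c (pt c (?x + s *\<^sub>R ((u + v) + - u))) (F3 s)"
  "taylor2 F3 id_blinfun (- ?G (- u)) (- ?D (u + v) (- u) + (1/2) *\<^sub>R - ?D (- u) (- u) + (1/2) *\<^sub>R (?G (- u) o\<^sub>L ?G (- u)))"
  by (rule segment_family[OF c x, where \<alpha> = "u + v" and w = "- u"]) (rule that; assumption)
 obtain \<delta>4 F4 where F4: "\<delta>4 > 0" "continuous_on {-\<delta>4..\<delta>4} F4" "F4 0 = id_blinfun"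
  "\<And>s. s \<in> {-\<delta>4..\<delta>4} \<Longrightarrow> transports c (pt c (?x + s *\<^sub>R v)) c (pt c (?x + s *\<^sub>R (v + - v))) (F4 s)"
  "taylor2 F4 id_blinfun (- ?G (- v)) (- ?D v (- v) + (1/2) *\<^sub>R - ?D (- v) (- v) + (1/2) *\<^sub>R (?G (- v) o\<^sub>L ?G (- v)))"
  by (rule segment_family[OF c x, where \<alpha> = v and w = "- v"]) (rule that; assumption)
 define \<delta> where "\<delta> = min (min \<delta>1 \<delta>2) (min \<delta>3 \<delta>4)"
 have d: "\<delta> > 0" unfolding \<delta>_def by (intro iffD2[OF min_less_iff_conj] conjI F1(1) F2(1) F3(1) F4(1))
 have "\<delta> \<le> \<delta>1" "\<delta> \<le> \<delta>2" "\<delta> \<le> \<delta>3" "\<delta> \<le> \<delta>4" unfolding \<delta>_def by linarith+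
 then have sub: "{-\<delta>..\<delta>} \<subseteq> {-\<delta>1..\<delta>1}" "{-\<delta>..\<delta>} \<subseteq> {-\<delta>2..\<delta>2}" "{-\<delta>..\<delta>} \<subseteq> {-\<delta>3..\<delta>3}" "{-\<delta>..\<delta>} \<subseteq> {-\<delta>4..\<delta>4}"
  by simp_all
 define P where "P s = F4 s o\<^sub>L (F3 s o\<^sub>L (F2 s o\<^sub>L F1 s))" for s
 show ?thesis
 proof (rule that[OF d])
  show "continuous_on {-\<delta>..\<delta>} P" unfolding P_def
   by (intro bounded_bilinear.continuous_on[OF bounded_bilinear_blinfun_compose]
     continuous_on_subset[OF F1(2) sub(1)] continuous_on_subset[OF F2(2) sub(2)] continuous_on_subset[OF F3(2) sub(3)] continuous_on_subset[OF F4(2) sub(4)])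
  show "P 0 = id_blinfun" unfolding P_def F1 F2 F3 F4 by (simp add: blinfun_compose_id)
  fix s assume s: "s \<in> {-\<delta>..\<delta>}"
  have pp: "pt c ?x = p" unfolding pt_def by (rule chart_inv[OF c p])
  note t1 = F1(4)[OF subsetD[OF sub(1) s]] and t2 = F2(4)[OF subsetD[OF sub(2) s]]
   and t3 = F3(4)[OF subsetD[OF sub(3) s]] and t4 = F4(4)[OF subsetD[OF sub(4) s]]
  have "transports c p c p (\<lambda>z. F4 s (F3 s (F2 s (F1 s z))))"
   using transports_compose[OF transports_compose[OF transports_compose[OF
    t1[simplified pp add_0 scaleR_zero_right add_0_right] t2] t3[simplified]] t4[simplified]] by (simp add: pp)
  moreover have "(\<lambda>z. F4 s (F3 s (F2 s (F1 s z)))) = blinfun_apply (P s)" unfolding P_def by (simp add: fun_eq_iff)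
  ultimately show "transports c p c p (P s)" by simp
 next
  have D0: "?D 0 = 0" "?D (- v) = - ?D v" "?D (- u) = - ?D u" "?D (u + v) = ?D u + ?D v"
   using linear_0[OF lin] linear_neg[OF lin] linear_add[OF lin] by auto
  note T = taylor2_compose[OF F4(5) taylor2_compose[OF F3(5) taylor2_compose[OF F2(5) F1(5)]], folded P_def]
  let ?b1 = "- ?G u" and ?b2 = "- ?G v" and ?b3 = "- ?G (- u)" and ?b4 = "- ?G (- v)"
  let ?c1 = "- ?D 0 u + (1/2) *\<^sub>R - ?D u u + (1/2) *\<^sub>R (?G u o\<^sub>L ?G u)"
  let ?c2 = "- ?D u v + (1/2) *\<^sub>R - ?D v v + (1/2) *\<^sub>R (?G v o\<^sub>L ?G v)"
  let ?c3 = "- ?D (u + v) (- u) + (1/2) *\<^sub>R - ?D (- u) (- u) + (1/2) *\<^sub>R (?G (- u) o\<^sub>L ?G (- u))"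
  let ?c4 = "- ?D v (- v) + (1/2) *\<^sub>R - ?D (- v) (- v) + (1/2) *\<^sub>R (?G (- v) o\<^sub>L ?G (- v))"
  have b: "(id_blinfun o\<^sub>L ((id_blinfun o\<^sub>L ((id_blinfun o\<^sub>L ?b1) + (?b2 o\<^sub>L id_blinfun))) + (?b3 o\<^sub>L (id_blinfun o\<^sub>L id_blinfun))))
   + (?b4 o\<^sub>L (id_blinfun o\<^sub>L (id_blinfun o\<^sub>L id_blinfun))) = 0"
   by (rule blinfun_eqI) (simp add: bl)
  have half: "(1/2) *\<^sub>R x + ((1/2) *\<^sub>R x + y) = x + y" "(1/2) *\<^sub>R x + (1/2) *\<^sub>R x = x" for x y :: 'e
   unfolding add.assoc[symmetric] scaleR_add_left[symmetric] by simp_all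
  have R: "C.Rm ?x v u w = ?D v u w - ?D u v w + ?G v (?G u w) - ?G u (?G v w)" for w by (rule C.Rm_apply)
  have cc: "(id_blinfun o\<^sub>L
   ((id_blinfun o\<^sub>L ((id_blinfun o\<^sub>L ?c1) + (?b2 o\<^sub>L ?b1) + (?c2 o\<^sub>L id_blinfun))) + (?b3 o\<^sub>L ((id_blinfun o\<^sub>L ?b1) + (?b2 o\<^sub>L id_blinfun))) + (?c3 o\<^sub>L (id_blinfun o\<^sub>L id_blinfun))))
   + (?b4 o\<^sub>L ((id_blinfun o\<^sub>L ((id_blinfun o\<^sub>L ?b1) + (?b2 o\<^sub>L id_blinfun))) + (?b3 o\<^sub>L (id_blinfun o\<^sub>L id_blinfun))))
   + (?c4 o\<^sub>L (id_blinfun o\<^sub>L (id_blinfun o\<^sub>L id_blinfun))) = C.Rm ?x v u"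
   by (rule blinfun_eqI) (simp add: R D0 bl half algebra_simps)
  show "taylor2 P id_blinfun 0 (C.Rm ?x v u)"
   using T unfolding b cc by (simp add: blinfun_compose_id P_def[abs_def])
 qed
qed

text \<open>Differentiability at the identity is enough for the open mapping theorem of Sussmann.\<close>

definition velocity :: "('a, 'e) chart \<Rightarrow> 'a \<Rightarrow> 'e endo \<Rightarrow> bool" where
 "velocity c p \<xi> \<longleftrightarrow> (\<exists>P \<delta>. \<delta> > 0 \<and> continuous_on {-\<delta>..\<delta>} P \<and> P 0 = id_blinfun \<and>
  (P has_vector_derivative \<xi>) (at 0) \<and> (\<forall>t\<in>{-\<delta>..\<delta>}. transports c p c p (P t)))"

text \<open>The loop around a square of side \<open>\<surd>t\<close> turns the second order term into a first derivative.\<close>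

lemma velocity_curvature:
 assumes c: "c \<in> \<A>" and p: "p \<in> fst c"
 shows "velocity c p (local_metric.Rm (\<Gamma> c) (snd c p) u v)"
proof -
 let ?R = "local_metric.Rm (\<Gamma> c) (snd c p)"
 have x: "snd c p \<in> chart_image c" using p unfolding chart_image_def by blast
 interpret C: local_metric "chart_image c" "g c" "\<Gamma> c" by (rule local_metric_chart[OF c])
 obtain \<delta>1 P1 where P1: "\<delta>1 > 0" "continuous_on {-\<delta>1..\<delta>1} P1" "P1 0 = id_blinfun"
  "\<And>s. s \<in> {-\<delta>1..\<delta>1} \<Longrightarrow> transports c p c p (P1 s)" "taylor2 P1 id_blinfun 0 (?R u v)"
  by (rule loop_family[OF c p]) (rule that; assumption)
 obtain \<delta>2 P2 where P2: "\<delta>2 > 0" "continuous_on {-\<delta>2..\<delta>2} P2" "P2 0 = id_blinfun"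
  "\<And>s. s \<in> {-\<delta>2..\<delta>2} \<Longrightarrow> transports c p c p (P2 s)" "taylor2 P2 id_blinfun 0 (?R v u)"
  by (rule loop_family[OF c p]) (rule that; assumption)
 have anti: "?R v u = - ?R u v" by (rule blinfun_eqI) (simp add: C.Rm_def bl)
 define \<delta>0 where "\<delta>0 = min \<delta>1 \<delta>2"
 have d0: "\<delta>0 > 0" "\<delta>0 \<le> \<delta>1" "\<delta>0 \<le> \<delta>2" using P1(1) P2(1) unfolding \<delta>0_def by auto
 define \<delta> where "\<delta> = \<delta>0\<^sup>2"
 have d: "\<delta> > 0" unfolding \<delta>_def using d0 by simp
 have sq: "0 \<le> sqrt \<bar>t\<bar>" "sqrt \<bar>t\<bar> \<le> \<delta>0" if "t \<in> {-\<delta>..\<delta>}" for t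
 proof -
  have "\<bar>t\<bar> \<le> \<delta>0\<^sup>2" using that unfolding \<delta>_def by auto
  then have "sqrt \<bar>t\<bar> \<le> sqrt (\<delta>0\<^sup>2)" by (rule real_sqrt_le_mono)
  then show "sqrt \<bar>t\<bar> \<le> \<delta>0" using d0 by simp
 qed simp
 \<comment> \<open>For negative times the loop has u and v exchanged; its second order term is the
   opposite one, so the one-sided derivatives agree.\<close>
 define P where "P t = (if t \<le> 0 then P2 (sqrt \<bar>t\<bar>) else P1 (sqrt \<bar>t\<bar>))" for t
 have "continuous_on ({-\<delta>..0} \<union> {0..\<delta>}) P"
  unfolding P_def
 proof (rule continuous_on_cases)
  show "continuous_on {-\<delta>..0} (\<lambda>t. P2 (sqrt \<bar>t\<bar>))"
  proof (rule continuous_on_compose2[OF P2(2)])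
   have "sqrt \<bar>t\<bar> \<in> {-\<delta>2..\<delta>2}" if "t \<in> {-\<delta>..0}" for t
    using sq[of t] d0 that d unfolding atLeastAtMost_iff by linarith
   then show "(\<lambda>t. sqrt \<bar>t\<bar>) ` {-\<delta>..0} \<subseteq> {-\<delta>2..\<delta>2}" by blast
  qed (intro continuous_intros)
  show "continuous_on {0..\<delta>} (\<lambda>t. P1 (sqrt \<bar>t\<bar>))"
  proof (rule continuous_on_compose2[OF P1(2)])
   have "sqrt \<bar>t\<bar> \<in> {-\<delta>1..\<delta>1}" if "t \<in> {0..\<delta>}" for t
    using sq[of t] d0 that d unfolding atLeastAtMost_iff by linarith
   then show "(\<lambda>t. sqrt \<bar>t\<bar>) ` {0..\<delta>} \<subseteq> {-\<delta>1..\<delta>1}" by blast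
  qed (intro continuous_intros)
  show "\<forall>t. t \<in> {-\<delta>..0} \<and> \<not> t \<le> 0 \<or> t \<in> {0..\<delta>} \<and> t \<le> 0 \<longrightarrow> P2 (sqrt \<bar>t\<bar>) = P1 (sqrt \<bar>t\<bar>)"
  proof (intro allI impI)
   fix t :: real assume "t \<in> {-\<delta>..0} \<and> \<not> t \<le> 0 \<or> t \<in> {0..\<delta>} \<and> t \<le> 0"
   then have "t = 0" by auto
   then show "P2 (sqrt \<bar>t\<bar>) = P1 (sqrt \<bar>t\<bar>)" by (simp add: P1(3) P2(3))
  qed
 qed auto
 moreover have "{-\<delta>..0} \<union> {0..\<delta>} = {-\<delta>..\<delta>}" using d by auto
 ultimately have cont: "continuous_on {-\<delta>..\<delta>} P" by simp
 have P0: "P 0 = id_blinfun" unfolding P_def by (simp add: P2(3))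
 have "(P has_vector_derivative ?R u v) (at 0)"
  unfolding has_vector_derivative_def has_derivative_at_alt
 proof (intro conjI allI impI bounded_linear_scaleR_left)
  fix e :: real assume e: "0 < e"
  obtain \<eta>1 where e1: "\<eta>1 > 0" "\<And>s. \<bar>s\<bar> < \<eta>1 \<Longrightarrow> norm (P1 s - (id_blinfun + s *\<^sub>R 0 + s\<^sup>2 *\<^sub>R ?R u v)) \<le> e * s\<^sup>2"
   using taylor2D[OF P1(5) e P1(3)] by blast
  obtain \<eta>2 where e2: "\<eta>2 > 0" "\<And>s. \<bar>s\<bar> < \<eta>2 \<Longrightarrow> norm (P2 s - (id_blinfun + s *\<^sub>R 0 + s\<^sup>2 *\<^sub>R ?R v u)) \<le> e * s\<^sup>2"
   using taylor2D[OF P2(5) e P2(3)] by blast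
  have "norm (P y - P 0 - (y - 0) *\<^sub>R ?R u v) \<le> e * norm (y - 0)" if y: "norm (y - 0) < (min \<eta>1 \<eta>2)\<^sup>2" for y
  proof -
   have "sqrt \<bar>y\<bar> < sqrt ((min \<eta>1 \<eta>2)\<^sup>2)" using y by (intro real_sqrt_less_mono) simp
   then have s: "\<bar>sqrt \<bar>y\<bar>\<bar> < \<eta>1" "\<bar>sqrt \<bar>y\<bar>\<bar> < \<eta>2" using e1(1) e2(1) by auto
   show ?thesis
   proof (cases "y \<le> 0")
    case True
    then have Py: "P y = P2 (sqrt \<bar>y\<bar>)" unfolding P_def by simp
    show ?thesis using e2(2)[OF s(2)] True unfolding P0 Py anti by (simp add: algebra_simps)
   next
    case False
    then have Py: "P y = P1 (sqrt \<bar>y\<bar>)" unfolding P_def by simp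
    show ?thesis using e1(2)[OF s(1)] False unfolding P0 Py by (simp add: algebra_simps)
   qed
  qed
  moreover have "(min \<eta>1 \<eta>2)\<^sup>2 > 0" using e1(1) e2(1) by (simp add: min_def)
  ultimately show "\<exists>d>0. \<forall>y. norm (y - 0) < d \<longrightarrow> norm (P y - P 0 - (y - 0) *\<^sub>R ?R u v) \<le> e * norm (y - 0)" by blast
 qed
 moreover have "transports c p c p (P t)" if t: "t \<in> {-\<delta>..\<delta>}" for t
 proof (cases "t \<le> 0")
  case True
  have "transports c p c p (P2 (sqrt \<bar>t\<bar>))" by (rule P2(4), unfold atLeastAtMost_iff) (use sq[OF t] d0 in linarith)
  then show ?thesis using True by (simp add: P_def)
 next
  case False
  have "transports c p c p (P1 (sqrt \<bar>t\<bar>))" by (rule P1(4), unfold atLeastAtMost_iff) (use sq[OF t] d0 in linarith)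
  then show ?thesis using False by (simp add: P_def)
 qed
 ultimately show ?thesis unfolding velocity_def using d cont P0 by blast
qed

text \<open>Both curves pass through the identity, so the product rule yields the sum.\<close>

lemma velocity_add:
 assumes "velocity c p \<xi>" "velocity c p \<eta>"
 shows "velocity c p (\<xi> + \<eta>)"
proof -
 obtain P \<delta>1 where P: "\<delta>1 > 0" "continuous_on {-\<delta>1..\<delta>1} P" "P 0 = id_blinfun"
  "(P has_vector_derivative \<xi>) (at 0)" "\<And>t. t \<in> {-\<delta>1..\<delta>1} \<Longrightarrow> transports c p c p (P t)"
  using assms(1) unfolding velocity_def by blast
 obtain P' \<delta>2 where P': "\<delta>2 > 0" "continuous_on {-\<delta>2..\<delta>2} P'" "P' 0 = id_blinfun"
  "(P' has_vector_derivative \<eta>) (at 0)" "\<And>t. t \<in> {-\<delta>2..\<delta>2} \<Longrightarrow> transports c p c p (P' t)"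
  using assms(2) unfolding velocity_def by blast
 define \<delta> where "\<delta> = min \<delta>1 \<delta>2"
 have d: "\<delta> > 0" and sub: "{-\<delta>..\<delta>} \<subseteq> {-\<delta>1..\<delta>1}" "{-\<delta>..\<delta>} \<subseteq> {-\<delta>2..\<delta>2}"
  using P(1) P'(1) unfolding \<delta>_def by auto
 have "continuous_on {-\<delta>..\<delta>} (\<lambda>t. P t o\<^sub>L P' t)"
  by (intro bounded_bilinear.continuous_on[OF bounded_bilinear_blinfun_compose]
    continuous_on_subset[OF P(2) sub(1)] continuous_on_subset[OF P'(2) sub(2)])
 moreover have "((\<lambda>t. P t o\<^sub>L P' t) has_vector_derivative (\<xi> + \<eta>)) (at 0)"
  using bounded_bilinear.has_vector_derivative[OF bounded_bilinear_blinfun_compose P(4) P'(4)]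
  by (simp add: P(3) P'(3) blinfun_compose_id add.commute)
 moreover have "transports c p c p (P t o\<^sub>L P' t)" if "t \<in> {-\<delta>..\<delta>}" for t
 proof -
  have "transports c p c p (\<lambda>v. P t (P' t v))"
   by (rule transports_compose[OF P'(5) P(5)]) (use that sub in auto)
  moreover have "(\<lambda>v. P t (P' t v)) = blinfun_apply (P t o\<^sub>L P' t)" by (simp add: fun_eq_iff)
  ultimately show ?thesis by simp
 qed
 ultimately show ?thesis unfolding velocity_def
  by (intro exI[of _ "\<lambda>t. P t o\<^sub>L P' t"] exI[of _ \<delta>]) (use d P(3) P'(3) in \<open>auto simp: blinfun_compose_id\<close>)
qed

lemma velocity_scale:
 assumes "velocity c p \<xi>"
 shows "velocity c p (k *\<^sub>R \<xi>)"
proof -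
 obtain P \<delta>1 where P: "\<delta>1 > 0" "continuous_on {-\<delta>1..\<delta>1} P" "P 0 = id_blinfun"
  "(P has_vector_derivative \<xi>) (at 0)" "\<And>t. t \<in> {-\<delta>1..\<delta>1} \<Longrightarrow> transports c p c p (P t)"
  using assms(1) unfolding velocity_def by blast
 define \<delta> where "\<delta> = \<delta>1 / (\<bar>k\<bar> + 1)"
 have d: "\<delta> > 0" unfolding \<delta>_def using P(1) by (simp add: add_nonneg_pos)
 have kt: "k * t \<in> {-\<delta>1..\<delta>1}" if "t \<in> {-\<delta>..\<delta>}" for t
 proof -
  have "\<bar>k * t\<bar> \<le> (\<bar>k\<bar> + 1) * \<delta>" unfolding abs_mult using that d by (intro mult_mono) auto
  also have "\<dots> = \<delta>1" unfolding \<delta>_def by (simp add: field_simps)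
  finally show ?thesis by auto
 qed
 have kd: "((\<lambda>t. k * t) has_vector_derivative k) (at 0)"
  unfolding has_real_derivative_iff_has_vector_derivative[symmetric] by (auto intro!: derivative_eq_intros)
 have cont: "continuous_on {-\<delta>..\<delta>} (\<lambda>t. P (k * t))"
  by (rule continuous_on_compose2[OF P(2)]) (use kt in \<open>auto intro!: continuous_intros\<close>)
 have "(P has_vector_derivative \<xi>) (at (k * 0))" using P(4) by simp
 from vector_diff_chain_at[OF kd this] have der: "((\<lambda>t. P (k * t)) has_vector_derivative k *\<^sub>R \<xi>) (at 0)"
  by (simp add: o_def)
 show ?thesis unfolding velocity_def
  by (intro exI[of _ "\<lambda>t. P (k * t)"] exI[of _ \<delta>] conjI ballI d cont der P(5) kt) (simp_all add: P(3))
qed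

text \<open>Travel to q, run the loops there, and return.\<close>

lemma velocity_conjugate:
 fixes A A' :: "'e endo"
 assumes A: "transports c p d q A" and A': "A o\<^sub>L A' = id_blinfun" "A' o\<^sub>L A = id_blinfun" and v: "velocity d q \<xi>"
 shows "velocity c p (A' o\<^sub>L (\<xi> o\<^sub>L A))"
proof -
 obtain P \<delta> where P: "\<delta> > 0" "continuous_on {-\<delta>..\<delta>} P" "P 0 = id_blinfun"
  "(P has_vector_derivative \<xi>) (at 0)" "\<And>t. t \<in> {-\<delta>..\<delta>} \<Longrightarrow> transports d q d q (P t)"
  using v unfolding velocity_def by blast
 note bb = bounded_bilinear_blinfun_compose
 let ?P = "\<lambda>t. A' o\<^sub>L (P t o\<^sub>L A)"
 have "A (A' v) = v" for v using A'(1) by (metis blinfun_apply_blinfun_compose id_blinfun.rep_eq id_apply)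
 from transports_reverse[OF A this] have R: "transports d q c p A'" .
 have "continuous_on {-\<delta>..\<delta>} ?P"
  by (intro bounded_bilinear.continuous_on[OF bb] P(2) continuous_on_const)
 moreover have "(?P has_vector_derivative (A' o\<^sub>L (\<xi> o\<^sub>L A))) (at 0)"
  by (rule bounded_linear.has_vector_derivative[OF bounded_bilinear.bounded_linear_right[OF bb]
    bounded_linear.has_vector_derivative[OF bounded_bilinear.bounded_linear_left[OF bb] P(4)]])
 moreover have "transports c p c p (?P t)" if t: "t \<in> {-\<delta>..\<delta>}" for t
 proof -
  have "transports c p c p (\<lambda>v. A' (P t (A v)))"
   by (rule transports_compose[OF transports_compose[OF A P(5)[OF t]] R])
  moreover have "(\<lambda>v. A' (P t (A v))) = blinfun_apply (?P t)" by (simp add: fun_eq_iff)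
  ultimately show ?thesis by simp
 qed
 ultimately show ?thesis unfolding velocity_def
  by (intro exI[of _ ?P] exI[of _ \<delta>]) (use P(1,3) A'(2) in \<open>auto simp: blinfun_compose_id\<close>)
qed

text \<open>One solution along the ray serves all end points, by rescaling time. The derivatives at
  0 are the first order data that \<open>annihilator_zero\<close> asks for.\<close>

lemma ray_transport:
 assumes c: "c \<in> \<A>" and p: "p \<in> fst c"
 obtains \<epsilon> \<Phi> \<Psi> where "\<epsilon> > 0" "\<Phi> 0 = id_blinfun" "\<Psi> 0 = id_blinfun"
  "(\<Phi> has_vector_derivative - \<Gamma> c (snd c p) u) (at 0 within {0..\<epsilon>})"
  "(\<Psi> has_vector_derivative \<Gamma> c (snd c p) u) (at 0 within {0..\<epsilon>})"
  "\<And>t. t \<in> {0..\<epsilon>} \<Longrightarrow> \<Psi> t o\<^sub>L \<Phi> t = id_blinfun" "\<And>t. t \<in> {0..\<epsilon>} \<Longrightarrow> \<Phi> t o\<^sub>L \<Psi> t = id_blinfun"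
  "\<And>t. t \<in> {0..\<epsilon>} \<Longrightarrow> snd c p + t *\<^sub>R u \<in> chart_image c"
  "\<And>t. t \<in> {0..\<epsilon>} \<Longrightarrow> transports c p c (pt c (snd c p + t *\<^sub>R u)) (\<Phi> t)"
proof -
 let ?x = "snd c p"
 have x: "?x \<in> chart_image c" using p unfolding chart_image_def by blast
 obtain \<rho> where rho: "\<rho> > 0" "ball ?x \<rho> \<subseteq> chart_image c" using chart(2)[OF c] x open_contains_ball by blast
 define \<epsilon> where "\<epsilon> = \<rho> / (2 * (norm u + 1))"
 have e: "\<epsilon> > 0" unfolding \<epsilon>_def using rho by (simp add: add_nonneg_pos)
 have im: "?x + t *\<^sub>R u \<in> chart_image c" if t: "t \<in> {0..\<epsilon>}" for t
 proof (rule subsetD[OF rho(2)])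
  have "norm (t *\<^sub>R u) \<le> \<epsilon> * (norm u + 1)" unfolding norm_scaleR using t e by (intro mult_mono) auto
  also have "\<dots> = \<rho> / 2" unfolding \<epsilon>_def by (simp add: field_simps add_nonneg_eq_0_iff)
  finally show "?x + t *\<^sub>R u \<in> ball ?x \<rho>" using rho(1) by (simp add: dist_norm)
 qed
 define L where "L t = - \<Gamma> c (?x + t *\<^sub>R u) u" for t
 have "continuous_on {0..\<epsilon>} (\<lambda>t. \<Gamma> c (?x + t *\<^sub>R u))"
  by (rule continuous_on_compose2[OF continuous_\<Gamma>[OF c]]) (use im in \<open>auto intro!: continuous_intros\<close>)
 then have L: "continuous_on {0..\<epsilon>} L" unfolding L_def by (intro continuous_intros)
 obtain K where K: "\<And>t. t \<in> {0..\<epsilon>} \<Longrightarrow> norm (L t) \<le> K"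
  using compact_imp_bounded[OF compact_continuous_image[OF L compact_Icc]] unfolding bounded_iff by (metis imageI)
 obtain \<Phi> \<Psi> where \<Phi>: "\<Phi> 0 = id_blinfun" "\<Psi> 0 = id_blinfun"
  "\<And>t. t \<in> {0..\<epsilon>} \<Longrightarrow> (\<Phi> has_vector_derivative (L t o\<^sub>L \<Phi> t)) (at t within {0..\<epsilon>})"
  "\<And>t. t \<in> {0..\<epsilon>} \<Longrightarrow> (\<Psi> has_vector_derivative - (\<Psi> t o\<^sub>L L t)) (at t within {0..\<epsilon>})"
  "\<And>t. t \<in> {0..\<epsilon>} \<Longrightarrow> \<Psi> t o\<^sub>L \<Phi> t = id_blinfun" "\<And>t. t \<in> {0..\<epsilon>} \<Longrightarrow> \<Phi> t o\<^sub>L \<Psi> t = id_blinfun"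
  by (rule fundamental_solution[OF L less_imp_le[OF e] K]) (assumption, (rule that; assumption))
 have \<Phi>0: "(\<Phi> has_vector_derivative - \<Gamma> c ?x u) (at 0 within {0..\<epsilon>})"
  using \<Phi>(3)[of 0] e by (simp add: L_def \<Phi>(1) blinfun_compose_id)
 have \<Psi>0: "(\<Psi> has_vector_derivative \<Gamma> c ?x u) (at 0 within {0..\<epsilon>})"
  using \<Phi>(4)[of 0] e by (simp add: L_def \<Phi>(2) blinfun_compose_id)
 have T: "transports c p c (pt c (?x + t *\<^sub>R u)) (\<Phi> t)" if t: "t \<in> {0..\<epsilon>}" for t
 proof -
  have rt: "r * t \<in> {0..\<epsilon>}" if "r \<in> {0..1}" for r
   using that t mult_mono[of r 1 t \<epsilon>] by auto
  have e: "?x + r *\<^sub>R t *\<^sub>R u = ?x + (r * t) *\<^sub>R u" for r by simp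
  have "transports c (pt c ?x) c (pt c (?x + t *\<^sub>R u)) (\<Phi> t)"
  proof (rule transports_line[OF c]; unfold e)
   show "?x + (r * t) *\<^sub>R u \<in> chart_image c" if "r \<in> {0..1}" for r by (rule im[OF rt[OF that]])
   show "time_one (\<lambda>r. - \<Gamma> c (?x + (r * t) *\<^sub>R u) (t *\<^sub>R u)) (\<Phi> t)"
    unfolding time_one_def
   proof (intro exI[of _ "\<lambda>r. \<Phi> (r * t)"] conjI ballI)
    fix r :: real assume r: "r \<in> {0..1}"
    have m: "((\<lambda>r. r * t) has_vector_derivative t) (at r within {0..1})"
     unfolding has_real_derivative_iff_has_vector_derivative[symmetric] by (auto intro!: derivative_eq_intros)
    have "(\<lambda>r. r * t) ` {0..1} \<subseteq> {0..\<epsilon>}" using rt by blast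
    from vector_diff_chain_within[OF m has_vector_derivative_within_subset[OF \<Phi>(3)[OF rt[OF r]] this]]
    have "((\<lambda>r. \<Phi> (r * t)) has_vector_derivative t *\<^sub>R (L (r * t) o\<^sub>L \<Phi> (r * t))) (at r within {0..1})"
     by (simp add: o_def)
    moreover have "t *\<^sub>R (L (r * t) o\<^sub>L \<Phi> (r * t)) = (- \<Gamma> c (?x + (r * t) *\<^sub>R u) (t *\<^sub>R u)) o\<^sub>L \<Phi> (r * t)"
     by (rule blinfun_eqI) (simp add: L_def bl)
    ultimately show "((\<lambda>r. \<Phi> (r * t)) has_vector_derivative ((- \<Gamma> c (?x + (r * t) *\<^sub>R u) (t *\<^sub>R u)) o\<^sub>L \<Phi> (r * t))) (at r within {0..1})"
     by (simp only:)
   qed (simp_all add: \<Phi>(1))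
  qed
  then show ?thesis by (simp add: pt_def chart_inv[OF c p])
 qed
 show ?thesis by (rule that[OF e \<Phi>(1,2) \<Phi>0 \<Psi>0 \<Phi>(5,6) im T])
qed

end

section \<open>Quaternions\<close>

definition qconj :: "quat \<Rightarrow> quat" where "qconj p = (cnj (fst p), - snd p)"

lemma qmult_assoc: "qmult (qmult p q) r = qmult p (qmult q r)"
 by (simp add: qmult_def algebra_simps)

lemma qmult_linear:
 "qmult (p + p') q = qmult p q + qmult p' q" "qmult p (q + q') = qmult p q + qmult p q'"
 "qmult (a *\<^sub>R p) q = a *\<^sub>R qmult p q" "qmult p (a *\<^sub>R q) = a *\<^sub>R qmult p q"
 "qmult (p - p') q = qmult p q - qmult p' q" "qmult p (q - q') = qmult p q - qmult p q'"
 "qmult (- p) q = - qmult p q" "qmult p (- q) = - qmult p q"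
 by (simp_all add: qmult_def algebra_simps prod_eq_iff)

lemma qmult_one: "qmult (1, 0) q = q" "qmult q (1, 0) = q" "qmult (- 1, 0) q = - q" "qmult q (- 1, 0) = - q"
 by (simp_all add: qmult_def prod_eq_iff)

lemma quat_norm: "(norm q)\<^sup>2 = (Re (fst q))\<^sup>2 + (Im (fst q))\<^sup>2 + (Re (snd q))\<^sup>2 + (Im (snd q))\<^sup>2"
 by (cases q) (simp add: norm_Pair cmod_power2)

lemma norm_qmult: "norm (qmult p q) = norm p * norm q"
proof -
 have "(norm (qmult p q))\<^sup>2 = (norm p * norm q)\<^sup>2"
  unfolding power_mult_distrib quat_norm qmult_def by (simp add: power2_eq_square algebra_simps)
 then show ?thesis by simp
qed

lemma qmult_qconj: "qmult q (qconj q) = ((norm q)\<^sup>2, 0)" "qmult (qconj q) q = ((norm q)\<^sup>2, 0)"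
 unfolding quat_norm
 by (simp_all add: qmult_def qconj_def complex_eq_iff power2_eq_square algebra_simps)

lemma norm_qconj: "norm (qconj q) = norm q"
proof -
 have "(norm (qconj q))\<^sup>2 = (norm q)\<^sup>2" unfolding quat_norm by (simp add: qconj_def)
 then show ?thesis by simp
qed

lemma rscale_component: "rscale q v $ r = qmult (v $ r) q"
 by (simp add: rscale_def)

lemma rscale_rscale: "rscale p (rscale q v) = rscale (qmult q p) v"
 by (simp add: vec_eq_iff rscale_component qmult_assoc)

lemma rscale_linear: "rscale q (v + w) = rscale q v + rscale q w" "rscale q (a *\<^sub>R v) = a *\<^sub>R rscale q v"
 "rscale (p + q) v = rscale p v + rscale q v" "rscale (a *\<^sub>R q) v = a *\<^sub>R rscale q v"
 "rscale (- q) v = - rscale q v" "rscale (p - q) v = rscale p v - rscale q v"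
 by (simp_all add: vec_eq_iff rscale_component qmult_linear)

lemma rscale_one: "rscale (1, 0) v = v" "rscale (- 1, 0) v = - v"
 by (simp_all add: vec_eq_iff rscale_component qmult_one)

lemma linear_rscale: "linear (rscale q)"
 by (rule linearI) (simp_all add: rscale_linear)

lemma quat_inner: "p \<bullet> q = Re (fst p) * Re (fst q) + Im (fst p) * Im (fst q) + Re (snd p) * Re (snd q) + Im (snd p) * Im (snd q)"
 for p q :: quat
 by (simp add: inner_prod_def inner_complex_def)

lemma rscale_inner: "rscale p v \<bullet> rscale q v = (p \<bullet> q) * (v \<bullet> v)"
proof -
 have "qmult x p \<bullet> qmult x q = (p \<bullet> q) * (x \<bullet> x)" for x
  unfolding quat_inner qmult_def by (simp add: algebra_simps)
 then show ?thesis by (simp add: inner_vec_def rscale_component sum_distrib_left)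
qed

lemma norm_rscale: "norm (rscale q v) = norm q * norm v"
proof -
 have "(norm (rscale q v))\<^sup>2 = (norm q * norm v)\<^sup>2"
  unfolding power_mult_distrib by (simp add: power2_norm_eq_inner rscale_inner)
 then show ?thesis by simp
qed

lemma rscale_unit_isometry: "norm q = 1 \<Longrightarrow> orthogonal_transformation (rscale q)"
 unfolding orthogonal_transformation by (simp add: linear_rscale norm_rscale)

abbreviation "qi \<equiv> (\<i>, 0) :: quat"
abbreviation "qj \<equiv> (0, 1) :: quat"
abbreviation "qk \<equiv> (0, \<i>) :: quat"

lemma quat_units:
 "qmult qi qj = qk" "qmult qj qi = - qk" "qmult qi qi = - (1, 0)" "qmult qj qj = - (1, 0)" "qmult qk qk = - (1, 0)"
 "qmult qj qk = qi" "qmult qk qj = - qi" "qmult qk qi = qj" "qmult qi qk = - qj"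
 by (simp_all add: qmult_def)

lemma quat_expansion: "q = Re (fst q) *\<^sub>R (1, 0) + Im (fst q) *\<^sub>R qi + Re (snd q) *\<^sub>R qj + Im (snd q) *\<^sub>R qk"
 by (simp add: prod_eq_iff complex_eq_iff)

lemma rscale_eq_0: "rscale q v = 0 \<Longrightarrow> v \<noteq> 0 \<Longrightarrow> q = 0"
 using norm_rscale[of q v] by simp

text \<open>i and j generate the quaternions; real linearity gives the rest.\<close>

lemma Sp_intro:
 fixes f :: "quat ^ 'n \<Rightarrow> quat ^ 'n"
 assumes f: "orthogonal_transformation f" and i: "\<And>v. f (rscale qi v) = rscale qi (f v)" and j: "\<And>v. f (rscale qj v) = rscale qj (f v)"
 shows "f \<in> Sp"
proof -
 have lin: "linear f" using f unfolding orthogonal_transformation_def by blast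
 have k: "f (rscale qk v) = rscale qk (f v)" for v
 proof -
  have k: "rscale qk w = rscale qj (rscale qi w)" for w :: "quat ^ 'n" unfolding rscale_rscale quat_units ..
  show ?thesis unfolding k by (simp only: i j)
 qed
 have "f (rscale q v) = rscale q (f v)" for q v
 proof -
  have e: "rscale q w = Re (fst q) *\<^sub>R w + Im (fst q) *\<^sub>R rscale qi w + Re (snd q) *\<^sub>R rscale qj w + Im (snd q) *\<^sub>R rscale qk w" for w
  proof -
   have "rscale q w = rscale (Re (fst q) *\<^sub>R (1, 0) + Im (fst q) *\<^sub>R qi + Re (snd q) *\<^sub>R qj + Im (snd q) *\<^sub>R qk) w"
    using quat_expansion[of q] by simp
   then show ?thesis by (simp only: rscale_linear rscale_one)
  qed
  show ?thesis unfolding e[of v] e[of "f v"] by (simp only: linear_add[OF lin] linear_cmul[OF lin] i j k)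
 qed
 then show ?thesis using f unfolding Sp_def by blast
qed

text \<open>A normaliser element conjugates \<open>i, j\<close> to \<open>p\<^sub>1, p\<^sub>2\<close>; averaging produces \<open>q\<close> with
 \<open>i q = q p\<^sub>1\<close> and \<open>j q = q p\<^sub>2\<close>.\<close>

lemma quat_intertwiner:
 assumes p: "qmult p1 p1 = - (1, 0)" "qmult p2 p2 = - (1, 0)" "qmult p2 p1 = - qmult p1 p2"
 obtains q where "norm q = 1" "qmult qi q = qmult q p1" "qmult qj q = qmult q p2"
proof -
 define T where "T t = t - qmult qi (qmult t p1) - qmult qj (qmult t p2) - qmult qk (qmult t (qmult p1 p2))" for t
 have unit: "qmult qi (qmult qi x) = - x" "qmult qj (qmult qj x) = - x" "qmult qk (qmult qk x) = - x"
  "qmult qi (qmult qj x) = qmult qk x" "qmult qj (qmult qi x) = - qmult qk x" "qmult qj (qmult qk x) = qmult qi x"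
  "qmult qk (qmult qj x) = - qmult qi x" "qmult qk (qmult qi x) = qmult qj x" "qmult qi (qmult qk x) = - qmult qj x" for x
  by (simp_all only: qmult_assoc[symmetric] quat_units qmult_linear qmult_one)
 have r: "qmult p1 (qmult p1 x) = - x" for x
  by (simp only: qmult_assoc[symmetric] p qmult_linear qmult_one)
 have Ti: "qmult qi (T t) = qmult (T t) p1" for t
  unfolding T_def by (simp only: qmult_linear unit) (simp add: qmult_assoc p r qmult_linear qmult_one)
 have Tj: "qmult qj (T t) = qmult (T t) p2" for t
  unfolding T_def by (simp only: qmult_linear unit) (simp add: qmult_assoc p r qmult_linear qmult_one)
 \<comment> \<open>A single T t may vanish; this combination of four values equals 4, so not all of
   them do.\<close>
 have "T (1, 0) - qmult qi (T qi) - qmult qj (T qj) - qmult qk (T qk) = 4 *\<^sub>R (1, 0)"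
  unfolding T_def by (simp only: qmult_linear unit quat_units qmult_one qmult_assoc[symmetric]) (simp add: prod_eq_iff qmult_linear scaleR_conv_of_real)
 moreover have "qmult x 0 = 0" for x by (simp add: qmult_def prod_eq_iff)
 ultimately have "\<exists>t. T t \<noteq> 0" by (metis diff_zero scaleR_eq_0_iff zero_neq_numeral fst_conv fst_zero zero_neq_one)
 then obtain t where t: "T t \<noteq> 0" by blast
 show ?thesis
  by (rule that[of "(1 / norm (T t)) *\<^sub>R T t"]) (use t Ti Tj in \<open>simp_all add: qmult_linear\<close>)
qed

text \<open>Injectivity of u forces the relations of i and j on p1 and p2. With the intertwiner q,
  the map u composed with right multiplication by q becomes quaternionic linear.\<close>

lemma Sp1Sp_intro:
 fixes u :: "quat ^ 'n \<Rightarrow> quat ^ 'n"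
 assumes u: "orthogonal_transformation u" and 1: "\<And>v. u (rscale p1 v) = rscale qi (u v)" and 2: "\<And>v. u (rscale p2 v) = rscale qj (u v)"
 shows "u \<in> Sp1Sp"
proof -
 have lin: "linear u" and inj: "inj u" using u orthogonal_transformation_linear orthogonal_transformation_inj by blast+
 obtain e :: "quat ^ 'n" where e: "e \<noteq> 0" by (metis norm_zero vector_choose_size zero_neq_one zero_le_one)
 have faithful: "p = q" if "u (rscale p e) = u (rscale q e)" for p q
 proof -
  have "rscale (p - q) e = 0" using injD[OF inj that] by (simp add: rscale_linear)
  from rscale_eq_0[OF this e] show ?thesis by simp
 qed
 have neg: "u (- v) = - u v" for v by (rule linear_neg[OF lin])
 have "u (rscale (qmult p1 p1) e) = u (rscale (- (1, 0)) e)"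
  unfolding rscale_rscale[symmetric] 1 by (simp add: rscale_rscale quat_units rscale_linear rscale_one neg)
 then have p1: "qmult p1 p1 = - (1, 0)" by (rule faithful)
 have "u (rscale (qmult p2 p2) e) = u (rscale (- (1, 0)) e)"
  unfolding rscale_rscale[symmetric] 2 by (simp add: rscale_rscale quat_units rscale_linear rscale_one neg)
 then have p2: "qmult p2 p2 = - (1, 0)" by (rule faithful)
 have "u (rscale (qmult p2 p1) e) = u (rscale (- qmult p1 p2) e)"
  unfolding rscale_linear rscale_rscale[symmetric] 1 2 neg by (simp only: rscale_rscale quat_units rscale_linear)
 then have p12: "qmult p2 p1 = - qmult p1 p2" by (rule faithful)
 obtain q where q: "norm q = 1" "qmult qi q = qmult q p1" "qmult qj q = qmult q p2"
  by (rule quat_intertwiner[OF p1 p2 p12]) (rule that; assumption)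
 define f where "f v = u (rscale q v)" for v
 have "f \<in> Sp"
 proof (rule Sp_intro)
  show "orthogonal_transformation f" unfolding f_def[abs_def]
   using orthogonal_transformation_compose[OF u rscale_unit_isometry[OF q(1)]] by (simp add: o_def)
  show "f (rscale qi v) = rscale qi (f v)" for v
   unfolding f_def 1[symmetric] rscale_rscale q(2) ..
  show "f (rscale qj v) = rscale qj (f v)" for v
   unfolding f_def 2[symmetric] rscale_rscale q(3) ..
 qed
 moreover have "u = f \<circ> rscale (qconj q)"
  unfolding f_def fun_eq_iff o_def rscale_rscale using qmult_qconj(2)[of q] q(1) by (simp add: rscale_one)
 moreover have "norm (qconj q) = 1" using norm_qconj[of q] q(1) by simp
 ultimately show ?thesis unfolding Sp1Sp_def by blast
qed

section \<open>The groups Sp(n) and Sp(1)Sp(n)\<close>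

lemma SpD: assumes "f \<in> Sp"
 shows "orthogonal_transformation f" "f (rscale q v) = rscale q (f v)" "linear f" "f v \<bullet> f w = v \<bullet> w" "bij f"
proof -
 show f: "orthogonal_transformation f" and "f (rscale q v) = rscale q (f v)" using assms unfolding Sp_def by blast+
 then show "linear f" "f v \<bullet> f w = v \<bullet> w" unfolding orthogonal_transformation_def by blast+
 show "bij f" by (rule orthogonal_transformation_bij[OF f])
qed

lemma Sp_compose: "f \<in> Sp \<Longrightarrow> h \<in> Sp \<Longrightarrow> f \<circ> h \<in> Sp"
 unfolding Sp_def by (auto intro: orthogonal_transformation_compose)

lemma Sp_inv: assumes f: "f \<in> Sp" shows "inv f \<in> Sp"
proof -
 note F = SpD[OF f]
 have "inv f (rscale q v) = rscale q (inv f v)" for q v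
  by (rule inv_f_eq[OF bij_is_inj[OF F(5)]]) (simp add: F(2) surj_f_inv_f[OF bij_is_surj[OF F(5)]])
 then show ?thesis using orthogonal_transformation_inv[OF F(1)] unfolding Sp_def by blast
qed

lemma Sp1Sp_orthogonal: "u \<in> Sp1Sp \<Longrightarrow> orthogonal_transformation u"
 unfolding Sp1Sp_def using orthogonal_transformation_compose[OF SpD(1) rscale_unit_isometry] by blast

lemma Sp1Sp_compose:
 assumes "u \<in> Sp1Sp" "w \<in> Sp1Sp" shows "u \<circ> w \<in> Sp1Sp"
proof -
 obtain f q h r where u: "u = f \<circ> rscale q" "f \<in> Sp" "norm q = 1" and w: "w = h \<circ> rscale r" "h \<in> Sp" "norm r = 1"
  using assms unfolding Sp1Sp_def by blast
 have "u \<circ> w = (f \<circ> h) \<circ> rscale (qmult r q)"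
  unfolding u w fun_eq_iff o_def by (simp add: SpD(2)[OF w(2)] rscale_rscale[symmetric])
 moreover have "norm (qmult r q) = 1" by (simp add: norm_qmult u w)
 ultimately show ?thesis using Sp_compose[OF u(2) w(2)] unfolding Sp1Sp_def by blast
qed

lemma Sp1Sp_inv:
 assumes "u \<in> Sp1Sp" shows "inv u \<in> Sp1Sp"
proof -
 obtain f q where u: "u = f \<circ> rscale q" "f \<in> Sp" "norm q = 1" using assms unfolding Sp1Sp_def by blast
 note F = SpD[OF Sp_inv[OF u(2)]]
 have "inv u v = (inv f \<circ> rscale (qconj q)) v" for v
 proof (rule inv_f_eq)
  show "inj u" using Sp1Sp_orthogonal[OF assms] orthogonal_transformation_inj by blast
  have "qmult (qconj q) q = (1, 0)" using qmult_qconj(2)[of q] u(3) by simp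
  then show "u ((inv f \<circ> rscale (qconj q)) v) = v"
   unfolding u(1) o_def F(2)[symmetric] rscale_rscale by (simp add: F(2) rscale_one surj_f_inv_f[OF bij_is_surj[OF SpD(5)[OF u(2)]]])
 qed
 then have "inv u = inv f \<circ> rscale (qconj q)" by blast
 moreover have "norm (qconj q) = 1" using norm_qconj[of q] u(3) by simp
 ultimately show ?thesis using Sp_inv[OF u(2)] unfolding Sp1Sp_def by blast
qed

subsection \<open>Generation by a neighbourhood of the identity\<close>

text \<open>The quaternionic Hermitian form, assembled from real inner products;
  \<open>inner_qform\<close> characterises it by duality with the right multiples of u.\<close>

definition qform :: "quat ^ 'n \<Rightarrow> quat ^ 'n \<Rightarrow> quat" where
 "qform u z = (Complex (u \<bullet> z) (rscale qi u \<bullet> z), Complex (rscale qj u \<bullet> z) (rscale qk u \<bullet> z))"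

lemma rscale_expansion: "rscale q w = Re (fst q) *\<^sub>R w + Im (fst q) *\<^sub>R rscale qi w + Re (snd q) *\<^sub>R rscale qj w + Im (snd q) *\<^sub>R rscale qk w"
proof -
 have "rscale q w = rscale (Re (fst q) *\<^sub>R (1, 0) + Im (fst q) *\<^sub>R qi + Re (snd q) *\<^sub>R qj + Im (snd q) *\<^sub>R qk) w"
  using quat_expansion[of q] by simp
 then show ?thesis by (simp only: rscale_linear rscale_one)
qed

lemma inner_qform: "rscale p u \<bullet> z = p \<bullet> qform u z"
 unfolding rscale_expansion[of p u] qform_def quat_inner by (simp add: inner_add_left)

lemma qform_eqI: "(\<And>p. rscale p u \<bullet> z = p \<bullet> q) \<Longrightarrow> qform u z = q"
 unfolding inner_qform by (metis vector_eq_ldot)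

lemma rscale_adjoint: "rscale p u \<bullet> rscale q z = rscale (qmult p (qconj q)) u \<bullet> z"
proof -
 have "qmult x p \<bullet> qmult y q = qmult x (qmult p (qconj q)) \<bullet> y" for x y
  unfolding quat_inner qmult_def qconj_def by (simp add: algebra_simps)
 then show ?thesis by (simp add: inner_vec_def rscale_component)
qed

lemma qform_rscale: "qform u (rscale q z) = qmult (qform u z) q"
proof (rule qform_eqI)
 fix p
 have "qmult p (qconj q) \<bullet> x = p \<bullet> qmult x q" for x
  unfolding quat_inner qmult_def qconj_def by (simp add: algebra_simps)
 then show "rscale p u \<bullet> rscale q z = p \<bullet> qmult (qform u z) q" unfolding rscale_adjoint unfolding inner_qform .
qed

lemma qform_add: "qform u (z + w) = qform u z + qform u w"
 by (rule qform_eqI) (simp add: inner_add_right inner_qform)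

lemma qform_scale: "qform u (a *\<^sub>R z) = a *\<^sub>R qform u z"
 by (rule qform_eqI) (simp add: inner_qform)

lemma qform_diff_left: "qform (u - u') z = qform u z - qform u' z"
proof (rule qform_eqI)
 fix p
 have "rscale p (u - u') = rscale p u - rscale p u'" using linear_diff[OF linear_rscale] .
 then show "rscale p (u - u') \<bullet> z = p \<bullet> (qform u z - qform u' z)" by (simp add: inner_diff_left inner_diff_right inner_qform)
qed

lemma qform_Sp: "f \<in> Sp \<Longrightarrow> qform (f u) (f z) = qform u z"
proof (rule qform_eqI)
 fix p assume f: "f \<in> Sp"
 show "rscale p (f u) \<bullet> f z = p \<bullet> qform u z"
  unfolding SpD(2)[OF f, symmetric] SpD(4)[OF f] inner_qform ..
qed

text \<open>A quaternionic rank one perturbation of the identity; the isometric ones are the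
  quaternionic reflections.\<close>

definition qreflection :: "quat ^ 'n \<Rightarrow> quat \<Rightarrow> quat ^ 'n \<Rightarrow> quat ^ 'n" where
 "qreflection u \<beta> z = z + rscale (qmult \<beta> (qform u z)) u"

text \<open>The condition on \<beta> is the vanishing of the factor by which
  \<open>qform u v \<bullet> qform u w\<close> enters the change of the inner product.\<close>

lemma qreflection_Sp:
 assumes \<beta>: "2 * Re (fst \<beta>) + (u \<bullet> u) * (\<beta> \<bullet> \<beta>) = 0"
 shows "qreflection u \<beta> \<in> Sp"
proof -
 have "qreflection u \<beta> v \<bullet> qreflection u \<beta> w = v \<bullet> w" for v w
 proof -
  let ?x = "qform u v" and ?y = "qform u w"
  have 1: "qmult \<beta> ?y \<bullet> ?x + qmult \<beta> ?x \<bullet> ?y = 2 * Re (fst \<beta>) * (?x \<bullet> ?y)"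
   unfolding quat_inner qmult_def by (simp add: algebra_simps)
  have 2: "qmult \<beta> ?x \<bullet> qmult \<beta> ?y = (\<beta> \<bullet> \<beta>) * (?x \<bullet> ?y)"
   unfolding quat_inner qmult_def by (simp add: algebra_simps)
  have "qreflection u \<beta> v \<bullet> qreflection u \<beta> w = v \<bullet> w + (qmult \<beta> ?y \<bullet> ?x + qmult \<beta> ?x \<bullet> ?y) + (qmult \<beta> ?x \<bullet> qmult \<beta> ?y) * (u \<bullet> u)"
   unfolding qreflection_def by (simp add: inner_add_left inner_add_right rscale_inner inner_commute[of v "rscale _ u"]) (simp add: inner_qform)
  also have "\<dots> = v \<bullet> w + (2 * Re (fst \<beta>) + (u \<bullet> u) * (\<beta> \<bullet> \<beta>)) * (?x \<bullet> ?y)" unfolding 1 2 by (simp add: algebra_simps)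
  finally show ?thesis using \<beta> by simp
 qed
 moreover have "linear (qreflection u \<beta>)"
  by (rule linearI) (simp_all add: qreflection_def qform_add qform_scale qmult_linear rscale_linear scaleR_add_right)
 moreover have "qreflection u \<beta> (rscale q v) = rscale q (qreflection u \<beta> v)" for q v
  unfolding qreflection_def by (simp add: qform_rscale rscale_linear rscale_rscale qmult_assoc)
 ultimately show ?thesis unfolding Sp_def orthogonal_transformation_def by blast
qed

lemma Sp_subset_Sp1Sp: "f \<in> Sp \<Longrightarrow> f \<in> Sp1Sp"
proof -
 assume f: "f \<in> Sp"
 have "f = f \<circ> rscale (1, 0)" by (simp add: fun_eq_iff rscale_one)
 moreover have "norm ((1, 0) :: quat) = 1" by (simp add: norm_Pair)
 ultimately show ?thesis using f unfolding Sp1Sp_def by blast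
qed

lemma id_Sp: "id \<in> Sp"
 unfolding Sp_def by (simp add: orthogonal_transformation_def id_def linear_iff)

lemma qreflection_diff: "norm (qreflection u \<beta> v - qreflection u \<beta>' v) \<le> (norm u * norm u) * dist \<beta> \<beta>' * norm v"
proof -
 have n: "norm (qform u v) \<le> norm u * norm v"
 proof (cases "qform u v = 0")
  case False
  have "norm (qform u v) * norm (qform u v) = rscale (qform u v) u \<bullet> v" unfolding inner_qform by (simp add: power2_norm_eq_inner[symmetric] power2_eq_square)
  also have "\<dots> \<le> norm (rscale (qform u v) u) * norm v" by (rule norm_cauchy_schwarz)
  finally show ?thesis using False by (simp add: norm_rscale)
 qed simp
 have "qreflection u \<beta> v - qreflection u \<beta>' v = rscale (qmult (\<beta> - \<beta>') (qform u v)) u"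
  unfolding qreflection_def by (simp add: qmult_linear rscale_linear)
 then have "norm (qreflection u \<beta> v - qreflection u \<beta>' v) = dist \<beta> \<beta>' * norm (qform u v) * norm u"
  by (simp add: norm_rscale norm_qmult dist_norm)
 also have "\<dots> \<le> dist \<beta> \<beta>' * (norm u * norm v) * norm u" using n by (intro mult_right_mono mult_left_mono) auto
 finally show ?thesis by (simp add: mult_ac)
qed

text \<open>Isolates the group theory: closure under composition and a neighbourhood of the identity
  must generate everything.\<close>

locale near_identity =
 fixes H :: "(quat ^ 'n \<Rightarrow> quat ^ 'n) set" and \<epsilon> :: real
 assumes comp: "u \<in> H \<Longrightarrow> w \<in> H \<Longrightarrow> u \<circ> w \<in> H" and \<epsilon>: "\<epsilon> > 0"
  and near: "u \<in> Sp1Sp \<Longrightarrow> (\<And>v. norm (u v - v) \<le> \<epsilon> * norm v) \<Longrightarrow> u \<in> H"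
begin

lemma id_in: "id \<in> H"
 by (rule near[OF Sp_subset_Sp1Sp[OF id_Sp]]) (use \<epsilon> in simp)

text \<open>Members with close parameters differ by a factor near the identity, so membership in H
  is locally constant along the family.\<close>

lemma connected_family:
 fixes F :: "quat \<Rightarrow> quat ^ 'n \<Rightarrow> quat ^ 'n"
 assumes S: "connected S" "a \<in> S" "b \<in> S" and F: "\<And>x. x \<in> S \<Longrightarrow> F x \<in> Sp1Sp"
  and lip: "\<And>x y v. norm (F x v - F y v) \<le> C * dist x y * norm v" and C: "C \<ge> 0"
 shows "F a \<in> H \<longleftrightarrow> F b \<in> H"
proof (rule connected_equivalence_relation[OF S])
 fix x assume x: "x \<in> S"
 define r where "r = \<epsilon> / (C + 1)"
 have r: "r > 0" unfolding r_def using \<epsilon> C by simp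
 have step: "F z \<in> H" if y: "y \<in> S" "z \<in> S" "dist z y < r" "F y \<in> H" for y z
 proof -
  have b: "bij (F y)" using orthogonal_transformation_bij[OF Sp1Sp_orthogonal[OF F[OF y(1)]]] .
  have "F z \<circ> inv (F y) \<in> H"
  proof (rule near[OF Sp1Sp_compose[OF F[OF y(2)] Sp1Sp_inv[OF F[OF y(1)]]]])
   fix v
   define w where "w = inv (F y) v"
   have v: "v = F y w" unfolding w_def by (simp add: surj_f_inv_f[OF bij_is_surj[OF b]])
   have nw: "norm v = norm w" unfolding v using Sp1Sp_orthogonal[OF F[OF y(1)]] orthogonal_transformation by blast
   have "C * dist z y \<le> (C + 1) * r" using y(3) C by (intro mult_mono) auto
   also have "\<dots> = \<epsilon>" unfolding r_def using C by simp
   finally have "C * dist z y * norm w \<le> \<epsilon> * norm w" by (rule mult_right_mono) simp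
   with lip[of z w y] have "norm (F z w - F y w) \<le> \<epsilon> * norm w" by linarith
   then show "norm ((F z \<circ> inv (F y)) v - v) \<le> \<epsilon> * norm v"
    unfolding nw o_def w_def[symmetric] unfolding v .
  qed
  from comp[OF this y(4)] have "F z \<circ> inv (F y) \<circ> F y \<in> H" .
  moreover have "F z \<circ> inv (F y) \<circ> F y = F z" using b by (simp add: fun_eq_iff bij_is_inj)
  ultimately show ?thesis by simp
 qed
 show "\<exists>T. openin (top_of_set S) T \<and> x \<in> T \<and> (\<forall>y\<in>T. (F x \<in> H) = (F y \<in> H))"
 proof (intro exI[of _ "S \<inter> ball x r"] conjI ballI)
  show "openin (top_of_set S) (S \<inter> ball x r)" by (rule openin_open_Int) simp
  fix y assume "y \<in> S \<inter> ball x r"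
  then have "y \<in> S" "dist x y < r" "dist y x < r" by (simp_all add: dist_commute)
  then show "(F x \<in> H) = (F y \<in> H)" using step[of x y] step[of y x] x by blast
 qed (use x r in auto)
qed auto

lemma rscale_in: assumes "norm q = 1" shows "rscale q \<in> H"
proof -
 have "rscale (1, 0) = (id :: quat ^ 'n \<Rightarrow> quat ^ 'n)" by (simp add: fun_eq_iff rscale_one)
 moreover have "(rscale (1, 0) :: quat ^ 'n \<Rightarrow> quat ^ 'n) \<in> H \<longleftrightarrow> rscale q \<in> H"
 proof (rule connected_family[where S = "sphere 0 1" and C = 1])
  show "connected (sphere (0 :: quat) 1)" by (rule connected_sphere) simp
  show "rscale x \<in> Sp1Sp" if "x \<in> sphere 0 1" for x
  proof -
   have "rscale x = id \<circ> rscale x" by simp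
   moreover have "norm x = 1" using that by simp
   ultimately show ?thesis using id_Sp unfolding Sp1Sp_def by blast
  qed
  show "norm (rscale x v - rscale y v) \<le> 1 * dist x y * norm v" for x y v
   unfolding rscale_linear[symmetric] norm_rscale dist_norm by simp
 qed (use assms in \<open>auto simp: norm_Pair\<close>)
 ultimately show ?thesis using id_in by simp
qed

text \<open>With n = |u|^2 the admissible \<beta> form the sphere with centre -1/n and radius 1/n.
  It is connected and contains 0, the parameter of the identity.\<close>

lemma qreflection_in:
 assumes u: "u \<noteq> 0" and \<beta>: "2 * Re (fst \<beta>) + (u \<bullet> u) * (\<beta> \<bullet> \<beta>) = 0"
 shows "qreflection u \<beta> \<in> H"
proof -
 define n where "n = u \<bullet> u"
 have n: "n > 0" unfolding n_def using u by simp
 define S where "S = {\<beta> :: quat. 2 * Re (fst \<beta>) + n * (\<beta> \<bullet> \<beta>) = 0}"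
 have "S = sphere (complex_of_real (- 1 / n), 0) (1 / n)"
 proof (intro set_eqI)
  fix \<gamma> :: quat
  have "\<gamma> \<in> sphere (complex_of_real (- 1 / n), 0) (1 / n) \<longleftrightarrow> (norm (\<gamma> - (complex_of_real (- 1 / n), 0)))\<^sup>2 = (1 / n)\<^sup>2"
   using n by (simp add: dist_norm norm_minus_commute power2_eq_iff_nonneg)
  also have "(norm (\<gamma> - (complex_of_real (- 1 / n), 0)))\<^sup>2 = (\<gamma> \<bullet> \<gamma>) + 2 * Re (fst \<gamma>) / n + (1 / n)\<^sup>2"
   unfolding quat_norm quat_inner using n by (simp add: power2_eq_square field_simps)
  also have "\<dots> = (1 / n)\<^sup>2 \<longleftrightarrow> n * ((\<gamma> \<bullet> \<gamma>) + 2 * Re (fst \<gamma>) / n) = 0" using n by simp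
  also have "n * ((\<gamma> \<bullet> \<gamma>) + 2 * Re (fst \<gamma>) / n) = 2 * Re (fst \<gamma>) + n * (\<gamma> \<bullet> \<gamma>)" using n by (simp add: distrib_left)
  also have "\<dots> = 0 \<longleftrightarrow> \<gamma> \<in> S" unfolding S_def by simp
  finally show "\<gamma> \<in> S \<longleftrightarrow> \<gamma> \<in> sphere (complex_of_real (- 1 / n), 0) (1 / n)" by blast
 qed
 moreover have "connected (sphere (complex_of_real (- 1 / n), 0 :: complex) (1 / n))" by (rule connected_sphere) simp
 ultimately have S: "connected S" by simp
 have "qreflection u 0 \<in> H \<longleftrightarrow> qreflection u \<beta> \<in> H"
 proof (rule connected_family[OF S])
  show "0 \<in> S" "\<beta> \<in> S" using \<beta> unfolding S_def n_def by simp_all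
  show "qreflection u x \<in> Sp1Sp" if "x \<in> S" for x
   using that unfolding S_def n_def by (intro Sp_subset_Sp1Sp qreflection_Sp) simp
  show "norm (qreflection u x v - qreflection u y v) \<le> (norm u * norm u) * dist x y * norm v" for x y v
   by (rule qreflection_diff)
 qed simp
 moreover have "qreflection u 0 = id"
  using rscale_linear(4)[of 0 "(1, 0)" u] by (simp add: fun_eq_iff qreflection_def qmult_def zero_prod_def)
 ultimately show ?thesis using id_in by simp
qed

text \<open>Induction in the style of Cartan and Dieudonne: splitting off a reflection that carries
  x to f x and respects the fixed vectors of f enlarges the fixed space.\<close>

lemma Sp_in: "f \<in> Sp \<Longrightarrow> f \<in> H"
proof (induction "DIM(quat ^ 'n) - dim {v. f v = v}" arbitrary: f rule: less_induct)
 case less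
 note f = less.prems and F = SpD[OF less.prems]
 show ?case
 proof (cases "\<forall>v. f v = v")
  case True
  then have "f = id" by (simp add: fun_eq_iff)
  then show ?thesis using id_in by simp
 next
  case False
  then obtain x where x: "f x \<noteq> x" by blast
  \<comment> \<open>\<beta> is the inverse of c, which makes the reflection send x to x + u = f
    x.\<close>
  define u c \<beta> where "u = f x - x" and "c = qform u x" and "\<beta> = (1 / (c \<bullet> c)) *\<^sub>R qconj c"
  have u: "u \<noteq> 0" unfolding u_def using x by simp
  have Rec: "2 * Re (fst c) = - (u \<bullet> u)"
   unfolding c_def qform_def u_def using F(4)[of x x] by (simp add: inner_diff_left inner_diff_right inner_commute)
  have c: "c \<noteq> 0" using Rec u by auto
  then have cc: "c \<bullet> c > 0" by simp
  have "\<beta> \<bullet> \<beta> = 1 / (c \<bullet> c)"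
   using cc norm_qconj[of c] unfolding \<beta>_def
   by (simp add: power2_norm_eq_inner[symmetric] power2_eq_square)
  moreover have "Re (fst \<beta>) = Re (fst c) / (c \<bullet> c)" unfolding \<beta>_def by (simp add: qconj_def)
  ultimately have \<beta>: "2 * Re (fst \<beta>) + (u \<bullet> u) * (\<beta> \<bullet> \<beta>) = 0"
   using Rec by (simp add: field_simps)
  define \<rho> where "\<rho> = qreflection u \<beta>"
  have \<rho>: "\<rho> \<in> Sp" "\<rho> \<in> H" unfolding \<rho>_def using qreflection_Sp[OF \<beta>] qreflection_in[OF u \<beta>] by auto
  have "qmult \<beta> c = (1, 0)"
   unfolding \<beta>_def using qmult_qconj(2)[of c] cc by (simp add: qmult_linear power2_norm_eq_inner scaleR_conv_of_real)
  then have \<rho>x: "\<rho> x = f x" unfolding \<rho>_def qreflection_def c_def[symmetric] by (simp add: rscale_one u_def)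
  define h where "h = inv \<rho> \<circ> f"
  have h: "h \<in> Sp" unfolding h_def by (rule Sp_compose[OF Sp_inv[OF \<rho>(1)] f])
  have inv: "inv \<rho> z = w" if "\<rho> w = z" for w z by (rule inv_f_eq[OF bij_is_inj[OF SpD(5)[OF \<rho>(1)]] that])
  \<comment> \<open>A fixed vector of f is orthogonal to f x - x over the quaternions, so the
    reflection does not move it.\<close>
  have fixed: "h w = w" if w: "f w = w" for w
  proof -
   have "qform u w = 0" unfolding u_def qform_diff_left using qform_Sp[OF f, of x w] w by simp
   then have "\<rho> w = w" using rscale_linear(4)[of 0 "(1, 0)" u] by (simp add: \<rho>_def qreflection_def qmult_def zero_prod_def)
   from inv[OF this] show ?thesis unfolding h_def by (simp add: w)
  qed
  have hx: "h x = x" unfolding h_def using inv[OF \<rho>x] by simp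
  have sub: "subspace {v. f v = v}" if "linear f" for f :: "quat ^ 'n \<Rightarrow> quat ^ 'n"
   unfolding subspace_def using linear_0[OF that] linear_add[OF that] linear_cmul[OF that] by simp
  have "{v. f v = v} \<subset> {v. h v = v}" using fixed hx x by blast
  then have "dim {v. f v = v} < dim {v. h v = v}"
   by (intro dim_psubset) (simp add: span_eq_iff[THEN iffD2, OF sub[OF F(3)]] span_eq_iff[THEN iffD2, OF sub[OF SpD(3)[OF h]]])
  moreover have "dim {v. h v = v} \<le> DIM(quat ^ 'n)" by (rule dim_subset_UNIV)
  ultimately have "h \<in> H" by (intro less.hyps[OF _ h]) linarith
  then have "\<rho> \<circ> h \<in> H" by (rule comp[OF \<rho>(2)])
  moreover have "\<rho> \<circ> h = f" unfolding h_def by (simp add: fun_eq_iff surj_f_inv_f[OF bij_is_surj[OF SpD(5)[OF \<rho>(1)]]])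
  ultimately show ?thesis by simp
 qed
qed

lemma Sp1Sp_subset: "Sp1Sp \<subseteq> H"
 unfolding Sp1Sp_def using comp[OF Sp_in rscale_in] by blast

end

subsection \<open>The model quaternionic structure\<close>

definition stdb :: "(quat ^ 'n) bilin" where "stdb = Blinfun blinfun_inner_right"
definition rsc :: "quat \<Rightarrow> (quat ^ 'n) endo" where "rsc q = Blinfun (rscale q)"

lemma stdb: "stdb v w = v \<bullet> w"
 unfolding stdb_def by (simp add: bounded_linear_Blinfun_apply[OF bounded_linear_blinfun_inner_right])

lemma rsc: "rsc q v = rscale q v"
 unfolding rsc_def by (simp add: bounded_linear_Blinfun_apply linear_conv_bounded_linear[symmetric] linear_rscale)

lemma rscale_isometry: "norm q = 1 \<Longrightarrow> rscale q v \<bullet> rscale q w = v \<bullet> w"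
 using rscale_unit_isometry unfolding orthogonal_transformation_def by blast

text \<open>Right multiplication reverses products: the operators of i and j compose to that of ji =
  -k, which is therefore the third structure.\<close>

lemma std_quat: "quat_hermitian stdb (rsc qi) (rsc qj) (rsc (- qk))"
proof
 show "quat_triple stdb (span {rsc qi, rsc qj, rsc (- qk)}) (rsc qi) (rsc qj) (rsc (- qk))"
  unfolding quat_triple_def
  by (auto intro!: blinfun_eqI simp: rsc stdb rscale_isometry norm_Pair rscale_rscale qmult_linear quat_units rscale_linear rscale_one blinfun.bilinear_simps inner_prod_def
    simp del: uminus_Pair)
qed (auto simp: stdb inner_commute)

declare uminus_Pair [simp del]

abbreviation "model_ims \<equiv> quat_hermitian.ims (rsc qi) (rsc qj) (rsc (- qk))"
abbreviation "model_spn \<equiv> quat_hermitian.spn stdb (rsc qi) (rsc qj) (rsc (- qk))"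

lemma Sp_commuting:
 fixes F :: "(quat ^ 'n) endo"
 assumes "blinfun_apply F \<in> Sp" shows "quat_hermitian.commuting (rsc qi) (rsc qj) (rsc (- qk)) F"
proof -
 interpret S: quat_hermitian stdb "rsc qi" "rsc qj" "rsc (- qk)" by (rule std_quat)
 show ?thesis by (rule S.commutingI) (simp_all only: rsc SpD(2)[OF assms])
qed

text \<open>Writing \<open>w = f \<circ> rscale q\<close>, orthogonality to the Lie algebra makes \<open>q\<close> real and \<open>f\<close> symmetric,
 so that \<open>w\<close> is an involution.\<close>

lemma Sp1Sp_transversal:
 fixes w :: "quat ^ 'n \<Rightarrow> quat ^ 'n"
 assumes w: "w \<in> Sp1Sp" and B: "orthonormal_frame stdb B"
  and im: "\<And>c1 c2 c3. (\<Sum>k\<in>B. w k \<bullet> model_ims c1 c2 c3 k) = 0"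
  and sp: "\<And>X. model_spn X \<Longrightarrow> (\<Sum>k\<in>B. w k \<bullet> X k) = 0"
  and near: "\<And>v. norm (w v - v) \<le> 1 / 2 * norm v"
 shows "w = id"
proof -
 interpret S: quat_hermitian_frame stdb "rsc qi" "rsc qj" "rsc (- qk)" B
  using std_quat B unfolding quat_hermitian_frame_def quat_hermitian_frame_axioms_def by blast
 obtain f q where w_eq: "w = f \<circ> rscale q" and f: "f \<in> Sp" and q: "norm q = 1"
  using w unfolding Sp1Sp_def by blast
 let ?q0 = "Re (fst q)" and ?q1 = "Im (fst q)" and ?q2 = "Re (snd q)" and ?q3 = "- Im (snd q)"
 define F where "F = Blinfun f"
 define G where "G = Blinfun (inv f)"
 have F: "F v = f v" for v unfolding F_def
  by (simp add: bounded_linear_Blinfun_apply linear_conv_bounded_linear[symmetric] SpD(3)[OF f])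
 have G: "G v = inv f v" for v unfolding G_def
  by (simp add: bounded_linear_Blinfun_apply linear_conv_bounded_linear[symmetric] SpD(3)[OF Sp_inv[OF f]])
 have F': "blinfun_apply F = f" and G': "blinfun_apply G = inv f" using F G by (simp_all add: fun_eq_iff)
 have cF: "S.commuting F" by (rule Sp_commuting) (simp add: F' f)
 have cG: "S.commuting G" by (rule Sp_commuting) (simp add: G' Sp_inv[OF f])
 have FG: "f (inv f v) = v" for v by (simp add: surj_f_inv_f[OF bij_is_surj[OF SpD(5)[OF f]]])
 have adj: "F v \<bullet> z = v \<bullet> G z" for v z using SpD(4)[OF f, of v "inv f z"] by (simp add: F G FG)
 note lin = SpD(3)[OF f]
 have w_exp: "w v = ?q0 *\<^sub>R F v + F (S.ims ?q1 ?q2 ?q3 v)" for v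
 proof -
  have "rscale q v = ?q0 *\<^sub>R v + S.ims ?q1 ?q2 ?q3 v"
   unfolding rscale_expansion[of q v] S.ims_apply rsc by (simp add: rscale_linear del: uminus_Pair)
  then show ?thesis unfolding w_eq o_def F by (simp add: linear_add[OF lin] linear_cmul[OF lin])
 qed
 have tr0: "(\<Sum>k\<in>B. S.ims c1 c2 c3 k \<bullet> A k) = 0" if "S.commuting A" for c1 c2 c3 A
  using S.trace_J_commuting[OF that] unfolding stdb S.ims_apply
  by (simp add: inner_add_left sum.distrib sum_distrib_left[symmetric])
 have cc: "S.commuting (X o\<^sub>L Y)" if "S.commuting X" "S.commuting Y" for X Y
  using that unfolding S.commuting_def by simp
 \<comment> \<open>Since G is the adjoint of F, this is twice the skew part of f. It lies in sp(n),
   and orthogonality of w to it will yield |A|^2 = 0.\<close>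
 define A where "A = F - G"
 have cA: "S.commuting A" using cF cG unfolding A_def S.commuting_def by (simp add: blinfun.bilinear_simps)
 have "skew stdb A" unfolding skew_def stdb A_def
  using adj by (simp add: blinfun.bilinear_simps inner_diff_left inner_diff_right inner_commute[of "G _"]) (simp add: inner_commute)
 then have A: "S.spn A" using cA unfolding S.spn_def by blast
 define T where "T = (\<Sum>k\<in>B. F k \<bullet> k)"
 have trw: "(\<Sum>k\<in>B. w k \<bullet> k) = ?q0 * T"
 proof -
  have "(\<Sum>k\<in>B. F (S.ims ?q1 ?q2 ?q3 k) \<bullet> k) = 0" unfolding adj by (rule tr0[OF cG])
  then show ?thesis unfolding w_exp T_def by (simp add: inner_add_left sum.distrib sum_distrib_left)
 qed
 have fin: "finite B" and ne: "B \<noteq> {}" and unit: "k \<in> B \<Longrightarrow> k \<bullet> k = 1" for k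
  using B card.infinite[of B] unfolding orthonormal_frame_def stdb by fastforce+
 \<comment> \<open>Closeness to the identity makes the trace positive; as it equals
   \<open>?q0 * T\<close>, both factors are non-zero.\<close>
 have "(\<Sum>k\<in>B. w k \<bullet> k) > 0"
 proof (rule sum_pos[OF fin ne])
  fix k assume k: "k \<in> B"
  have "norm k = 1" using unit[OF k] by (simp add: norm_eq_1)
  then have "\<bar>(w k - k) \<bullet> k\<bar> \<le> 1 / 2" using Cauchy_Schwarz_ineq2[of "w k - k" k] near[of k] by simp
  then show "w k \<bullet> k > 0" unfolding inner_diff_left unit[OF k] by linarith
 qed
 then have q0: "?q0 \<noteq> 0" "T \<noteq> 0" unfolding trw by auto
 have "(\<Sum>k\<in>B. F (S.ims ?q1 ?q2 ?q3 k) \<bullet> A k) = 0"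
  unfolding adj using tr0[OF cc[OF cG cA]] by simp
 then have "?q0 * (\<Sum>k\<in>B. F k \<bullet> A k) = 0"
  using sp[OF A] unfolding w_exp by (simp add: inner_add_left sum.distrib sum_distrib_left)
 then have FA: "(\<Sum>k\<in>B. F k \<bullet> A k) = 0" using q0 by simp
 have skA: "A v \<bullet> z = - (v \<bullet> A z)" for v z using \<open>skew stdb A\<close> unfolding skew_def stdb by simp
 have "(\<Sum>k\<in>B. G k \<bullet> A k) = (\<Sum>k\<in>B. k \<bullet> A (F k))"
 proof (rule S.frame_adjoint[where h = "\<lambda>x y. x \<bullet> A y" and A = G])
  show "bilinear (\<lambda>x y. x \<bullet> A y)" unfolding bilinear_def linear_iff
   by (simp add: blinfun.bilinear_simps inner_add_left inner_add_right)
  show "stdb (G v) z = stdb v (F z)" for v z unfolding stdb using adj[of z v] by (simp add: inner_commute)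
 qed
 also have "\<dots> = - (\<Sum>k\<in>B. F k \<bullet> A k)"
  unfolding sum_negf[symmetric] by (intro sum.cong refl) (use skA in \<open>simp add: inner_commute\<close>)
 finally have "(\<Sum>k\<in>B. A k \<bullet> A k) = 0"
  using FA by (simp add: A_def blinfun.bilinear_simps inner_diff_left sum_subtractf)
 then have A0: "A k = 0" if "k \<in> B" for k using that fin by (simp add: sum_nonneg_eq_0_iff)
 have "A v = 0" for v
 proof -
  have "A v = A (\<Sum>k\<in>B. stdb v k *\<^sub>R k)" by (simp add: S.frame_expansion)
  also have "\<dots> = 0" by (simp add: blinfun.sum_right blinfun.scaleR_right A0)
  finally show ?thesis .
 qed
 then have sym: "f (f v) = v" for v using FG[of v] by (metis A_def F G blinfun.diff_left eq_iff_diff_eq_0)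
 have FI: "F (S.ims a b c x) = S.ims a b c (F x)" for a b c x
  using S.commutingD[OF cF] by (simp add: S.ims_apply blinfun.bilinear_simps)
 have id_c: "S.commuting id_blinfun" unfolding S.commuting_def by simp
 \<comment> \<open>The pairing of two imaginary elements is their scalar product plus an imaginary
   term whose trace against f vanishes. Orthogonality to sp(1) thus isolates the imaginary part of
   q.\<close>
 have coeff: "(c1 * ?q1 + c2 * ?q2 + c3 * ?q3) * T = 0" for c1 c2 c3
 proof -
  have "(\<Sum>k\<in>B. F k \<bullet> S.ims c1 c2 c3 k) = 0" using tr0[OF cF, of c1 c2 c3] by (simp add: inner_commute)
  then have 0: "(\<Sum>k\<in>B. F (S.ims ?q1 ?q2 ?q3 k) \<bullet> S.ims c1 c2 c3 k) = 0"
   using im[of c1 c2 c3] unfolding w_exp by (simp add: inner_add_left sum.distrib sum_distrib_left[symmetric])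
  have "S.ims ?q1 ?q2 ?q3 x \<bullet> S.ims c1 c2 c3 y = (c1 * ?q1 + c2 * ?q2 + c3 * ?q3) * (x \<bullet> y)
   + S.ims (?q2 * c3 - ?q3 * c2) (?q3 * c1 - ?q1 * c3) (?q1 * c2 - ?q2 * c1) x \<bullet> y" for x y
  proof -
   have "stdb (S.ims a b c x) (S.ims c1 c2 c3 y) = (c1 * a + c2 * b + c3 * c) * stdb x y
   + stdb (S.ims (b * c3 - c * c2) (c * c1 - a * c3) (a * c2 - b * c1) x) y" for a b c
    by (simp add: S.ims_apply blinfun.bilinear_simps S.J_simps algebra_simps)
   then show ?thesis unfolding stdb .
  qed
  then have "(\<Sum>k\<in>B. F (S.ims ?q1 ?q2 ?q3 k) \<bullet> S.ims c1 c2 c3 k) = (c1 * ?q1 + c2 * ?q2 + c3 * ?q3) * T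
   + (\<Sum>k\<in>B. S.ims (?q2 * c3 - ?q3 * c2) (?q3 * c1 - ?q1 * c3) (?q1 * c2 - ?q2 * c1) (F k) \<bullet> k)"
   unfolding FI T_def by (simp add: sum.distrib sum_distrib_left)
  also have "(\<Sum>k\<in>B. S.ims (?q2 * c3 - ?q3 * c2) (?q3 * c1 - ?q1 * c3) (?q1 * c2 - ?q2 * c1) (F k) \<bullet> k) = 0"
   unfolding FI[symmetric] adj by (rule tr0[OF cG])
  finally show ?thesis using 0 by simp
 qed
 have "?q1 = 0" "?q2 = 0" "?q3 = 0" using coeff[of 1 0 0] coeff[of 0 1 0] coeff[of 0 0 1] q0 by auto
 moreover from this have "?q0\<^sup>2 = 1" using q quat_norm[of q] by simp
 ultimately have w2: "w (w v) = v" for v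
  unfolding w_exp S.ims_apply by (simp add: F sym linear_cmul[OF lin] linear_0[OF lin] power2_eq_square)
 have linw: "linear w" using Sp1Sp_orthogonal[OF w] orthogonal_transformation_linear by blast
 \<comment> \<open>z = v - w v satisfies w z = - z, so |2 z| \<le> |z| / 2.\<close>
 have "w v = v" for v
 proof -
  let ?z = "v - w v"
  have "w ?z = - ?z" using w2 by (simp add: linear_diff[OF linw])
  moreover have "- ?z - ?z = - 2 *\<^sub>R ?z" by (simp add: scaleR_2)
  ultimately have "norm (- 2 *\<^sub>R ?z) \<le> 1 / 2 * norm ?z" using near[of ?z] by (simp only:)
  then show ?thesis by simp
 qed
 then show ?thesis by (simp add: fun_eq_iff)
qed

text \<open>Gram-Schmidt over the quaternions, by induction over subsets of the index type; the
  lines chosen so far never fill all 4n dimensions.\<close>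

lemma quaternionic_basis:
 fixes b :: "(quat ^ 'n) bilin"
 assumes "quat_hermitian b J1 J2 J3"
 shows "\<exists>a :: 'n \<Rightarrow> quat ^ 'n. \<forall>r. b (a r) (a r) = 1 \<and> (\<forall>s. s \<noteq> r \<longrightarrow> quat_hermitian.perp b J1 J2 J3 (a r) (a s))"
proof -
 interpret quat_hermitian b J1 J2 J3 by fact
 have "\<exists>a :: 'n \<Rightarrow> quat ^ 'n. \<forall>r\<in>A. b (a r) (a r) = 1 \<and> (\<forall>s\<in>A. s \<noteq> r \<longrightarrow> perp (a r) (a s))" if "finite A" for A :: "'n set"
  using that
 proof (induction rule: finite_induct)
  case (insert x A)
  then obtain a :: "'n \<Rightarrow> quat ^ 'n" where a: "\<And>r. r \<in> A \<Longrightarrow> b (a r) (a r) = 1"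
   "\<And>r s. r \<in> A \<Longrightarrow> s \<in> A \<Longrightarrow> s \<noteq> r \<Longrightarrow> perp (a r) (a s)" by blast
  define S where "S = a ` A \<union> (\<lambda>r. J1 (a r)) ` A \<union> (\<lambda>r. J2 (a r)) ` A \<union> (\<lambda>r. J3 (a r)) ` A"
  have "card S \<le> card A + card A + card A + card A"
   unfolding S_def by (intro order_trans[OF card_Un_le] add_mono card_image_le insert.hyps(1))
  moreover have "card A < CARD('n)"
   using insert.hyps by (intro psubset_card_mono) auto
  ultimately have "card S < DIM(quat ^ 'n)" by simp
  moreover have "finite S" unfolding S_def using insert.hyps by simp
  ultimately obtain v where v: "v \<noteq> 0" "\<forall>s\<in>S. b s v = 0" using exists_orthogonal by blast
  define e where "e = (1 / sqrt (b v v)) *\<^sub>R v"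
  have e: "b e e = 1" unfolding e_def using pos[OF v(1)] v(1) by (simp add: bl)
  have p: "perp e (a r)" if "r \<in> A" for r
  proof -
   have "b (a r) v = 0" "b (J1 (a r)) v = 0" "b (J2 (a r)) v = 0" "b (J3 (a r)) v = 0"
    using v(2) that unfolding S_def by auto
   then show ?thesis unfolding perp_def e_def
    using sym[of v "a r"] sym[of v "J1 (a r)"] sym[of v "J2 (a r)"] sym[of v "J3 (a r)"] by (simp add: bl)
  qed
  show ?case
  proof (intro exI[of _ "a(x := e)"] ballI conjI impI)
   fix r assume r: "r \<in> insert x A"
   show "b ((a(x := e)) r) ((a(x := e)) r) = 1" using r e a(1) by auto
   fix s assume s: "s \<in> insert x A" "s \<noteq> r"
   show "perp ((a(x := e)) r) ((a(x := e)) s)"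
    using r s p a(2) perp_sym[OF p] insert.hyps(2) by (cases "r = x"; cases "s = x") auto
  qed
 qed auto
 from this[of UNIV] show ?thesis by auto
qed

lemma model_isomorphism:
 fixes b :: "(quat ^ 'n) bilin"
 assumes "quat_hermitian b J1 J2 J3"
 obtains L :: "quat ^ 'n \<Rightarrow> quat ^ 'n" where "linear L" "bij L" "\<And>v w. L v \<bullet> L w = b v w"
  "\<And>v. L (J1 v) = rscale qi (L v)" "\<And>v. L (J2 v) = rscale qj (L v)"
proof -
 interpret quat_hermitian b J1 J2 J3 by fact
 obtain a :: "'n \<Rightarrow> quat ^ 'n" where a: "\<And>r. b (a r) (a r) = 1" "\<And>r s. s \<noteq> r \<Longrightarrow> perp (a r) (a s)"
  using quaternionic_basis[OF assms] by blast
 \<comment> \<open>The sign before J3 matches the third structure -k of the model.\<close>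
 define k where "k r q = Re (fst q) *\<^sub>R a r + Im (fst q) *\<^sub>R J1 (a r) + Re (snd q) *\<^sub>R J2 (a r) - Im (snd q) *\<^sub>R J3 (a r)" for r q
 define K where "K v = (\<Sum>r\<in>UNIV. k r (v $ r))" for v :: "quat ^ 'n"
 have kk: "b (k r p) (k s q) = (if s = r then p \<bullet> q else 0)" for r s p q
 proof (cases "s = r")
  case True
  show ?thesis unfolding True k_def quat_inner by (simp add: bl J_simps a(1) algebra_simps)
 next
  case False
  from a(2)[OF this] have p: "b (a r) (a s) = 0" "b (a r) (J1 (a s)) = 0" "b (a r) (J2 (a s)) = 0" "b (a r) (J3 (a s)) = 0"
   unfolding perp_def by auto
  show ?thesis using False unfolding k_def by (simp add: bl J_simps p)
 qed
 have iso: "b (K v) (K w) = stdb v w" for v w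
  unfolding K_def stdb inner_vec_def by (simp add: blinfun.sum_left blinfun.sum_right kk)
 have "linear K" "bij K" by (rule isometry_linear[OF _ pos iso]; simp add: stdb)+
 then have inv: "inv K (K v) = v" "K (inv K v) = v" for v
  by (simp_all add: bij_is_inj bij_is_surj surj_f_inv_f)
 have K1: "K (rscale qi v) = J1 (K v)" for v
  unfolding K_def blinfun.sum_right rscale_component
  by (intro sum.cong refl) (simp add: k_def qmult_def bl J_simps algebra_simps)
 have K2: "K (rscale qj v) = J2 (K v)" for v
  unfolding K_def blinfun.sum_right rscale_component
  by (intro sum.cong refl) (simp add: k_def qmult_def bl J_simps algebra_simps)
 show ?thesis
 proof (rule that[of "inv K"])
  show "linear (inv K)"
   by (rule isometry_linear(1)[of b stdb]) (use pos iso[of "inv K _" "inv K _"] in \<open>simp_all add: inv stdb\<close>)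
  show "bij (inv K)" using \<open>bij K\<close> by (rule bij_imp_bij_inv)
  show "inv K v \<bullet> inv K w = b v w" for v w using iso[of "inv K v" "inv K w"] by (simp add: inv stdb)
  show "inv K (J1 v) = rscale qi (inv K v)" for v using K1[of "inv K v"] by (metis inv)
  show "inv K (J2 v) = rscale qj (inv K v)" for v using K2[of "inv K v"] by (metis inv)
 qed
qed

subsection \<open>A group with enough velocities\<close>

text \<open>The index type has 4n elements. Endomorphisms become vectors of columns indexed by it,
  on which the inner product is the trace form.\<close>

definition ebasis :: "'n::finite \<times> bool \<times> bool \<Rightarrow> quat ^ 'n" where
 "ebasis i = axis (fst i) (if fst (snd i) then if snd (snd i) then (1, 0) else qi else if snd (snd i) then qj else qk)"

lemma ebasis_inner: "ebasis i \<bullet> ebasis j = (if i = j then 1 else 0)"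
proof -
 obtain r s t where i: "i = (r, s, t)" by (cases i)
 obtain r' s' t' where j: "j = (r', s', t')" by (cases j)
 show ?thesis unfolding i j ebasis_def
  by (cases s; cases t; cases s'; cases t') (auto simp: inner_axis_axis inner_prod_def inner_complex_def)
qed

lemma inj_ebasis: "inj ebasis"
 by (rule injI) (metis ebasis_inner zero_neq_one)

lemma ebasis_frame: "orthonormal_frame stdb (range (ebasis :: 'n::finite \<times> bool \<times> bool \<Rightarrow> quat ^ 'n))"
proof -
 have "card (range (ebasis :: 'n \<times> bool \<times> bool \<Rightarrow> quat ^ 'n)) = DIM(quat ^ 'n)"
  unfolding card_image[OF inj_ebasis] by (simp add: card_UNIV_bool flip: UNIV_Times_UNIV)
 then show ?thesis unfolding orthonormal_frame_def stdb
  by (auto simp: ebasis_inner dest: injD[OF inj_ebasis])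
qed

lemma ebasis_expansion: "(\<Sum>i\<in>UNIV. (v \<bullet> ebasis i) *\<^sub>R ebasis i) = v"
proof -
 interpret S: quat_hermitian_frame stdb "rsc qi" "rsc qj" "rsc (- qk)" "range ebasis"
  using std_quat ebasis_frame unfolding quat_hermitian_frame_def quat_hermitian_frame_axioms_def by blast
 show ?thesis using S.frame_expansion[of v] by (simp add: sum.reindex[OF inj_ebasis] stdb)
qed

type_synonym 'n qmat = "(quat ^ 'n) ^ ('n \<times> bool \<times> bool)"

definition mat_of :: "(quat ^ 'n) endo \<Rightarrow> 'n::finite qmat" where
 "mat_of \<xi> = (\<chi> i. \<xi> (ebasis i))"

definition endo_of :: "'n::finite qmat \<Rightarrow> (quat ^ 'n) endo" where
 "endo_of A = (\<Sum>i\<in>UNIV. blinfun_scaleR_left (A $ i) o\<^sub>L blinfun_inner_left (ebasis i))"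

lemma endo_of_apply: "endo_of A v = (\<Sum>i\<in>UNIV. (v \<bullet> ebasis i) *\<^sub>R A $ i)"
 unfolding endo_of_def by (simp add: blinfun.sum_left)

lemma endo_mat: "endo_of (mat_of \<xi>) = \<xi>"
proof (rule blinfun_eqI)
 fix v
 have "\<xi> v = \<xi> (\<Sum>i\<in>UNIV. (v \<bullet> ebasis i) *\<^sub>R ebasis i)" by (simp only: ebasis_expansion)
 then show "endo_of (mat_of \<xi>) v = \<xi> v"
  by (simp add: endo_of_apply mat_of_def blinfun.sum_right blinfun.scaleR_right)
qed

lemma mat_endo: "mat_of (endo_of A) = A"
 by (simp add: vec_eq_iff mat_of_def endo_of_apply ebasis_inner if_distrib[of "\<lambda>x. x *\<^sub>R _"] cong: if_cong)

lemma bounded_linear_mat_of: "bounded_linear mat_of"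
proof (rule bounded_linear_intro)
 show "mat_of (x + y) = mat_of x + mat_of y" "mat_of (r *\<^sub>R x) = r *\<^sub>R mat_of x" for x y :: "(quat ^ 'n) endo" and r
  by (simp_all add: mat_of_def vec_eq_iff blinfun.bilinear_simps)
 show "norm (mat_of x) \<le> norm x * (\<Sum>i\<in>UNIV. norm (ebasis i :: quat ^ 'n))" for x :: "(quat ^ 'n) endo"
 proof -
  have "norm (mat_of x) \<le> (\<Sum>i\<in>UNIV. norm (mat_of x $ i))"
   unfolding norm_vec_def by (rule L2_set_le_sum) simp
  also have "\<dots> \<le> (\<Sum>i\<in>UNIV. norm x * norm (ebasis i :: quat ^ 'n))"
   unfolding mat_of_def by (intro sum_mono) (simp add: norm_blinfun)
  finally show ?thesis by (simp add: sum_distrib_left)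
 qed
qed

lemma linear_endo_of: "linear endo_of"
 by (rule linearI; rule blinfun_eqI)
  (simp_all add: endo_of_apply blinfun.bilinear_simps scaleR_add_right sum.distrib scaleR_sum_right mult.commute)

lemma bounded_linear_endo_of: "bounded_linear endo_of"
 using linear_endo_of by (simp add: linear_conv_bounded_linear)

lemma mat_inner: "mat_of \<xi> \<bullet> mat_of \<eta> = (\<Sum>k\<in>range ebasis. \<xi> k \<bullet> \<eta> k)"
 unfolding inner_vec_def mat_of_def by (simp add: sum.reindex[OF inj_ebasis] o_def)

definition sp_algebra :: "(quat ^ 'n) endo set" where
 "sp_algebra = {model_ims c1 c2 c3 + X |c1 c2 c3 X.
  model_spn X}"

text \<open>Elements of the algebra are skew and hence orthogonal to the identity, so w and w - id
  have the same pairings with them.\<close>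

lemma Sp1Sp_transversal_algebra:
 fixes w :: "(quat ^ 'n) endo"
 assumes w: "blinfun_apply w \<in> Sp1Sp" and orth: "\<And>\<xi>. \<xi> \<in> sp_algebra \<Longrightarrow> mat_of (w - id_blinfun) \<bullet> mat_of \<xi> = 0"
  and near: "\<And>v. norm (w v - v) \<le> 1 / 2 * norm v"
 shows "w = id_blinfun"
proof -
 interpret S: quat_hermitian_frame stdb "rsc qi" "rsc qj" "rsc (- qk)" "range (ebasis :: _ \<Rightarrow> quat ^ 'n)"
  using std_quat ebasis_frame unfolding quat_hermitian_frame_def quat_hermitian_frame_axioms_def by blast
 have sk: "skew stdb \<xi>" if "\<xi> \<in> sp_algebra" for \<xi> :: "(quat ^ 'n) endo"
  using that S.ims_skew unfolding sp_algebra_def S.spn_def skew_def by (auto simp: blinfun.bilinear_simps)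
 have "(\<Sum>k\<in>range ebasis. w k \<bullet> \<xi> k) = 0" if \<xi>: "\<xi> \<in> sp_algebra" for \<xi>
 proof -
  have "k \<bullet> \<xi> k = 0" for k using sk[OF \<xi>] unfolding skew_def stdb by (metis inner_commute neg_equal_0_iff_equal equal_neg_zero)
  moreover have "(\<Sum>k\<in>range ebasis. (w k - k) \<bullet> \<xi> k) = 0"
   using orth[OF \<xi>] unfolding mat_inner by (simp add: blinfun.bilinear_simps)
  ultimately show ?thesis by (simp add: inner_diff_left)
 qed
 moreover have "S.spn 0" unfolding S.spn_def skew_def S.commuting_def by simp
 then have "S.ims c1 c2 c3 \<in> sp_algebra" for c1 c2 c3 unfolding sp_algebra_def by force
 moreover have "S.ims 0 0 0 = 0" unfolding S.ims_def by simp
 then have "X \<in> sp_algebra" if "S.spn X" for X using that unfolding sp_algebra_def by force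
 ultimately have "blinfun_apply w = id"
  using near by (intro Sp1Sp_transversal[OF w ebasis_frame]) auto
 then show ?thesis by (intro blinfun_eqI) simp
qed

lemma subspace_sp_algebra: "subspace (sp_algebra :: (quat ^ 'n) endo set)"
proof -
 interpret S: quat_hermitian "stdb :: (quat ^ 'n) bilin" "rsc qi" "rsc qj" "rsc (- qk)" by (rule std_quat)
 have z: "S.spn 0" unfolding S.spn_def skew_def S.commuting_def by simp
 have a: "S.spn (X + Y)" if "S.spn X" "S.spn Y" for X Y
  using that unfolding S.spn_def skew_def S.commuting_def by (simp add: blinfun.bilinear_simps)
 have s: "S.spn (r *\<^sub>R X)" if "S.spn X" for r X
  using that unfolding S.spn_def skew_def S.commuting_def by (simp add: blinfun.bilinear_simps)
 show ?thesis unfolding subspace_def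
 proof (intro conjI ballI allI)
  have "(0 :: (quat ^ 'n) endo) = S.ims 0 0 0 + 0" unfolding S.ims_def by simp
  then show "(0 :: (quat ^ 'n) endo) \<in> sp_algebra" using z unfolding sp_algebra_def by blast
  fix x y :: "(quat ^ 'n) endo" and r assume "x \<in> sp_algebra"
  then obtain c1 c2 c3 X where x: "x = S.ims c1 c2 c3 + X" "S.spn X" unfolding sp_algebra_def by blast
  have "r *\<^sub>R x = S.ims (r * c1) (r * c2) (r * c3) + r *\<^sub>R X" unfolding x S.ims_def by (simp add: scaleR_add_right)
  then show "r *\<^sub>R x \<in> sp_algebra" using s[OF x(2)] unfolding sp_algebra_def by blast
  assume "y \<in> sp_algebra"
  then obtain d1 d2 d3 Y where y: "y = S.ims d1 d2 d3 + Y" "S.spn Y" unfolding sp_algebra_def by blast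
  have "x + y = S.ims (c1 + d1) (c2 + d2) (c3 + d3) + (X + Y)" unfolding x y S.ims_def by (simp add: scaleR_add_left)
  then show "x + y \<in> sp_algebra" using a[OF x(2) y(2)] unfolding sp_algebra_def by blast
 qed
qed

text \<open>Coordinates of the second kind: the curve of b is run for time \<eta> \<bullet> b, and
  the results are multiplied. The product is continuous near 0, and its derivative is formed only at
  0.\<close>

lemma product_of_curves:
 fixes H :: "(quat ^ 'n \<Rightarrow> quat ^ 'n) set" and D :: "'v::euclidean_space \<Rightarrow> (quat ^ 'n) endo"
 assumes comp: "\<And>u w. u \<in> H \<Longrightarrow> w \<in> H \<Longrightarrow> u \<circ> w \<in> H" and id: "id \<in> H" and B: "finite B"
  and vel: "\<And>b. b \<in> B \<Longrightarrow> \<exists>P \<delta>. \<delta> > 0 \<and> continuous_on {-\<delta>..\<delta>} P \<and> P 0 = id_blinfun \<and>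
  (P has_vector_derivative D b) (at 0) \<and> (\<forall>t\<in>{-\<delta>..\<delta>}. blinfun_apply (P t) \<in> H)"
 shows "\<exists>\<Theta> \<delta>. \<delta> > 0 \<and> continuous_on (ball 0 \<delta>) \<Theta> \<and> \<Theta> 0 = id_blinfun \<and>
  (\<Theta> has_derivative (\<lambda>\<eta>. \<Sum>b\<in>B. (\<eta> \<bullet> b) *\<^sub>R D b)) (at 0) \<and> (\<forall>\<eta>\<in>ball 0 \<delta>. blinfun_apply (\<Theta> \<eta>) \<in> H)"
 using B vel
proof (induction rule: finite_induct)
 case empty
 have "blinfun_apply id_blinfun \<in> H" using id by (simp add: id_def id_blinfun.rep_eq)
 then show ?case by (intro exI[of _ "\<lambda>_. id_blinfun"] exI[of _ 1]) auto
next
 case (insert b B)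
 note bb = bounded_bilinear_blinfun_compose
 obtain \<Theta> \<delta> where \<Theta>: "\<delta> > 0" "continuous_on (ball 0 \<delta>) \<Theta>" "\<Theta> 0 = id_blinfun"
  "(\<Theta> has_derivative (\<lambda>\<eta>. \<Sum>b\<in>B. (\<eta> \<bullet> b) *\<^sub>R D b)) (at 0)" "\<And>\<eta>. \<eta> \<in> ball 0 \<delta> \<Longrightarrow> blinfun_apply (\<Theta> \<eta>) \<in> H"
  using insert.IH[OF insert.prems] by blast
 obtain P \<delta>' where P: "\<delta>' > 0" "continuous_on {-\<delta>'..\<delta>'} P" "P 0 = id_blinfun"
  "(P has_vector_derivative D b) (at 0)" "\<And>t. t \<in> {-\<delta>'..\<delta>'} \<Longrightarrow> blinfun_apply (P t) \<in> H"
  using insert.prems[of b] by blast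
 define \<epsilon> where "\<epsilon> = min \<delta> (\<delta>' / (norm b + 1))"
 have e: "\<epsilon> > 0" "ball 0 \<epsilon> \<subseteq> ball (0 :: 'v) \<delta>" unfolding \<epsilon>_def using \<Theta>(1) P(1) by (auto simp: add_nonneg_pos)
 have inb: "\<eta> \<bullet> b \<in> {-\<delta>'..\<delta>'}" if "\<eta> \<in> ball 0 \<epsilon>" for \<eta>
 proof -
  have "\<bar>\<eta> \<bullet> b\<bar> \<le> norm \<eta> * norm b" by (rule Cauchy_Schwarz_ineq2)
  also have "\<dots> \<le> \<delta>' / (norm b + 1) * (norm b + 1)" using that P(1) unfolding \<epsilon>_def by (intro mult_mono) auto
  also have "\<dots> = \<delta>'" by (simp add: add_nonneg_eq_0_iff)
  finally show ?thesis by auto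
 qed
 have "continuous_on (ball 0 \<epsilon>) (\<lambda>\<eta>. P (\<eta> \<bullet> b))"
  by (rule continuous_on_compose2[OF P(2)]) (use inb in \<open>auto intro!: continuous_intros\<close>)
 then have "continuous_on (ball 0 \<epsilon>) (\<lambda>\<eta>. P (\<eta> \<bullet> b) o\<^sub>L \<Theta> \<eta>)"
  by (intro bounded_bilinear.continuous_on[OF bb] continuous_on_subset[OF \<Theta>(2) e(2)])
 moreover have "((\<lambda>\<eta>. P (\<eta> \<bullet> b) o\<^sub>L \<Theta> \<eta>) has_derivative (\<lambda>\<eta>. \<Sum>b\<in>insert b B. (\<eta> \<bullet> b) *\<^sub>R D b)) (at 0)"
 proof -
  have "((\<lambda>\<eta>. P (\<eta> \<bullet> b)) has_derivative (\<lambda>\<eta>. (\<eta> \<bullet> b) *\<^sub>R D b)) (at 0)"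
  proof (rule has_derivative_compose[where f = "\<lambda>\<eta>. \<eta> \<bullet> b" and g = P])
   show "((\<lambda>\<eta>. \<eta> \<bullet> b) has_derivative (\<lambda>\<eta>. \<eta> \<bullet> b)) (at 0)" by (rule bounded_linear_imp_has_derivative) (rule bounded_linear_inner_left)
   show "(P has_derivative (\<lambda>t. t *\<^sub>R D b)) (at (0 \<bullet> b))" using P(4) unfolding has_vector_derivative_def by simp
  qed
  from bounded_bilinear.FDERIV[OF bb this \<Theta>(4)]
  show ?thesis
   by (rule has_derivative_eq_rhs) (use insert.hyps in \<open>simp add: P(3) \<Theta>(3) blinfun_compose_id fun_eq_iff add.commute\<close>)
 qed
 moreover have "blinfun_apply (P (\<eta> \<bullet> b) o\<^sub>L \<Theta> \<eta>) \<in> H" if \<eta>: "\<eta> \<in> ball 0 \<epsilon>" for \<eta>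
 proof -
  have "blinfun_apply (P (\<eta> \<bullet> b) o\<^sub>L \<Theta> \<eta>) = blinfun_apply (P (\<eta> \<bullet> b)) \<circ> blinfun_apply (\<Theta> \<eta>)" by (simp add: fun_eq_iff)
  then show ?thesis using comp[OF P(5)[OF inb[OF \<eta>]] \<Theta>(5)[OF subsetD[OF e(2) \<eta>]]] by simp
 qed
 ultimately show ?case
  using e(1) by (intro exI[of _ "\<lambda>\<eta>. P (\<eta> \<bullet> b) o\<^sub>L \<Theta> \<eta>"] exI[of _ \<epsilon>] conjI ballI) (assumption | simp add: P(3) \<Theta>(3) blinfun_compose_id)+
qed

text \<open>\<Theta> covers the directions of the algebra and 1 + Z the orthogonal ones, so F has
  derivative id at 0 and its image contains a neighbourhood. A group element there equals \<Theta>
  \<eta> times some w in the group with w - 1 orthogonal to the algebra, and transversality gives w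
  = 1.\<close>

theorem Sp1Sp_from_velocities:
 fixes H :: "(quat ^ 'n \<Rightarrow> quat ^ 'n) set"
 assumes sub: "H \<subseteq> Sp1Sp" and comp: "\<And>u w. u \<in> H \<Longrightarrow> w \<in> H \<Longrightarrow> u \<circ> w \<in> H" and id: "id \<in> H"
  and vel: "\<And>\<xi>. \<xi> \<in> sp_algebra \<Longrightarrow> \<exists>P \<delta>. \<delta> > 0 \<and> continuous_on {-\<delta>..\<delta>} P \<and> P 0 = id_blinfun \<and>
  (P has_vector_derivative \<xi>) (at 0) \<and> (\<forall>t\<in>{-\<delta>..\<delta>}. blinfun_apply (P t) \<in> H)"
 shows "H = Sp1Sp"
proof -
 note bb = bounded_bilinear_blinfun_compose
 have "subspace (mat_of ` (sp_algebra :: (quat ^ 'n) endo set))"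
  by (intro linear_subspace_image subspace_sp_algebra bounded_linear.linear[OF bounded_linear_mat_of])
 then obtain B :: "'n qmat set" where B: "pairwise orthogonal B" "\<And>x. x \<in> B \<Longrightarrow> norm x = 1" "independent B"
   "span B = mat_of ` sp_algebra" using orthonormal_basis_subspace by metis
 have fin: "finite B" by (rule independent_imp_finite[OF B(3)])
 have BB: "b \<bullet> b' = (if b = b' then 1 else 0)" if "b \<in> B" "b' \<in> B" for b b'
  using B(1,2) that unfolding pairwise_def orthogonal_def by (auto simp: norm_eq_1)
 have "endo_of b \<in> sp_algebra" if "b \<in> B" for b
  using span_base[OF that] unfolding B(4) by (auto simp: endo_mat)
 then obtain \<Theta> \<delta> where \<Theta>: "\<delta> > 0" "continuous_on (ball 0 \<delta>) \<Theta>" "\<Theta> 0 = id_blinfun"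
  "(\<Theta> has_derivative (\<lambda>\<eta>. \<Sum>b\<in>B. (\<eta> \<bullet> b) *\<^sub>R endo_of b)) (at 0)" "\<And>\<eta>. \<eta> \<in> ball 0 \<delta> \<Longrightarrow> blinfun_apply (\<Theta> \<eta>) \<in> H"
  using product_of_curves[OF comp id fin vel, where D = endo_of] by blast
 define \<pi> where "\<pi> \<eta> = \<eta> - (\<Sum>b\<in>B. (\<eta> \<bullet> b) *\<^sub>R b)" for \<eta> :: "'n qmat"
 define Z where "Z \<eta> = endo_of (\<pi> \<eta>)" for \<eta>
 have "linear \<pi>" unfolding \<pi>_def
  by (rule linearI) (simp_all add: inner_add_left scaleR_add_left sum.distrib scaleR_sum_right scaleR_diff_right)
 then have "bounded_linear \<pi>" by (simp add: linear_conv_bounded_linear)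
 then have Z: "bounded_linear Z" unfolding Z_def by (rule bounded_linear_compose[OF bounded_linear_endo_of])
 obtain K where K: "K > 0" "\<And>\<eta>. norm (Z \<eta>) \<le> norm \<eta> * K" using bounded_linear.pos_bounded[OF Z] by blast
 define F where "F \<eta> = mat_of (\<Theta> \<eta> o\<^sub>L (id_blinfun + Z \<eta>))" for \<eta>
 \<comment> \<open>The bound 1/(2 K) keeps |Z \<eta>| at most 1/2, as transversality
   requires.\<close>
 define r where "r = min \<delta> (1 / (2 * K))"
 have r: "r > 0" "ball 0 r \<subseteq> ball (0 :: 'n qmat) \<delta>" unfolding r_def using \<Theta>(1) K(1) by auto
 have Z0: "Z 0 = 0" by (rule linear_0[OF bounded_linear.linear[OF Z]])
 have "F 0 \<in> interior (F ` ball 0 r)"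
 proof (rule sussmann_open_mapping[OF open_ball])
  show "continuous_on (ball 0 \<delta>) F" unfolding F_def
   by (intro bounded_linear.continuous_on[OF bounded_linear_mat_of] bounded_bilinear.continuous_on[OF bb] \<Theta>(2)
     continuous_on_add continuous_on_const linear_continuous_on[OF Z])
  show "(0 :: 'n qmat) \<in> ball 0 \<delta>" using \<Theta>(1) by simp
  have "((\<lambda>\<eta>. id_blinfun + Z \<eta>) has_derivative Z) (at 0)"
   using has_derivative_add[OF has_derivative_const bounded_linear_imp_has_derivative[OF Z]] by simp
  note D = bounded_linear.has_derivative[OF bounded_linear_mat_of bounded_bilinear.FDERIV[OF bb \<Theta>(4) this]]
  have sumE: "(\<Sum>b\<in>B. (\<eta> \<bullet> b) *\<^sub>R endo_of b) = endo_of (\<Sum>b\<in>B. (\<eta> \<bullet> b) *\<^sub>R b)" for \<eta>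
   by (simp add: linear_sum[OF linear_endo_of] linear_cmul[OF linear_endo_of])
  show "(F has_derivative id) (at 0)" unfolding F_def[abs_def]
  proof (rule has_derivative_eq_rhs[OF D], rule ext)
   fix \<eta> :: "'n qmat"
   show "mat_of ((\<Theta> 0 o\<^sub>L Z \<eta>) + ((\<Sum>b\<in>B. (\<eta> \<bullet> b) *\<^sub>R endo_of b) o\<^sub>L (id_blinfun + Z 0))) = id \<eta>"
    unfolding \<Theta>(3) Z0 add_0_right blinfun_compose_id sumE
    unfolding Z_def linear_add[OF linear_endo_of, symmetric] mat_endo \<pi>_def by simp
  qed
  show "bounded_linear (id :: 'n qmat \<Rightarrow> 'n qmat)" by (simp add: id_def)
  show "ball 0 r \<subseteq> ball (0 :: 'n qmat) \<delta>" by (rule r(2))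
  show "(0 :: 'n qmat) \<in> interior (ball 0 r)" using r(1) by (simp add: interior_open)
 qed simp
 then obtain e where e: "e > 0" "ball (F 0) e \<subseteq> F ` ball 0 r" unfolding mem_interior by blast
 have F0: "F 0 = mat_of id_blinfun" unfolding F_def \<Theta>(3) Z0 by (simp add: blinfun_compose_id)
 define N where "N = (\<Sum>i\<in>UNIV. norm (ebasis i :: quat ^ 'n))"
 have N: "N \<ge> 0" unfolding N_def by (rule sum_nonneg) simp
 interpret near_identity H "e / (2 * (N + 1))"
 proof
  show "u \<circ> w \<in> H" if "u \<in> H" "w \<in> H" for u w by (rule comp[OF that])
  show "e / (2 * (N + 1)) > 0" using e(1) N by simp
  fix u :: "quat ^ 'n \<Rightarrow> quat ^ 'n" assume u: "u \<in> Sp1Sp" and near: "\<And>v. norm (u v - v) \<le> e / (2 * (N + 1)) * norm v"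
  define U where "U = Blinfun u"
  have linu: "linear u" using Sp1Sp_orthogonal[OF u] orthogonal_transformation_linear by blast
  have U: "blinfun_apply U = u" unfolding U_def
   by (simp add: bounded_linear_Blinfun_apply linear_conv_bounded_linear[symmetric] linu)
  have "norm (U - id_blinfun) \<le> e / (2 * (N + 1))"
   by (rule norm_blinfun_bound) (use near e(1) N in \<open>simp_all add: blinfun.bilinear_simps U\<close>)
  have "norm (mat_of U - mat_of id_blinfun) \<le> (\<Sum>i\<in>UNIV. norm ((mat_of U - mat_of id_blinfun) $ i))"
   unfolding norm_vec_def by (rule L2_set_le_sum) simp
  also have "\<dots> \<le> (\<Sum>i\<in>UNIV. e / (2 * (N + 1)) * norm (ebasis i :: quat ^ 'n))"
   using near by (intro sum_mono) (simp add: mat_of_def U)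
  also have "\<dots> = e / (2 * (N + 1)) * N" unfolding N_def by (simp add: sum_distrib_left)
  also have "\<dots> \<le> e / (2 * (N + 1)) * (N + 1)" using e(1) N by (intro mult_left_mono) auto
  also have "\<dots> = e / 2" using N by (simp add: field_simps)
  finally have "mat_of U \<in> ball (F 0) e" unfolding F0 using e(1) by (simp add: dist_norm norm_minus_commute)
  then obtain \<eta> where \<eta>: "\<eta> \<in> ball 0 r" "mat_of U = F \<eta>" using e(2) by blast
  let ?w = "id_blinfun + Z \<eta>"
  have UP: "U = \<Theta> \<eta> o\<^sub>L ?w" using arg_cong[OF \<eta>(2), of endo_of] by (simp add: F_def endo_mat)
  have PH: "blinfun_apply (\<Theta> \<eta>) \<in> H" using \<Theta>(5) r(2) \<eta>(1) by blast
  then have PS: "blinfun_apply (\<Theta> \<eta>) \<in> Sp1Sp" using sub by blast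
  have "blinfun_apply ?w = inv (\<Theta> \<eta>) \<circ> u"
  proof
   fix v
   have "u v = \<Theta> \<eta> (?w v)" unfolding U[symmetric] UP by simp
   then show "?w v = (inv (\<Theta> \<eta>) \<circ> u) v"
    using orthogonal_transformation_inj[OF Sp1Sp_orthogonal[OF PS]] by simp
  qed
  then have wS: "blinfun_apply ?w \<in> Sp1Sp" using Sp1Sp_compose[OF Sp1Sp_inv[OF PS] u] by simp
  have "?w = id_blinfun"
  proof (rule Sp1Sp_transversal_algebra[OF wS])
   fix \<xi> :: "(quat ^ 'n) endo" assume "\<xi> \<in> sp_algebra"
   then have mB: "mat_of \<xi> \<in> span B" unfolding B(4) by blast
   have zb: "\<pi> \<eta> \<bullet> b = 0" if "b \<in> B" for b
   proof -
    have "(\<Sum>b'\<in>B. (\<eta> \<bullet> b') *\<^sub>R b') \<bullet> b = (\<Sum>b'\<in>B. if b' = b then \<eta> \<bullet> b' else 0)"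
     unfolding inner_sum_left by (intro sum.cong refl) (simp add: BB that)
    then show ?thesis unfolding \<pi>_def using that fin by (simp add: inner_diff_left)
   qed
   have "\<pi> \<eta> \<bullet> x = 0" if "x \<in> span B" for x
    using that by (induction rule: span_induct_alt) (auto simp: inner_add_right zb)
   with mB show "mat_of (?w - id_blinfun) \<bullet> mat_of \<xi> = 0" by (simp add: Z_def mat_endo)
  next
   fix v
   have "norm (Z \<eta> v) \<le> norm (Z \<eta>) * norm v" by (rule norm_blinfun)
   also have "norm (Z \<eta>) \<le> norm \<eta> * K" by (rule K(2))
   also have "\<dots> \<le> 1 / (2 * K) * K" using \<eta>(1) K(1) unfolding r_def by (intro mult_right_mono) auto
   also have "\<dots> = 1 / 2" using K(1) by simp
   finally show "norm (?w v - v) \<le> 1 / 2 * norm v" by (simp add: blinfun.bilinear_simps mult_right_mono)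
  qed
  then show "u \<in> H" using PH UP U by (simp add: blinfun_compose_id)
 qed
 show ?thesis using sub Sp1Sp_subset by blast
qed

section \<open>Conformal Killing forms\<close>

context local_metric begin

lemma nabe_diff:
 assumes "smooth_on A S" "smooth_on B S" "x \<in> S"
 shows "nabe (\<lambda>y. A y - B y) x u = nabe A x u - nabe B x u"
proof -
 have "frechet_derivative (\<lambda>y. A y - B y) (at x) u = frechet_derivative A (at x) u - frechet_derivative B (at x) u"
  by (rule frechetI) (intro has_derivative_diff smooth_on_deriv[OF assms(1,3)] smooth_on_deriv[OF assms(2,3)])
 then show ?thesis unfolding nabe_def by (intro blinfun_eqI) (simp add: bl)
qed

lemma nabe_compose:
 assumes "smooth_on A S" "smooth_on B S" "x \<in> S"
 shows "nabe (\<lambda>y. A y o\<^sub>L B y) x u = (nabe A x u o\<^sub>L B x) + (A x o\<^sub>L nabe B x u)"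
proof -
 have "frechet_derivative (\<lambda>y. A y o\<^sub>L B y) (at x) u = (A x o\<^sub>L frechet_derivative B (at x) u) + (frechet_derivative A (at x) u o\<^sub>L B x)"
  by (rule frechetI, rule bounded_bilinear.FDERIV[OF bounded_bilinear_blinfun_compose smooth_on_deriv[OF assms(1,3)] smooth_on_deriv[OF assms(2,3)]])
 then show ?thesis unfolding nabe_def by (intro blinfun_eqI) (simp add: bl)
qed

definition sharp :: "('e \<Rightarrow> 'e bilin) \<Rightarrow> 'e \<Rightarrow> 'e endo" where
 "sharp \<phi> x = Blinfun (\<lambda>v. raise x (\<Sum>j\<in>Basis. \<phi> x v j *\<^sub>R j))"

lemma sharp_apply: "sharp \<phi> x v = raise x (\<Sum>j\<in>Basis. \<phi> x v j *\<^sub>R j)"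
proof -
 have "bounded_linear (\<lambda>v. raise x (\<Sum>j\<in>Basis. \<phi> x v j *\<^sub>R j))"
  unfolding linear_conv_bounded_linear[symmetric]
  by (rule linearI) (simp_all add: bl scaleR_add_left sum.distrib blinfun.sum_right scaleR_sum_right)
 then show ?thesis unfolding sharp_def by (simp add: bounded_linear_Blinfun_apply)
qed

lemma sharp: assumes x: "x \<in> S" shows "g x (sharp \<phi> x v) w = \<phi> x v w"
proof -
 have "\<phi> x v w = \<phi> x v (\<Sum>j\<in>Basis. (w \<bullet> j) *\<^sub>R j)" by (simp add: euclidean_representation)
 then show ?thesis by (simp add: sharp_apply raise[OF x] inner_sum_left blinfun.sum_right bl inner_commute mult.commute)
qed

lemma smooth_sharp: "smooth_on \<phi> S \<Longrightarrow> smooth_on (sharp \<phi>) S"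
proof (rule smooth_on_blinfunI[OF open_S])
 fix i :: 'e assume "smooth_on \<phi> S"
 then have "smooth_on (\<lambda>x. raise x (\<Sum>j\<in>Basis. \<phi> x i j *\<^sub>R j)) S"
  by (intro smooth_on_blinfun_apply smooth_raise open_S smooth_on_sum finite_Basis smooth_on_scaleR smooth_on_const) 
 then show "smooth_on (\<lambda>x. sharp \<phi> x i) S" by (simp add: sharp_apply)
qed

text \<open>The metric is parallel, so index raising commutes with covariant differentiation. This
  links \<open>nabla_form\<close> to \<open>nabe\<close>.\<close>

lemma nabe_sharp:
 assumes \<phi>: "smooth_on \<phi> S" and x: "x \<in> S"
 shows "g x (nabe (sharp \<phi>) x u v) w = frechet_derivative \<phi> (at x) u v w - \<phi> x (\<Gamma> x u v) w - \<phi> x v (\<Gamma> x u w)"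
proof -
 let ?l = "\<lambda>t::real. x + t *\<^sub>R u"
 have l: "(?l has_vector_derivative u) (at 0)" by (auto intro!: derivative_eq_intros)
 have l0: "?l 0 \<in> S" using x by simp
 have "((\<lambda>t. sharp \<phi> (?l t) v) has_vector_derivative nabe (sharp \<phi>) x u v + sharp \<phi> x (\<Gamma> x u v) - \<Gamma> x u (sharp \<phi> x v)) (at 0)"
  using endo_along[OF smooth_sharp[OF \<phi>] l0 l has_vector_derivative_const, of v] by simp
 from metric_along[OF l0 l this has_vector_derivative_const, of w]
 have 1: "((\<lambda>t. g (?l t) (sharp \<phi> (?l t) v) w) has_vector_derivative
   g x (nabe (sharp \<phi>) x u v) w + \<phi> x (\<Gamma> x u v) w + \<phi> x v (\<Gamma> x u w)) (at 0)"
  by (simp add: bl sharp[OF x])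
 have op: "open (?l -` S)" by (intro open_vimage open_S continuous_intros)
 have 2: "((\<lambda>t. \<phi> (?l t) v w) has_vector_derivative
   g x (nabe (sharp \<phi>) x u v) w + \<phi> x (\<Gamma> x u v) w + \<phi> x v (\<Gamma> x u w)) (at 0)"
  by (rule has_vector_derivative_transform_within_open[OF 1 op]) (use x sharp in auto)
 have "((\<lambda>y. \<phi> y v w) has_derivative (\<lambda>u. frechet_derivative \<phi> (at x) u v w)) (at (x + 0 *\<^sub>R u))"
  by (auto intro!: derivative_eq_intros smooth_on_deriv[OF \<phi> x])
 from has_derivative_line[OF this, of UNIV]
 have 3: "((\<lambda>t. \<phi> (?l t) v w) has_vector_derivative frechet_derivative \<phi> (at x) u v w) (at 0)" by simp
 from vector_derivative_unique_at[OF 2 3] show ?thesis by simp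
qed

text \<open>The trace in any orthonormal frame equals the one in the coordinate basis and its dual.
  The latter varies smoothly with x, whereas frames are chosen point by point.\<close>

lemma frame_trace:
 assumes x: "x \<in> S" and B: "orthonormal_frame (g x) B" and expand: "\<And>v. (\<Sum>e\<in>B. g x v e *\<^sub>R e) = v" and h: "bilinear h"
 shows "(\<Sum>e\<in>B. h e e) = (\<Sum>k\<in>Basis. h (raise x k) (k :: 'e) :: real)"
proof -
 have "(\<Sum>e\<in>B. h e e) = (\<Sum>e\<in>B. \<Sum>k\<in>Basis. (e \<bullet> k) * h e k)"
 proof (intro sum.cong refl)
  fix e
  have "h e e = h e (\<Sum>k\<in>Basis. (e \<bullet> k) *\<^sub>R k)" by (simp add: euclidean_representation)
  also have "\<dots> = (\<Sum>k\<in>Basis. (e \<bullet> k) * h e k)"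
   using h unfolding bilinear_def by (simp add: linear_sum linear_cmul)
  finally show "h e e = (\<Sum>k\<in>Basis. (e \<bullet> k) * h e k)" .
 qed
 also have "\<dots> = (\<Sum>k\<in>Basis. \<Sum>e\<in>B. g x (raise x k) e * h e k)"
  unfolding raise(1)[OF x] by (subst sum.swap) (simp add: inner_commute)
 also have "\<dots> = (\<Sum>k\<in>Basis. h (\<Sum>e\<in>B. g x (raise x k) e *\<^sub>R e) k)"
  using h unfolding bilinear_def by (simp add: linear_sum[of "\<lambda>v. h v _"] linear_cmul[of "\<lambda>v. h v _"])
 finally show ?thesis unfolding expand .
qed

text \<open>The divergence written in fixed coordinates, which makes its smoothness visible.\<close>

definition div_vector :: "('e \<Rightarrow> 'e endo) \<Rightarrow> 'e \<Rightarrow> 'e" where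
 "div_vector A x = raise x (\<Sum>j\<in>Basis. (\<Sum>k\<in>Basis. \<Sum>l\<in>Basis. (raise x k \<bullet> l) * g x (nabe A x l k) j) *\<^sub>R j)"

lemma smooth_div_vector: "smooth_on A S \<Longrightarrow> smooth_on (div_vector A) S"
 unfolding div_vector_def
 by (intro smooth_on_blinfun_apply smooth_raise open_S smooth_on_sum finite_Basis smooth_on_scaleR smooth_on_const
   smooth_on_bilinear[OF bounded_bilinear_mult] smooth_on_inner smooth_g smooth_nabe)

lemma nabe_linear: assumes "smooth_on A S" "x \<in> S"
 shows "linear (nabe A x)"
proof -
 note D = linear_D[OF assms(2,1)]
 show ?thesis by (rule linearI; rule blinfun_eqI) (simp_all add: nabe_def linear_add[OF D] linear_cmul[OF D] bl algebra_simps)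
qed

lemma div_vector:
 assumes A: "smooth_on A S" and x: "x \<in> S" and B: "orthonormal_frame (g x) B" and expand: "\<And>v. (\<Sum>e\<in>B. g x v e *\<^sub>R e) = v"
 shows "g x (div_vector A x) w = (\<Sum>e\<in>B. g x (nabe A x e e) w)"
proof -
 note L = nabe_linear[OF A x]
 have "(\<Sum>l\<in>Basis. (r \<bullet> l) * g x (nabe A x l k) w) = g x (nabe A x r k) w" for r k w
 proof -
  have "nabe A x r = nabe A x (\<Sum>l\<in>Basis. (r \<bullet> l) *\<^sub>R l)" by (simp add: euclidean_representation)
  also have "\<dots> = (\<Sum>l\<in>Basis. (r \<bullet> l) *\<^sub>R nabe A x l)" by (simp add: linear_sum[OF L] linear_cmul[OF L])
  finally show ?thesis by (simp add: blinfun.sum_left blinfun.sum_right bl)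
 qed
 then have "div_vector A x = raise x (\<Sum>j\<in>Basis. (\<Sum>k\<in>Basis. g x (nabe A x (raise x k) k) j) *\<^sub>R j)"
  unfolding div_vector_def by simp
 also have "\<dots> = raise x (\<Sum>j\<in>Basis. (\<Sum>e\<in>B. g x (nabe A x e e) j) *\<^sub>R j)"
 proof -
  have "bilinear (\<lambda>u v. g x (nabe A x u v) j)" for j
   unfolding bilinear_def by (auto intro!: linearI simp: linear_add[OF L] linear_cmul[OF L] bl)
  from frame_trace[OF x B expand this] show ?thesis by simp
 qed
 finally have "g x (div_vector A x) w = (\<Sum>j\<in>Basis. (\<Sum>e\<in>B. g x (nabe A x e e) j) * (j \<bullet> w))"
  by (simp add: raise[OF x] inner_sum_left)
 also have "\<dots> = g x (\<Sum>e\<in>B. nabe A x e e) (\<Sum>j\<in>Basis. (w \<bullet> j) *\<^sub>R j)"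
  by (simp add: blinfun.sum_right blinfun.sum_left bl inner_commute mult.commute)
 finally show ?thesis by (simp add: euclidean_representation blinfun.sum_right blinfun.sum_left)
qed

end

lemma exists_frame:
 fixes b :: "(quat ^ 'n) bilin"
 assumes "quat_hermitian b J1 J2 J3"
 shows "\<exists>B. orthonormal_frame b B"
proof -
 obtain L :: "quat ^ 'n \<Rightarrow> quat ^ 'n" where L: "linear L" "bij L" "\<And>v w. L v \<bullet> L w = b v w"
  by (rule model_isomorphism[OF assms]) (rule that; assumption)
 have i: "b (inv L v) (inv L w) = v \<bullet> w" for v w
  unfolding L(3)[symmetric] by (simp add: surj_f_inv_f[OF bij_is_surj[OF L(2)]])
 have inj: "inj (inv L)" using bij_imp_bij_inv[OF L(2)] bij_is_inj by blast
 have "card (inv L ` Basis) = DIM(quat ^ 'n)" unfolding card_image[OF inj_on_subset[OF inj subset_UNIV]] by simp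
 then have "orthonormal_frame b (inv L ` Basis)"
  unfolding orthonormal_frame_def by (auto simp: i inner_Basis dest: injD[OF inj])
 then show ?thesis by blast
qed

context local_qk begin

text \<open>For a section j of Q the bracket of A with j is a section of Q, and so is its
  derivative. By the Leibniz rule, subtracting the bracket of A with \<nabla>j leaves the bracket of
  \<nabla>A with j.\<close>

lemma nabe_normalizes:
 assumes A: "smooth_on A S" and nm: "\<And>y J. y \<in> S \<Longrightarrow> J \<in> span {J1 y, J2 y, J3 y} \<Longrightarrow> (A y o\<^sub>L J) - (J o\<^sub>L A y) \<in> span {J1 y, J2 y, J3 y}"
  and x: "x \<in> S" and J: "J \<in> {J1 x, J2 x, J3 x}"
 shows "(nabe A x u o\<^sub>L J) - (J o\<^sub>L nabe A x u) \<in> span {J1 x, J2 x, J3 x}"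
proof -
 have main: "(nabe A x u o\<^sub>L j x) - (j x o\<^sub>L nabe A x u) \<in> span {J1 x, J2 x, J3 x}"
  if j: "smooth_on j S" "\<And>y. y \<in> S \<Longrightarrow> j y \<in> span {J1 y, J2 y, J3 y}" for j :: "'a \<Rightarrow> 'a endo"
 proof -
  have s: "smooth_on (\<lambda>y. A y o\<^sub>L j y) S" "smooth_on (\<lambda>y. j y o\<^sub>L A y) S"
   by (intro smooth_on_compose open_S A j(1))+
  have "nabe (\<lambda>y. (A y o\<^sub>L j y) - (j y o\<^sub>L A y)) x u \<in> span {J1 x, J2 x, J3 x}"
   by (rule parallel[OF smooth_on_diff[OF open_S s] _ x]) (rule nm[OF _ j(2)])
  moreover have "(A x o\<^sub>L nabe j x u) - (nabe j x u o\<^sub>L A x) \<in> span {J1 x, J2 x, J3 x}"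
   by (rule nm[OF x parallel[OF j x]])
  ultimately have "nabe (\<lambda>y. (A y o\<^sub>L j y) - (j y o\<^sub>L A y)) x u - ((A x o\<^sub>L nabe j x u) - (nabe j x u o\<^sub>L A x))
    \<in> span {J1 x, J2 x, J3 x}" by (rule span_diff)
  also have "nabe (\<lambda>y. (A y o\<^sub>L j y) - (j y o\<^sub>L A y)) x u - ((A x o\<^sub>L nabe j x u) - (nabe j x u o\<^sub>L A x))
   = (nabe A x u o\<^sub>L j x) - (j x o\<^sub>L nabe A x u)"
   unfolding nabe_diff[OF s x] nabe_compose[OF A j(1) x] nabe_compose[OF j(1) A x] by simp
  finally show ?thesis .
 qed
 have "J1 y \<in> span {J1 y, J2 y, J3 y}" "J2 y \<in> span {J1 y, J2 y, J3 y}" "J3 y \<in> span {J1 y, J2 y, J3 y}" for y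
  by (auto intro: span_base)
 then show ?thesis using main[OF smooth_J(1)] main[OF smooth_J(2)] main[OF smooth_J(3)] J by blast
qed

end

context quat_hermitian begin

lemma span_J_bracket:
 assumes "K \<in> span {J1, J2, J3}" "J \<in> span {J1, J2, J3}"
 shows "(K o\<^sub>L J) - (J o\<^sub>L K) \<in> span {J1, J2, J3}"
proof -
 obtain a1 a2 a3 c1 c2 c3 where e: "K = ims a1 a2 a3" "J = ims c1 c2 c3" using assms unfolding span_J by blast
 have "(K o\<^sub>L J) - (J o\<^sub>L K) = ims (2 * (a2 * c3 - a3 * c2)) (2 * (a3 * c1 - a1 * c3)) (2 * (a1 * c2 - a2 * c1))"
 proof (rule blinfun_eqI)
  fix v
  have "s *\<^sub>R w + s *\<^sub>R w = (2 * s) *\<^sub>R w" for s and w :: 'e by (simp add: scaleR_2[symmetric])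
  then show "((K o\<^sub>L J) - (J o\<^sub>L K)) v = ims (2 * (a2 * c3 - a3 * c2)) (2 * (a3 * c1 - a1 * c3)) (2 * (a1 * c2 - a2 * c1)) v"
   unfolding e by (simp add: ims_apply bl J_products J_squares algebra_simps)
 qed
 then show ?thesis unfolding span_J by blast
qed

lemma commuting_bracket:
 fixes E :: "'e endo"
 shows "commuting E \<Longrightarrow> J \<in> span {J1, J2, J3} \<Longrightarrow> (E o\<^sub>L J) - (J o\<^sub>L E) = 0"
 by (rule blinfun_eqI) (auto simp: span_J ims_apply bl commutingD)

text \<open>The triple supplied by \<open>S2H\<close> may differ from J1, J2, J3 but spans the same
  fibre; for the other summand, invariance of a form under J means that its endomorphism commutes
  with J.\<close>

lemma compatible_endo:
 fixes A :: "'e endo"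
 assumes T: "quat_triple b (span {J1, J2, J3}) K1 K2 K3"
  and \<alpha>: "\<alpha> \<in> span {b o\<^sub>L K1, b o\<^sub>L K2, b o\<^sub>L K3}" and \<beta>: "\<beta> \<in> S2E b (span {J1, J2, J3})"
  and A: "\<And>v w. b (A v) w = (\<alpha> + \<beta>) v w"
 shows "\<exists>j P. A = j + P \<and> j \<in> span {J1, J2, J3} \<and> spn P"
proof -
 have K: "span {K1, K2, K3} = span {J1, J2, J3}" using T unfolding quat_triple_def by blast
 have "\<exists>j\<in>span {K1, K2, K3}. \<alpha> = (b o\<^sub>L j)"
 proof -
  have "linear (\<lambda>j. b o\<^sub>L j)" by (rule linearI; rule blinfun_eqI) (simp_all add: bl)
  from linear_span_image[OF this, of "{K1, K2, K3}"] have "span {b o\<^sub>L K1, b o\<^sub>L K2, b o\<^sub>L K3} = (\<lambda>j. b o\<^sub>L j) ` span {K1, K2, K3}" by simp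
  then show ?thesis using \<alpha> by blast
 qed
 then obtain j where j: "j \<in> span {J1, J2, J3}" "\<alpha> = (b o\<^sub>L j)" unfolding K by blast
 define P where "P = A - j"
 have P: "b (P v) w = \<beta> v w" for v w unfolding P_def by (simp add: bl A j(2))
 have alt: "\<beta> v w = - \<beta> w v" for v w using \<beta> unfolding S2E_def alternating_def by blast
 have inv: "\<beta> (J v) (J w) = \<beta> v w" if "J \<in> {J1, J2, J3}" for J v w
  using \<beta> triple that unfolding S2E_def by blast
 have "skew b P" unfolding skew_def
 proof (intro allI)
  fix v w show "b (P v) w = - b v (P w)" using alt[of v w] P[of v w] P[of w v] sym[of v "P w"] by linarith
 qed
 moreover have "commuting P"
 proof (rule commutingI; rule nondegenerate)
  fix v w
  show "b (P (J1 v)) w = b (J1 (P v)) w" using inv[of J1 v "- J1 w"] P by (simp add: bl J_skew J_squares)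
  show "b (P (J2 v)) w = b (J2 (P v)) w" using inv[of J2 v "- J2 w"] P by (simp add: bl J_skew J_squares)
 qed
 ultimately show ?thesis using j(1) unfolding spn_def P_def by (intro exI[of _ j] exI[of _ "A - j"]) simp
qed

end

text \<open>The passage from forms to endomorphisms: the hypotheses on \<psi> become an instance of
  \<open>local_ck\<close> near x.\<close>

lemma local_ck_at:
 fixes M :: "('a, quat ^ 'n) riem" and Q :: "('a, quat ^ 'n) chart \<Rightarrow> quat ^ 'n \<Rightarrow> (quat ^ 'n) endo set"
 assumes qk: "qk_manifold M Q" and sc: "nonzero_scalar_curvature M" and tf: "two_form M \<psi>"
  and cp: "compatible M Q \<psi>" and ck: "conformal_killing M \<psi>" and c: "c \<in> atlas M" and x: "x \<in> chart_image c"
 obtains V J1 J2 J3 \<Psi> \<theta> where "x \<in> V" "V \<subseteq> chart_image c" "local_ck V (metric M c) (christoffel M c) J1 J2 J3 \<Psi> \<theta>"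
  "\<And>y. y \<in> V \<Longrightarrow> Q c y = span {J1 y, J2 y, J3 y}"
  "\<And>y u v w. y \<in> V \<Longrightarrow> nabla_form M \<psi> c y u v w = metric M c y (local_metric.nabe (christoffel M c) \<Psi> y u v) w"
proof -
 interpret qk_manifold M Q by (rule qk)
 obtain V J1 J2 J3 where V: "x \<in> V" "V \<subseteq> chart_image c" and lq: "local_qk V (g c) (\<Gamma> c) J1 J2 J3"
  and QV: "\<And>y. y \<in> V \<Longrightarrow> Q c y = span {J1 y, J2 y, J3 y}" by (rule local_qk_at[OF c x]) blast
 interpret L: local_qk V "g c" "\<Gamma> c" J1 J2 J3 by (rule lq)
 have "smooth_on (\<psi> c) (chart_image c)" using tf c unfolding two_form_def bilinear_tensor_field_def by blast
 then have \<psi>: "smooth_on (\<psi> c) V" by (rule smooth_on_subset[OF _ V(2)])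
 have alt: "\<psi> c y v w = - \<psi> c y w v" if "y \<in> V" for y v w
  using tf c V(2) that unfolding two_form_def alternating_def by blast
 have Dalt: "frechet_derivative (\<psi> c) (at y) u v w = - frechet_derivative (\<psi> c) (at y) u w v" if y: "y \<in> V" for y u v w
 proof -
  have D: "((\<lambda>z. \<psi> c z v w) has_derivative (\<lambda>u. frechet_derivative (\<psi> c) (at y) u v w)) (at y)" for v w
   by (auto intro!: derivative_eq_intros smooth_on_deriv[OF \<psi> y])
  have "((\<lambda>z. - \<psi> c z w v) has_derivative (\<lambda>u. - frechet_derivative (\<psi> c) (at y) u w v)) (at y)"
   by (rule has_derivative_minus[OF D])
  from L.derivative_unique[OF D[of v w] L.has_derivative_cong[OF this y alt[symmetric]]] show ?thesis .
 qed
 define \<Psi> where "\<Psi> = L.sharp (\<psi> c)"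
 have s\<Psi>: "smooth_on \<Psi> V" unfolding \<Psi>_def by (rule L.smooth_sharp[OF \<psi>])
 have nf: "nabla_form M \<psi> c y u v w = g c y (L.nabe \<Psi> y u v) w" if y: "y \<in> V" for y u v w
  unfolding \<Psi>_def L.nabe_sharp[OF \<psi> y] nabla_form_def Let_def ..
 have frame: "\<exists>B. orthonormal_frame (g c y) B" if "y \<in> V" for y
  by (rule exists_frame[OF L.qh[OF that]])
 define k where "k = real DIM(quat ^ 'n) - 1"
 have k: "k > 0" using L.dim unfolding k_def by simp
 \<comment> \<open>Normalised so that the codifferential is 4n - 1 times the dual of \<theta>,
   cancelling the constant before the wedge term.\<close>
 define \<theta> where "\<theta> y = (- 1 / k) *\<^sub>R L.div_vector \<Psi> y" for y
 have s\<theta>: "smooth_on \<theta> V" unfolding \<theta>_def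
  by (intro smooth_on_scaleR L.open_S smooth_on_const L.smooth_div_vector[OF s\<Psi>])
 have \<delta>: "codifferential M \<psi> c y w = k * g c y (\<theta> y) w" if y: "y \<in> V" for y w
 proof -
  define B where "B = (SOME B. orthonormal_frame (g c y) B)"
  have B: "orthonormal_frame (g c y) B" unfolding B_def using frame[OF y] by (rule someI_ex)
  interpret F: quat_hermitian_frame "g c y" "J1 y" "J2 y" "J3 y" B
   using L.qh[OF y] B unfolding quat_hermitian_frame_def quat_hermitian_frame_axioms_def by blast
  show ?thesis using k L.div_vector[OF s\<Psi> y B F.frame_expansion, of w]
   unfolding codifferential_def B_def[symmetric] Let_def nf[OF y] \<theta>_def by (simp add: bl)
 qed
 have dec: "\<exists>j P. \<Psi> y = j + P \<and> j \<in> span {J1 y, J2 y, J3 y} \<and> quat_hermitian.spn (g c y) (J1 y) (J2 y) (J3 y) P" if y: "y \<in> V" for y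
 proof -
  interpret H: quat_hermitian "g c y" "J1 y" "J2 y" "J3 y" by (rule L.qh[OF y])
  have yc: "y \<in> chart_image c" using y V(2) by blast
  have "\<exists>\<alpha>\<in>S2H (g c y) (Q c y). \<exists>\<beta>\<in>S2E (g c y) (Q c y). \<psi> c y = \<alpha> + \<beta>"
   using cp c yc unfolding compatible_def by blast
  then obtain \<alpha> \<beta> K1 K2 K3 where ab: "\<psi> c y = \<alpha> + \<beta>" and \<beta>: "\<beta> \<in> S2E (g c y) (span {J1 y, J2 y, J3 y})"
   and K: "quat_triple (g c y) (span {J1 y, J2 y, J3 y}) K1 K2 K3" and \<alpha>: "\<alpha> \<in> span {g c y o\<^sub>L K1, g c y o\<^sub>L K2, g c y o\<^sub>L K3}"
   unfolding S2H_def QV[OF y] by blast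
  show ?thesis by (rule H.compatible_endo[OF K \<alpha> \<beta>]) (simp add: \<Psi>_def L.sharp[OF y] ab)
 qed
 have nm: "(\<Psi> y o\<^sub>L J) - (J o\<^sub>L \<Psi> y) \<in> span {J1 y, J2 y, J3 y}" if y: "y \<in> V" and J: "J \<in> span {J1 y, J2 y, J3 y}" for y J
 proof -
  interpret H: quat_hermitian "g c y" "J1 y" "J2 y" "J3 y" by (rule L.qh[OF y])
  obtain j P where jP: "\<Psi> y = j + P" "j \<in> span {J1 y, J2 y, J3 y}" "H.spn P" using dec[OF y] by blast
  have "(\<Psi> y o\<^sub>L J) - (J o\<^sub>L \<Psi> y) = ((j o\<^sub>L J) - (J o\<^sub>L j)) + ((P o\<^sub>L J) - (J o\<^sub>L P))"
   unfolding jP(1) by (rule blinfun_eqI) (simp add: bl)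
  also have "(P o\<^sub>L J) - (J o\<^sub>L P) = 0" using jP(3) H.commuting_bracket J unfolding H.spn_def by blast
  finally show ?thesis using H.span_J_bracket[OF jP(2) J] by simp
 qed
 have ckN: "L.nabe \<Psi> y u = quat_hermitian.N (g c y) (J1 y) (J2 y) (J3 y) (\<theta> y) u" if y: "y \<in> V" for y u
 proof -
  interpret H: quat_hermitian "g c y" "J1 y" "J2 y" "J3 y" by (rule L.qh[OF y])
  obtain e :: "quat ^ 'n" where e: "e \<noteq> 0" by (rule L.nonzero_vector)
  have "skew (g c y) (L.nabe \<Psi> y u)" for u
   unfolding skew_def
  proof (intro allI)
   fix v w
   have "nabla_form M \<psi> c y u v w = - nabla_form M \<psi> c y u w v"
    unfolding nabla_form_def Let_def
    using Dalt[OF y, of u v w] alt[OF y, of "\<Gamma> c y u v" w] alt[OF y, of v "\<Gamma> c y u w"] by simp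
   then show "g c y (L.nabe \<Psi> y u v) w = - g c y v (L.nabe \<Psi> y u w)"
    unfolding nf[OF y] using H.sym[of "L.nabe \<Psi> y u w" v] by simp
  qed
  \<comment> \<open>\<Psi> takes values in the normaliser of the parallel bundle Q, hence so does
    its covariant derivative.\<close>
  then have "\<exists>c1 c2 c3 E. L.nabe \<Psi> y u = H.ims c1 c2 c3 + E \<and> H.spn E" for u
   using H.normalizer_decomp[OF _ L.nabe_normalizes[OF s\<Psi> nm y] e] by blast
  then obtain f1 f2 f3 E where fE: "\<And>u. L.nabe \<Psi> y u = H.ims (f1 u) (f2 u) (f3 u) + E u" "\<And>u. H.spn (E u)" by metis
  have yc: "y \<in> chart_image c" using y V(2) by blast
  have cancel: "1 / k * (p * (k * q) - r * (k * s)) = p * q - r * s" for p q r s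
  proof -
   have "p * (k * q) - r * (k * s) = k * (p * q - r * s)" by (simp add: algebra_simps)
   then show ?thesis using k by simp
  qed
  show ?thesis
  proof (rule H.compatible_twistor_form[OF L.dim L.nabe_linear[OF s\<Psi> y] fE])
   fix v z
   \<comment> \<open>On equal arguments only the wedge term of the equation survives.\<close>
   have "ext_deriv \<psi> c y v v z = 0"
    using Dalt[OF y, of z v v] unfolding ext_deriv_def Let_def by simp
   moreover have "nabla_form M \<psi> c y v v z = 1 / 3 * ext_deriv \<psi> c y v v z
    - 1 / k * wedge (g c y v) (codifferential M \<psi> c y) v z"
    using ck c yc unfolding conformal_killing_def k_def by blast
   ultimately show "g c y (L.nabe \<Psi> y v v) z = g c y (\<theta> y) v * g c y v z - g c y (\<theta> y) z * g c y v v"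
    unfolding wedge_def \<delta>[OF y] nf[OF y] cancel by simp
  qed
 qed
 have "local_ck V (g c) (\<Gamma> c) J1 J2 J3 \<Psi> \<theta>"
 proof
  show "smooth_on \<Psi> V" "smooth_on \<theta> V" by (rule s\<Psi> s\<theta>)+
  fix y assume y: "y \<in> V"
  show "L.nabe \<Psi> y u v = L.NN y (\<theta> y) u v" for u v unfolding ckN[OF y] L.NN_eq[OF y] ..
  show "\<exists>j P. \<Psi> y = j + P \<and> j \<in> span {J1 y, J2 y, J3 y} \<and> quat_hermitian.commuting (J1 y) (J2 y) (J3 y) P"
   using dec[OF y] quat_hermitian.spn_def[OF L.qh[OF y]] by blast
  define B where "B = (SOME B. orthonormal_frame (g c y) B)"
  have B: "orthonormal_frame (g c y) B" unfolding B_def using frame[OF y] by (rule someI_ex)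
  have "scalar_curvature M c y \<noteq> 0" using sc c y V(2) unfolding nonzero_scalar_curvature_def by blast
  moreover have "scalar_curvature M c y = (\<Sum>e\<in>B. \<Sum>f\<in>B. g c y (L.Rm y e f f) e)"
   unfolding scalar_curvature_def B_def[symmetric] Let_def curvature_def L.Rm_apply ..
  ultimately show "\<exists>B. orthonormal_frame (g c y) B \<and> (\<Sum>e\<in>B. \<Sum>f\<in>B. g c y (L.Rm y e f f) e) \<noteq> 0"
   using B by auto
 qed
 then show ?thesis using that[OF V _ QV nf] by blast
qed

section \<open>The holonomy group\<close>

lemma endo_of_linear:
 fixes f :: "'e::euclidean_space \<Rightarrow> 'e"
 assumes "linear f" "bij f"
 obtains A A' :: "'e endo" where "blinfun_apply A = f" "blinfun_apply A' = inv f"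
  "A o\<^sub>L A' = id_blinfun" "A' o\<^sub>L A = id_blinfun"
proof -
 have inv: "linear (inv f)"
  using linear_injective_isomorphism[OF assms(1) bij_is_inj[OF assms(2)]] assms(2)
  by (metis inv_unique_comp comp_apply eq_id_iff)
 have A: "blinfun_apply (Blinfun f) = f" "blinfun_apply (Blinfun (inv f)) = inv f"
  using assms(1) inv by (simp_all add: bounded_linear_Blinfun_apply linear_conv_bounded_linear)
 show ?thesis
  by (rule that[OF A]; rule blinfun_eqI)
   (simp_all add: A bij_is_inj[OF assms(2)] surj_f_inv_f[OF bij_is_surj[OF assms(2)]])
qed

lemma inverse_apply:
 fixes A A' :: "'e::euclidean_space endo"
 shows "A o\<^sub>L A' = id_blinfun \<Longrightarrow> A (A' v) = v"
 by (metis blinfun_apply_blinfun_compose blinfun_apply_id_blinfun)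

lemma conjugate_algebra:
 fixes b b' :: "'e::euclidean_space bilin"
 assumes H: "quat_hermitian b J1 J2 J3" and H': "quat_hermitian b' K1 K2 K3"
  and A: "A o\<^sub>L A' = id_blinfun" "A' o\<^sub>L A = id_blinfun" and iso: "\<And>v w. b' (A v) (A w) = b v w"
  and J: "\<And>v. A (J1 v) = K1 (A v)" "\<And>v. A (J2 v) = K2 (A v)" and E: "quat_hermitian.spn b J1 J2 J3 E"
 shows "A o\<^sub>L ((quat_hermitian.ims J1 J2 J3 c1 c2 c3 + E) o\<^sub>L A') = quat_hermitian.ims K1 K2 K3 c1 c2 c3 + (A o\<^sub>L (E o\<^sub>L A'))"
  "quat_hermitian.spn b' K1 K2 K3 (A o\<^sub>L (E o\<^sub>L A'))"
proof -
 interpret H: quat_hermitian b J1 J2 J3 by (rule H)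
 interpret H': quat_hermitian b' K1 K2 K3 by (rule H')
 note inv = inverse_apply[OF A(1)] inverse_apply[OF A(2)]
 have J3: "A (J3 v) = K3 (A v)" for v unfolding H.J3_eq J H'.J3_eq ..
 show "A o\<^sub>L ((H.ims c1 c2 c3 + E) o\<^sub>L A') = H'.ims c1 c2 c3 + (A o\<^sub>L (E o\<^sub>L A'))"
  by (rule blinfun_eqI) (simp add: H.ims_apply H'.ims_apply H.bl J J3 inv)
 have JA: "A' (K1 v) = J1 (A' v)" "A' (K2 v) = J2 (A' v)" for v
  using J(1)[of "A' v"] J(2)[of "A' v"] by (metis inv)+
 have sk: "skew b E" and cm: "H.commuting E" using E unfolding H.spn_def by auto
 have iso': "b' (A v) w = b v (A' w)" "b' w (A v) = b (A' w) v" for v w using iso[of v "A' w"] iso[of "A' w" v] by (simp_all add: inv)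
 have "skew b' (A o\<^sub>L (E o\<^sub>L A'))" using sk unfolding skew_def by (simp add: iso')
 moreover have "H'.commuting (A o\<^sub>L (E o\<^sub>L A'))"
  by (rule H'.commutingI) (simp_all add: JA J H.commutingD[OF cm])
 ultimately show "H'.spn (A o\<^sub>L (E o\<^sub>L A'))" unfolding H'.spn_def by blast
qed

context qk_manifold begin

text \<open>The Lie algebra \<open>sp(1) + sp(n)\<close> as the normaliser of \<open>Q\<close> among the skew endomorphisms.\<close>

definition qlie :: "('a, 'e) chart \<Rightarrow> 'a \<Rightarrow> 'e endo \<Rightarrow> bool" where
 "qlie c p X \<longleftrightarrow> skew (g c (snd c p)) X \<and> (\<forall>J\<in>Q c (snd c p). (X o\<^sub>L J) - (J o\<^sub>L X) \<in> Q c (snd c p))"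

text \<open>Transports are isometries and preserve Q in both directions, so they preserve its
  normaliser.\<close>

lemma qlie_conjugate:
 fixes A A' X :: "'e endo"
 assumes A: "transports c p d q A" "transports d q c p A'" and inv: "A o\<^sub>L A' = id_blinfun" "A' o\<^sub>L A = id_blinfun"
  and X: "qlie c p X"
 shows "qlie d q (A o\<^sub>L (X o\<^sub>L A'))"
 unfolding qlie_def
proof (intro conjI ballI)
 note I = inverse_apply[OF inv(1)] inverse_apply[OF inv(2)]
 let ?gp = "g c (snd c p)" and ?gq = "g d (snd d q)"
 have iso: "?gq (A v) w = ?gp v (A' w)" "?gq w (A v) = ?gp (A' w) v" for v w
  using transports_isometry(1)[OF A(1), of v "A' w"] transports_isometry(1)[OF A(1), of "A' w" v] by (simp_all add: I)
 show "skew ?gq (A o\<^sub>L (X o\<^sub>L A'))" using X unfolding qlie_def skew_def by (simp add: iso)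
 fix J assume "J \<in> Q d (snd d q)"
 from transports_Q[OF A(2) this] obtain J' where J': "J' \<in> Q c (snd c p)" "\<And>v. J' (A' v) = A' (J v)" by blast
 have "(X o\<^sub>L J') - (J' o\<^sub>L X) \<in> Q c (snd c p)" using X J'(1) unfolding qlie_def by blast
 from transports_Q[OF A(1) this] obtain K where K: "K \<in> Q d (snd d q)" "\<And>v. K (A v) = A (((X o\<^sub>L J') - (J' o\<^sub>L X)) v)" by blast
 have AJ: "J (A z) = A (J' z)" for z using J'(2)[of "A z"] by (simp add: I)
 have "((A o\<^sub>L (X o\<^sub>L A')) o\<^sub>L J) - (J o\<^sub>L (A o\<^sub>L (X o\<^sub>L A'))) = K"
 proof (rule blinfun_eqI)
  fix v
  show "(((A o\<^sub>L (X o\<^sub>L A')) o\<^sub>L J) - (J o\<^sub>L (A o\<^sub>L (X o\<^sub>L A')))) v = K v"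
   using K(2)[of "A' v"] by (simp add: I bl AJ J'(2)[symmetric])
 qed
 then show "((A o\<^sub>L (X o\<^sub>L A')) o\<^sub>L J) - (J o\<^sub>L (A o\<^sub>L (X o\<^sub>L A'))) \<in> Q d (snd d q)" using K(1) by simp
qed

lemma transports_inverse:
 fixes A A' :: "'e endo"
 assumes "transports c p d q A" "A o\<^sub>L A' = id_blinfun"
 shows "transports d q c p A'"
 by (rule transports_reverse[OF assms(1)]) (rule inverse_apply[OF assms(2)])

end

lemma linear_bracket_span:
 assumes "\<And>J. J \<in> B \<Longrightarrow> (X o\<^sub>L J) - (J o\<^sub>L X) \<in> span B" "J \<in> span B"
 shows "(X o\<^sub>L J) - (J o\<^sub>L X) \<in> span (B :: 'e::euclidean_space endo set)"
proof -
 have "linear (\<lambda>J. (X o\<^sub>L J) - (J o\<^sub>L X))"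
  by (rule linearI; rule blinfun_eqI) (simp_all add: blinfun.bilinear_simps algebra_simps)
 from linear_span_image[OF this, of B] have "(X o\<^sub>L J) - (J o\<^sub>L X) \<in> span ((\<lambda>J. (X o\<^sub>L J) - (J o\<^sub>L X)) ` B)" using assms(2) by blast
 moreover have "span ((\<lambda>J. (X o\<^sub>L J) - (J o\<^sub>L X)) ` B) \<subseteq> span B" by (rule span_minimal) (use assms(1) in auto)
 ultimately show ?thesis by blast
qed

text \<open>The holonomy is computed at one point with \<theta> \<noteq> 0; L identifies its tangent
  space with the model, where the group theory applies.\<close>

locale ck_point = qk_manifold M Q for M :: "('a, quat ^ 'n) riem" and Q :: "('a, quat ^ 'n) chart \<Rightarrow> quat ^ 'n \<Rightarrow> (quat ^ 'n) endo set" +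
 fixes c :: "('a, quat ^ 'n) chart" and p :: 'a and V :: "(quat ^ 'n) set" and J1 J2 J3 \<Psi> :: "quat ^ 'n \<Rightarrow> (quat ^ 'n) endo"
  and \<theta> :: "quat ^ 'n \<Rightarrow> quat ^ 'n" and L L' :: "(quat ^ 'n) endo"
 assumes c: "c \<in> \<A>" and p: "p \<in> fst c" and pV: "snd c p \<in> V" and V: "V \<subseteq> chart_image c"
  and ck: "local_ck V (g c) (\<Gamma> c) J1 J2 J3 \<Psi> \<theta>" and QV: "y \<in> V \<Longrightarrow> Q c y = span {J1 y, J2 y, J3 y}"
  and \<theta>: "\<theta> (snd c p) \<noteq> 0"
  and L: "L o\<^sub>L L' = id_blinfun" "L' o\<^sub>L L = id_blinfun" and L_iso: "L v \<bullet> L w = g c (snd c p) v w"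
  and L_J: "L (J1 (snd c p) v) = rscale qi (L v)" "L (J2 (snd c p) v) = rscale qj (L v)"
begin

abbreviation "x0 \<equiv> snd c p"

sublocale C: local_ck V "g c" "\<Gamma> c" J1 J2 J3 \<Psi> \<theta> by (rule ck)

lemma H: "quat_hermitian (g c x0) (J1 x0) (J2 x0) (J3 x0)" by (rule C.qh[OF pV])

lemma LL: "L (L' v) = v" "L' (L v) = v" using inverse_apply L by blast+

lemma L'_iso: "g c x0 (L' v) (L' w) = v \<bullet> w" unfolding L_iso[symmetric] LL ..

lemma L'_J: "L' (rscale qi v) = J1 x0 (L' v)" "L' (rscale qj v) = J2 x0 (L' v)"
 using L_J[of "L' v"] by (metis LL)+

lemma qlie_to_model: assumes X: "qlie c p X" shows "L o\<^sub>L (X o\<^sub>L L') \<in> sp_algebra"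
proof -
 interpret H: quat_hermitian "g c x0" "J1 x0" "J2 x0" "J3 x0" by (rule H)
 obtain e :: "quat ^ 'n" where e: "e \<noteq> 0" by (rule C.nonzero_vector)
 have sk: "skew (g c x0) X" and br: "(X o\<^sub>L J) - (J o\<^sub>L X) \<in> span {J1 x0, J2 x0, J3 x0}" if "J \<in> {J1 x0, J2 x0, J3 x0}" for J
  using X span_base[OF that] unfolding qlie_def QV[OF pV] by auto
 obtain c1 c2 c3 E where E: "X = H.ims c1 c2 c3 + E" "H.spn E"
  using H.normalizer_decomp[OF sk br e] by blast
 show ?thesis unfolding E(1) sp_algebra_def
  using conjugate_algebra[OF H std_quat L _ _ _ E(2)] by (simp add: stdb rsc L_iso L_J) blast
qed

lemma qlie_of_model: assumes \<zeta>: "\<zeta> \<in> sp_algebra" shows "qlie c p (L' o\<^sub>L (\<zeta> o\<^sub>L L))"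
proof -
 interpret H: quat_hermitian "g c x0" "J1 x0" "J2 x0" "J3 x0" by (rule H)
 obtain c1 c2 c3 Y where Y: "\<zeta> = model_ims c1 c2 c3 + Y"
  "model_spn Y" using \<zeta> unfolding sp_algebra_def by blast
 define E where "E = L' o\<^sub>L (Y o\<^sub>L L)"
 have E: "L' o\<^sub>L (\<zeta> o\<^sub>L L) = H.ims c1 c2 c3 + E" "H.spn E"
  unfolding Y(1) E_def by (rule conjugate_algebra[OF std_quat H L(2,1) _ _ _ Y(2)]; simp add: stdb rsc L'_iso L'_J)+
 have "skew (g c x0) (H.ims c1 c2 c3 + E)"
  using H.ims_skew[of c1 c2 c3] E(2) unfolding H.spn_def skew_def by (simp add: bl)
 moreover have "((H.ims c1 c2 c3 + E) o\<^sub>L J) - (J o\<^sub>L (H.ims c1 c2 c3 + E)) \<in> span {J1 x0, J2 x0, J3 x0}"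
  if J: "J \<in> span {J1 x0, J2 x0, J3 x0}" for J
 proof -
  have "((H.ims c1 c2 c3 + E) o\<^sub>L J) - (J o\<^sub>L (H.ims c1 c2 c3 + E))
   = ((H.ims c1 c2 c3 o\<^sub>L J) - (J o\<^sub>L H.ims c1 c2 c3)) + ((E o\<^sub>L J) - (J o\<^sub>L E))"
   by (rule blinfun_eqI) (simp add: bl)
  also have "(E o\<^sub>L J) - (J o\<^sub>L E) = 0" using E(2) H.commuting_bracket J unfolding H.spn_def by blast
  finally show ?thesis using H.span_J_bracket[OF _ J, of "H.ims c1 c2 c3"] H.span_J by auto
 qed
 ultimately show ?thesis unfolding E(1) qlie_def QV[OF pV] by blast
qed

lemma Rm_qlie:
 assumes q: "q \<in> fst c" "snd c q \<in> V"
 shows "qlie c q (C.Rm (snd c q) u v)"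
 unfolding qlie_def QV[OF q(2)] using C.Rm_skew[OF q(2)] linear_bracket_span[OF C.Rm_normalizes[OF q(2)]] by blast

text \<open>Curvature endomorphisms at nearby points, conjugated back along a ray, are velocities at
  p. Orthogonality of V0 to them says that its translate W t is orthogonal to the curvature at its
  own point, which is the condition of \<open>annihilator_zero\<close>.\<close>

lemma orthogonal_to_velocities:
 assumes V0: "qlie c p V0"
  and orth: "\<And>\<xi>. velocity c p \<xi> \<Longrightarrow> qlie c p \<xi> \<Longrightarrow> mat_of (L o\<^sub>L (\<xi> o\<^sub>L L')) \<bullet> mat_of (L o\<^sub>L (V0 o\<^sub>L L')) = 0"
 shows "V0 = 0"
proof (rule C.annihilator_zero[OF pV \<theta>])
 fix u
 obtain \<epsilon> \<Phi> \<Psi> where R: "\<epsilon> > 0" "\<Phi> 0 = id_blinfun" "\<Psi> 0 = id_blinfun"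
  "(\<Phi> has_vector_derivative - \<Gamma> c x0 u) (at 0 within {0..\<epsilon>})"
  "(\<Psi> has_vector_derivative \<Gamma> c x0 u) (at 0 within {0..\<epsilon>})"
  "\<And>t. t \<in> {0..\<epsilon>} \<Longrightarrow> \<Psi> t o\<^sub>L \<Phi> t = id_blinfun" "\<And>t. t \<in> {0..\<epsilon>} \<Longrightarrow> \<Phi> t o\<^sub>L \<Psi> t = id_blinfun"
  "\<And>t. t \<in> {0..\<epsilon>} \<Longrightarrow> x0 + t *\<^sub>R u \<in> chart_image c"
  "\<And>t. t \<in> {0..\<epsilon>} \<Longrightarrow> transports c p c (pt c (x0 + t *\<^sub>R u)) (\<Phi> t)"
  by (rule ray_transport[OF c p, where u = u]) (rule that; assumption)
 obtain \<rho> where rho: "\<rho> > 0" "ball x0 \<rho> \<subseteq> V" using C.open_S pV open_contains_ball by blast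
 define \<epsilon>' where "\<epsilon>' = min \<epsilon> (\<rho> / (2 * (norm u + 1)))"
 have e: "\<epsilon>' > 0" "{0..\<epsilon>'} \<subseteq> {0..\<epsilon>}" unfolding \<epsilon>'_def using R(1) rho(1) by (auto simp: add_nonneg_pos)
 have inV: "x0 + t *\<^sub>R u \<in> V" if t: "t \<in> {0..\<epsilon>'}" for t
 proof (rule subsetD[OF rho(2)])
  have "norm (t *\<^sub>R u) \<le> \<rho> / (2 * (norm u + 1)) * (norm u + 1)"
   unfolding norm_scaleR using t rho(1) unfolding \<epsilon>'_def by (intro mult_mono) auto
  also have "\<dots> = \<rho> / 2" by (simp add: field_simps add_nonneg_eq_0_iff)
  finally show "x0 + t *\<^sub>R u \<in> ball x0 \<rho>" using rho(1) by (simp add: dist_norm)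
 qed
 define W where "W t = \<Phi> t o\<^sub>L (V0 o\<^sub>L \<Psi> t)" for t
 note bb = bounded_bilinear_blinfun_compose
 have "W 0 = V0" unfolding W_def R by (simp add: blinfun_compose_id)
 moreover have "(W has_vector_derivative ((V0 o\<^sub>L \<Gamma> c x0 u) - (\<Gamma> c x0 u o\<^sub>L V0))) (at 0 within {0..\<epsilon>'})"
  unfolding W_def[abs_def]
  by (rule has_vector_derivative_eq_rhs[OF bounded_bilinear.has_vector_derivative[OF bb
     has_vector_derivative_within_subset[OF R(4) e(2)] bounded_linear.has_vector_derivative[OF bounded_bilinear.bounded_linear_right[OF bb]
      has_vector_derivative_within_subset[OF R(5) e(2)]]]])
   (rule blinfun_eqI, simp add: R bl)
 moreover have "C.annihilates (x0 + t *\<^sub>R u) (W t)" if t: "t \<in> {0..\<epsilon>'}" for t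
 proof -
  let ?y = "x0 + t *\<^sub>R u"
  define q where "q = pt c ?y"
  have te: "t \<in> {0..\<epsilon>}" using t e(2) by blast
  have q: "q \<in> fst c" "snd c q = ?y" unfolding q_def using pt[OF c R(8)[OF te]] by auto
  have y: "?y \<in> V" by (rule inV[OF t])
  have T: "transports c p c q (\<Phi> t)" unfolding q_def by (rule R(9)[OF te])
  have T': "transports c q c p (\<Psi> t)" by (rule transports_inverse[OF T R(7)[OF te]])
  have W: "qlie c q (W t)" unfolding W_def by (rule qlie_conjugate[OF T T' R(7)[OF te] R(6)[OF te] V0])
  have \<Psi>\<Phi>: "\<Psi> t (\<Phi> t v) = v" for v by (rule inverse_apply[OF R(6)[OF te]])
  have iso: "g c ?y (\<Phi> t v) (\<Phi> t w) = g c x0 v w" for v w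
   using transports_isometry(1)[OF T] unfolding q(2) .
  have iso': "g c ?y v (\<Phi> t w) = g c x0 (\<Psi> t v) w" for v w
   using iso[of "\<Psi> t v" w] by (simp add: inverse_apply[OF R(7)[OF te]])
  \<comment> \<open>The model frame pulled back to p and carried along the ray; in it traces at the
    new point equal traces at p.\<close>
  define f where "f i = \<Phi> t (L' (ebasis i))" for i
  have ff: "g c ?y (f i) (f j) = (if i = j then 1 else 0)" for i j
   unfolding f_def iso L'_iso by (rule ebasis_inner)
  have inj: "inj f" by (rule injI) (metis ff zero_neq_one)
  have "card (range f) = card (range (ebasis :: _ \<Rightarrow> quat ^ 'n))" unfolding card_image[OF inj] card_image[OF inj_ebasis] ..
  then have fr: "orthonormal_frame (g c ?y) (range f)"
   using ebasis_frame unfolding orthonormal_frame_def by (auto simp: ff dest: injD[OF inj])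
  have "(\<Sum>k\<in>range f. g c ?y (C.Rm ?y a b k) (W t k)) = 0" for a b
  proof -
   define \<xi> where "\<xi> = \<Psi> t o\<^sub>L (C.Rm ?y a b o\<^sub>L \<Phi> t)"
   have "velocity c p \<xi>" unfolding \<xi>_def
    by (rule velocity_conjugate[OF T R(7)[OF te] R(6)[OF te]]) (use velocity_curvature[OF c q(1)] in \<open>simp add: q(2)\<close>)
   moreover have "qlie c p \<xi>" unfolding \<xi>_def
    by (rule qlie_conjugate[OF T' T R(6)[OF te] R(7)[OF te]]) (use Rm_qlie[OF q(1)] y in \<open>simp add: q(2)\<close>)
   ultimately have "mat_of (L o\<^sub>L (\<xi> o\<^sub>L L')) \<bullet> mat_of (L o\<^sub>L (V0 o\<^sub>L L')) = 0" by (rule orth)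
   then show ?thesis unfolding mat_inner sum.reindex[OF inj] sum.reindex[OF inj_ebasis] o_def
    by (simp add: L_iso f_def W_def iso' \<Psi>\<Phi> \<xi>_def)
  qed
  then show ?thesis using W fr unfolding C.annihilates_def qlie_def q(2) QV[OF y] by (blast intro: span_base)
 qed
 ultimately show "\<exists>\<epsilon>>0. \<exists>V'. V' 0 = V0 \<and> (V' has_vector_derivative ((V0 o\<^sub>L \<Gamma> c x0 u) - (\<Gamma> c x0 u o\<^sub>L V0))) (at 0 within {0..\<epsilon>}) \<and>
   (\<forall>t\<in>{0..\<epsilon>}. x0 + t *\<^sub>R u \<in> V \<and> C.annihilates (x0 + t *\<^sub>R u) (V' t))"
  using e(1) inV by blast
qed

text \<open>Velocities inside the algebra form a subspace. If it were proper, a non-zero element of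
  the algebra would be orthogonal to it, which \<open>orthogonal_to_velocities\<close>
  excludes.\<close>

lemma velocity_qlie: assumes X: "qlie c p X" shows "velocity c p X"
proof -
 define cj where "cj \<xi> = mat_of (L o\<^sub>L (\<xi> o\<^sub>L L'))" for \<xi>
 have lin: "linear cj"
  unfolding cj_def
  by (intro linear_compose[OF _ bounded_linear.linear[OF bounded_linear_mat_of], unfolded o_def] linearI; rule blinfun_eqI; simp add: bl)
 have inj: "\<xi> = \<eta>" if "cj \<xi> = cj \<eta>" for \<xi> \<eta>
 proof (rule blinfun_eqI)
  fix v
  have "L o\<^sub>L (\<xi> o\<^sub>L L') = L o\<^sub>L (\<eta> o\<^sub>L L')" using that unfolding cj_def by (metis endo_mat)
  then have "(L o\<^sub>L (\<xi> o\<^sub>L L')) (L v) = (L o\<^sub>L (\<eta> o\<^sub>L L')) (L v)" by simp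
  then have "L (\<xi> v) = L (\<eta> v)" by (simp add: LL)
  then show "\<xi> v = \<eta> v" by (metis LL(2))
 qed
 define D where "D = {\<xi>. velocity c p \<xi> \<and> cj \<xi> \<in> mat_of ` sp_algebra}"
 have sG: "subspace (mat_of ` (sp_algebra :: (quat ^ 'n) endo set))"
  by (intro linear_subspace_image subspace_sp_algebra bounded_linear.linear[OF bounded_linear_mat_of])
 have "velocity c p (0 *\<^sub>R C.Rm x0 0 0)" by (intro velocity_scale velocity_curvature c p)
 then have "subspace D"
  unfolding subspace_def D_def using velocity_add velocity_scale
  by (simp add: linear_0[OF lin] linear_add[OF lin] linear_cmul[OF lin] subspace_0[OF sG] subspace_add[OF sG] subspace_scale[OF sG])
 then have sW: "subspace (cj ` D)" by (rule linear_subspace_image[OF lin])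
 have WG: "cj ` D \<subseteq> mat_of ` sp_algebra" unfolding D_def by blast
 have "cj ` D = mat_of ` sp_algebra"
 proof (rule ccontr)
  assume "cj ` D \<noteq> mat_of ` sp_algebra"
  then have "span (cj ` D) \<subset> span (mat_of ` (sp_algebra :: (quat ^ 'n) endo set))"
   using WG by (simp add: span_eq_iff[THEN iffD2, OF sW] span_eq_iff[THEN iffD2, OF sG] psubset_eq)
  then obtain z where z: "z \<noteq> 0" "z \<in> span (mat_of ` (sp_algebra :: (quat ^ 'n) endo set))" "\<And>y. y \<in> span (cj ` D) \<Longrightarrow> orthogonal z y"
   using orthogonal_to_subspace_exists_gen by blast
  then obtain \<zeta> where \<zeta>: "\<zeta> \<in> sp_algebra" "z = mat_of \<zeta>" unfolding span_eq_iff[THEN iffD2, OF sG] by blast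
  define V0 where "V0 = L' o\<^sub>L (\<zeta> o\<^sub>L L)"
  have \<zeta>': "L o\<^sub>L (V0 o\<^sub>L L') = \<zeta>" unfolding V0_def by (rule blinfun_eqI) (simp add: LL)
  have "V0 = 0"
  proof (rule orthogonal_to_velocities)
   show "qlie c p V0" unfolding V0_def by (rule qlie_of_model[OF \<zeta>(1)])
   fix \<xi> assume "velocity c p \<xi>" "qlie c p \<xi>"
   then have "cj \<xi> \<in> span (cj ` D)" using qlie_to_model unfolding D_def cj_def by (intro span_base) blast
   from z(3)[OF this] show "mat_of (L o\<^sub>L (\<xi> o\<^sub>L L')) \<bullet> mat_of (L o\<^sub>L (V0 o\<^sub>L L')) = 0"
    unfolding \<zeta>' \<zeta>(2)[symmetric] cj_def[symmetric] orthogonal_def by (simp add: inner_commute)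
  qed
  then have "\<zeta> = 0" unfolding \<zeta>'[symmetric] by (intro blinfun_eqI) (simp add: bl)
  then have "z = 0" unfolding \<zeta>(2) by (simp add: mat_of_def vec_eq_iff)
  then show False using z(1) by blast
 qed
 then have "cj X \<in> cj ` D" unfolding cj_def using qlie_to_model[OF X] by blast
 then show ?thesis using inj unfolding D_def by blast
qed

lemma holonomy_model: "(\<lambda>P. L \<circ> P \<circ> L') ` holonomy M c p = Sp1Sp"
proof (rule Sp1Sp_from_velocities)
 let ?H = "(\<lambda>P. blinfun_apply L \<circ> P \<circ> blinfun_apply L') ` holonomy M c p"
 interpret H: quat_hermitian "g c x0" "J1 x0" "J2 x0" "J3 x0" by (rule H)
 have hol: "P \<in> holonomy M c p \<longleftrightarrow> transports c p c p P" for P by (rule holonomy_iff[OF c p])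
 have lin: "linear (blinfun_apply A)" for A :: "(quat ^ 'n) endo" by (simp add: blinfun.bounded_linear_right bounded_linear.linear)
 show "?H \<subseteq> Sp1Sp"
 proof
  fix u assume "u \<in> ?H"
  then obtain P where "P \<in> holonomy M c p" and u: "u = L \<circ> P \<circ> L'" by blast
  then have P: "transports c p c p P" unfolding hol by blast
  note P' = transports_isometry[OF P]
  have "linear u" unfolding u by (intro linear_compose lin P'(2))
  moreover have "u v \<bullet> u w = v \<bullet> w" for v w unfolding u o_def L_iso P'(1) L'_iso ..
  ultimately have ou: "orthogonal_transformation u" unfolding orthogonal_transformation_def by blast
  have "transports c p c p (inv P)"
   by (rule transports_reverse[OF P]) (rule surj_f_inv_f[OF bij_is_surj[OF P'(3)]])
  note TQ = transports_Q[OF this]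
  \<comment> \<open>Pull J back by P to an element of Q; in the model it is right multiplication by
    some r. This is the input of \<open>Sp1Sp_intro\<close>.\<close>
  have ex: "\<exists>r. \<forall>v. u (rscale r v) = L (J (P (L' v)))" if JQ: "J \<in> Q c x0" for J
  proof -
   obtain J' where J': "J' \<in> Q c x0" "\<And>v. J' (inv P v) = inv P (J v)" using TQ[OF JQ] by blast
   obtain a1 a2 a3 where a: "J' = H.ims a1 a2 a3" using J'(1) unfolding QV[OF pV] H.span_J by blast
   have PJ: "P (J' z) = J (P z)" for z
    using J'(2)[of "P z"] by (simp add: inv_f_f[OF bij_is_inj[OF P'(3)]] surj_f_inv_f[OF bij_is_surj[OF P'(3)]])
   \<comment> \<open>The sign of a3 reflects that J3 corresponds to -k.\<close>
   define r where "r = (Complex 0 a1, Complex a2 (- a3))"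
   have LJ3: "L (J3 x0 v) = - rscale qk (L v)" for v
    unfolding H.J3_eq L_J rscale_rscale quat_units rscale_linear ..
   have "L (J' z) = rscale r (L z)" for z
    unfolding a rscale_expansion[of r] by (simp add: r_def H.ims_apply bl L_J LJ3)
   then have "L' (rscale r v) = J' (L' v)" for v by (metis LL)
   then have "u (rscale r v) = L (J (P (L' v)))" for v unfolding u by (simp add: PJ)
   then show ?thesis by blast
  qed
  have J12: "J1 x0 \<in> Q c x0" "J2 x0 \<in> Q c x0" unfolding QV[OF pV] by (auto intro: span_base)
  obtain r1 where r1: "\<And>v. u (rscale r1 v) = rscale qi (u v)"
   using ex[OF J12(1)] unfolding L_J u by auto
  obtain r2 where r2: "\<And>v. u (rscale r2 v) = rscale qj (u v)"
   using ex[OF J12(2)] unfolding L_J u by auto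
  show "u \<in> Sp1Sp" by (rule Sp1Sp_intro[OF ou r1 r2])
 qed
 show "u \<circ> w \<in> ?H" if uw: "u \<in> ?H" "w \<in> ?H" for u w
 proof -
  obtain P R where PR: "P \<in> holonomy M c p" "R \<in> holonomy M c p" and P: "u = L \<circ> P \<circ> L'" and R: "w = L \<circ> R \<circ> L'"
   using uw by blast
  have "transports c p c p (\<lambda>v. P (R v))" 
   using transports_compose PR unfolding hol by blast
  moreover have "u \<circ> w = L \<circ> (\<lambda>v. P (R v)) \<circ> L'" unfolding P R by (simp add: fun_eq_iff LL)
  ultimately show ?thesis using hol by blast
 qed
 have vel: "\<exists>P \<delta>. \<delta> > 0 \<and> continuous_on {-\<delta>..\<delta>} P \<and> P 0 = id_blinfun \<and>
  (P has_vector_derivative \<xi>) (at 0) \<and> (\<forall>t\<in>{-\<delta>..\<delta>}. blinfun_apply (P t) \<in> ?H)" if \<xi>: "\<xi> \<in> sp_algebra" for \<xi>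
 proof -
  note bb = bounded_bilinear_blinfun_compose
  obtain P \<delta> where P: "\<delta> > 0" "continuous_on {-\<delta>..\<delta>} P" "P 0 = id_blinfun"
  "(P has_vector_derivative (L' o\<^sub>L (\<xi> o\<^sub>L L))) (at 0)" "\<And>t. t \<in> {-\<delta>..\<delta>} \<Longrightarrow> transports c p c p (P t)"
   using velocity_qlie[OF qlie_of_model[OF \<xi>]] unfolding velocity_def by blast
  let ?P = "\<lambda>t. L o\<^sub>L (P t o\<^sub>L L')"
  have "continuous_on {-\<delta>..\<delta>} ?P" by (intro bounded_bilinear.continuous_on[OF bb] P(2) continuous_on_const)
  moreover have "(?P has_vector_derivative \<xi>) (at 0)"
   by (rule has_vector_derivative_eq_rhs[OF bounded_linear.has_vector_derivative[OF bounded_bilinear.bounded_linear_right[OF bb]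
    bounded_linear.has_vector_derivative[OF bounded_bilinear.bounded_linear_left[OF bb] P(4)]]])
    (rule blinfun_eqI, simp add: LL)
  moreover have "blinfun_apply (?P t) \<in> ?H" if "t \<in> {-\<delta>..\<delta>}" for t
  proof -
   have "blinfun_apply (?P t) = L \<circ> P t \<circ> L'" by (simp add: fun_eq_iff)
   then show ?thesis using P(5)[OF that] hol by blast
  qed
  moreover have "?P 0 = id_blinfun" unfolding P(3) by (rule blinfun_eqI) (simp add: LL)
  ultimately show ?thesis using P(1) by (intro exI[of _ ?P] exI[of _ \<delta>] conjI ballI)
 qed
 then show "\<exists>P \<delta>. \<delta> > 0 \<and> continuous_on {-\<delta>..\<delta>} P \<and> P 0 = id_blinfun \<and>
  (P has_vector_derivative \<xi>) (at 0) \<and> (\<forall>t\<in>{-\<delta>..\<delta>}. blinfun_apply (P t) \<in> ?H)" if "\<xi> \<in> sp_algebra" for \<xi>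
  using that .
 \<comment> \<open>The identity is the value at time 0 of a curve in the set, for example one with
   velocity 0.\<close>
 obtain P :: "real \<Rightarrow> (quat ^ 'n) endo" and \<delta> :: real where P: "\<delta> > 0" "P 0 = id_blinfun" "\<forall>t\<in>{-\<delta>..\<delta>}. blinfun_apply (P t) \<in> ?H"
  using vel[OF subspace_0[OF subspace_sp_algebra]] by blast
 have "0 \<in> {-\<delta>..\<delta>}" using P(1) by simp
 then have "blinfun_apply (P 0) \<in> ?H" using P(3) by blast
 moreover have "blinfun_apply (P 0) = id" unfolding P(2) by (simp add: fun_eq_iff)
 ultimately show "id \<in> ?H" by metis
qed

end

theorem proposition8:
 fixes M :: "('a, quat ^ 'n) riem"
  and Q :: "('a, quat ^ 'n) chart \<Rightarrow> quat ^ 'n \<Rightarrow> (quat ^ 'n) endo set"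
  and \<psi> :: "('a, quat ^ 'n) form2"
 assumes "CARD('n) \<ge> 2"
  and "quaternionic_kaehler M Q"
  and "connected_space (mtop M)"
  and "nonzero_scalar_curvature M"
  and "two_form M \<psi>"
  and "compatible M Q \<psi>"
  and "conformal_killing M \<psi>"
  and "\<not> parallel_form M \<psi>"
 shows "holonomy_is_Sp1Sp M"
proof -
 interpret qk_manifold M Q
  by unfold_locales (use assms(2) in \<open>auto simp: quaternionic_kaehler_def\<close>)
 have qkM: "qk_manifold M Q" by unfold_locales
 obtain c x u v w where c: "c \<in> \<A>" and x: "x \<in> chart_image c" and ne: "nabla_form M \<psi> c x u v w \<noteq> 0"
  using assms(8) unfolding parallel_form_def by blast
 obtain V J1 J2 J3 \<Psi> \<theta> where V: "x \<in> V" "V \<subseteq> chart_image c" and ck: "local_ck V (g c) (\<Gamma> c) J1 J2 J3 \<Psi> \<theta>"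
  and QV: "\<And>y. y \<in> V \<Longrightarrow> Q c y = span {J1 y, J2 y, J3 y}"
  and nf: "\<And>y u v w. y \<in> V \<Longrightarrow> nabla_form M \<psi> c y u v w = g c y (local_metric.nabe (\<Gamma> c) \<Psi> y u v) w"
  by (rule local_ck_at[OF qkM assms(4-7) c x]) (rule that; assumption)
 interpret C: local_ck V "g c" "\<Gamma> c" J1 J2 J3 \<Psi> \<theta> by (rule ck)
 \<comment> \<open>\<nabla>\<Psi> is linear in \<theta>, so it could not be non-zero at x
   otherwise.\<close>
 have \<theta>: "\<theta> x \<noteq> 0"
 proof
  assume "\<theta> x = 0"
  then have "C.nabe \<Psi> x u v = 0" unfolding C.ck[OF V(1)] by (simp add: C.NN_def C.m_def C.bl)
  then show False using ne unfolding nf[OF V(1)] by (simp add: C.bl)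
 qed
 define p where "p = pt c x"
 have p: "p \<in> fst c" "snd c p = x" unfolding p_def using pt[OF c x] by auto
 obtain l :: "quat ^ 'n \<Rightarrow> quat ^ 'n" where l: "linear l" "bij l" "\<And>v w. l v \<bullet> l w = g c x v w"
  "\<And>v. l (J1 x v) = rscale qi (l v)" "\<And>v. l (J2 x v) = rscale qj (l v)"
  by (rule model_isomorphism[OF C.qh[OF V(1)]]) (rule that; assumption)
 obtain L L' :: "(quat ^ 'n) endo" where L: "blinfun_apply L = l" "blinfun_apply L' = inv l"
  "L o\<^sub>L L' = id_blinfun" "L' o\<^sub>L L = id_blinfun"
  by (rule endo_of_linear[OF l(1,2)]) (rule that; assumption)
 interpret P: ck_point M Q c p V J1 J2 J3 \<Psi> \<theta> L L'
  by unfold_locales (simp_all add: p c V QV \<theta> L(1) l(3-) L(3,4))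
 have hol: "(\<lambda>P. l \<circ> P \<circ> inv l) ` holonomy M c p = Sp1Sp" using P.holonomy_model unfolding L(1,2) .
 show ?thesis unfolding holonomy_is_Sp1Sp_def
 proof (intro ballI)
  fix d q assume d: "d \<in> \<A>" and q: "q \<in> fst d"
  \<comment> \<open>Conjugation by A identifies the holonomy groups at p and q, and l composed with
    its inverse is the isometry to the model at q.\<close>
  obtain A where A: "transports c p d q A" using connected_transport[OF assms(3) c p(1) d q] by blast
  note A' = transports_isometry[OF A]
  have inv: "A (inv A v) = v" "inv A (A v) = v" "inv l (l v) = v" for v
   using A'(3) l(2) by (simp_all add: bij_is_inj surj_f_inv_f bij_is_surj)
  have R: "transports d q c p (inv A)" by (rule transports_reverse[OF A]) (rule inv(1))
  define k where "k = l \<circ> inv A"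
  have k: "linear k" "bij k" unfolding k_def
   using transports_isometry(2)[OF R] l(1,2) A'(3) by (auto intro: linear_compose bij_comp bij_imp_bij_inv)
  have invk: "inv k = A \<circ> inv l" unfolding k_def using l(2) A'(3) by (simp add: o_inv_distrib bij_imp_bij_inv inv_inv_eq)
  have same: "(\<lambda>P. k \<circ> P \<circ> inv k) ` holonomy M d q = (\<lambda>P. l \<circ> P \<circ> inv l) ` holonomy M c p"
  proof (intro equalityI subsetI)
   fix u assume "u \<in> (\<lambda>P. k \<circ> P \<circ> inv k) ` holonomy M d q"
   then obtain P where P: "P \<in> holonomy M d q" "u = k \<circ> P \<circ> inv k" by blast
   then have "transports d q d q P" using holonomy_iff[OF d q] by blast
   then have "transports c p c p (\<lambda>v. inv A (P (A v)))" by (intro transports_compose[OF transports_compose[OF A] R])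
   moreover have "u = l \<circ> (\<lambda>v. inv A (P (A v))) \<circ> inv l" unfolding P(2) invk unfolding k_def by (simp add: fun_eq_iff)
   ultimately show "u \<in> (\<lambda>P. l \<circ> P \<circ> inv l) ` holonomy M c p" using holonomy_iff[OF c p(1)] by blast
  next
   fix u assume "u \<in> (\<lambda>P. l \<circ> P \<circ> inv l) ` holonomy M c p"
   then obtain P where P: "P \<in> holonomy M c p" "u = l \<circ> P \<circ> inv l" by blast
   then have "transports c p c p P" using holonomy_iff[OF c p(1)] by blast
   then have "transports d q d q (\<lambda>v. A (P (inv A v)))" by (intro transports_compose[OF transports_compose[OF R] A])
   moreover have "u = k \<circ> (\<lambda>v. A (P (inv A v))) \<circ> inv k" unfolding P(2) invk unfolding k_def by (simp add: fun_eq_iff inv)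
   ultimately show "u \<in> (\<lambda>P. k \<circ> P \<circ> inv k) ` holonomy M d q" using holonomy_iff[OF d q] by blast
  qed
  have iso: "k v \<bullet> k w = g d (snd d q) v w" for v w
   using transports_isometry(1)[OF R] unfolding k_def o_def l(3) p(2) .
  show "\<exists>L :: quat ^ 'n \<Rightarrow> quat ^ 'n. linear L \<and> bij L \<and> (\<forall>v w. L v \<bullet> L w = g d (snd d q) v w) \<and>
   (\<lambda>P. L \<circ> P \<circ> inv L) ` holonomy M d q = Sp1Sp"
   by (intro exI[of _ k] conjI allI k iso) (simp only: same hol)
 qed
qed

end
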